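(* Let $d\ge3$ and $2\le p\le2+4/d$. There exists $C>0$ such that for all $f\in L^2(\mathbb{R}^d,\mathrm{d}\boldsymbol x)$ we have $$\bigg\{\int_{\mathbb{R}}\int_{\mathbb{R}^d}|e^{it\Delta}f(\boldsymbol x)|^p\frac{\mathrm{d}\boldsymbol x}{\|\boldsymbol x\|^{d+2-pd/2}}\,\mathrm{d}t\bigg\}^{1/p}\le C\bigg\{\int_{\mathbb{R}^d}|f(\boldsymbol x)|^2\,\mathrm{d}\boldsymbol x\bigg\}^{1/2}.$$
   Context: $e^{it\Delta}f(\boldsymbol x)$ is the solution of the Schr\"odinger equation $\partial_t u=i\Delta u$ on $\mathbb{R}^d\times\mathbb{R}$ with $u(\boldsymbol x,0)=f(\boldsymbol x)$; $\|\cdot\|$ is the Euclidean norm. Functions are complex valued. *)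

theory Defs
  imports "HOL-Analysis.Analysis"
begin

definition square_integrable :: "('a::euclidean_space \<Rightarrow> complex) \<Rightarrow> bool"
  where "square_integrable f \<longleftrightarrow>
    f \<in> borel_measurable lebesgue \<and> integrable lebesgue (\<lambda>x. (cmod (f x))\<^sup>2)"

definition partial_derivative :: "'a::euclidean_space \<Rightarrow> ('a \<Rightarrow> complex) \<Rightarrow> 'a \<Rightarrow> complex"
  where "partial_derivative b \<phi> x = frechet_derivative \<phi> (at x) b"

definition laplacian :: "('a::euclidean_space \<Rightarrow> complex) \<Rightarrow> 'a \<Rightarrow> complex"
  where "laplacian \<phi> x = (\<Sum>b\<in>Basis. partial_derivative b (partial_derivative b \<phi>) x)"

text \<open>Smoothness below: every iterated partial derivative is (totally) differentiable everywhere,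
  hence also continuous.\<close>

definition test_function :: "('a::euclidean_space \<Rightarrow> complex) \<Rightarrow> bool"
  where "test_function \<phi> \<longleftrightarrow>
    (\<forall>bs. set bs \<subseteq> Basis \<longrightarrow> foldr partial_derivative bs \<phi> differentiable_on UNIV) \<and>
    compact (closure {x. \<phi> x \<noteq> 0})"

text \<open>
  The solution of the Schroedinger equation for data that are merely in $L^2$ is understood
  in the standard weak sense: \<open>u\<close> is a continuous curve in $L^2$, starts at \<open>f\<close>, and satisfies
  the equation against every test function in the space variable. For \<open>u\<close> continuous into
  $L^2$ this is the same as solving the equation in the sense of distributions on space-time.
  The solution exists for every \<open>f\<close> in $L^2$ and is unique, each \<open>u t\<close> being determined up to
  a null set. The pairing with test functions is bilinear, so the Laplacian moves onto the
  test function without conjugation.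
\<close>

definition schrodinger_solution ::
    "('a::euclidean_space \<Rightarrow> complex) \<Rightarrow> (real \<Rightarrow> 'a \<Rightarrow> complex) \<Rightarrow> bool"
  where "schrodinger_solution f u \<longleftrightarrow>
    (\<forall>t. square_integrable (u t)) \<and>
    (\<forall>t. ((\<lambda>s. \<integral>x. (cmod (u s x - u t x))\<^sup>2 \<partial>lebesgue) \<longlongrightarrow> 0) (at t)) \<and>
    (AE x in lebesgue. u 0 x = f x) \<and>
    (\<forall>\<phi>. test_function \<phi> \<longrightarrow>
      (\<forall>t. ((\<lambda>s. \<integral>x. u s x * \<phi> x \<partial>lebesgue) has_vector_derivative
             \<i> * (\<integral>x. u t x * laplacian \<phi> x \<partial>lebesgue)) (at t)))"

text \<open>Meant for exponents \<open>a > 0\<close>.\<close>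

definition ennreal_powr :: "ennreal \<Rightarrow> real \<Rightarrow> ennreal"
  where "ennreal_powr y a = (if y = \<infinity> then \<infinity> else ennreal (enn2real y powr a))"

end

theory Submission
  imports Defs "HOL-Complex_Analysis.Complex_Analysis" "HOL-Probability.Probability"
begin

text \<open>
  Write \<open>d\<close> for the dimension, \<open>q = 2 + 4/d\<close> and \<open>p = 2 (1 - \<theta>) + q \<theta>\<close> with
  \<open>0 \<le> \<theta> \<le> 1\<close>. The exponent of the weight is then \<open>2 (1 - \<theta>)\<close>, so the
  integrand is the product of the \<open>1 - \<theta>\<close> power of \<open>|u|\<^sup>2 / |x|\<^sup>2\<close> and the
  \<open>\<theta>\<close> power of \<open>|u|\<^sup>q\<close>. After normalising by the norm of the datum, the inequality
  \<open>X^(1 - \<theta>) Y^\<theta> \<le> X + Y\<close> reduces everything to two endpoint estimates for the free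
  evolution: the smoothing estimate of Kato with weight \<open>|x|^(-2)\<close> (\<open>kato_smoothing\<close>)
  and the Strichartz estimate in \<open>L^q\<close> of space-time (\<open>strichartz\<close>).

  Both endpoints are first proved for the regularised evolution \<open>propagate (\<epsilon> + i t) f\<close>, the
  convolution of \<open>f\<close> with the heat kernel at the complex time \<open>\<epsilon> + i t\<close>. For
  \<open>\<epsilon> > 0\<close> this kernel is a Gaussian, so that the oscillatory integrals converge absolutely and
  Fubini applies throughout, while the two bounds that matter hold uniformly in \<open>\<epsilon>\<close>: the operator
  is a contraction of \<open>L\<^sup>2\<close>, and its kernel is at most \<open>(4 \<pi> |t|)^(-d/2)\<close>.

  The endpoints follow from one duality scheme. The space-time integral \<open>N\<close> of a power of the
  evolution is its pairing with a suitable multiple \<open>\<Phi>\<close> of itself, hence the inner product of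
  \<open>f\<close> with a superposition \<open>V\<close> in time of functions \<open>w t\<close> obtained by propagating
  \<open>\<Phi> t\<close> back to time zero (\<open>duality_pairing\<close>). So \<open>N \<le> \<parallel>f\<parallel> \<parallel>V\<parallel>\<close>, and the square of
  \<open>\<parallel>V\<parallel>\<close> is the double time integral of the inner products of \<open>w t\<close> and \<open>w s\<close>. By the semigroup
  law these inner products are governed by the evolution over time \<open>t - s\<close>.
  For Strichartz, interpolation between \<open>L\<^sup>1\<close> and \<open>L\<^sup>2\<close> (\<open>marcinkiewicz_propagate\<close>) gives decay
  \<open>|t - s|^(-2/q)\<close>, which the Hardy--Littlewood--Sobolev inequality integrates.
  For Kato, \<open>\<Phi>\<close> is cut into the dyadic annuli \<open>|x| ~ 2^k\<close>; in dimension at least three the pieces at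
  scales \<open>k\<close> and \<open>l\<close> interact with strength \<open>(2^(k + l) / |t - s|)^(3/2)\<close>, which is integrable at
  infinity, and summation over the scales converges because different scales are almost orthogonal
  (\<open>dyadic_almost_orthogonality\<close>).

  A solution enters only through the weak formulation. Pairing \<open>u s\<close> with a truncated Gaussian
  that itself evolves backwards in time gives a function of \<open>s\<close> whose derivative tends to zero as the
  truncation is removed. Hence the heat flow \<open>e^(\<epsilon> \<Delta>) (u t)\<close> equals \<open>propagate (\<epsilon> + i t) f\<close>
  (\<open>solution_smoothed_representation\<close>). As \<open>\<epsilon>\<close> tends to zero, \<open>e^(\<epsilon> \<Delta>) (u t)\<close> tends to
  \<open>u t\<close> in \<open>L\<^sup>2\<close>, and Fatou's lemma in space and in time transfers the uniform bounds to \<open>u\<close>.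
\<close>

section \<open>Gaussian integrals with complex parameters\<close>

text \<open>The mean value inequality on the (convex) ball bounds the difference quotients
  by \<open>g\<close>, so dominated convergence applies to them. Used twice for Gaussian integrals and once
  for the pairing of a solution with a moving kernel.\<close>

lemma has_field_derivative_integral_dominated:
  fixes F F' :: "complex \<Rightarrow> 'a \<Rightarrow> complex"
  assumes e: "e > 0"
    and deriv: "\<And>z x. z \<in> ball z0 e \<Longrightarrow> x \<in> space M \<Longrightarrow>
      ((\<lambda>z. F z x) has_field_derivative F' z x) (at z)"
    and bound: "\<And>z x. z \<in> ball z0 e \<Longrightarrow> x \<in> space M \<Longrightarrow> cmod (F' z x) \<le> g x"
    and int: "\<And>z. z \<in> ball z0 e \<Longrightarrow> integrable M (F z)"
    and g: "integrable M g"
  shows "((\<lambda>z. \<integral>x. F z x \<partial>M) has_field_derivative (\<integral>x. F' z0 x \<partial>M)) (at z0)"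
proof -
  have lip: "cmod ((F z x - F z0 x) / (z - z0)) \<le> g x" if z: "z \<in> ball z0 e" "z \<noteq> z0" and x: "x \<in> space M" for z x
  proof -
    have "cmod (F z x - F z0 x) \<le> g x * cmod (z - z0)"
    proof (rule field_differentiable_bound[where S="ball z0 e" and f'="\<lambda>z. F' z x"])
      show "((\<lambda>z. F z x) has_field_derivative F' w x) (at w within ball z0 e)" if "w \<in> ball z0 e" for w
        using deriv[OF that x] has_field_derivative_at_within by blast
    qed (use z e x bound in auto)
    then show ?thesis using z by (simp add: norm_divide field_simps)
  qed
  have F'_meas: "F' z0 \<in> borel_measurable M"
  proof (rule borel_measurable_LIMSEQ_metric)
    show "(\<lambda>x. (F (z0 + of_real (e / (2 * (real n + 1)))) x - F z0 x) / of_real (e / (2 * (real n + 1)))) \<in> borel_measurable M" for n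
    proof -
      have "e / (2 * (real n + 1)) < e" using e by (simp add: field_simps add_pos_nonneg)
      then have "z0 + of_real (e / (2 * (real n + 1))) \<in> ball z0 e"
        using e by (simp add: dist_norm norm_divide norm_mult del: of_real_divide)
      then show ?thesis using int e borel_measurable_integrable by (intro borel_measurable_divide borel_measurable_diff) auto
    qed
    fix x assume x: "x \<in> space M"
    have lim: "((\<lambda>h. (F (z0 + h) x - F z0 x) / h) \<longlongrightarrow> F' z0 x) (at 0)"
      using deriv[of z0 x] x e by (simp add: DERIV_def)
    have "(\<lambda>n. e / (2 * (real n + 1))) \<longlonglongrightarrow> 0" by real_asymp
    then have "(\<lambda>n. complex_of_real (e / (2 * (real n + 1)))) \<longlonglongrightarrow> of_real 0"
      by (rule tendsto_of_real)
    then have "filterlim (\<lambda>n. complex_of_real (e / (2 * (real n + 1)))) (at 0) sequentially"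
      using e by (auto simp: filterlim_at intro!: always_eventually simp del: of_real_divide)
    from filterlim_compose[OF lim this]
    show "(\<lambda>n. (F (z0 + of_real (e / (2 * (real n + 1)))) x - F z0 x) / of_real (e / (2 * (real n + 1)))) \<longlonglongrightarrow> F' z0 x" .
  qed
  show ?thesis
    unfolding has_field_derivative_iff
  proof (rule tendsto_at_iff_sequentially[THEN iffD2], intro allI impI)
    fix X assume X: "\<forall>i. X i \<in> UNIV - {z0}" "X \<longlonglongrightarrow> z0"
    obtain n0 where n0: "\<And>n. n \<ge> n0 \<Longrightarrow> X n \<in> ball z0 e"
      using X(2) e unfolding LIMSEQ_def by (auto simp: dist_commute)
    let ?G = "\<lambda>n x. (F (X (n + n0)) x - F z0 x) / (X (n + n0) - z0)"
    have intX: "integrable M (F (X (n + n0)))" for n using int n0 by simp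
    have int0: "integrable M (F z0)" using int e by simp
    have "(\<lambda>n. \<integral>x. ?G n x \<partial>M) \<longlonglongrightarrow> (\<integral>x. F' z0 x \<partial>M)"
    proof (rule integral_dominated_convergence[where w=g])
      show "?G n \<in> borel_measurable M" for n
        using intX int0 borel_measurable_integrable by (intro borel_measurable_divide borel_measurable_diff) auto
      show "AE x in M. (\<lambda>n. ?G n x) \<longlonglongrightarrow> F' z0 x"
      proof (rule AE_I2)
        fix x assume x: "x \<in> space M"
        have "((\<lambda>z. (F z x - F z0 x) / (z - z0)) \<longlongrightarrow> F' z0 x) (at z0)"
          using deriv[of z0 x] x e by (simp add: has_field_derivative_iff)
        moreover have "filterlim (\<lambda>n. X (n + n0)) (at z0) sequentially"
          using X by (auto simp: filterlim_at LIMSEQ_ignore_initial_segment intro!: always_eventually)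
        ultimately show "(\<lambda>n. ?G n x) \<longlonglongrightarrow> F' z0 x" by (rule filterlim_compose)
      qed
      show "AE x in M. norm (?G n x) \<le> g x" for n
        using lip n0 X(1) by (intro AE_I2) simp
    qed (use g F'_meas in auto)
    moreover have "(\<integral>x. ?G n x \<partial>M) = ((\<integral>x. F (X (n + n0)) x \<partial>M) - (\<integral>x. F z0 x \<partial>M)) / (X (n + n0) - z0)" for n
      using intX int0 by simp
    ultimately have "(\<lambda>n. ((\<integral>x. F (X (n + n0)) x \<partial>M) - (\<integral>x. F z0 x \<partial>M)) / (X (n + n0) - z0)) \<longlonglongrightarrow> (\<integral>x. F' z0 x \<partial>M)"
      by (simp only:)
    then show "((\<lambda>z. ((\<integral>x. F z x \<partial>M) - (\<integral>x. F z0 x \<partial>M)) / (z - z0)) \<circ> X) \<longlonglongrightarrow> (\<integral>x. F' z0 x \<partial>M)"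
      unfolding comp_def by (rule LIMSEQ_offset)
  qed
qed

lemma gaussian_integral_real:
  assumes a: "a > 0"
  shows "(\<integral>\<^sup>+(x::real). ennreal (exp (- a * x\<^sup>2)) \<partial>lborel) = ennreal (sqrt (pi / a))"
proof -
  have h: "has_bochner_integral lborel (\<lambda>x::real. exp (- x\<^sup>2)) (sqrt pi)"
    using has_bochner_integral_even_function[OF gaussian_moment_0] by simp
  have "(\<integral>\<^sup>+(x::real). ennreal (exp (- x\<^sup>2)) \<partial>lborel) = ennreal (sqrt pi)"
    using h by (subst nn_integral_eq_integral) (auto simp: has_bochner_integral_iff)
  also have "(\<integral>\<^sup>+(x::real). ennreal (exp (- x\<^sup>2)) \<partial>lborel) = ennreal (sqrt a) * (\<integral>\<^sup>+(x::real). ennreal (exp (- a * x\<^sup>2)) \<partial>lborel)"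
    using a by (subst nn_integral_real_affine[where c="sqrt a" and t=0]) (auto simp: power_mult_distrib)
  finally have *: "ennreal (sqrt a) * (\<integral>\<^sup>+(x::real). ennreal (exp (- a * x\<^sup>2)) \<partial>lborel) = ennreal (sqrt pi)" by simp
  have "ennreal (1 / sqrt a) * (ennreal (sqrt a) * (\<integral>\<^sup>+(x::real). ennreal (exp (- a * x\<^sup>2)) \<partial>lborel)) = ennreal (1 / sqrt a) * ennreal (sqrt pi)"
    by (simp only: *)
  then show ?thesis
    using a by (simp add: mult.assoc[symmetric] ennreal_mult[symmetric] real_sqrt_divide)
qed

lemma nn_integral_gaussian:
  assumes a: "a > 0"
  shows "(\<integral>\<^sup>+(x::'a::euclidean_space). ennreal (exp (- a * (norm x)\<^sup>2)) \<partial>lborel) = ennreal (sqrt (pi / a) ^ DIM('a))"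
proof -
  have "exp (- a * (norm x)\<^sup>2) = (\<Prod>b\<in>Basis. exp (- a * (x \<bullet> b)\<^sup>2))" for x :: 'a
  proof -
    have "(norm x)\<^sup>2 = (\<Sum>b\<in>Basis. (x \<bullet> b)\<^sup>2)"
      by (simp only: power2_norm_eq_inner euclidean_inner[of x x]) (simp add: power2_eq_square)
    then show ?thesis by (simp add: exp_sum[symmetric] sum_distrib_left)
  qed
  then have "(\<integral>\<^sup>+(x::'a). ennreal (exp (- a * (norm x)\<^sup>2)) \<partial>lborel) = (\<integral>\<^sup>+(x::'a). (\<Prod>b\<in>Basis. ennreal (exp (- a * (x \<bullet> b)\<^sup>2))) \<partial>lborel)"
    by (simp add: prod_ennreal)
  also have "\<dots> = (\<Prod>b\<in>(Basis::'a set). \<integral>\<^sup>+x. ennreal (exp (- a * x\<^sup>2)) \<partial>lborel)"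
    by (rule nn_integral_lborel_prod) auto
  also have "\<dots> = ennreal (sqrt (pi / a) ^ DIM('a))"
    using gaussian_integral_real[OF a] a by (simp add: ennreal_power)
  finally show ?thesis .
qed

lemma integrable_gaussian:
  assumes "a > 0"
  shows "integrable lborel (\<lambda>x::'a::euclidean_space. exp (- a * (norm x)\<^sup>2))"
  using nn_integral_gaussian[OF assms, where 'a='a] by (intro integrableI_nonneg) auto

lemma integral_gaussian:
  assumes "a > 0"
  shows "(\<integral>(x::'a::euclidean_space). exp (- a * (norm x)\<^sup>2) \<partial>lborel) = sqrt (pi / a) ^ DIM('a)"
  using nn_integral_gaussian[OF assms, where 'a='a] assms
  by (intro integral_eq_nn_integral[THEN trans]) auto

lemma integrable_translate:
  fixes f :: "'a::euclidean_space \<Rightarrow> 'b::{banach, second_countable_topology}"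
  assumes "integrable lborel f"
  shows "integrable lborel (\<lambda>x. f (c + x))"
proof -
  have "integrable (distr lborel borel ((+) c)) f" using assms by (simp add: lborel_distr_plus)
  then show ?thesis by (subst (asm) integrable_distr_eq) (use assms in auto)
qed

lemma integral_translate:
  fixes f :: "'a::euclidean_space \<Rightarrow> 'b::{banach, second_countable_topology}"
  assumes [measurable]: "f \<in> borel_measurable borel"
  shows "(\<integral>x. f (c + x) \<partial>lborel) = (\<integral>x. f x \<partial>lborel)"
  by (subst lborel_distr_plus[of c, symmetric], subst integral_distr) auto

lemma nn_integral_translate:
  fixes f :: "'a::euclidean_space \<Rightarrow> ennreal"
  assumes [measurable]: "f \<in> borel_measurable borel"
  shows "(\<integral>\<^sup>+x. f (c + x) \<partial>lborel) = (\<integral>\<^sup>+x. f x \<partial>lborel)"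
  by (subst lborel_distr_plus[of c, symmetric], subst nn_integral_distr) auto

text \<open>Completing the square absorbs the linear term \<open>K r\<close>, and the quadratic factor costs
  part of the decay. This produces dominating functions for derivatives of Gaussians in their parameters.\<close>

lemma quadratic_gaussian_le:
  fixes a K r :: real
  assumes a: "a > 0" and r: "r \<ge> 0"
  shows "(1 + r)\<^sup>2 * exp (- a * r\<^sup>2 + K * r) \<le> (2 + 8 / a) * exp (K\<^sup>2 / a) * exp (- (a / 2) * r\<^sup>2)"
proof -
  have "K * r \<le> a * r\<^sup>2 / 4 + K\<^sup>2 / a"
  proof -
    have "0 \<le> (a * r / 2 - K)\<^sup>2 / a" using a by simp
    also have "\<dots> = a * r\<^sup>2 / 4 + K\<^sup>2 / a - K * r"
      using a by (simp add: power2_eq_square field_simps)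
    finally show ?thesis by simp
  qed
  then have 1: "exp (- a * r\<^sup>2 + K * r) \<le> exp (K\<^sup>2 / a) * exp (- (a / 2) * r\<^sup>2) * exp (- (a / 4) * r\<^sup>2)"
    by (simp add: mult_exp_exp)
  have "(1 + r)\<^sup>2 \<le> 2 + 2 * r\<^sup>2"
    using sum_squares_ge_zero[of "1 - r" 0] by (simp add: power2_eq_square algebra_simps)
  moreover have "r\<^sup>2 \<le> (4 / a) * exp ((a / 4) * r\<^sup>2)"
    using exp_ge_add_one_self[of "(a / 4) * r\<^sup>2"] a by (simp add: field_simps)
  moreover have "1 \<le> exp ((a / 4) * r\<^sup>2)" using a by simp
  ultimately have "(1 + r)\<^sup>2 \<le> 2 * exp ((a / 4) * r\<^sup>2) + 2 * ((4 / a) * exp ((a / 4) * r\<^sup>2))"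
    by linarith
  then have 2: "(1 + r)\<^sup>2 \<le> (2 + 8 / a) * exp ((a / 4) * r\<^sup>2)"
    by (simp add: algebra_simps)
  have "(1 + r)\<^sup>2 * exp (- a * r\<^sup>2 + K * r) \<le> ((2 + 8 / a) * exp ((a / 4) * r\<^sup>2)) *
      (exp (K\<^sup>2 / a) * exp (- (a / 2) * r\<^sup>2) * exp (- (a / 4) * r\<^sup>2))"
    using a by (intro mult_mono 1 2) auto
  also have "\<dots> = (2 + 8 / a) * exp (K\<^sup>2 / a) * exp (- (a / 2) * r\<^sup>2)"
    by (simp add: mult_exp_exp algebra_simps exp_minus_inverse flip: exp_add)
  finally show ?thesis .
qed

lemma integrable_quadratic_gaussian:
  assumes a: "a > 0"
  shows "integrable lborel (\<lambda>x::'a::euclidean_space. (1 + norm x)\<^sup>2 * exp (- a * (norm x)\<^sup>2 + K * norm x))"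
proof (rule Bochner_Integration.integrable_bound)
  show "integrable lborel (\<lambda>x::'a. (2 + 8 / a) * exp (K\<^sup>2 / a) * exp (- (a / 2) * (norm x)\<^sup>2))"
    using a integrable_gaussian[of "a / 2"] by (intro integrable_mult_right) auto
  show "AE x::'a in lborel. norm ((1 + norm x)\<^sup>2 * exp (- a * (norm x)\<^sup>2 + K * norm x))
      \<le> norm ((2 + 8 / a) * exp (K\<^sup>2 / a) * exp (- (a / 2) * (norm x)\<^sup>2))"
  proof (rule AE_I2)
    fix x :: 'a
    show "norm ((1 + norm x)\<^sup>2 * exp (- a * (norm x)\<^sup>2 + K * norm x))
      \<le> norm ((2 + 8 / a) * exp (K\<^sup>2 / a) * exp (- (a / 2) * (norm x)\<^sup>2))"
      using quadratic_gaussian_le[OF a, of "norm x" K] a by (simp add: abs_mult)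
  qed
qed simp

definition gauss :: "complex \<Rightarrow> complex \<Rightarrow> 'a::euclidean_space \<Rightarrow> 'a \<Rightarrow> complex"
  where "gauss A B b x = exp (- A * of_real ((norm x)\<^sup>2) + B * of_real (b \<bullet> x))"

lemma borel_measurable_gauss [measurable]: "gauss A B b \<in> borel_measurable borel"
  unfolding gauss_def by measurable

lemma norm_gauss_le:
  assumes "a \<le> Re A" "cmod B \<le> K"
  shows "cmod (gauss A B b x) \<le> exp (- a * (norm x)\<^sup>2 + K * norm b * norm x)"
proof -
  have "Re B * (b \<bullet> x) \<le> \<bar>Re B\<bar> * \<bar>b \<bullet> x\<bar>" by (simp add: abs_mult[symmetric])
  also have "\<dots> \<le> K * (norm b * norm x)"
    using assms abs_Re_le_cmod[of B] by (intro mult_mono Cauchy_Schwarz_ineq2) auto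
  moreover have "a * (norm x)\<^sup>2 \<le> Re A * (norm x)\<^sup>2" using assms by (intro mult_right_mono) auto
  ultimately show ?thesis by (simp add: gauss_def algebra_simps)
qed

lemma integrable_gauss:
  assumes "Re A > 0"
  shows "integrable lborel (gauss A B b)"
proof (rule Bochner_Integration.integrable_bound)
  show "integrable lborel (\<lambda>x::'a. (1 + norm x)\<^sup>2 * exp (- Re A * (norm x)\<^sup>2 + (cmod B * norm b) * norm x))"
    using assms by (rule integrable_quadratic_gaussian)
  show "AE x in lborel. norm (gauss A B b x) \<le> norm ((1 + norm x)\<^sup>2 * exp (- Re A * (norm x)\<^sup>2 + (cmod B * norm b) * norm x))"
  proof (rule AE_I2)
    fix x :: 'a
    have "cmod (gauss A B b x) \<le> 1 * exp (- Re A * (norm x)\<^sup>2 + cmod B * norm b * norm x)"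
      using norm_gauss_le[of "Re A" A B "cmod B"] by simp
    also have "\<dots> \<le> (1 + norm x)\<^sup>2 * exp (- Re A * (norm x)\<^sup>2 + cmod B * norm b * norm x)"
      by (intro mult_right_mono) (auto simp: one_le_power)
    finally show "norm (gauss A B b x) \<le> norm ((1 + norm x)\<^sup>2 * exp (- Re A * (norm x)\<^sup>2 + (cmod B * norm b) * norm x))"
      by simp
  qed
qed simp

lemma gauss_holomorphic_linear:
  assumes A: "Re A > 0"
  shows "(\<lambda>B. \<integral>x. gauss A B b x \<partial>lborel) holomorphic_on UNIV"
proof -
  have "((\<lambda>B. \<integral>x. gauss A B b x \<partial>lborel) has_field_derivative (\<integral>x. of_real (b \<bullet> x) * gauss A B0 b x \<partial>lborel)) (at B0)" for B0
  proof (rule has_field_derivative_integral_dominated[where e=1])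
    show "integrable lborel (\<lambda>x. norm b * ((1 + norm x)\<^sup>2 * exp (- Re A * (norm x)\<^sup>2 + ((cmod B0 + 1) * norm b) * norm x)))"
      using A by (intro integrable_mult_right integrable_quadratic_gaussian)
    fix B x assume B: "B \<in> ball B0 1"
    show "((\<lambda>B. gauss A B b x) has_field_derivative of_real (b \<bullet> x) * gauss A B b x) (at B)"
      unfolding gauss_def by (auto intro!: derivative_eq_intros)
    have "cmod B \<le> cmod B0 + 1"
      using B norm_triangle_ineq2[of B B0] by (simp add: dist_norm norm_minus_commute)
    then have "cmod (gauss A B b x) \<le> exp (- Re A * (norm x)\<^sup>2 + (cmod B0 + 1) * norm b * norm x)"
      by (intro norm_gauss_le) auto
    moreover have "\<bar>b \<bullet> x\<bar> \<le> norm b * (1 + norm x)\<^sup>2"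
    proof -
      have "\<bar>b \<bullet> x\<bar> \<le> norm b * norm x" by (rule Cauchy_Schwarz_ineq2)
      also have "\<dots> \<le> norm b * (1 + norm x)\<^sup>2"
        by (intro mult_left_mono) (auto simp: power2_eq_square algebra_simps)
      finally show ?thesis .
    qed
    ultimately have "\<bar>b \<bullet> x\<bar> * cmod (gauss A B b x) \<le> (norm b * (1 + norm x)\<^sup>2) * exp (- Re A * (norm x)\<^sup>2 + (cmod B0 + 1) * norm b * norm x)"
      by (intro mult_mono) auto
    then show "cmod (of_real (b \<bullet> x) * gauss A B b x) \<le> norm b * ((1 + norm x)\<^sup>2 * exp (- Re A * (norm x)\<^sup>2 + ((cmod B0 + 1) * norm b) * norm x))"
      by (simp add: norm_mult mult.assoc)
  qed (use A integrable_gauss in auto)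
  then show ?thesis by (auto simp: holomorphic_on_open)
qed

lemma gauss_holomorphic_quadratic:
  "(\<lambda>A. \<integral>x. gauss A B b x \<partial>lborel) holomorphic_on {A. Re A > 0}"
proof -
  have "((\<lambda>A. \<integral>x. gauss A B b x \<partial>lborel) has_field_derivative (\<integral>x. - of_real ((norm x)\<^sup>2) * gauss A0 B b x \<partial>lborel)) (at A0)"
    if A0: "Re A0 > 0" for A0
  proof (rule has_field_derivative_integral_dominated[where e="Re A0 / 2"])
    show "integrable lborel (\<lambda>x. (1 + norm x)\<^sup>2 * exp (- (Re A0 / 2) * (norm x)\<^sup>2 + (cmod B * norm b) * norm x))"
      using A0 by (intro integrable_quadratic_gaussian) auto
    fix A assume A: "A \<in> ball A0 (Re A0 / 2)"
    have ReA: "Re A0 / 2 \<le> Re A"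
      using A abs_Re_le_cmod[of "A0 - A"] by (auto simp: dist_norm)
    then show "integrable lborel (gauss A B b)" using A0 by (intro integrable_gauss) auto
    fix x
    show "((\<lambda>A. gauss A B b x) has_field_derivative - of_real ((norm x)\<^sup>2) * gauss A B b x) (at A)"
      unfolding gauss_def by (auto intro!: derivative_eq_intros)
    have "(norm x)\<^sup>2 * cmod (gauss A B b x) \<le> (1 + norm x)\<^sup>2 * exp (- (Re A0 / 2) * (norm x)\<^sup>2 + (cmod B * norm b) * norm x)"
      using ReA by (intro mult_mono power_mono norm_gauss_le) auto
    then show "cmod (- of_real ((norm x)\<^sup>2) * gauss A B b x) \<le> (1 + norm x)\<^sup>2 * exp (- (Re A0 / 2) * (norm x)\<^sup>2 + (cmod B * norm b) * norm x)"
      by (simp add: norm_mult norm_power)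
  qed (use A0 in auto)
  then show ?thesis by (subst holomorphic_on_open) (auto simp: open_halfspace_Re_gt)
qed

text \<open>For real parameters completing the square turns the integrand into a translated Gaussian.\<close>

lemma gauss_integral_real:
  assumes a: "a > 0"
  shows "(\<integral>x. gauss (of_real a) (of_real \<beta>) (b::'a::euclidean_space) x \<partial>lborel) =
    (of_real (sqrt pi) / csqrt (of_real a)) ^ DIM('a) * exp ((of_real \<beta>)\<^sup>2 * of_real ((norm b)\<^sup>2) / (4 * of_real a))"
proof -
  define c where "c = (- \<beta> / (2 * a)) *\<^sub>R b"
  have eq: "gauss (of_real a) (of_real \<beta>) b x = complex_of_real (exp (\<beta>\<^sup>2 * (norm b)\<^sup>2 / (4 * a)) * exp (- a * (norm (c + x))\<^sup>2))" for x
  proof -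
    have "- a * (norm (c + x))\<^sup>2 + \<beta>\<^sup>2 * (norm b)\<^sup>2 / (4 * a) = - a * (norm x)\<^sup>2 + \<beta> * (b \<bullet> x)"
      using a unfolding power2_norm_eq_inner c_def
      by (simp add: inner_simps inner_commute power2_eq_square field_simps)
    then show ?thesis
      unfolding gauss_def by (simp only: mult_exp_exp exp_of_real[symmetric] of_real_mult[symmetric] of_real_add[symmetric] of_real_minus[symmetric] add.commute)
  qed
  have "(\<integral>x. gauss (of_real a) (of_real \<beta>) b x \<partial>lborel) =
      of_real (exp (\<beta>\<^sup>2 * (norm b)\<^sup>2 / (4 * a)) * (\<integral>x. exp (- a * (norm (c + x))\<^sup>2) \<partial>lborel))"
    unfolding eq by (subst integral_complex_of_real) simp
  also have "(\<integral>x. exp (- a * (norm (c + x))\<^sup>2) \<partial>lborel) = (\<integral>(x::'a). exp (- a * (norm x)\<^sup>2) \<partial>lborel)"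
    by (rule integral_translate[of "\<lambda>x. exp (- a * (norm x)\<^sup>2)"]) simp
  also have "\<dots> = sqrt (pi / a) ^ DIM('a)" using a by (rule integral_gaussian)
  finally show ?thesis
    using a by (simp add: exp_of_real[symmetric] real_sqrt_divide mult.commute power_divide)
qed

lemma islimpt_complex_reals: "complex_of_real 1 islimpt (complex_of_real ` {0<..})"
  unfolding islimpt_approachable
proof (intro allI impI)
  fix e :: real assume "e > 0"
  then show "\<exists>x'\<in>complex_of_real ` {0<..}. x' \<noteq> of_real 1 \<and> dist x' (of_real 1) < e"
    by (intro bexI[of _ "of_real (1 + e / 2)"] imageI) (auto simp: dist_norm norm_divide)
qed

text \<open>Both sides are holomorphic in \<open>A\<close> and in \<open>B\<close> and agree on positive reals, so the
  identity theorem applies, first in \<open>B\<close> with \<open>A\<close> real and then in \<open>A\<close>. Analytic continuation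
  also selects the branch: the principal square root is holomorphic on the right half-plane.\<close>

theorem gauss_integral:
  assumes A: "Re A > 0"
  shows "(\<integral>x. gauss A B (b::'a::euclidean_space) x \<partial>lborel) =
    (of_real (sqrt pi) / csqrt A) ^ DIM('a) * exp (B\<^sup>2 * of_real ((norm b)\<^sup>2) / (4 * A))"
proof -
  let ?G = "\<lambda>A B. (of_real (sqrt pi) / csqrt A) ^ DIM('a) * exp (B\<^sup>2 * of_real ((norm b)\<^sup>2) / (4 * A))"
  let ?F = "\<lambda>A B. \<integral>x. gauss A B b x \<partial>lborel"
  have nz: "A \<notin> \<real>\<^sub>\<le>\<^sub>0" "A \<noteq> 0" if "Re A > 0" for A
    using that by (auto simp: complex_nonpos_Reals_iff)
  have real: "?F (of_real a) B - ?G (of_real a) B = 0" if a: "a > 0" for a B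
  proof (rule analytic_continuation[where f="\<lambda>B. ?F (of_real a) B - ?G (of_real a) B" and S=UNIV and U="of_real ` {0<..}" and \<xi>="of_real 1"])
    show "(\<lambda>B. ?F (of_real a) B - ?G (of_real a) B) holomorphic_on UNIV"
      using a by (intro holomorphic_intros gauss_holomorphic_linear) auto
    show "?F (of_real a) z - ?G (of_real a) z = 0" if z: "z \<in> complex_of_real ` {0<..}" for z
      using z gauss_integral_real[OF a] by auto
  qed (use islimpt_complex_reals in auto)
  have "?F A B - ?G A B = 0"
  proof (rule analytic_continuation[where f="\<lambda>A. ?F A B - ?G A B" and S="{A. Re A > 0}" and U="of_real ` {0<..}" and \<xi>="of_real 1"])
    show "(\<lambda>A. ?F A B - ?G A B) holomorphic_on {A. Re A > 0}"
      using nz by (intro holomorphic_intros gauss_holomorphic_quadratic) auto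
    show "connected {A. Re A > 0}" by (intro convex_connected convex_halfspace_Re_gt)
    show "?F z B - ?G z B = 0" if z: "z \<in> complex_of_real ` {0<..}" for z
      using z real by auto
  qed (use A islimpt_complex_reals in \<open>auto simp: open_halfspace_Re_gt\<close>)
  then show ?thesis by simp
qed

section \<open>The heat kernel at complex times\<close>

lemma borel_measurable_complex_parts [measurable]:
  "Re \<in> borel_measurable borel" "Im \<in> borel_measurable borel" "cnj \<in> borel_measurable borel"
  by (auto intro!: borel_measurable_continuous_onI continuous_intros)

text \<open>Integrating \<open>2 |f| |g| \<le> c |f|\<^sup>2 + |g|\<^sup>2 / c\<close> and optimising over \<open>c\<close>.\<close>

lemma cauchy_schwarz_integral:
  fixes f g :: "'a \<Rightarrow> complex"
  assumes [measurable]: "f \<in> borel_measurable M" "g \<in> borel_measurable M"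
    and f: "integrable M (\<lambda>x. (cmod (f x))\<^sup>2)" and g: "integrable M (\<lambda>x. (cmod (g x))\<^sup>2)"
  shows "integrable M (\<lambda>x. f x * g x)"
    and "(\<integral>x. cmod (f x) * cmod (g x) \<partial>M) \<le> sqrt (\<integral>x. (cmod (f x))\<^sup>2 \<partial>M) * sqrt (\<integral>x. (cmod (g x))\<^sup>2 \<partial>M)"
    and "cmod (\<integral>x. f x * g x \<partial>M) \<le> sqrt (\<integral>x. (cmod (f x))\<^sup>2 \<partial>M) * sqrt (\<integral>x. (cmod (g x))\<^sup>2 \<partial>M)"
proof -
  have le: "cmod (f x) * cmod (g x) \<le> (c * (cmod (f x))\<^sup>2 + (cmod (g x))\<^sup>2 / c) / 2" if "c > 0" for c x
  proof -
    have "0 \<le> (c * cmod (f x) - cmod (g x))\<^sup>2 / c" using that by simp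
    also have "\<dots> = c * (cmod (f x))\<^sup>2 + (cmod (g x))\<^sup>2 / c - 2 * (cmod (f x) * cmod (g x))"
      using that by (simp add: power2_eq_square field_simps)
    finally show ?thesis by simp
  qed
  show int: "integrable M (\<lambda>x. f x * g x)"
  proof (rule Bochner_Integration.integrable_bound)
    show "integrable M (\<lambda>x. (1 * (cmod (f x))\<^sup>2 + (cmod (g x))\<^sup>2 / 1) / 2)" using f g by simp
    show "AE x in M. norm (f x * g x) \<le> norm ((1 * (cmod (f x))\<^sup>2 + (cmod (g x))\<^sup>2 / 1) / 2)"
      using le[of 1] by (intro AE_I2) (simp add: norm_mult)
  qed simp
  let ?A = "\<integral>x. (cmod (f x))\<^sup>2 \<partial>M" and ?B = "\<integral>x. (cmod (g x))\<^sup>2 \<partial>M"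
  let ?I = "\<integral>x. cmod (f x) * cmod (g x) \<partial>M"
  have intn: "integrable M (\<lambda>x. cmod (f x) * cmod (g x))"
    using integrable_norm[OF int] by (simp add: norm_mult)
  have A0: "?A \<ge> 0" "?B \<ge> 0" by (auto intro!: integral_nonneg_AE)
  have bound: "?I \<le> (c * ?A + ?B / c) / 2" if c: "c > 0" for c
  proof -
    have "?I \<le> (\<integral>x. (c * (cmod (f x))\<^sup>2 + (cmod (g x))\<^sup>2 / c) / 2 \<partial>M)"
      using le[OF c] f g intn by (intro integral_mono) auto
    then show ?thesis using f g by simp
  qed
  show *: "?I \<le> sqrt ?A * sqrt ?B"
  proof (rule field_le_epsilon)
    fix e :: real assume e: "e > 0"
    define a b where "a = sqrt ?A" and "b = sqrt ?B"
    have ab: "a \<ge> 0" "b \<ge> 0" "?A = a\<^sup>2" "?B = b\<^sup>2" using A0 by (auto simp: a_def b_def)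
    \<comment> \<open>The optimal \<open>c\<close> is \<open>b / a\<close>; shifting both by \<open>d\<close> keeps it positive and finite when a norm vanishes.\<close>
    define d where "d = min 1 (e / (a + b + 1))"
    have "d \<le> e / (a + b + 1)" by (simp add: d_def)
    moreover have "a + b + 1 > 0" using ab by simp
    ultimately have "d * (a + b + 1) \<le> e" by (subst (asm) pos_le_divide_eq) auto
    moreover have "d > 0" "d \<le> 1" using e ab by (auto simp: d_def)
    ultimately have d: "d > 0" "d \<le> 1" "d * (a + b + 1) \<le> e" by auto
    have "?I \<le> ((b + d) / (a + d) * a\<^sup>2 + b\<^sup>2 / ((b + d) / (a + d))) / 2"
      using bound[of "(b + d) / (a + d)"] ab d by simp
    also have "(b + d) / (a + d) * a\<^sup>2 \<le> (b + d) * (a + d)"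
    proof -
      have "a\<^sup>2 / (a + d) \<le> a + d" using ab d by (simp add: divide_simps power2_eq_square algebra_simps)
      then have "(b + d) * (a\<^sup>2 / (a + d)) \<le> (b + d) * (a + d)" using ab d by (intro mult_left_mono) auto
      then show ?thesis by simp
    qed
    also have "b\<^sup>2 / ((b + d) / (a + d)) \<le> (b + d) * (a + d)"
    proof -
      have "b\<^sup>2 / (b + d) \<le> b + d" using ab d by (simp add: divide_simps power2_eq_square algebra_simps)
      then have "(a + d) * (b\<^sup>2 / (b + d)) \<le> (a + d) * (b + d)" using ab d by (intro mult_left_mono) auto
      then show ?thesis by (simp add: mult.commute)
    qed
    also have "((b + d) * (a + d) + (b + d) * (a + d)) / 2 = a * b + d * (a + b + d)" by (simp add: algebra_simps)
    also have "d * (a + b + d) \<le> d * (a + b + 1)" using d by (intro mult_left_mono) auto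
    finally have "?I \<le> a * b + e" using d by simp
    then show "?I \<le> sqrt ?A * sqrt ?B + e" by (simp add: a_def b_def)
  qed
  have "cmod (\<integral>x. f x * g x \<partial>M) \<le> (\<integral>x. cmod (f x * g x) \<partial>M)" by (rule integral_norm_bound)
  then show "cmod (\<integral>x. f x * g x \<partial>M) \<le> sqrt ?A * sqrt ?B" using * by (simp add: norm_mult)
qed

lemma norm_csqrt: "cmod (csqrt z) = sqrt (cmod z)"
  by (metis norm_ge_zero norm_power power2_csqrt real_sqrt_unique)

text \<open>For \<open>z = \<epsilon> + i t\<close> this is the kernel of \<open>e^(z \<Delta>)\<close>. The principal branch of the square root
  makes it holomorphic in \<open>z\<close> on the right half-plane.\<close>

definition heat_kernel :: "complex \<Rightarrow> 'a::euclidean_space \<Rightarrow> complex"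
  where "heat_kernel z x = exp (- of_real ((norm x)\<^sup>2) / (4 * z)) / csqrt (of_real (4 * pi) * z) ^ DIM('a)"

lemma borel_measurable_heat_kernel [measurable]: "heat_kernel z \<in> borel_measurable borel"
  unfolding heat_kernel_def by measurable

lemma borel_measurable_heat_kernel' [measurable (raw)]:
  assumes [measurable]: "f \<in> borel_measurable M" "g \<in> borel_measurable M"
  shows "(\<lambda>x. heat_kernel (f x) (g x)) \<in> borel_measurable M"
proof -
  have "csqrt = (\<lambda>z. of_real (sqrt ((cmod z + Re z) / 2)) +
      \<i> * of_real ((if Im z = 0 then 1 else sgn (Im z)) * sqrt ((cmod z - Re z) / 2)))"
    by (auto simp: complex_eq_iff)
  moreover have "(\<lambda>z. of_real (sqrt ((cmod z + Re z) / 2)) +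
      \<i> * of_real ((if Im z = 0 then 1 else sgn (Im z)) * sqrt ((cmod z - Re z) / 2))) \<in> borel_measurable borel"
    by measurable
  ultimately have [measurable]: "csqrt \<in> borel_measurable borel"
    by (simp only:)
  show ?thesis unfolding heat_kernel_def by measurable
qed

lemma heat_kernel_minus: "heat_kernel z (x - y) = heat_kernel z (y - x)"
  by (simp add: heat_kernel_def norm_minus_commute)

lemma norm_heat_kernel:
  "cmod (heat_kernel z (x::'a::euclidean_space)) =
    exp (- (Re z / (4 * (cmod z)\<^sup>2)) * (norm x)\<^sup>2) / sqrt (4 * pi * cmod z) ^ DIM('a)"
proof -
  have "Re (- of_real ((norm x)\<^sup>2) / (4 * z)) = - (Re z / (4 * (cmod z)\<^sup>2)) * (norm x)\<^sup>2"
  proof (cases "z = 0")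
    case False
    then have "0 < (Re z)\<^sup>2 + (Im z)\<^sup>2" by (simp add: cmod_power2[symmetric])
    then show ?thesis by (simp add: Re_divide cmod_power2 divide_simps)
  qed simp
  then show ?thesis
    by (simp add: heat_kernel_def norm_divide norm_power norm_mult norm_csqrt)
qed

text \<open>The dispersive estimate: it depends on \<open>Im z\<close> alone and therefore survives the limit in which
  \<open>Re z\<close> tends to zero.\<close>

lemma heat_kernel_dispersive:
  assumes "Re z \<ge> 0" "Im z \<noteq> 0"
  shows "cmod (heat_kernel z (x::'a::euclidean_space)) \<le> 1 / sqrt (4 * pi * \<bar>Im z\<bar>) ^ DIM('a)"
proof -
  have "exp (- (Re z / (4 * (cmod z)\<^sup>2)) * (norm x)\<^sup>2) \<le> 1" using assms by simp
  moreover have "sqrt (4 * pi * \<bar>Im z\<bar>) ^ DIM('a) \<le> sqrt (4 * pi * cmod z) ^ DIM('a)"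
    using abs_Im_le_cmod[of z] by (intro power_mono) auto
  ultimately show ?thesis
    unfolding norm_heat_kernel using assms by (intro frac_le) auto
qed

lemma heat_kernel_bounded: 
  assumes "Re z > 0"
  shows "cmod (heat_kernel z (x::'a::euclidean_space)) \<le> 1 / sqrt (4 * pi * cmod z) ^ DIM('a)"
  unfolding norm_heat_kernel using assms by (intro divide_right_mono) auto

lemma integrable_norm_heat_kernel:
  assumes "Re z > 0"
  shows "integrable lborel (\<lambda>x::'a::euclidean_space. cmod (heat_kernel z x))"
proof -
  have "Re z / (4 * (cmod z)\<^sup>2) > 0" using assms by (auto intro!: divide_pos_pos)
  from integrable_gaussian[OF this, where 'a='a] show ?thesis
    unfolding norm_heat_kernel by simp
qed

lemma integrable_heat_kernel:
  assumes "Re z > 0"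
  shows "integrable lborel (heat_kernel z :: 'a::euclidean_space \<Rightarrow> complex)"
  using integrable_norm_heat_kernel[OF assms, where 'a='a]
  by (subst (asm) integrable_norm_iff) auto

lemma integrable_power2_heat_kernel:
  assumes "Re z > 0"
  shows "integrable lborel (\<lambda>x::'a::euclidean_space. (cmod (heat_kernel z x))\<^sup>2)"
proof (rule Bochner_Integration.integrable_bound)
  show "integrable lborel (\<lambda>x::'a. 1 / sqrt (4 * pi * cmod z) ^ DIM('a) * cmod (heat_kernel z x))"
    using integrable_norm_heat_kernel[OF assms, where 'a='a] by (intro integrable_mult_right)
  show "AE x::'a in lborel. norm ((cmod (heat_kernel z x))\<^sup>2) \<le> norm (1 / sqrt (4 * pi * cmod z) ^ DIM('a) * cmod (heat_kernel z x))"
  proof (rule AE_I2)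
    fix x :: 'a
    have "cmod (heat_kernel z x) * cmod (heat_kernel z x) \<le> 1 / sqrt (4 * pi * cmod z) ^ DIM('a) * cmod (heat_kernel z x)"
      using heat_kernel_bounded[OF assms, of x] by (intro mult_right_mono) auto
    then show "norm ((cmod (heat_kernel z x))\<^sup>2) \<le> norm (1 / sqrt (4 * pi * cmod z) ^ DIM('a) * cmod (heat_kernel z x))"
      by (simp add: power2_eq_square abs_mult)
  qed
qed simp

lemma integrable_heat_kernel_shift:
  assumes "Re z > 0"
  shows "integrable lborel (\<lambda>y::'a::euclidean_space. cmod (heat_kernel z (x - y)))"
    "integrable lborel (\<lambda>y::'a. (cmod (heat_kernel z (x - y)))\<^sup>2)"
  using integrable_translate[OF integrable_norm_heat_kernel[OF assms, where 'a='a], of "- x"]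
    integrable_translate[OF integrable_power2_heat_kernel[OF assms, where 'a='a], of "- x"]
  by (simp_all add: heat_kernel_minus[of z x])

lemma heat_kernel_real:
  assumes "e > 0"
  shows "heat_kernel (of_real e) x = of_real (cmod (heat_kernel (of_real e) x))"
    "heat_kernel (of_real e) (x::'a::euclidean_space) = of_real (exp (- (norm x)\<^sup>2 / (4 * e)) / sqrt (4 * pi * e) ^ DIM('a))"
proof -
  have "csqrt (of_real (4 * pi) * of_real e) = of_real (sqrt (4 * pi * e))"
    using assms by (subst of_real_mult[symmetric], subst csqrt_of_real_nonneg) auto
  then show *: "heat_kernel (of_real e) x = of_real (exp (- (norm x)\<^sup>2 / (4 * e)) / sqrt (4 * pi * e) ^ DIM('a))"
    unfolding heat_kernel_def by (simp add: exp_of_real[symmetric])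
  show "heat_kernel (of_real e) x = of_real (cmod (heat_kernel (of_real e) x))"
    unfolding * norm_of_real using assms by simp
qed

lemma integral_heat_kernel_real:
  assumes e: "e > 0"
  shows "(\<integral>x. cmod (heat_kernel (of_real e) (x::'a::euclidean_space)) \<partial>lborel) = 1"
proof -
  have "(\<integral>(x::'a). cmod (heat_kernel (of_real e) x) \<partial>lborel) = (\<integral>(x::'a). exp (- (1 / (4 * e)) * (norm x)\<^sup>2) \<partial>lborel) / sqrt (4 * pi * e) ^ DIM('a)"
    using e unfolding norm_heat_kernel by (simp add: power2_eq_square)
  also have "\<dots> = 1" using e by (subst integral_gaussian) (auto simp: mult.commute mult.left_commute)
  finally show ?thesis .
qed

lemma nn_integral_heat_kernel_real:
  assumes e: "e > 0"
  shows "(\<integral>\<^sup>+y. ennreal (cmod (heat_kernel (of_real e) (x - y::'a::euclidean_space))) \<partial>lborel) = 1"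
proof -
  have "(\<integral>\<^sup>+y. ennreal (cmod (heat_kernel (of_real e) (x - y))) \<partial>lborel) = (\<integral>\<^sup>+(y::'a). ennreal (cmod (heat_kernel (of_real e) (- x + y))) \<partial>lborel)"
    by (simp add: heat_kernel_minus[of _ x])
  also have "\<dots> = (\<integral>\<^sup>+(y::'a). ennreal (cmod (heat_kernel (of_real e) y)) \<partial>lborel)"
    by (rule nn_integral_translate) simp
  also have "\<dots> = 1" 
    using integrable_norm_heat_kernel[of "of_real e", where 'a='a] integral_heat_kernel_real[OF e, where 'a='a] e
    by (subst nn_integral_eq_integral) auto
  finally show ?thesis .
qed

text \<open>The semigroup law up to a phase. The product of two kernels is a single complex Gaussian in \<open>y\<close>
  after completing the square, so \<open>gauss_integral\<close> evaluates the integral. Since only absolute values of such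
  integrals are estimated later, it suffices that the quotient \<open>\<omega>\<close> of the square roots has modulus one; this
  avoids choosing branches.\<close>

lemma heat_kernel_semigroup:
  assumes z: "Re z > 0" and w: "Re w > 0"
  obtains \<omega> where "cmod \<omega> = 1"
    "\<And>x x' :: 'a::euclidean_space.
      (\<integral>y. cnj (heat_kernel z (x - y)) * heat_kernel w (x' - y) \<partial>lborel) = \<omega> * heat_kernel (cnj z + w) (x - x')"
proof
  let ?d = "DIM('a)"
  define A where "A = 1 / (4 * cnj z) + 1 / (4 * w)"
  define c where "c = cnj (csqrt (of_real (4 * pi) * z)) ^ ?d * csqrt (of_real (4 * pi) * w) ^ ?d"
  define \<omega> where "\<omega> = (of_real (sqrt pi) / csqrt A) ^ ?d * csqrt (of_real (4 * pi) * (cnj z + w)) ^ ?d / c"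
  have nz: "z \<noteq> 0" "w \<noteq> 0" "cnj z + w \<noteq> 0" using z w by (auto simp: complex_eq_iff)
  have A: "A = (cnj z + w) / (4 * cnj z * w)" unfolding A_def using nz by (simp add: field_simps)
  have ReA: "Re A > 0"
  proof -
    have "Re (1 / (4 * cnj z)) > 0" "Re (1 / (4 * w)) > 0"
      using z w by (auto simp: Re_divide intro!: divide_pos_pos add_pos_nonneg)
    then show ?thesis by (simp add: A_def)
  qed
  have A0: "A \<noteq> 0" using ReA by auto
  show "cmod \<omega> = 1"
  proof -
    have "cmod \<omega> = (sqrt pi / sqrt (cmod A) * sqrt (4 * pi * cmod (cnj z + w)) / (sqrt (4 * pi * cmod z) * sqrt (4 * pi * cmod w))) ^ ?d"
      unfolding \<omega>_def c_def by (simp add: norm_divide norm_mult norm_power norm_csqrt power_divide power_mult_distrib)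
    also have "cmod A = cmod (cnj z + w) / (4 * cmod z * cmod w)" unfolding A by (simp add: norm_divide norm_mult)
    also have "sqrt pi / sqrt (cmod (cnj z + w) / (4 * cmod z * cmod w)) * sqrt (4 * pi * cmod (cnj z + w)) / (sqrt (4 * pi * cmod z) * sqrt (4 * pi * cmod w)) = 1"
      using nz by (simp add: real_sqrt_mult real_sqrt_divide field_simps)
    finally show ?thesis by simp
  qed
  fix x x' :: 'a
  define b where "b = x' - x"
  have "(\<integral>y. cnj (heat_kernel z (x - y)) * heat_kernel w (x' - y) \<partial>lborel) =
      (\<integral>y. cnj (heat_kernel z (x - (x + y))) * heat_kernel w (x' - (x + y)) \<partial>lborel)"
    by (rule integral_translate[symmetric]) simp
  also have "\<dots> = (\<integral>y. exp (- of_real ((norm b)\<^sup>2) / (4 * w)) / c * gauss A (1 / (2 * w)) b y \<partial>lborel)"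
  proof (rule Bochner_Integration.integral_cong[OF refl])
    fix y
    have e1: "cnj (heat_kernel z (x - (x + y))) = exp (- of_real ((norm y)\<^sup>2) / (4 * cnj z)) / cnj (csqrt (of_real (4 * pi) * z)) ^ ?d"
      by (simp add: heat_kernel_def exp_cnj)
    have e2: "heat_kernel w (x' - (x + y)) = exp (- of_real ((norm (b - y))\<^sup>2) / (4 * w)) / csqrt (of_real (4 * pi) * w) ^ ?d"
      by (simp add: heat_kernel_def b_def algebra_simps)
    have nb: "(norm (b - y))\<^sup>2 = (norm b)\<^sup>2 - 2 * (b \<bullet> y) + (norm y)\<^sup>2"
      unfolding power2_norm_eq_inner by (simp add: inner_simps inner_commute)
    have "- of_real ((norm y)\<^sup>2) / (4 * cnj z) + - of_real ((norm (b - y))\<^sup>2) / (4 * w) =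
        - of_real ((norm b)\<^sup>2) / (4 * w) + (- A * of_real ((norm y)\<^sup>2) + 1 / (2 * w) * of_real (b \<bullet> y))"
      unfolding nb A_def using nz by (simp add: field_simps)
    then show "cnj (heat_kernel z (x - (x + y))) * heat_kernel w (x' - (x + y)) =
        exp (- of_real ((norm b)\<^sup>2) / (4 * w)) / c * gauss A (1 / (2 * w)) b y"
      unfolding e1 e2 c_def gauss_def by (simp add: mult_exp_exp)
  qed
  also have "\<dots> = exp (- of_real ((norm b)\<^sup>2) / (4 * w)) / c *
      ((of_real (sqrt pi) / csqrt A) ^ ?d * exp ((1 / (2 * w))\<^sup>2 * of_real ((norm b)\<^sup>2) / (4 * A)))"
    by (simp add: gauss_integral[OF ReA])
  also have "\<dots> = (of_real (sqrt pi) / csqrt A) ^ ?d / c * exp (- of_real ((norm b)\<^sup>2) / (4 * (cnj z + w)))"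
  proof -
    have "- of_real ((norm b)\<^sup>2) / (4 * w) + (1 / (2 * w))\<^sup>2 * of_real ((norm b)\<^sup>2) / (4 * A) = - of_real ((norm b)\<^sup>2) / (4 * (cnj z + w))"
    proof -
      have "(1 / (2 * w))\<^sup>2 / (4 * A) = cnj z / (4 * w * (cnj z + w))"
        unfolding A using nz by (simp add: field_simps power2_eq_square)
      moreover have "- 1 / (4 * w) + cnj z / (4 * w * (cnj z + w)) = - 1 / (4 * (cnj z + w))"
        using nz by (simp add: divide_simps)
      ultimately have "of_real ((norm b)\<^sup>2) * (- 1 / (4 * w) + (1 / (2 * w))\<^sup>2 / (4 * A)) = of_real ((norm b)\<^sup>2) * (- 1 / (4 * (cnj z + w)))"
        by simp
      then show ?thesis by (simp add: algebra_simps)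
    qed
    then show ?thesis by (simp add: mult_exp_exp mult.commute mult.left_commute)
  qed
  also have "\<dots> = \<omega> * heat_kernel (cnj z + w) (x - x')"
  proof -
    have "csqrt (of_real (4 * pi) * (cnj z + w)) ^ ?d \<noteq> 0" using nz by simp
    then show ?thesis
      unfolding \<omega>_def heat_kernel_def b_def by (simp add: norm_minus_commute)
  qed
  finally show "(\<integral>y. cnj (heat_kernel z (x - y)) * heat_kernel w (x' - y) \<partial>lborel) = \<omega> * heat_kernel (cnj z + w) (x - x')" .
qed

section \<open>The regularised evolution\<close>

definition propagate :: "complex \<Rightarrow> ('a::euclidean_space \<Rightarrow> complex) \<Rightarrow> 'a \<Rightarrow> complex"
  where "propagate z g x = (\<integral>y. g y * heat_kernel z (x - y) \<partial>lborel)"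

lemma borel_measurable_propagate [measurable]:
  assumes [measurable]: "g \<in> borel_measurable borel"
  shows "propagate z g \<in> borel_measurable borel"
  unfolding propagate_def by measurable

lemma integrable_product_bounded:
  fixes f g :: "'a \<Rightarrow> complex"
  assumes f: "integrable M f" and [measurable]: "g \<in> borel_measurable M" and g: "\<And>x. cmod (g x) \<le> C"
  shows "integrable M (\<lambda>x. f x * g x)"
proof (rule Bochner_Integration.integrable_bound)
  show "integrable M (\<lambda>x. f x * of_real C)" using f by (rule integrable_mult_left)
  have "cmod (f x) * cmod (g x) \<le> cmod (f x) * \<bar>C\<bar>" for x
    using g[of x] by (intro mult_left_mono) auto
  then show "AE x in M. norm (f x * g x) \<le> norm (f x * of_real C)" by (intro AE_I2) (simp add: norm_mult)
  show "(\<lambda>x. f x * g x) \<in> borel_measurable M" using f by measurable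
qed

lemma integrable_convolution_pair:
  fixes g k :: "'a::euclidean_space \<Rightarrow> complex"
  assumes g: "integrable lborel g" and k: "integrable lborel k"
  shows "integrable (lborel \<Otimes>\<^sub>M lborel) (\<lambda>(x, y). g x * k (y - x))"
proof (rule lborel_pair.Fubini_integrable)
  have [measurable]: "g \<in> borel_measurable borel" "k \<in> borel_measurable borel" using g k by auto
  show "(\<lambda>(x, y). g x * k (y - x)) \<in> borel_measurable (lborel \<Otimes>\<^sub>M lborel)" by measurable
  have kx: "integrable lborel (\<lambda>y. k (y - x))" for x
    using integrable_translate[OF k, of "- x"] by simp
  have "(\<integral>y. cmod (k (y - x)) \<partial>lborel) = (\<integral>y. cmod (k y) \<partial>lborel)" for x
    using integral_translate[of "\<lambda>y. cmod (k y)" "- x"] by simp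
  then show "integrable lborel (\<lambda>x. \<integral>y. norm (case (x, y) of (x, y) \<Rightarrow> g x * k (y - x)) \<partial>lborel)"
    using g by (simp add: norm_mult)
  show "AE x in lborel. integrable lborel (\<lambda>y. case (x, y) of (x, y) \<Rightarrow> g x * k (y - x))"
    using kx by simp
qed

lemma propagate_bounded:
  assumes g: "integrable lborel g" and z: "Re z > 0" and b: "\<And>x::'a::euclidean_space. cmod (heat_kernel z x) \<le> c"
  shows "cmod (propagate z g x) \<le> c * (\<integral>(y::'a). cmod (g y) \<partial>lborel)"
    and "integrable lborel (\<lambda>y. g y * heat_kernel z (x - y))"
proof -
  have [measurable]: "g \<in> borel_measurable borel" using g by auto
  show *: "integrable lborel (\<lambda>y. g y * heat_kernel z (x - y))"
    using g b by (intro integrable_product_bounded) auto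
  have "cmod (propagate z g x) \<le> (\<integral>y. cmod (g y * heat_kernel z (x - y)) \<partial>lborel)"
    unfolding propagate_def by (rule integral_norm_bound)
  also have "\<dots> \<le> (\<integral>y. c * cmod (g y) \<partial>lborel)"
  proof (rule integral_mono)
    fix y show "cmod (g y * heat_kernel z (x - y)) \<le> c * cmod (g y)"
      using b[of "x - y"] mult_left_mono[of "cmod (heat_kernel z (x - y))" c "cmod (g y)"] by (simp add: norm_mult mult.commute)
  qed (use * g in \<open>auto intro: integrable_norm\<close>)
  finally show "cmod (propagate z g x) \<le> c * (\<integral>y. cmod (g y) \<partial>lborel)" using g by simp
qed

lemma propagate_L1:
  assumes g: "integrable lborel (g :: 'a::euclidean_space \<Rightarrow> complex)" and z: "Re z > 0"
  shows "integrable lborel (propagate z g)"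
proof -
  have "integrable lborel (\<lambda>y. \<integral>x. g x * heat_kernel z (y - x) \<partial>lborel)"
    using lborel_pair.integrable_snd[OF integrable_convolution_pair[OF g integrable_heat_kernel[OF z]]] by simp
  then show ?thesis by (simp add: propagate_def[abs_def])
qed

text \<open>The inner product of two back-propagated functions is a single propagation over the combined
  time; this is what turns a square of the solution operator into the operator itself.\<close>

lemma propagate_pairing:
  assumes z: "Re z > 0" and w: "Re w > 0"
  obtains \<omega> where "cmod \<omega> = 1"
    "\<And>g h :: 'a::euclidean_space \<Rightarrow> complex. integrable lborel g \<Longrightarrow> integrable lborel h \<Longrightarrow>
      (\<integral>y. (\<integral>x. g x * cnj (heat_kernel z (x - y)) \<partial>lborel) * cnj (\<integral>x. h x * cnj (heat_kernel w (x - y)) \<partial>lborel) \<partial>lborel)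
      = \<omega> * (\<integral>x. g x * propagate (cnj z + w) (\<lambda>x. cnj (h x)) x \<partial>lborel)"
proof -
  obtain \<omega> where om: "cmod \<omega> = 1" and sg: "\<And>x x' :: 'a.
      (\<integral>y. cnj (heat_kernel z (x - y)) * heat_kernel w (x' - y) \<partial>lborel) = \<omega> * heat_kernel (cnj z + w) (x - x')"
    using heat_kernel_semigroup[OF z w] by blast
  show ?thesis
  proof (rule that[OF om])
    fix g h :: "'a \<Rightarrow> complex"
    assume g: "integrable lborel g" and h: "integrable lborel h"
    have [measurable]: "g \<in> borel_measurable borel" "h \<in> borel_measurable borel" using g h by auto
    define h' where "h' = (\<lambda>x. cnj (h x))"
    have h': "integrable lborel h'" using h by (simp add: h'_def)
    have [measurable]: "h' \<in> borel_measurable borel" unfolding h'_def by measurable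
    let ?k = "\<lambda>x. cnj (heat_kernel z x)"
    have k: "integrable lborel (?k :: 'a \<Rightarrow> complex)" using integrable_heat_kernel[OF z, where 'a='a] by simp
    define B where "B y = propagate w h' y" for y
    have B: "cnj (\<integral>x. h x * cnj (heat_kernel w (x - y)) \<partial>lborel) = B y" for y
      unfolding B_def propagate_def h'_def by (simp add: heat_kernel_minus[of w y] flip: Bochner_Integration.integral_cnj)
    have [measurable]: "B \<in> borel_measurable borel" unfolding B_def by measurable
    have Bb: "cmod (B y) \<le> 1 / sqrt (4 * pi * cmod w) ^ DIM('a) * (\<integral>x. cmod (h' x) \<partial>lborel)" for y
      unfolding B_def by (rule propagate_bounded[OF h' w heat_kernel_bounded[OF w]])
    have int1: "integrable (lborel \<Otimes>\<^sub>M lborel) (\<lambda>(x, y). g x * ?k (x - y) * B y)"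
    proof -
      have "integrable (lborel \<Otimes>\<^sub>M lborel) (\<lambda>p. (case p of (x, y) \<Rightarrow> g x * ?k (y - x)) * B (snd p))"
        using Bb by (intro integrable_product_bounded[OF integrable_convolution_pair[OF g k]]) auto
      then show ?thesis by (simp add: heat_kernel_minus[of z] case_prod_beta')
    qed
    have "(\<integral>y. (\<integral>x. g x * ?k (x - y) \<partial>lborel) * B y \<partial>lborel) = (\<integral>y. (\<integral>x. g x * ?k (x - y) * B y \<partial>lborel) \<partial>lborel)"
      by simp
    also have "\<dots> = (\<integral>x. (\<integral>y. g x * ?k (x - y) * B y \<partial>lborel) \<partial>lborel)"
      using lborel_pair.Fubini_integral[OF int1] by simp
    also have "\<dots> = (\<integral>x. g x * (\<omega> * propagate (cnj z + w) h' x) \<partial>lborel)"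
    proof (rule Bochner_Integration.integral_cong[OF refl])
      fix x
      have int2: "integrable (lborel \<Otimes>\<^sub>M lborel) (\<lambda>(x', y). h' x' * heat_kernel w (y - x') * ?k (x - y))"
      proof -
        have "integrable (lborel \<Otimes>\<^sub>M lborel) (\<lambda>p. (case p of (x', y) \<Rightarrow> h' x' * heat_kernel w (y - x')) * ?k (x - snd p))"
          using heat_kernel_bounded[OF z]
          by (intro integrable_product_bounded[OF integrable_convolution_pair[OF h' integrable_heat_kernel[OF w]]]) auto
        then show ?thesis by (simp add: case_prod_beta')
      qed
      have "(\<integral>y. g x * ?k (x - y) * B y \<partial>lborel) = g x * (\<integral>y. ?k (x - y) * B y \<partial>lborel)"
        by (simp add: mult.assoc)
      also have "(\<integral>y. ?k (x - y) * B y \<partial>lborel) = (\<integral>y. (\<integral>x'. h' x' * heat_kernel w (y - x') * ?k (x - y) \<partial>lborel) \<partial>lborel)"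
        unfolding B_def propagate_def by (simp add: mult.commute)
      also have "\<dots> = (\<integral>x'. (\<integral>y. h' x' * heat_kernel w (y - x') * ?k (x - y) \<partial>lborel) \<partial>lborel)"
        using lborel_pair.Fubini_integral[OF int2] by simp
      also have "\<dots> = (\<integral>x'. h' x' * (\<integral>y. ?k (x - y) * heat_kernel w (x' - y) \<partial>lborel) \<partial>lborel)"
        by (simp add: heat_kernel_minus[of w] mult.assoc mult.commute[of "heat_kernel w _"])
      also have "\<dots> = \<omega> * propagate (cnj z + w) h' x"
        unfolding sg propagate_def by (simp add: mult.left_commute)
      finally show "(\<integral>y. g x * ?k (x - y) * B y \<partial>lborel) = g x * (\<omega> * propagate (cnj z + w) h' x)" .
    qed
    also have "\<dots> = \<omega> * (\<integral>x. g x * propagate (cnj z + w) h' x \<partial>lborel)"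
      by (simp add: mult.left_commute)
    finally show "(\<integral>y. (\<integral>x. g x * ?k (x - y) \<partial>lborel) * cnj (\<integral>x. h x * cnj (heat_kernel w (x - y)) \<partial>lborel) \<partial>lborel)
      = \<omega> * (\<integral>x. g x * propagate (cnj z + w) (\<lambda>x. cnj (h x)) x \<partial>lborel)"
      unfolding B h'_def .
  qed
qed

text \<open>At positive real times the kernel is a probability density, so Schur's test with constant one
  applies: split the product by the arithmetic-geometric mean inequality and integrate the kernel in either variable.\<close>

lemma real_propagate_form:
  fixes g h :: "'a::euclidean_space \<Rightarrow> complex"
  assumes e: "e > 0" and [measurable]: "g \<in> borel_measurable borel" "h \<in> borel_measurable borel"
  shows "(\<integral>\<^sup>+x. ennreal (cmod (g x) * cmod (propagate (of_real e) h x)) \<partial>lborel) \<le>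
    (\<integral>\<^sup>+x. ennreal ((cmod (g x))\<^sup>2 / 2) \<partial>lborel) + (\<integral>\<^sup>+x. ennreal ((cmod (h x))\<^sup>2 / 2) \<partial>lborel)"
proof -
  let ?K = "\<lambda>x y. ennreal (cmod (heat_kernel (of_real e) (x - y)))"
  have "(\<integral>\<^sup>+x. ennreal (cmod (g x) * cmod (propagate (of_real e) h x)) \<partial>lborel) \<le>
     (\<integral>\<^sup>+x. \<integral>\<^sup>+y. ennreal ((cmod (g x))\<^sup>2 / 2) * ?K x y + ennreal ((cmod (h y))\<^sup>2 / 2) * ?K x y \<partial>lborel \<partial>lborel)"
  proof (rule nn_integral_mono)
    fix x :: 'a
    have "ennreal (cmod (propagate (of_real e) h x)) \<le> (\<integral>\<^sup>+y. ennreal (cmod (h y * heat_kernel (of_real e) (x - y))) \<partial>lborel)"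
      unfolding propagate_def
    proof (cases "integrable lborel (\<lambda>y. h y * heat_kernel (of_real e) (x - y))")
      case True then show "ennreal (cmod (\<integral>y. h y * heat_kernel (of_real e) (x - y) \<partial>lborel)) \<le> (\<integral>\<^sup>+y. ennreal (cmod (h y * heat_kernel (of_real e) (x - y))) \<partial>lborel)"
        by (rule integral_norm_bound_ennreal)
    qed (simp add: not_integrable_integral_eq)
    then have "ennreal (cmod (g x) * cmod (propagate (of_real e) h x)) \<le> ennreal (cmod (g x)) * (\<integral>\<^sup>+y. ennreal (cmod (h y * heat_kernel (of_real e) (x - y))) \<partial>lborel)"
      by (simp add: ennreal_mult mult_left_mono)
    also have "\<dots> = (\<integral>\<^sup>+y. ennreal (cmod (g x)) * ennreal (cmod (h y * heat_kernel (of_real e) (x - y))) \<partial>lborel)"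
      by (rule nn_integral_cmult[symmetric]) measurable
    also have "\<dots> \<le> (\<integral>\<^sup>+y. ennreal ((cmod (g x))\<^sup>2 / 2) * ?K x y + ennreal ((cmod (h y))\<^sup>2 / 2) * ?K x y \<partial>lborel)"
    proof (rule nn_integral_mono)
      fix y :: 'a
      let ?k = "cmod (heat_kernel (of_real e) (x - y))"
      have "cmod (g x) * cmod (h y) \<le> (cmod (g x))\<^sup>2 / 2 + (cmod (h y))\<^sup>2 / 2"
        using sum_squares_bound[of "cmod (g x)" "cmod (h y)"] by simp
      then have "cmod (g x) * cmod (h y) * ?k \<le> ((cmod (g x))\<^sup>2 / 2 + (cmod (h y))\<^sup>2 / 2) * ?k"
        by (rule mult_right_mono) simp
      then show "ennreal (cmod (g x)) * ennreal (cmod (h y * heat_kernel (of_real e) (x - y))) \<le> ennreal ((cmod (g x))\<^sup>2 / 2) * ?K x y + ennreal ((cmod (h y))\<^sup>2 / 2) * ?K x y"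
        by (simp add: norm_mult ennreal_mult[symmetric] ennreal_plus[symmetric] algebra_simps del: ennreal_plus)
    qed
    finally show "ennreal (cmod (g x) * cmod (propagate (of_real e) h x)) \<le> (\<integral>\<^sup>+y. ennreal ((cmod (g x))\<^sup>2 / 2) * ?K x y + ennreal ((cmod (h y))\<^sup>2 / 2) * ?K x y \<partial>lborel)" .
  qed
  also have "\<dots> = (\<integral>\<^sup>+x. (\<integral>\<^sup>+y. ennreal ((cmod (g x))\<^sup>2 / 2) * ?K x y \<partial>lborel) + (\<integral>\<^sup>+y. ennreal ((cmod (h y))\<^sup>2 / 2) * ?K x y \<partial>lborel) \<partial>lborel)"
    by (intro nn_integral_cong nn_integral_add) measurable
  also have "\<dots> = (\<integral>\<^sup>+x. (\<integral>\<^sup>+y. ennreal ((cmod (g x))\<^sup>2 / 2) * ?K x y \<partial>lborel) \<partial>lborel) + (\<integral>\<^sup>+x. (\<integral>\<^sup>+y. ennreal ((cmod (h y))\<^sup>2 / 2) * ?K x y \<partial>lborel) \<partial>lborel)"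
    by (intro nn_integral_add) measurable
  also have "(\<integral>\<^sup>+x. (\<integral>\<^sup>+y. ennreal ((cmod (g x))\<^sup>2 / 2) * ?K x y \<partial>lborel) \<partial>lborel) = (\<integral>\<^sup>+x. ennreal ((cmod (g x))\<^sup>2 / 2) \<partial>lborel)"
    by (intro nn_integral_cong, subst nn_integral_cmult) (simp_all add: nn_integral_heat_kernel_real[OF e])
  also have "(\<integral>\<^sup>+x. (\<integral>\<^sup>+y. ennreal ((cmod (h y))\<^sup>2 / 2) * ?K x y \<partial>lborel) \<partial>lborel) = (\<integral>\<^sup>+y. (\<integral>\<^sup>+x. ennreal ((cmod (h y))\<^sup>2 / 2) * ?K x y \<partial>lborel) \<partial>lborel)"
    by (rule lborel_pair.Fubini'[symmetric]) measurable
  also have "\<dots> = (\<integral>\<^sup>+y. ennreal ((cmod (h y))\<^sup>2 / 2) \<partial>lborel)"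
  proof (intro nn_integral_cong)
    fix y :: 'a
    have "(\<integral>\<^sup>+x. ?K x y \<partial>lborel) = 1"
      using nn_integral_heat_kernel_real[OF e, of y] by (simp add: heat_kernel_minus[of _ y])
    then show "(\<integral>\<^sup>+x. ennreal ((cmod (h y))\<^sup>2 / 2) * ?K x y \<partial>lborel) = ennreal ((cmod (h y))\<^sup>2 / 2)"
      by (subst nn_integral_cmult) simp_all
  qed
  finally show ?thesis .
qed

text \<open>The square of the norm of the evolution at time \<open>z\<close> is, by the semigroup law, a quadratic form of the
  heat operator at the real time \<open>2 Re z\<close>, which is a contraction by \<open>real_propagate_form\<close>.\<close>

lemma propagate_L2:
  fixes g :: "'a::euclidean_space \<Rightarrow> complex"
  assumes z: "Re z > 0" and g: "integrable lborel g" and g2: "integrable lborel (\<lambda>x. (cmod (g x))\<^sup>2)"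
  shows "integrable lborel (\<lambda>x. (cmod (propagate z g x))\<^sup>2)"
    and "(\<integral>x. (cmod (propagate z g x))\<^sup>2 \<partial>lborel) \<le> (\<integral>x. (cmod (g x))\<^sup>2 \<partial>lborel)"
proof -
  have [measurable]: "g \<in> borel_measurable borel" using g by auto
  have b: "cmod (propagate z g x) \<le> 1 / sqrt (4 * pi * cmod z) ^ DIM('a) * (\<integral>x. cmod (g x) \<partial>lborel)" for x
    by (rule propagate_bounded[OF g z heat_kernel_bounded[OF z]])
  have int: "integrable lborel (\<lambda>x. propagate z g x * cnj (propagate z g x))"
    using b by (intro integrable_product_bounded[OF propagate_L1[OF g z]]) auto
  have eq: "propagate z g x * cnj (propagate z g x) = of_real ((cmod (propagate z g x))\<^sup>2)" for x
    by (rule complex_norm_square[symmetric])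
  show int2: "integrable lborel (\<lambda>x. (cmod (propagate z g x))\<^sup>2)"
    using integrable_norm[OF int] by (simp add: norm_mult power2_eq_square)
  obtain \<omega> where om: "cmod \<omega> = 1" and pair: "\<And>g h :: 'a \<Rightarrow> complex. integrable lborel g \<Longrightarrow> integrable lborel h \<Longrightarrow>
      (\<integral>y. (\<integral>x. g x * cnj (heat_kernel z (x - y)) \<partial>lborel) * cnj (\<integral>x. h x * cnj (heat_kernel z (x - y)) \<partial>lborel) \<partial>lborel)
      = \<omega> * (\<integral>x. g x * propagate (cnj z + z) (\<lambda>x. cnj (h x)) x \<partial>lborel)"
    using propagate_pairing[OF z z] by blast
  have c: "(\<integral>x. cnj (g x) * cnj (heat_kernel z (x - y)) \<partial>lborel) = cnj (propagate z g y)" for y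
    unfolding propagate_def by (simp add: heat_kernel_minus[of z y] flip: Bochner_Integration.integral_cnj)
  have "(\<integral>y. cnj (propagate z g y) * cnj (cnj (propagate z g y)) \<partial>lborel) = \<omega> * (\<integral>x. cnj (g x) * propagate (cnj z + z) g x \<partial>lborel)"
    using pair[of "\<lambda>x. cnj (g x)" "\<lambda>x. cnj (g x)"] g unfolding c by simp
  moreover have "cnj (propagate z g y) * cnj (cnj (propagate z g y)) = of_real ((cmod (propagate z g y))\<^sup>2)" for y
    using eq[of y] by (simp add: mult.commute)
  moreover have zz: "cnj z + z = of_real (2 * Re z)" by (simp add: complex_eq_iff)
  ultimately have "of_real (\<integral>x. (cmod (propagate z g x))\<^sup>2 \<partial>lborel) = \<omega> * (\<integral>x. cnj (g x) * propagate (of_real (2 * Re z)) g x \<partial>lborel)"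
    by (simp only: integral_complex_of_real)
  then have "cmod (of_real (\<integral>x. (cmod (propagate z g x))\<^sup>2 \<partial>lborel)) = cmod (\<integral>x. cnj (g x) * propagate (of_real (2 * Re z)) g x \<partial>lborel)"
    using om by (simp only: norm_mult mult_1)
  then have "(\<integral>x. (cmod (propagate z g x))\<^sup>2 \<partial>lborel) = cmod (\<integral>x. cnj (g x) * propagate (of_real (2 * Re z)) g x \<partial>lborel)"
    by (simp add: integral_nonneg_AE)
  also have "ennreal \<dots> \<le> (\<integral>\<^sup>+x. ennreal (cmod (cnj (g x) * propagate (of_real (2 * Re z)) g x)) \<partial>lborel)"
    by (cases "integrable lborel (\<lambda>x. cnj (g x) * propagate (of_real (2 * Re z)) g x)")
      (auto intro: integral_norm_bound_ennreal simp: not_integrable_integral_eq)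
  also have "\<dots> \<le> (\<integral>\<^sup>+x. ennreal ((cmod (g x))\<^sup>2 / 2) \<partial>lborel) + (\<integral>\<^sup>+x. ennreal ((cmod (g x))\<^sup>2 / 2) \<partial>lborel)"
    using real_propagate_form[of "2 * Re z" g g] z by (simp add: norm_mult)
  also have "\<dots> = ennreal (\<integral>x. (cmod (g x))\<^sup>2 \<partial>lborel)"
  proof -
    have "(\<integral>\<^sup>+x. ennreal ((cmod (g x))\<^sup>2 / 2) \<partial>lborel) = ennreal ((\<integral>x. (cmod (g x))\<^sup>2 \<partial>lborel) / 2)"
      using g2 by (subst nn_integral_eq_integral) auto
    then show ?thesis by (simp add: ennreal_plus[symmetric] integral_nonneg_AE del: ennreal_plus)
  qed
  finally show "(\<integral>x. (cmod (propagate z g x))\<^sup>2 \<partial>lborel) \<le> (\<integral>x. (cmod (g x))\<^sup>2 \<partial>lborel)"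
    by (subst (asm) ennreal_le_iff) (auto intro!: integral_nonneg_AE)
qed

section \<open>Two interpolation inequalities\<close>

lemma nn_integral_powr_from_0:
  assumes a: "a > 0" and b: "b \<ge> 0"
  shows "(\<integral>\<^sup>+s. ennreal (indicator {0..b} s * s powr (a - 1)) \<partial>lborel) = ennreal (b powr a / a)"
proof -
  have "((\<lambda>x. x powr (a - 1)) has_integral b powr (a - 1 + 1) / (a - 1 + 1)) {0..b}"
    using a b by (intro has_integral_powr_from_0) auto
  then show ?thesis
    by (subst nn_integral_has_integral_lebesgue[where f="\<lambda>x. x powr (a - 1)"]) auto
qed

text \<open>Young's inequality, applied to \<open>f\<close> and \<open>g\<close> normalised by \<open>A\<close> and \<open>B\<close>. Stating it with upper
  bounds in place of the norms avoids powers of extended reals.\<close>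

lemma holder_nn_integral:
  fixes f g :: "'a \<Rightarrow> real"
  assumes pq: "p > 1" "q > 1" "1 / p + 1 / q = 1"
    and [measurable]: "f \<in> borel_measurable M" "g \<in> borel_measurable M"
    and nn: "\<And>x. f x \<ge> 0" "\<And>x. g x \<ge> 0"
    and A: "A > 0" "(\<integral>\<^sup>+x. ennreal (f x powr p) \<partial>M) \<le> ennreal A"
    and B: "B > 0" "(\<integral>\<^sup>+x. ennreal (g x powr q) \<partial>M) \<le> ennreal B"
  shows "(\<integral>\<^sup>+x. ennreal (f x * g x) \<partial>M) \<le> ennreal (A powr (1 / p) * B powr (1 / q))"
proof -
  define a b where "a = A powr (1 / p)" and "b = B powr (1 / q)"
  have ab: "a > 0" "b > 0" "a powr p = A" "b powr q = B" using A B pq by (auto simp: a_def b_def powr_powr)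
  have "f x * g x \<le> a * b * (f x powr p / (p * A) + g x powr q / (q * B))" for x
  proof -
    have "f x / a * (g x / b) \<le> (f x / a) powr p / p + (g x / b) powr q / q"
      using nn ab pq by (intro Youngs_inequality) auto
    also have "\<dots> = f x powr p / (p * A) + g x powr q / (q * B)"
      using nn ab by (simp add: powr_divide mult.commute)
    finally show ?thesis using ab by (simp add: field_simps)
  qed
  then have "(\<integral>\<^sup>+x. ennreal (f x * g x) \<partial>M) \<le> (\<integral>\<^sup>+x. ennreal (a * b / (p * A)) * ennreal (f x powr p) + ennreal (a * b / (q * B)) * ennreal (g x powr q) \<partial>M)"
    using ab pq A B by (intro nn_integral_mono) (simp add: ennreal_mult[symmetric] ennreal_plus[symmetric] algebra_simps del: ennreal_plus)
  also have "\<dots> = ennreal (a * b / (p * A)) * (\<integral>\<^sup>+x. ennreal (f x powr p) \<partial>M) + ennreal (a * b / (q * B)) * (\<integral>\<^sup>+x. ennreal (g x powr q) \<partial>M)"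
    by (simp add: nn_integral_add nn_integral_cmult)
  also have "\<dots> \<le> ennreal (a * b / (p * A)) * ennreal A + ennreal (a * b / (q * B)) * ennreal B"
    using A B by (intro add_mono mult_left_mono) auto
  also have "\<dots> = ennreal (a * b * (1 / p + 1 / q))"
    using ab A B pq by (simp add: ennreal_mult[symmetric] ennreal_plus[symmetric] field_simps del: ennreal_plus)
  finally show ?thesis using pq by (simp add: a_def b_def)
qed

text \<open>Write \<open>v x powr q\<close> as the integral of \<open>q s^(q - 1)\<close> over \<open>0 \<le> s \<le> v x\<close> and
  exchange the integrals.\<close>

lemma nn_integral_power_layer_cake:
  fixes v :: "'a \<Rightarrow> real"
  assumes "sigma_finite_measure M" and [measurable]: "v \<in> borel_measurable M" and v: "\<And>x. v x \<ge> 0" and q: "q > 0"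
  shows "(\<integral>\<^sup>+x. ennreal (v x powr q) \<partial>M) = (\<integral>\<^sup>+s. ennreal (q * s powr (q - 1) * indicator {0..} s) * (\<integral>\<^sup>+x. indicator {x. s \<le> v x} x \<partial>M) \<partial>lborel)"
proof -
  interpret sigma_finite_measure M by fact
  interpret P: pair_sigma_finite M lborel by unfold_locales
  have "(\<integral>\<^sup>+x. ennreal (v x powr q) \<partial>M) = (\<integral>\<^sup>+x. (\<integral>\<^sup>+s. ennreal (q * s powr (q - 1) * indicator {0..} s) * indicator {x. s \<le> v x} x \<partial>lborel) \<partial>M)"
  proof (rule nn_integral_cong)
    fix x
    have "(\<integral>\<^sup>+s. ennreal (q * s powr (q - 1) * indicator {0..} s) * indicator {x. s \<le> v x} x \<partial>lborel) =
        (\<integral>\<^sup>+s. ennreal q * ennreal (indicator {0..v x} s * s powr (q - 1)) \<partial>lborel)"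
      using q by (intro nn_integral_cong) (auto simp: indicator_def ennreal_mult)
    also have "\<dots> = ennreal q * ennreal (v x powr q / q)"
      using q v by (subst nn_integral_cmult) (auto simp: nn_integral_powr_from_0)
    also have "\<dots> = ennreal (v x powr q)"
      using q by (simp add: ennreal_mult[symmetric])
    finally show "ennreal (v x powr q) = (\<integral>\<^sup>+s. ennreal (q * s powr (q - 1) * indicator {0..} s) * indicator {x. s \<le> v x} x \<partial>lborel)" ..
  qed
  also have "\<dots> = (\<integral>\<^sup>+s. (\<integral>\<^sup>+x. ennreal (q * s powr (q - 1) * indicator {0..} s) * indicator {x. s \<le> v x} x \<partial>M) \<partial>lborel)"
    by (rule P.Fubini'[symmetric]) measurable
  also have "\<dots> = (\<integral>\<^sup>+s. ennreal (q * s powr (q - 1) * indicator {0..} s) * (\<integral>\<^sup>+x. indicator {x. s \<le> v x} x \<partial>M) \<partial>lborel)"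
    by (intro nn_integral_cong nn_integral_cmult) measurable
  finally show ?thesis .
qed

text \<open>Marcinkiewicz interpolation between the bound \<open>\<Lambda>\<close> from \<open>L\<^sup>1\<close> to \<open>L^\<infinity>\<close> and the contraction
  of \<open>L\<^sup>2\<close>, with an explicit power of \<open>\<Lambda>\<close>. At each level \<open>s\<close> the function \<open>g\<close> is cut at
  a height \<open>h s\<close> chosen so that the part above the height contributes at most \<open>s / 2\<close> pointwise. The level set is then controlled by
  Chebyshev's inequality for the part below the height, and the layer cake formula integrates over \<open>s\<close>.\<close>

theorem marcinkiewicz_propagate:
  fixes g :: "'a::euclidean_space \<Rightarrow> complex"
  assumes q: "q > 2" and p: "p = q / (q - 1)" and z: "Re z > 0"
    and lam: "\<Lambda> > 0" "\<And>x::'a. cmod (heat_kernel z x) \<le> \<Lambda>"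
    and g: "integrable lborel g" and gb: "\<And>x. cmod (g x) \<le> M"
    and X: "X > 0" "(\<integral>\<^sup>+x. ennreal (cmod (g x) powr p) \<partial>lborel) \<le> ennreal X"
  shows "(\<integral>\<^sup>+x. ennreal (cmod (propagate z g x) powr q) \<partial>lborel) \<le>
    ennreal (4 * q / (q - 2) * 2 powr (q - 2) * (\<Lambda> powr (q - 2) * X powr (q - 1)))"
proof -
  have [measurable]: "g \<in> borel_measurable borel" using g by auto
  have p1: "p > 1" "p - 1 = 1 / (q - 1)" using q unfolding p by (auto simp: field_simps)
  have M0: "M \<ge> 0" using gb[of undefined] norm_ge_zero[of "g undefined"] by linarith
  have gp: "integrable lborel (\<lambda>x. cmod (g x) powr p)"
    using X by (intro integrableI_nonneg) (auto simp: less_top[symmetric] top_unique)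
  have gpX: "(\<integral>x. cmod (g x) powr p \<partial>lborel) \<le> X"
    using X gp by (subst (asm) nn_integral_eq_integral) auto
  let ?c = "2 * \<Lambda> * X"
  have c0: "?c > 0" using lam X by simp
  \<comment> \<open>The height at which the kernel bound gives \<open>s / 2\<close> for the part of \<open>g\<close> above it.\<close>
  define h where "h s = (?c / s) powr (q - 1)" for s
  have h0: "h s > 0" if "s > 0" for s using that lam X by (simp add: h_def)
  have hp: "h s powr (p - 1) = ?c / s" if "s > 0" for s
    using that lam X q unfolding h_def p1(2) by (simp add: powr_powr)
  have level: "(\<integral>\<^sup>+x. indicator {x. s \<le> cmod (propagate z g x)} x \<partial>lborel) \<le>
      ennreal (4 / s\<^sup>2) * (\<integral>\<^sup>+x. ennreal ((cmod (g x))\<^sup>2) * indicator {x. cmod (g x) \<le> h s} x \<partial>lborel)"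
    if s: "s > 0" for s
  proof -
    define g1 g2 where "g1 x = g x * indicator {x. h s < cmod (g x)} x" and "g2 x = g x * indicator {x. cmod (g x) \<le> h s} x" for x
    have [measurable]: "g1 \<in> borel_measurable borel" "g2 \<in> borel_measurable borel"
      unfolding g1_def g2_def by measurable
    have g12: "g x = g1 x + g2 x" for x by (auto simp: g1_def g2_def indicator_def)
    have i1: "integrable lborel g1" unfolding g1_def using g
      by (intro integrable_product_bounded[where C=1]) (auto simp: indicator_def)
    have i2: "integrable lborel g2" unfolding g2_def using g
      by (intro integrable_product_bounded[where C=1]) (auto simp: indicator_def)
    have i22: "integrable lborel (\<lambda>x. (cmod (g2 x))\<^sup>2)"
    proof -
      have "integrable lborel (\<lambda>x. g2 x * g2 x)"
        by (rule integrable_product_bounded[OF i2, where C=M]) (use gb M0 in \<open>auto simp: g2_def indicator_def\<close>)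
      from integrable_norm[OF this] show ?thesis by (simp add: norm_mult power2_eq_square)
    qed
    have "cmod (g1 x) * (?c / s) \<le> cmod (g x) powr p" for x
    proof (cases "h s < cmod (g x)")
      case True
      then have "h s powr (p - 1) \<le> cmod (g x) powr (p - 1)" using h0[OF s] p1 q by (intro powr_mono2) auto
      then have "cmod (g x) * (?c / s) \<le> cmod (g x) * cmod (g x) powr (p - 1)"
        unfolding hp[OF s] by (intro mult_left_mono) auto
      also have "\<dots> = cmod (g x) powr p"
        using True h0[OF s] by (simp add: powr_mult_base)
      finally show ?thesis using True by (simp add: g1_def)
    qed (simp add: g1_def)
    then have "(\<integral>x. cmod (g1 x) * (?c / s) \<partial>lborel) \<le> (\<integral>x. cmod (g x) powr p \<partial>lborel)"
      using i1 gp by (intro integral_mono) auto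
    also note gpX
    finally have "(\<integral>x. cmod (g1 x) \<partial>lborel) * (?c / s) \<le> X" by simp
    then have "\<Lambda> * (\<integral>x. cmod (g1 x) \<partial>lborel) \<le> s / 2" using s lam X by (simp add: field_simps)
    then have b1: "cmod (propagate z g1 x) \<le> s / 2" for x
      using propagate_bounded(1)[OF i1 z lam(2), of x] by linarith
    have sum: "propagate z g x = propagate z g1 x + propagate z g2 x" for x
      unfolding propagate_def g12[abs_def] distrib_right
      by (intro Bochner_Integration.integral_add propagate_bounded(2)[OF i1 z lam(2)] propagate_bounded(2)[OF i2 z lam(2)])
    have "(\<integral>\<^sup>+x. indicator {x. s \<le> cmod (propagate z g x)} x \<partial>lborel) \<le> (\<integral>\<^sup>+x. ennreal (4 / s\<^sup>2) * ennreal ((cmod (propagate z g2 x))\<^sup>2) \<partial>lborel)"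
    proof (rule nn_integral_mono)
      fix x
      show "indicator {x. s \<le> cmod (propagate z g x)} x \<le> ennreal (4 / s\<^sup>2) * ennreal ((cmod (propagate z g2 x))\<^sup>2)"
      proof (cases "s \<le> cmod (propagate z g x)")
        case True
        then have "s / 2 \<le> cmod (propagate z g2 x)"
          using b1[of x] norm_triangle_ineq[of "propagate z g1 x" "propagate z g2 x"] unfolding sum by linarith
        then have "(s / 2)\<^sup>2 \<le> (cmod (propagate z g2 x))\<^sup>2" using s by (intro power_mono) auto
        then have "1 \<le> 4 / s\<^sup>2 * (cmod (propagate z g2 x))\<^sup>2" using s by (simp add: power_divide field_simps)
        then show ?thesis using True by (simp add: ennreal_mult[symmetric])
      qed simp
    qed
    also have "\<dots> = ennreal (4 / s\<^sup>2) * (\<integral>\<^sup>+x. ennreal ((cmod (propagate z g2 x))\<^sup>2) \<partial>lborel)"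
      by (intro nn_integral_cmult) measurable
    also have "(\<integral>\<^sup>+x. ennreal ((cmod (propagate z g2 x))\<^sup>2) \<partial>lborel) \<le> (\<integral>\<^sup>+x. ennreal ((cmod (g2 x))\<^sup>2) \<partial>lborel)"
      using propagate_L2[OF z i2 i22] i22 by (simp add: nn_integral_eq_integral)
    also have "(\<integral>\<^sup>+x. ennreal ((cmod (g2 x))\<^sup>2) \<partial>lborel) = (\<integral>\<^sup>+x. ennreal ((cmod (g x))\<^sup>2) * indicator {x. cmod (g x) \<le> h s} x \<partial>lborel)"
      by (intro nn_integral_cong) (auto simp: g2_def indicator_def)
    finally show ?thesis by (simp add: mult_left_mono)
  qed
  have "(\<integral>\<^sup>+x. ennreal (cmod (propagate z g x) powr q) \<partial>lborel) =
     (\<integral>\<^sup>+s. ennreal (q * s powr (q - 1) * indicator {0..} s) * (\<integral>\<^sup>+x. indicator {x. s \<le> cmod (propagate z g x)} x \<partial>lborel) \<partial>lborel)"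
    using q by (intro nn_integral_power_layer_cake) (auto intro: sigma_finite_lborel)
  also have "\<dots> \<le> (\<integral>\<^sup>+s. (\<integral>\<^sup>+x. ennreal (4 * q * s powr (q - 3) * indicator {0<..} s) * (ennreal ((cmod (g x))\<^sup>2) * indicator {x. cmod (g x) \<le> h s} x) \<partial>lborel) \<partial>lborel)"
  proof (rule nn_integral_mono)
    fix s :: real
    show "ennreal (q * s powr (q - 1) * indicator {0..} s) * (\<integral>\<^sup>+x. indicator {x. s \<le> cmod (propagate z g x)} x \<partial>lborel) \<le>
      (\<integral>\<^sup>+x. ennreal (4 * q * s powr (q - 3) * indicator {0<..} s) * (ennreal ((cmod (g x))\<^sup>2) * indicator {x. cmod (g x) \<le> h s} x) \<partial>lborel)"
    proof (cases "s > 0")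
      case True
      have "ennreal (q * s powr (q - 1) * indicator {0..} s) * (\<integral>\<^sup>+x. indicator {x. s \<le> cmod (propagate z g x)} x \<partial>lborel) \<le>
          ennreal (q * s powr (q - 1)) * (ennreal (4 / s\<^sup>2) * (\<integral>\<^sup>+x. ennreal ((cmod (g x))\<^sup>2) * indicator {x. cmod (g x) \<le> h s} x \<partial>lborel))"
        using level[OF True] True by (intro mult_mono) auto
      also have "\<dots> = ennreal (q * s powr (q - 1) * (4 / s\<^sup>2)) * (\<integral>\<^sup>+x. ennreal ((cmod (g x))\<^sup>2) * indicator {x. cmod (g x) \<le> h s} x \<partial>lborel)"
        using q True by (subst ennreal_mult) (auto simp: mult.assoc)
      also have "q * s powr (q - 1) * (4 / s\<^sup>2) = 4 * q * s powr (q - 3)"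
      proof -
        have "s powr (q - 1) / s\<^sup>2 = s powr (q - 1) / s powr 2" using True by simp
        also have "\<dots> = s powr (q - 3)" by (simp flip: powr_diff)
        finally have "4 * q * (s powr (q - 1) / s\<^sup>2) = 4 * q * s powr (q - 3)" by (simp only:)
        then show ?thesis by (simp add: mult.commute mult.left_commute)
      qed
      finally show ?thesis using True by (subst nn_integral_cmult) auto
    qed (cases "s = 0"; simp)
  qed
  also have "\<dots> = (\<integral>\<^sup>+x. (\<integral>\<^sup>+s. ennreal (4 * q * s powr (q - 3) * indicator {0<..} s) * (ennreal ((cmod (g x))\<^sup>2) * indicator {x. cmod (g x) \<le> h s} x) \<partial>lborel) \<partial>lborel)"
    unfolding h_def by (rule lborel_pair.Fubini') measurable
  also have "\<dots> \<le> (\<integral>\<^sup>+x. ennreal (4 * q / (q - 2) * ?c powr (q - 2)) * ennreal (cmod (g x) powr p) \<partial>lborel)"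
  proof (rule nn_integral_mono)
    fix x
    show "(\<integral>\<^sup>+s. ennreal (4 * q * s powr (q - 3) * indicator {0<..} s) * (ennreal ((cmod (g x))\<^sup>2) * indicator {x. cmod (g x) \<le> h s} x) \<partial>lborel)
      \<le> ennreal (4 * q / (q - 2) * ?c powr (q - 2)) * ennreal (cmod (g x) powr p)"
    proof (cases "g x = 0")
      case False
      define a where "a = cmod (g x)"
      have a: "a > 0" using False by (simp add: a_def)
      \<comment> \<open>Inverts \<open>h\<close>: the point \<open>x\<close> lies below the height exactly for \<open>s \<le> \<sigma>\<close>.\<close>
      define \<sigma> where "\<sigma> = ?c * a powr (1 - p)"
      have sig: "\<sigma> > 0" using c0 a by (simp add: \<sigma>_def)
      have le: "s \<le> \<sigma>" if s: "s > 0" and as: "a \<le> h s" for s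
      proof -
        have "a powr (p - 1) \<le> h s powr (p - 1)" using as a p1 q by (intro powr_mono2) auto
        then have "s * a powr (p - 1) \<le> ?c" unfolding hp[OF s] using s by (simp add: field_simps)
        then have "s \<le> ?c / a powr (p - 1)" using a by (simp add: field_simps)
        also have "\<dots> = \<sigma>" using powr_minus_divide[of a "p - 1"] by (simp add: \<sigma>_def)
        finally show ?thesis .
      qed
      have "(\<integral>\<^sup>+s. ennreal (4 * q * s powr (q - 3) * indicator {0<..} s) * (ennreal ((cmod (g x))\<^sup>2) * indicator {x. cmod (g x) \<le> h s} x) \<partial>lborel)
        \<le> (\<integral>\<^sup>+s. ennreal (4 * q * a\<^sup>2) * ennreal (indicator {0..\<sigma>} s * s powr (q - 2 - 1)) \<partial>lborel)"
        using le q by (intro nn_integral_mono) (auto simp: indicator_def ennreal_mult[symmetric] a_def[symmetric])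
      also have "\<dots> = ennreal (4 * q * a\<^sup>2) * ennreal (\<sigma> powr (q - 2) / (q - 2))"
        using q sig nn_integral_powr_from_0[of "q - 2" \<sigma>] by (subst nn_integral_cmult) auto
      also have "\<dots> = ennreal (4 * q / (q - 2) * ?c powr (q - 2)) * ennreal (a powr p)"
      proof -
        have "a\<^sup>2 * (a powr (1 - p)) powr (q - 2) = a powr (2 + (1 - p) * (q - 2))"
          using a by (simp add: powr_powr powr_add powr_numeral)
        also have "2 + (1 - p) * (q - 2) = p" using q unfolding p by (simp add: field_simps)
        finally have *: "a\<^sup>2 * (a powr (1 - p)) powr (q - 2) = a powr p" .
        have "4 * q * a\<^sup>2 * (\<sigma> powr (q - 2) / (q - 2)) = 4 * q / (q - 2) * ?c powr (q - 2) * (a\<^sup>2 * (a powr (1 - p)) powr (q - 2))"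
          using c0 a unfolding \<sigma>_def by (subst powr_mult) auto
        then show ?thesis unfolding * using q by (subst (1 2) ennreal_mult[symmetric]) auto
      qed
      finally show ?thesis by (simp add: a_def)
    qed simp
  qed
  also have "\<dots> = ennreal (4 * q / (q - 2) * ?c powr (q - 2)) * (\<integral>\<^sup>+x. ennreal (cmod (g x) powr p) \<partial>lborel)"
    by (intro nn_integral_cmult) measurable
  also have "\<dots> \<le> ennreal (4 * q / (q - 2) * ?c powr (q - 2)) * ennreal X"
    using X by (intro mult_left_mono) auto
  also have "\<dots> = ennreal (4 * q / (q - 2) * 2 powr (q - 2) * (\<Lambda> powr (q - 2) * X powr (q - 1)))"
  proof -
    have "?c powr (q - 2) * X = 2 powr (q - 2) * (\<Lambda> powr (q - 2) * (X powr (q - 2) * X powr 1))"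
      using lam X by (simp add: powr_mult)
    also have "X powr (q - 2) * X powr 1 = X powr (q - 1)" by (simp only: powr_add[symmetric]) simp
    finally show ?thesis using q X by (subst ennreal_mult[symmetric]) (auto simp: mult.assoc)
  qed
  finally show ?thesis .
qed

lemma nn_integral_even_le:
  fixes f :: "real \<Rightarrow> ennreal"
  assumes [measurable]: "f \<in> borel_measurable borel"
  shows "(\<integral>\<^sup>+r. f \<bar>r\<bar> \<partial>lborel) \<le> 2 * (\<integral>\<^sup>+r. f r * indicator {0..} r \<partial>lborel)"
proof -
  have "(\<integral>\<^sup>+r. f \<bar>r\<bar> \<partial>lborel) \<le> (\<integral>\<^sup>+r. f r * indicator {0..} r + f (0 + (-1) * r) * indicator {0..} (0 + (-1) * r) \<partial>lborel)"
    by (intro nn_integral_mono) (auto simp: indicator_def abs_if)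
  also have "\<dots> = (\<integral>\<^sup>+r. f r * indicator {0..} r \<partial>lborel) + (\<integral>\<^sup>+r. f (0 + (-1) * r) * indicator {0..} (0 + (-1) * r) \<partial>lborel)"
    by (intro nn_integral_add) measurable
  also have "(\<integral>\<^sup>+r. f (0 + (-1) * r) * indicator {0..} (0 + (-1) * r) \<partial>lborel) = (\<integral>\<^sup>+r. f r * indicator {0..} r \<partial>lborel)"
    using nn_integral_real_affine[of "\<lambda>r. f r * indicator {0..} r" "-1" 0] by simp
  finally show ?thesis by (simp add: mult_2)
qed

lemma nn_integral_near_powr_le:
  assumes a: "a < 1" and R: "R \<ge> 0"
  shows "(\<integral>\<^sup>+t. ennreal (\<bar>t - s\<bar> powr (- a) * indicator {..R} \<bar>t - s\<bar>) \<partial>lborel) \<le> ennreal (2 * R powr (1 - a) / (1 - a))"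
proof -
  have "(\<integral>\<^sup>+t. ennreal (\<bar>t - s\<bar> powr (- a) * indicator {..R} \<bar>t - s\<bar>) \<partial>lborel) = (\<integral>\<^sup>+t. ennreal (\<bar>t\<bar> powr (- a) * indicator {..R} \<bar>t\<bar>) \<partial>lborel)"
    using nn_integral_translate[of "\<lambda>t. ennreal (\<bar>t\<bar> powr (- a) * indicator {..R} \<bar>t\<bar>)" "- s"] by simp
  also have "\<dots> \<le> 2 * (\<integral>\<^sup>+r. ennreal (r powr (- a) * indicator {..R} r) * indicator {0..} r \<partial>lborel)"
    by (rule nn_integral_even_le) measurable
  also have "(\<integral>\<^sup>+r. ennreal (r powr (- a) * indicator {..R} r) * indicator {0..} r \<partial>lborel) = (\<integral>\<^sup>+r. ennreal (indicator {0..R} r * r powr (1 - a - 1)) \<partial>lborel)"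
    by (intro nn_integral_cong) (auto simp: indicator_def)
  also have "\<dots> = ennreal (R powr (1 - a) / (1 - a))"
    using a R by (intro nn_integral_powr_from_0) auto
  also have "2 * \<dots> = ennreal (2 * R powr (1 - a) / (1 - a))"
    using a by (simp add: ennreal_mult[symmetric] flip: ennreal_numeral)
  finally show ?thesis .
qed

lemma nn_integral_far_powr_le:
  assumes a: "a > 1" and R: "R > 0"
  shows "(\<integral>\<^sup>+t. ennreal (\<bar>t - s\<bar> powr (- a) * indicator {R..} \<bar>t - s\<bar>) \<partial>lborel) \<le> ennreal (2 * R powr (1 - a) / (a - 1))"
proof -
  have "(\<integral>\<^sup>+t. ennreal (\<bar>t - s\<bar> powr (- a) * indicator {R..} \<bar>t - s\<bar>) \<partial>lborel) = (\<integral>\<^sup>+t. ennreal (\<bar>t\<bar> powr (- a) * indicator {R..} \<bar>t\<bar>) \<partial>lborel)"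
    using nn_integral_translate[of "\<lambda>t. ennreal (\<bar>t\<bar> powr (- a) * indicator {R..} \<bar>t\<bar>)" "- s"] by simp
  also have "\<dots> \<le> 2 * (\<integral>\<^sup>+r. ennreal (r powr (- a) * indicator {R..} r) * indicator {0..} r \<partial>lborel)"
    by (rule nn_integral_even_le) measurable
  also have "(\<integral>\<^sup>+r. ennreal (r powr (- a) * indicator {R..} r) * indicator {0..} r \<partial>lborel) = (\<integral>\<^sup>+r. ennreal (indicator {R..} r * r powr (- a)) \<partial>lborel)"
    using R by (intro nn_integral_cong) (auto simp: indicator_def)
  also have "\<dots> = ennreal (- (R powr (- a + 1)) / (- a + 1))"
    using a R by (intro nn_integral_has_integral_lebesgue has_integral_powr_to_inf) auto
  also have "- (R powr (- a + 1)) / (- a + 1) = R powr (1 - a) / (a - 1)"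
    by (metis add.commute diff_conv_add_uminus minus_diff_eq minus_divide_divide minus_minus)
  also have "2 * ennreal (R powr (1 - a) / (a - 1)) = ennreal (2 * R powr (1 - a) / (a - 1))"
    using a by (simp add: ennreal_mult[symmetric] flip: ennreal_numeral)
  finally show ?thesis .
qed

text \<open>The Hardy--Littlewood--Sobolev inequality on the line, in the case of equal
  exponents. By symmetry it is enough to integrate over \<open>\<phi> t \<le> \<phi> s\<close>. For fixed \<open>s\<close> the near part \<open>|t - s| \<le> R\<close> uses
  \<open>\<phi> t \<le> \<phi> s\<close>, and the far part uses Young's inequality against the \<open>L^p\<close> bound \<open>X\<close>. With
  \<open>R = X (\<phi> s)^(-p)\<close> all contributions are multiples of \<open>X^(1 - 2/q) (\<phi> s)^p\<close> after multiplication by \<open>\<phi> s\<close>.\<close>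

theorem hardy_littlewood_sobolev_diagonal:
  fixes \<phi> :: "real \<Rightarrow> real"
  assumes q: "q > 2" and p: "p = q / (q - 1)" 
    and [measurable]: "\<phi> \<in> borel_measurable borel" and nn: "\<And>t. \<phi> t \<ge> 0"
    and X: "X > 0" "(\<integral>\<^sup>+t. ennreal (\<phi> t powr p) \<partial>lborel) \<le> ennreal X"
  shows "(\<integral>\<^sup>+s. \<integral>\<^sup>+t. ennreal (\<phi> s * \<phi> t * \<bar>t - s\<bar> powr (- (2 / q))) \<partial>lborel \<partial>lborel) \<le>
    ennreal (2 * (2 / (1 - 2 / q) + 3) * X powr (2 / p))"
proof -
  have p1: "p > 1" using q unfolding p by (auto simp: field_simps)
  let ?C = "2 / (1 - 2 / q) + 3"
  have q2: "2 / q < 1" using q by simp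
  have div_le: "c / k \<le> c" if "0 \<le> c" "1 < k" for c k :: real
    using that mult_left_mono[of 1 k c] by (simp add: pos_divide_le_eq)
  have C0: "?C > 0" using q2 by (intro add_pos_pos divide_pos_pos) auto
  let ?J = "\<lambda>s t. ennreal (\<phi> s * \<phi> t * \<bar>t - s\<bar> powr (- (2 / q))) * indicator {(s, t). \<phi> t \<le> \<phi> s} (s, t)"
  have inner: "(\<integral>\<^sup>+t. ?J s t \<partial>lborel) \<le> ennreal (?C * X powr (1 - 2 / q)) * ennreal (\<phi> s powr p)" for s
  proof (cases "\<phi> s = 0")
    case False
    then have f0: "\<phi> s > 0" using nn[of s] by linarith
    define f where "f = \<phi> s"
    have f: "f > 0" using f0 by (simp add: f_def)
    \<comment> \<open>These choices balance the three contributions, see \<open>e1\<close> to \<open>e3\<close>.\<close>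
    define \<mu> R where "\<mu> = f powr (p - 1) * X powr (- (2 / q))" and "R = X * f powr (- p)"
    have mu: "\<mu> > 0" and R: "R > 0" using f X by (auto simp: \<mu>_def R_def)
    define E where "E = f powr (p - 1) * X powr (1 - 2 / q)"
    obtain u v where uv: "f = exp u" "X = exp v" using f X by (metis exp_ln)
    have e1: "f * R powr (1 - 2 / q) = E"
      unfolding E_def R_def uv p using q by (simp add: powr_def mult_exp_exp ln_mult) (simp add: field_simps)
    have e2: "\<mu> * X = E"
      unfolding E_def \<mu>_def uv p using q by (simp add: powr_def mult_exp_exp ln_mult) (simp add: field_simps)
    have e3: "\<mu> powr (- (q / p)) * R powr (- 1) = E"
    proof -
      have dist: "- c * (A * u + - B * v) + - 1 * (v + - p * u) = - (c * A) * u + (c * B) * v - v + p * u" for A B c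
        by (simp add: algebra_simps)
      have r: "q / p * (p - 1) = 1" "q / p * (2 / q) = 2 - 2 / q"
        using q unfolding p by (simp_all add: field_simps)
      have "- (q / p) * ((p - 1) * u + - (2 / q) * v) + - 1 * (v + - p * u) = (p - 1) * u + (1 - 2 / q) * v"
        unfolding dist r by (simp add: algebra_simps)
      then have *: "((p - 1) * u + - (2 / q) * v) * - (q / p) + (v + - p * u) * - 1 = u * (p - 1) + v * (1 - 2 / q)"
        by (simp only: mult.commute)
      have mR: "\<mu> = exp ((p - 1) * u + - (2 / q) * v)" "R = exp (v + - p * u)"
        unfolding \<mu>_def R_def uv by (simp_all add: exp_powr_real mult_exp_exp mult.commute)
      show ?thesis
        unfolding E_def mR unfolding uv exp_powr_real mult_exp_exp * ..
    qed
    have pt: "\<phi> t * \<bar>t - s\<bar> powr (- (2 / q)) * indicator {(s, t). \<phi> t \<le> \<phi> s} (s, t) \<le>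
        f * (\<bar>t - s\<bar> powr (- (2 / q)) * indicator {..R} \<bar>t - s\<bar>) + (\<mu> * \<phi> t powr p + \<mu> powr (- (q / p)) * (\<bar>t - s\<bar> powr (- 2) * indicator {R..} \<bar>t - s\<bar>))" for t
    proof (cases "\<phi> t \<le> \<phi> s")
      case True
      show ?thesis
      proof (cases "\<bar>t - s\<bar> \<le> R")
        case le: True
        have "\<phi> t * \<bar>t - s\<bar> powr (- (2 / q)) \<le> f * \<bar>t - s\<bar> powr (- (2 / q))"
          using True by (intro mult_right_mono) (auto simp: f_def)
        moreover have "0 \<le> \<mu> * \<phi> t powr p + \<mu> powr (- (q / p)) * (\<bar>t - s\<bar> powr (- 2) * indicator {R..} \<bar>t - s\<bar>)"
          using mu by auto
        ultimately show ?thesis using True le by simp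
      next
        case gt: False
        then have r: "\<bar>t - s\<bar> > 0" using R by linarith
        have "\<phi> t * \<bar>t - s\<bar> powr (- (2 / q)) = (\<mu> powr (1 / p) * \<phi> t) * (\<mu> powr (- (1 / p)) * \<bar>t - s\<bar> powr (- (2 / q)))"
          using mu by (simp add: powr_minus)
        also have "\<dots> \<le> (\<mu> powr (1 / p) * \<phi> t) powr p / p + (\<mu> powr (- (1 / p)) * \<bar>t - s\<bar> powr (- (2 / q))) powr q / q"
          using q p1 nn unfolding p by (intro Youngs_inequality) (auto simp: field_simps)
        also have "(\<mu> powr (1 / p) * \<phi> t) powr p = \<mu> * \<phi> t powr p"
          using mu nn p1 by (simp add: powr_mult powr_powr)
        also have "(\<mu> powr (- (1 / p)) * \<bar>t - s\<bar> powr (- (2 / q))) powr q = \<mu> powr (- (q / p)) * \<bar>t - s\<bar> powr (- 2)"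
          using mu q by (simp add: powr_mult powr_powr)
        also have "\<mu> * \<phi> t powr p / p \<le> \<mu> * \<phi> t powr p"
          using mu p1 by (intro div_le) auto
        also have "\<mu> powr (- (q / p)) * \<bar>t - s\<bar> powr (- 2) / q \<le> \<mu> powr (- (q / p)) * \<bar>t - s\<bar> powr (- 2)"
          using q by (intro div_le) auto
        finally show ?thesis using True gt f by simp
      qed
    next
      case False
      moreover have "0 \<le> f * (\<bar>t - s\<bar> powr (- (2 / q)) * indicator {..R} \<bar>t - s\<bar>) + (\<mu> * \<phi> t powr p + \<mu> powr (- (q / p)) * (\<bar>t - s\<bar> powr (- 2) * indicator {R..} \<bar>t - s\<bar>))"
        using mu f by (intro add_nonneg_nonneg mult_nonneg_nonneg) auto
      ultimately show ?thesis by simp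
    qed
    have J: "(\<integral>\<^sup>+t. ?J s t \<partial>lborel) = ennreal f * (\<integral>\<^sup>+t. ennreal (\<phi> t * \<bar>t - s\<bar> powr (- (2 / q)) * indicator {(s, t). \<phi> t \<le> \<phi> s} (s, t)) \<partial>lborel)"
    proof (subst nn_integral_cmult[symmetric])
      show "(\<integral>\<^sup>+t. ?J s t \<partial>lborel) = (\<integral>\<^sup>+t. ennreal f * ennreal (\<phi> t * \<bar>t - s\<bar> powr (- (2 / q)) * indicator {(s, t). \<phi> t \<le> \<phi> s} (s, t)) \<partial>lborel)"
      proof (rule nn_integral_cong)
        fix t
        show "?J s t = ennreal f * ennreal (\<phi> t * \<bar>t - s\<bar> powr (- (2 / q)) * indicator {(s, t). \<phi> t \<le> \<phi> s} (s, t))"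
          using nn[of s] nn[of t] by (cases "\<phi> t \<le> \<phi> s") (simp_all add: f_def ennreal_mult mult.assoc)
      qed
    qed measurable
    have "(\<integral>\<^sup>+t. ennreal (\<phi> t * \<bar>t - s\<bar> powr (- (2 / q)) * indicator {(s, t). \<phi> t \<le> \<phi> s} (s, t)) \<partial>lborel)
      \<le> (\<integral>\<^sup>+t. ennreal f * ennreal (\<bar>t - s\<bar> powr (- (2 / q)) * indicator {..R} \<bar>t - s\<bar>) + (ennreal \<mu> * ennreal (\<phi> t powr p) + ennreal (\<mu> powr (- (q / p))) * ennreal (\<bar>t - s\<bar> powr (- 2) * indicator {R..} \<bar>t - s\<bar>)) \<partial>lborel)"
      using pt f mu by (intro nn_integral_mono) (simp add: ennreal_mult[symmetric] ennreal_plus[symmetric] del: ennreal_plus)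
    also have "\<dots> = ennreal f * (\<integral>\<^sup>+t. ennreal (\<bar>t - s\<bar> powr (- (2 / q)) * indicator {..R} \<bar>t - s\<bar>) \<partial>lborel) +
        (ennreal \<mu> * (\<integral>\<^sup>+t. ennreal (\<phi> t powr p) \<partial>lborel) + ennreal (\<mu> powr (- (q / p))) * (\<integral>\<^sup>+t. ennreal (\<bar>t - s\<bar> powr (- 2) * indicator {R..} \<bar>t - s\<bar>) \<partial>lborel))"
      by (simp add: nn_integral_add nn_integral_cmult)
    also have "\<dots> \<le> ennreal f * ennreal (2 * R powr (1 - 2 / q) / (1 - 2 / q)) +
        (ennreal \<mu> * ennreal X + ennreal (\<mu> powr (- (q / p))) * ennreal (2 * R powr (1 - 2) / (2 - 1)))"
      using q2 R X by (intro add_mono mult_left_mono nn_integral_near_powr_le nn_integral_far_powr_le) auto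
    also have "\<dots> = ennreal (f * (2 * R powr (1 - 2 / q) / (1 - 2 / q)) + (\<mu> * X + \<mu> powr (- (q / p)) * (2 * R powr (1 - 2) / (2 - 1))))"
      using f mu X q2 by (simp only: ennreal_mult[symmetric] ennreal_plus[symmetric] powr_ge_zero mult_nonneg_nonneg divide_nonneg_nonneg
          diff_ge_0_iff_ge zero_le_numeral less_imp_le add_nonneg_nonneg one_le_numeral)
    also have "f * (2 * R powr (1 - 2 / q) / (1 - 2 / q)) + (\<mu> * X + \<mu> powr (- (q / p)) * (2 * R powr (1 - 2) / (2 - 1)))
        = 2 / (1 - 2 / q) * (f * R powr (1 - 2 / q)) + (\<mu> * X + 2 * (\<mu> powr (- (q / p)) * R powr (- 1)))"
      by (simp add: mult.commute mult.left_commute)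
    also have "2 / (1 - 2 / q) * (f * R powr (1 - 2 / q)) + (\<mu> * X + 2 * (\<mu> powr (- (q / p)) * R powr (- 1))) = ?C * E"
      unfolding e1 e2 e3 by (simp add: algebra_simps)
    finally have "(\<integral>\<^sup>+t. ?J s t \<partial>lborel) \<le> ennreal f * ennreal (?C * E)"
      unfolding J by (intro mult_left_mono) auto
    also have "\<dots> = ennreal (?C * X powr (1 - 2 / q)) * ennreal (f powr p)"
    proof -
      have "f * (?C * E) = ?C * X powr (1 - 2 / q) * (f * f powr (p - 1))" by (simp add: E_def)
      also have "f * f powr (p - 1) = f powr p" using f by (simp add: powr_mult_base)
      finally show ?thesis using f C0 by (simp add: ennreal_mult[symmetric] E_def)
    qed
    finally show ?thesis by (simp add: f_def)
  qed simp
  have half: "(\<integral>\<^sup>+s. \<integral>\<^sup>+t. ?J s t \<partial>lborel \<partial>lborel) \<le> ennreal (?C * X powr (2 / p))"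
  proof -
    have "(\<integral>\<^sup>+s. \<integral>\<^sup>+t. ?J s t \<partial>lborel \<partial>lborel) \<le> (\<integral>\<^sup>+s. ennreal (?C * X powr (1 - 2 / q)) * ennreal (\<phi> s powr p) \<partial>lborel)"
      by (intro nn_integral_mono inner)
    also have "\<dots> = ennreal (?C * X powr (1 - 2 / q)) * (\<integral>\<^sup>+s. ennreal (\<phi> s powr p) \<partial>lborel)"
      by (intro nn_integral_cmult) measurable
    also have "\<dots> \<le> ennreal (?C * X powr (1 - 2 / q)) * ennreal X" using X by (intro mult_left_mono) auto
    also have "\<dots> = ennreal (?C * X powr (2 / p))"
    proof -
      have "X powr (1 - 2 / q) * X = X powr (1 - 2 / q + 1)"
        using X powr_add[of X "1 - 2 / q" 1] by simp
      also have "1 - 2 / q + 1 = 2 / p" using q unfolding p by (simp add: field_simps)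
      finally show ?thesis using C0 X by (simp add: ennreal_mult[symmetric] mult.assoc)
    qed
    finally show ?thesis .
  qed
  have "(\<integral>\<^sup>+s. \<integral>\<^sup>+t. ennreal (\<phi> s * \<phi> t * \<bar>t - s\<bar> powr (- (2 / q))) \<partial>lborel \<partial>lborel) \<le> (\<integral>\<^sup>+s. \<integral>\<^sup>+t. ?J s t + ?J t s \<partial>lborel \<partial>lborel)"
  proof (intro nn_integral_mono)
    fix s t
    have sym: "\<phi> t * \<phi> s * \<bar>s - t\<bar> powr (- (2 / q)) = \<phi> s * \<phi> t * \<bar>t - s\<bar> powr (- (2 / q))"
      by (simp only: abs_minus_commute[of s t] mult.commute[of "\<phi> t"])
    show "ennreal (\<phi> s * \<phi> t * \<bar>t - s\<bar> powr (- (2 / q))) \<le> ?J s t + ?J t s"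
      unfolding sym by (cases "\<phi> t \<le> \<phi> s") auto
  qed
  also have "\<dots> = (\<integral>\<^sup>+s. (\<integral>\<^sup>+t. ?J s t \<partial>lborel) + (\<integral>\<^sup>+t. ?J t s \<partial>lborel) \<partial>lborel)"
    by (intro nn_integral_cong nn_integral_add) measurable
  also have "\<dots> = (\<integral>\<^sup>+s. \<integral>\<^sup>+t. ?J s t \<partial>lborel \<partial>lborel) + (\<integral>\<^sup>+s. \<integral>\<^sup>+t. ?J t s \<partial>lborel \<partial>lborel)"
    by (intro nn_integral_add) measurable
  also have "(\<integral>\<^sup>+s. \<integral>\<^sup>+t. ?J t s \<partial>lborel \<partial>lborel) = (\<integral>\<^sup>+s. \<integral>\<^sup>+t. ?J s t \<partial>lborel \<partial>lborel)"
    by (rule lborel_pair.Fubini') measurable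
  also have "(\<integral>\<^sup>+s. \<integral>\<^sup>+t. ?J s t \<partial>lborel \<partial>lborel) + (\<integral>\<^sup>+s. \<integral>\<^sup>+t. ?J s t \<partial>lborel \<partial>lborel) \<le> ennreal (?C * X powr (2 / p)) + ennreal (?C * X powr (2 / p))"
    by (intro add_mono half)
  also have "\<dots> = ennreal (2 * ?C * X powr (2 / p))"
    using C0 by (simp add: ennreal_plus[symmetric] del: ennreal_plus)
  finally show ?thesis .
qed

section \<open>Superpositions in time of square integrable functions\<close>

lemma nn_integral_pair_eq:
  assumes f: "f \<in> borel_measurable (M \<Otimes>\<^sub>M (lborel :: 'b::euclidean_space measure))" and g: "\<And>x y. f (x, y) = g x y"
  shows "(\<integral>\<^sup>+x. f x \<partial>(M \<Otimes>\<^sub>M lborel)) = (\<integral>\<^sup>+x. \<integral>\<^sup>+y. g x y \<partial>lborel \<partial>M)"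
  using lborel.nn_integral_fst[OF f] by (simp add: g)

text \<open>Compact support in time and square integrability in space-time make every
  double time integral below absolutely convergent, so that inner products and time integrals may be exchanged.\<close>

definition time_field :: "(real \<Rightarrow> 'a::euclidean_space \<Rightarrow> complex) \<Rightarrow> bool"
  where "time_field w \<longleftrightarrow> (\<lambda>(t, y). w t y) \<in> borel_measurable (lborel \<Otimes>\<^sub>M lborel) \<and>
    (\<exists>m. \<forall>t y. m < \<bar>t\<bar> \<longrightarrow> w t y = 0) \<and>
    (\<integral>\<^sup>+t. \<integral>\<^sup>+y. ennreal ((cmod (w t y))\<^sup>2) \<partial>lborel \<partial>lborel) < \<infinity>"

definition inner_product :: "(real \<Rightarrow> 'a::euclidean_space \<Rightarrow> complex) \<Rightarrow> (real \<Rightarrow> 'a \<Rightarrow> complex) \<Rightarrow> real \<Rightarrow> real \<Rightarrow> complex"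
  where "inner_product w v t s = (\<integral>y. w t y * cnj (v s y) \<partial>lborel)"

definition time_integral :: "(real \<Rightarrow> 'a::euclidean_space \<Rightarrow> complex) \<Rightarrow> real set \<Rightarrow> 'a \<Rightarrow> complex"
  where "time_integral w T y = (\<integral>t. of_real (indicator T t) * w t y \<partial>lborel)"

interpretation lborel_triple: pair_sigma_finite "lborel \<Otimes>\<^sub>M lborel" lborel
  by (simp add: lborel_prod pair_sigma_finite_def sigma_finite_lborel)

lemma time_field_measurable: "time_field w \<Longrightarrow> (\<lambda>(t, y). w t y) \<in> borel_measurable (lborel \<Otimes>\<^sub>M lborel)"
  by (simp add: time_field_def)

lemma time_field_measurable':
  assumes "time_field w" "f \<in> borel_measurable M" "g \<in> borel_measurable M"
  shows "(\<lambda>x. w (f x) (g x)) \<in> borel_measurable M"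
proof -
  have [measurable]: "f \<in> M \<rightarrow>\<^sub>M lborel" "g \<in> M \<rightarrow>\<^sub>M lborel" using assms by auto
  have "(\<lambda>x. (\<lambda>(t, y). w t y) (f x, g x)) \<in> borel_measurable M"
    by (rule measurable_compose[OF _ time_field_measurable[OF assms(1)]]) measurable
  then show ?thesis by simp
qed

lemma time_field_bound:
  assumes "time_field w"
  obtains m where "m > 0" "\<And>t y. m < \<bar>t\<bar> \<Longrightarrow> w t y = 0"
  using assms unfolding time_field_def by (metis gt_ex less_trans linorder_not_le max.strict_coboundedI1 max_def)

lemma norm_mult_le_squares: "cmod (a * cnj b) \<le> (cmod a)\<^sup>2 + (cmod b)\<^sup>2"
proof -
  have "2 * cmod a * cmod b \<le> (cmod a)\<^sup>2 + (cmod b)\<^sup>2" by (rule sum_squares_bound)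
  moreover have "0 \<le> cmod a * cmod b" by simp
  ultimately show ?thesis unfolding norm_mult complex_mod_cnj by linarith
qed

lemma time_field_triple_integrable:
  fixes w v :: "real \<Rightarrow> 'a::euclidean_space \<Rightarrow> complex"
  assumes w: "time_field w" and v: "time_field v"
  shows "integrable ((lborel \<Otimes>\<^sub>M lborel) \<Otimes>\<^sub>M lborel) (\<lambda>(p, y). w (fst p) y * cnj (v (snd p) y))"
proof (rule integrableI_bounded)
  note [measurable (raw)] = time_field_measurable'[OF w] time_field_measurable'[OF v]
  show "(\<lambda>(p, y). w (fst p) y * cnj (v (snd p) y)) \<in> borel_measurable ((lborel \<Otimes>\<^sub>M lborel) \<Otimes>\<^sub>M lborel)"
    by measurable
  obtain m where m: "m > 0" "\<And>t y. m < \<bar>t\<bar> \<Longrightarrow> w t y = 0" using time_field_bound[OF w] by blast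
  obtain n where n: "n > 0" "\<And>t y. n < \<bar>t\<bar> \<Longrightarrow> v t y = 0" using time_field_bound[OF v] by blast
  have "(\<integral>\<^sup>+x. ennreal (norm (case x of (p, y) \<Rightarrow> w (fst p) y * cnj (v (snd p) y))) \<partial>((lborel \<Otimes>\<^sub>M lborel) \<Otimes>\<^sub>M lborel))
    = (\<integral>\<^sup>+t. \<integral>\<^sup>+s. \<integral>\<^sup>+y. ennreal (cmod (w t y * cnj (v s y))) \<partial>lborel \<partial>lborel \<partial>lborel)"
  proof -
    have "(\<integral>\<^sup>+x. ennreal (norm (case x of (p, y) \<Rightarrow> w (fst p) y * cnj (v (snd p) y))) \<partial>((lborel \<Otimes>\<^sub>M lborel) \<Otimes>\<^sub>M lborel))
      = (\<integral>\<^sup>+p. \<integral>\<^sup>+y. ennreal (cmod (w (fst p) y * cnj (v (snd p) y))) \<partial>lborel \<partial>(lborel \<Otimes>\<^sub>M lborel))"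
      by (rule nn_integral_pair_eq) (simp_all, measurable)
    also have "\<dots> = (\<integral>\<^sup>+t. \<integral>\<^sup>+s. \<integral>\<^sup>+y. ennreal (cmod (w t y * cnj (v s y))) \<partial>lborel \<partial>lborel \<partial>lborel)"
      by (rule nn_integral_pair_eq) (simp_all, measurable)
    finally show ?thesis .
  qed
  also have "\<dots> \<le> (\<integral>\<^sup>+t. \<integral>\<^sup>+s. \<integral>\<^sup>+y. ennreal ((cmod (w t y))\<^sup>2) * indicator {-n..n} s + ennreal ((cmod (v s y))\<^sup>2) * indicator {-m..m} t \<partial>lborel \<partial>lborel \<partial>lborel)"
  proof (intro nn_integral_mono)
    fix t s y
    show "ennreal (cmod (w t y * cnj (v s y))) \<le> ennreal ((cmod (w t y))\<^sup>2) * indicator {-n..n} s + ennreal ((cmod (v s y))\<^sup>2) * indicator {-m..m} t"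
    proof (cases "\<bar>t\<bar> \<le> m \<and> \<bar>s\<bar> \<le> n")
      case True
      have "cmod (w t y * cnj (v s y)) \<le> (cmod (w t y))\<^sup>2 + (cmod (v s y))\<^sup>2"
        by (rule norm_mult_le_squares)
      then show ?thesis using True by (auto simp: ennreal_plus[symmetric] abs_le_iff simp del: ennreal_plus)
    next
      case False then have "w t y * cnj (v s y) = 0" using m n by (metis complex_cnj_zero mult_eq_0_iff linorder_not_le)
      then show ?thesis by (metis norm_zero ennreal_0 zero_le)
    qed
  qed
  also have "\<dots> = (\<integral>\<^sup>+t. \<integral>\<^sup>+s. (\<integral>\<^sup>+y. ennreal ((cmod (w t y))\<^sup>2) \<partial>lborel) * indicator {-n..n} s + (\<integral>\<^sup>+y. ennreal ((cmod (v s y))\<^sup>2) \<partial>lborel) * indicator {-m..m} t \<partial>lborel \<partial>lborel)"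
    by (intro nn_integral_cong) (simp add: nn_integral_add nn_integral_multc)
  also have "\<dots> = (\<integral>\<^sup>+t. (\<integral>\<^sup>+s. (\<integral>\<^sup>+y. ennreal ((cmod (w t y))\<^sup>2) \<partial>lborel) * indicator {-n..n} s \<partial>lborel) + (\<integral>\<^sup>+s. (\<integral>\<^sup>+y. ennreal ((cmod (v s y))\<^sup>2) \<partial>lborel) * indicator {-m..m} t \<partial>lborel) \<partial>lborel)"
    by (intro nn_integral_cong nn_integral_add) measurable
  also have "\<dots> = (\<integral>\<^sup>+t. (\<integral>\<^sup>+y. ennreal ((cmod (w t y))\<^sup>2) \<partial>lborel) * ennreal (2 * n) + (\<integral>\<^sup>+s. \<integral>\<^sup>+y. ennreal ((cmod (v s y))\<^sup>2) \<partial>lborel \<partial>lborel) * indicator {-m..m} t \<partial>lborel)"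
    using n(1) by (intro nn_integral_cong) (simp add: nn_integral_cmult nn_integral_multc flip: mult_2)
  also have "\<dots> = (\<integral>\<^sup>+t. \<integral>\<^sup>+y. ennreal ((cmod (w t y))\<^sup>2) \<partial>lborel \<partial>lborel) * ennreal (2 * n) + (\<integral>\<^sup>+s. \<integral>\<^sup>+y. ennreal ((cmod (v s y))\<^sup>2) \<partial>lborel \<partial>lborel) * ennreal (2 * m)"
    using m(1) by (simp add: nn_integral_add nn_integral_multc nn_integral_cmult flip: mult_2)
  also have "\<dots> < \<infinity>"
    using w v by (auto simp: time_field_def ennreal_mult_less_top)
  finally show "(\<integral>\<^sup>+x. ennreal (norm (case x of (p, y) \<Rightarrow> w (fst p) y * cnj (v (snd p) y))) \<partial>((lborel \<Otimes>\<^sub>M lborel) \<Otimes>\<^sub>M lborel)) < \<infinity>" .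
qed

text \<open>The exchange of integrations behind the duality argument, on an arbitrary set \<open>D\<close> of pairs of
  times, since the near and the far part of the time plane are estimated by different means.\<close>

lemma time_field_double_integral:
  fixes w v :: "real \<Rightarrow> 'a::euclidean_space \<Rightarrow> complex"
  assumes w: "time_field w" and v: "time_field v" and D: "D \<in> sets (lborel \<Otimes>\<^sub>M lborel)"
  defines "F \<equiv> \<lambda>y. \<integral>p. of_real (indicator D p) * (w (fst p) y * cnj (v (snd p) y)) \<partial>(lborel \<Otimes>\<^sub>M lborel)"
  shows "integrable lborel F"
    and "AE y in lborel. integrable (lborel \<Otimes>\<^sub>M lborel) (\<lambda>p. of_real (indicator D p) * (w (fst p) y * cnj (v (snd p) y)))"
    and "integrable (lborel \<Otimes>\<^sub>M lborel) (\<lambda>p. of_real (indicator D p) * inner_product w v (fst p) (snd p))"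
    and "(\<integral>y. F y \<partial>lborel) = (\<integral>p. of_real (indicator D p) * inner_product w v (fst p) (snd p) \<partial>(lborel \<Otimes>\<^sub>M lborel))"
    and "ennreal (cmod (\<integral>y. F y \<partial>lborel)) \<le> (\<integral>\<^sup>+t. \<integral>\<^sup>+s. indicator D (t, s) * ennreal (cmod (inner_product w v t s)) \<partial>lborel \<partial>lborel)"
proof -
  note [measurable (raw)] = time_field_measurable'[OF w] time_field_measurable'[OF v]
  note [measurable] = D
  have int: "integrable ((lborel \<Otimes>\<^sub>M lborel) \<Otimes>\<^sub>M lborel) (\<lambda>(p, y). of_real (indicator D p) * (w (fst p) y * cnj (v (snd p) y)))"
  proof -
    have "integrable ((lborel \<Otimes>\<^sub>M lborel) \<Otimes>\<^sub>M lborel) (\<lambda>x. (case x of (p, y) \<Rightarrow> w (fst p) y * cnj (v (snd p) y)) * of_real (indicator D (fst x)))"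
      by (rule integrable_product_bounded[OF time_field_triple_integrable[OF w v], where C=1]) (auto simp: indicator_def)
    then show ?thesis by (simp add: case_prod_beta' mult.commute)
  qed
  show "integrable lborel F" unfolding F_def
    using lborel_triple.integrable_snd[OF int] by simp
  show "AE y in lborel. integrable (lborel \<Otimes>\<^sub>M lborel) (\<lambda>p. of_real (indicator D p) * (w (fst p) y * cnj (v (snd p) y)))"
    using lborel_triple.AE_integrable_snd[OF int] by simp
  show int2: "integrable (lborel \<Otimes>\<^sub>M lborel) (\<lambda>p. of_real (indicator D p) * inner_product w v (fst p) (snd p))"
    using lborel_triple.integrable_fst[OF int] by (simp add: inner_product_def)
  show eq: "(\<integral>y. F y \<partial>lborel) = (\<integral>p. of_real (indicator D p) * inner_product w v (fst p) (snd p) \<partial>(lborel \<Otimes>\<^sub>M lborel))"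
    unfolding F_def using lborel_triple.Fubini_integral[OF int] by (simp add: inner_product_def)
  have [measurable]: "(\<lambda>p. inner_product w v (fst p) (snd p)) \<in> borel_measurable (lborel \<Otimes>\<^sub>M lborel)"
    unfolding inner_product_def by measurable
  have "ennreal (cmod (\<integral>y. F y \<partial>lborel)) \<le> (\<integral>\<^sup>+p. ennreal (cmod (of_real (indicator D p) * inner_product w v (fst p) (snd p))) \<partial>(lborel \<Otimes>\<^sub>M lborel))"
    unfolding eq by (rule integral_norm_bound_ennreal[OF int2])
  also have "\<dots> = (\<integral>\<^sup>+t. \<integral>\<^sup>+s. ennreal (cmod (of_real (indicator D (t, s)) * inner_product w v t s)) \<partial>lborel \<partial>lborel)"
    by (rule nn_integral_pair_eq) (simp_all, measurable)
  also have "\<dots> = (\<integral>\<^sup>+t. \<integral>\<^sup>+s. indicator D (t, s) * ennreal (cmod (inner_product w v t s)) \<partial>lborel \<partial>lborel)"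
    by (intro nn_integral_cong) (auto simp: indicator_def)
  finally show "ennreal (cmod (\<integral>y. F y \<partial>lborel)) \<le> (\<integral>\<^sup>+t. \<integral>\<^sup>+s. indicator D (t, s) * ennreal (cmod (inner_product w v t s)) \<partial>lborel \<partial>lborel)" .
qed

lemma time_integral_product:
  assumes w: "time_field w" and v: "time_field v" and [measurable]: "T \<in> sets borel" "S \<in> sets borel"
  shows "AE y in lborel. (\<integral>p. of_real (indicator (T \<times> S) p) * (w (fst p) y * cnj (v (snd p) y)) \<partial>(lborel \<Otimes>\<^sub>M lborel)) =
    time_integral w T y * cnj (time_integral v S y)"
proof -
  have "T \<times> S \<in> sets (lborel \<Otimes>\<^sub>M lborel)" by measurable
  from time_field_double_integral(2)[OF w v this] show ?thesis
  proof eventually_elim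
    case (elim y)
    have "(\<integral>p. of_real (indicator (T \<times> S) p) * (w (fst p) y * cnj (v (snd p) y)) \<partial>(lborel \<Otimes>\<^sub>M lborel)) =
        (\<integral>t. \<integral>s. (of_real (indicator T t) * w t y) * cnj (of_real (indicator S s) * v s y) \<partial>lborel \<partial>lborel)"
      using lborel_pair.integral_fst'[OF elim] by (simp add: indicator_times mult.assoc mult.left_commute)
    also have "\<dots> = time_integral w T y * cnj (time_integral v S y)"
      by (simp add: time_integral_def del: complex_cnj_mult)
    finally show ?case .
  qed
qed

lemma borel_measurable_time_integral:
  assumes w: "time_field w" and [measurable]: "T \<in> sets borel"
  shows "time_integral w T \<in> borel_measurable borel"
proof -
  note [measurable (raw)] = time_field_measurable'[OF w]
  show ?thesis unfolding time_integral_def by measurable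
qed

lemma time_integral_inner:
  assumes w: "time_field w" and v: "time_field v" and [measurable]: "T \<in> sets borel" "S \<in> sets borel"
  shows "integrable lborel (\<lambda>y. time_integral w T y * cnj (time_integral v S y))"
    and "(\<integral>y. time_integral w T y * cnj (time_integral v S y) \<partial>lborel) =
      (\<integral>p. of_real (indicator (T \<times> S) p) * inner_product w v (fst p) (snd p) \<partial>(lborel \<Otimes>\<^sub>M lborel))"
proof -
  note [measurable (raw)] = time_field_measurable'[OF w] time_field_measurable'[OF v]
  note [measurable] = borel_measurable_time_integral[OF w] borel_measurable_time_integral[OF v]
  have TS: "T \<times> S \<in> sets (lborel \<Otimes>\<^sub>M lborel)" by measurable
  note I = time_field_double_integral[OF w v TS]
  note ae = time_integral_product[OF w v assms(3,4)]
  show "integrable lborel (\<lambda>y. time_integral w T y * cnj (time_integral v S y))"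
    by (rule integrable_cong_AE_imp[OF I(1)]) (use ae in \<open>auto elim: eventually_mono\<close>)
  have "(\<integral>y. time_integral w T y * cnj (time_integral v S y) \<partial>lborel) =
      (\<integral>y. (\<integral>p. of_real (indicator (T \<times> S) p) * (w (fst p) y * cnj (v (snd p) y)) \<partial>(lborel \<Otimes>\<^sub>M lborel)) \<partial>lborel)"
    using ae I(1) by (intro integral_cong_AE) (auto elim: eventually_mono)
  then show "(\<integral>y. time_integral w T y * cnj (time_integral v S y) \<partial>lborel) =
      (\<integral>p. of_real (indicator (T \<times> S) p) * inner_product w v (fst p) (snd p) \<partial>(lborel \<Otimes>\<^sub>M lborel))"
    unfolding I(4) .
qed

text \<open>The square of the norm of a superposition is the double time integral of the inner products.\<close>

lemma time_integral_norm:
  assumes w: "time_field w" and [measurable]: "T \<in> sets borel"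
  shows "integrable lborel (\<lambda>y. (cmod (time_integral w T y))\<^sup>2)"
    and "(\<integral>\<^sup>+y. ennreal ((cmod (time_integral w T y))\<^sup>2) \<partial>lborel) \<le>
      (\<integral>\<^sup>+t. \<integral>\<^sup>+s. indicator (T \<times> T) (t, s) * ennreal (cmod (inner_product w w t s)) \<partial>lborel \<partial>lborel)"
proof -
  note [measurable] = borel_measurable_time_integral[OF w]
  have TT: "T \<times> T \<in> sets (lborel \<Otimes>\<^sub>M lborel)" by measurable
  note I = time_integral_inner[OF w w assms(2,2)]
  show int: "integrable lborel (\<lambda>y. (cmod (time_integral w T y))\<^sup>2)"
    using integrable_norm[OF I(1)] by (simp add: norm_mult power2_eq_square)
  have "of_real (\<integral>y. (cmod (time_integral w T y))\<^sup>2 \<partial>lborel) = (\<integral>y. time_integral w T y * cnj (time_integral w T y) \<partial>lborel)"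
    by (simp only: complex_norm_square[symmetric] integral_complex_of_real)
  then have "cmod (of_real (\<integral>y. (cmod (time_integral w T y))\<^sup>2 \<partial>lborel)) = cmod (\<integral>y. time_integral w T y * cnj (time_integral w T y) \<partial>lborel)"
    by (simp only:)
  then have "(\<integral>y. (cmod (time_integral w T y))\<^sup>2 \<partial>lborel) = cmod (\<integral>y. time_integral w T y * cnj (time_integral w T y) \<partial>lborel)"
    by (simp add: integral_nonneg_AE)
  then have "(\<integral>\<^sup>+y. ennreal ((cmod (time_integral w T y))\<^sup>2) \<partial>lborel) = ennreal (cmod (\<integral>y. time_integral w T y * cnj (time_integral w T y) \<partial>lborel))"
    using int by (simp add: nn_integral_eq_integral)
  also have "\<dots> \<le> (\<integral>\<^sup>+t. \<integral>\<^sup>+s. indicator (T \<times> T) (t, s) * ennreal (cmod (inner_product w w t s)) \<partial>lborel \<partial>lborel)"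
    using time_field_double_integral(4,5)[OF w w TT] unfolding I(2) by simp
  finally show "(\<integral>\<^sup>+y. ennreal ((cmod (time_integral w T y))\<^sup>2) \<partial>lborel) \<le>
      (\<integral>\<^sup>+t. \<integral>\<^sup>+s. indicator (T \<times> T) (t, s) * ennreal (cmod (inner_product w w t s)) \<partial>lborel \<partial>lborel)" .
qed

text \<open>A superposition over a set of times depending on \<open>s\<close> may be paired with one fixed
  slice; used for the part of the time plane near the diagonal.\<close>

lemma time_integral_slice:
  fixes w v :: "real \<Rightarrow> 'a::euclidean_space \<Rightarrow> complex"
  assumes w: "time_field w" and [measurable]: "g \<in> borel_measurable borel" and g2: "integrable lborel (\<lambda>y. (cmod (g y))\<^sup>2)"
    and [measurable]: "T \<in> sets borel"
  shows "(\<integral>t. of_real (indicator T t) * (\<integral>y. w t y * cnj (g y) \<partial>lborel) \<partial>lborel) = (\<integral>y. time_integral w T y * cnj (g y) \<partial>lborel)"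
proof -
  note [measurable (raw)] = time_field_measurable'[OF w]
  obtain m where m: "m > 0" "\<And>t y. m < \<bar>t\<bar> \<Longrightarrow> w t y = 0" using time_field_bound[OF w] by blast
  have int: "integrable (lborel \<Otimes>\<^sub>M lborel) (\<lambda>(t, y). of_real (indicator T t) * (w t y * cnj (g y)))"
  proof (rule integrableI_bounded)
    have "(\<integral>\<^sup>+x. ennreal (norm (case x of (t, y) \<Rightarrow> of_real (indicator T t) * (w t y * cnj (g y)))) \<partial>(lborel \<Otimes>\<^sub>M lborel))
      = (\<integral>\<^sup>+t. \<integral>\<^sup>+y. ennreal (cmod (of_real (indicator T t) * (w t y * cnj (g y)))) \<partial>lborel \<partial>lborel)"
      by (rule nn_integral_pair_eq) (simp_all, measurable)
    also have "\<dots> \<le> (\<integral>\<^sup>+t. \<integral>\<^sup>+y. ennreal ((cmod (w t y))\<^sup>2) + ennreal ((cmod (g y))\<^sup>2) * indicator {-m..m} t \<partial>lborel \<partial>lborel)"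
    proof (intro nn_integral_mono)
      fix t y
      show "ennreal (cmod (of_real (indicator T t) * (w t y * cnj (g y)))) \<le> ennreal ((cmod (w t y))\<^sup>2) + ennreal ((cmod (g y))\<^sup>2) * indicator {-m..m} t"
      proof (cases "\<bar>t\<bar> \<le> m")
        case True
        have "cmod (of_real (indicator T t) * (w t y * cnj (g y))) \<le> cmod (w t y * cnj (g y))"
          by (auto simp: indicator_def)
        also have "\<dots> \<le> (cmod (w t y))\<^sup>2 + (cmod (g y))\<^sup>2"
          by (rule norm_mult_le_squares)
        finally show ?thesis using True by (auto simp: ennreal_plus[symmetric] abs_le_iff simp del: ennreal_plus)
      qed (use m in auto)
    qed
    also have "\<dots> = (\<integral>\<^sup>+t. \<integral>\<^sup>+y. ennreal ((cmod (w t y))\<^sup>2) \<partial>lborel \<partial>lborel) + (\<integral>\<^sup>+y. ennreal ((cmod (g y))\<^sup>2) \<partial>lborel) * ennreal (2 * m)"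
      using m(1) by (simp add: nn_integral_add nn_integral_multc nn_integral_cmult flip: mult_2)
    also have "\<dots> < \<infinity>"
      using w g2 by (auto simp: time_field_def ennreal_mult_less_top nn_integral_eq_integral)
    finally show "(\<integral>\<^sup>+x. ennreal (norm (case x of (t, y) \<Rightarrow> of_real (indicator T t) * (w t y * cnj (g y)))) \<partial>(lborel \<Otimes>\<^sub>M lborel)) < \<infinity>" .
  qed measurable
  have "(\<integral>t. of_real (indicator T t) * (\<integral>y. w t y * cnj (g y) \<partial>lborel) \<partial>lborel) = (\<integral>t. \<integral>y. of_real (indicator T t) * (w t y * cnj (g y)) \<partial>lborel \<partial>lborel)"
    by simp
  also have "\<dots> = (\<integral>y. \<integral>t. of_real (indicator T t) * (w t y * cnj (g y)) \<partial>lborel \<partial>lborel)"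
    using lborel_pair.Fubini_integral[OF int] by simp
  also have "\<dots> = (\<integral>y. time_integral w T y * cnj (g y) \<partial>lborel)"
    unfolding time_integral_def by (simp add: mult.assoc[symmetric])
  finally show ?thesis .
qed

lemma ennreal_mult3: "0 \<le> x \<Longrightarrow> 0 \<le> y \<Longrightarrow> 0 \<le> z \<Longrightarrow> ennreal (x * y * z) = ennreal x * ennreal y * ennreal z"
  by (simp add: ennreal_mult)

section \<open>Almost orthogonality of dyadic scales\<close>

text \<open>The interaction in time of two pieces whose scales have product \<open>a\<close>: at most one because the evolution is a contraction, and controlled
  by the dispersive estimate beyond \<open>|r| = a\<close>. The exponent \<open>3/2\<close> is \<open>d/2\<close> for \<open>d = 3\<close>, the smallest half-dimension above one, so that
  \<open>decay a\<close> has integral of order \<open>a\<close>.\<close>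

definition decay :: "real \<Rightarrow> real \<Rightarrow> real"
  where "decay a r = (if \<bar>r\<bar> \<le> a then 1 else (a / \<bar>r\<bar>) powr (3 / 2))"

lemma borel_measurable_decay [measurable]: "decay a \<in> borel_measurable borel"
  unfolding decay_def[abs_def] by measurable

lemma decay_nonneg: "decay a r \<ge> 0"
  by (simp add: decay_def)

lemma decay_minus: "decay a (r - s) = decay a (s - r)"
  by (simp add: decay_def abs_minus_commute)

lemma nn_integral_indicator_abs:
  assumes "M \<ge> 0"
  shows "(\<integral>\<^sup>+t. indicator {..M} \<bar>t - s\<bar> \<partial>lborel) = ennreal (2 * M)"
proof -
  have "(\<integral>\<^sup>+t. indicator {..M} \<bar>t - s\<bar> \<partial>lborel) = (\<integral>\<^sup>+t. indicator {s - M..s + M} t \<partial>lborel)"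
    by (intro nn_integral_cong) (auto simp: indicator_def)
  then show ?thesis using assms by simp
qed

lemma nn_integral_decay_le:
  assumes a: "a > 0"
  shows "(\<integral>\<^sup>+t. ennreal (decay a (t - s)) \<partial>lborel) \<le> ennreal (6 * a)"
proof -
  have "(\<integral>\<^sup>+t. ennreal (decay a (t - s)) \<partial>lborel) \<le>
      (\<integral>\<^sup>+t. indicator {..a} \<bar>t - s\<bar> + ennreal (a powr (3 / 2)) * ennreal (\<bar>t - s\<bar> powr (- (3 / 2)) * indicator {a..} \<bar>t - s\<bar>) \<partial>lborel)"
    using a by (intro nn_integral_mono) (auto simp: decay_def powr_divide powr_minus_divide ennreal_mult[symmetric])
  also have "\<dots> = (\<integral>\<^sup>+t. indicator {..a} \<bar>t - s\<bar> \<partial>lborel) + ennreal (a powr (3 / 2)) * (\<integral>\<^sup>+t. ennreal (\<bar>t - s\<bar> powr (- (3 / 2)) * indicator {a..} \<bar>t - s\<bar>) \<partial>lborel)"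
    by (simp add: nn_integral_add nn_integral_cmult)
  also have "\<dots> \<le> ennreal (2 * a) + ennreal (a powr (3 / 2)) * ennreal (2 * a powr (1 - 3 / 2) / (3 / 2 - 1))"
    using a by (intro add_mono mult_left_mono nn_integral_far_powr_le) (auto simp: nn_integral_indicator_abs)
  also have "\<dots> = ennreal (2 * a + a powr (3 / 2) * (2 * a powr (1 - 3 / 2) / (3 / 2 - 1)))"
    using a by (subst ennreal_mult[symmetric]) (auto simp: ennreal_plus[symmetric] simp del: ennreal_plus)
  also have "a powr (3 / 2) * (2 * a powr (1 - 3 / 2) / (3 / 2 - 1)) = 4 * (a powr (3 / 2) * a powr (1 - 3 / 2))"
    by simp
  also have "a powr (3 / 2) * a powr (1 - 3 / 2) = a" using a by (simp flip: powr_add)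
  finally show ?thesis by simp
qed

text \<open>Schur's test: \<open>decay a\<close> is symmetric with integral at most \<open>6 a\<close>.\<close>

lemma schur_decay:
  fixes \<phi> :: "real \<Rightarrow> real"
  assumes a: "a > 0" and C: "C \<ge> 0" and [measurable]: "\<phi> \<in> borel_measurable borel" "T \<in> sets borel"
  shows "(\<integral>\<^sup>+t. \<integral>\<^sup>+s. indicator (T \<times> T) (t, s) * ennreal (C * decay a (t - s) * \<phi> t * \<phi> s) \<partial>lborel \<partial>lborel)
    \<le> ennreal (6 * C * a) * (\<integral>\<^sup>+t. ennreal ((\<phi> t)\<^sup>2) * indicator T t \<partial>lborel)"
proof -
  let ?I = "\<integral>\<^sup>+t. ennreal ((\<phi> t)\<^sup>2) * indicator T t \<partial>lborel"
  let ?G = "\<lambda>t s. ennreal (C / 2) * (ennreal ((\<phi> t)\<^sup>2) * indicator T t) * ennreal (decay a (s - t))"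
  have "(\<integral>\<^sup>+t. \<integral>\<^sup>+s. indicator (T \<times> T) (t, s) * ennreal (C * decay a (t - s) * \<phi> t * \<phi> s) \<partial>lborel \<partial>lborel)
     \<le> (\<integral>\<^sup>+t. \<integral>\<^sup>+s. ?G t s + ?G s t \<partial>lborel \<partial>lborel)"
  proof (intro nn_integral_mono)
    fix t s
    have "\<phi> t * \<phi> s \<le> (\<phi> t)\<^sup>2 / 2 + (\<phi> s)\<^sup>2 / 2" using sum_squares_bound[of "\<phi> t" "\<phi> s"] by simp
    then have "C * decay a (t - s) * (\<phi> t * \<phi> s) \<le> C * decay a (t - s) * ((\<phi> t)\<^sup>2 / 2 + (\<phi> s)\<^sup>2 / 2)"
      using C decay_nonneg by (intro mult_left_mono) auto
    also have "\<dots> = C / 2 * (\<phi> t)\<^sup>2 * decay a (s - t) + C / 2 * (\<phi> s)\<^sup>2 * decay a (t - s)"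
      by (simp add: decay_minus[of a s] algebra_simps)
    finally have "ennreal (C * decay a (t - s) * \<phi> t * \<phi> s) \<le> ennreal (C / 2 * (\<phi> t)\<^sup>2 * decay a (s - t) + C / 2 * (\<phi> s)\<^sup>2 * decay a (t - s))"
      by (intro ennreal_leI) (simp add: mult.assoc)
    also have "\<dots> = ennreal (C / 2) * ennreal ((\<phi> t)\<^sup>2) * ennreal (decay a (s - t)) + ennreal (C / 2) * ennreal ((\<phi> s)\<^sup>2) * ennreal (decay a (t - s))"
      using C decay_nonneg by (simp add: ennreal_mult[symmetric])
    finally show "indicator (T \<times> T) (t, s) * ennreal (C * decay a (t - s) * \<phi> t * \<phi> s) \<le> ?G t s + ?G s t"
      by (auto simp: indicator_def)
  qed
  also have "\<dots> = (\<integral>\<^sup>+t. \<integral>\<^sup>+s. ?G t s \<partial>lborel \<partial>lborel) + (\<integral>\<^sup>+t. \<integral>\<^sup>+s. ?G s t \<partial>lborel \<partial>lborel)"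
    by (simp add: nn_integral_add)
  also have "(\<integral>\<^sup>+t. \<integral>\<^sup>+s. ?G s t \<partial>lborel \<partial>lborel) = (\<integral>\<^sup>+t. \<integral>\<^sup>+s. ?G t s \<partial>lborel \<partial>lborel)"
    by (rule lborel_pair.Fubini') measurable
  finally have 1: "(\<integral>\<^sup>+t. \<integral>\<^sup>+s. indicator (T \<times> T) (t, s) * ennreal (C * decay a (t - s) * \<phi> t * \<phi> s) \<partial>lborel \<partial>lborel)
    \<le> 2 * (\<integral>\<^sup>+t. \<integral>\<^sup>+s. ?G t s \<partial>lborel \<partial>lborel)" by (simp add: mult_2)
  have "(\<integral>\<^sup>+t. \<integral>\<^sup>+s. ?G t s \<partial>lborel \<partial>lborel) = (\<integral>\<^sup>+t. ennreal (C / 2) * (ennreal ((\<phi> t)\<^sup>2) * indicator T t) * (\<integral>\<^sup>+s. ennreal (decay a (s - t)) \<partial>lborel) \<partial>lborel)"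
    by (intro nn_integral_cong nn_integral_cmult) measurable
  also have "\<dots> \<le> (\<integral>\<^sup>+t. ennreal (C / 2) * (ennreal ((\<phi> t)\<^sup>2) * indicator T t) * ennreal (6 * a) \<partial>lborel)"
    by (intro nn_integral_mono mult_left_mono nn_integral_decay_le a) auto
  also have "\<dots> = ennreal (C / 2) * ?I * ennreal (6 * a)"
    by (simp add: nn_integral_multc nn_integral_cmult)
  also have "\<dots> = ennreal (C / 2 * (6 * a)) * ?I"
  proof -
    have "ennreal (C / 2 * (6 * a)) = ennreal (C / 2) * ennreal (6 * a)" using C a by (intro ennreal_mult) auto
    then show ?thesis by (simp only: mult.assoc mult.commute[of ?I])
  qed
  finally have "2 * (\<integral>\<^sup>+t. \<integral>\<^sup>+s. ?G t s \<partial>lborel \<partial>lborel) \<le> 2 * (ennreal (C / 2 * (6 * a)) * ?I)"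
    by (intro mult_left_mono) auto
  also have "\<dots> = ennreal (6 * C * a) * ?I"
  proof -
    have "2 * ennreal (C / 2 * (6 * a)) = ennreal (2 * (C / 2 * (6 * a)))"
      using C a by (subst ennreal_mult) auto
    also have "2 * (C / 2 * (6 * a)) = 6 * C * a" by simp
    finally show ?thesis by (simp only: mult.assoc[symmetric])
  qed
  finally show ?thesis using 1 by (rule order_trans[rotated])
qed

text \<open>Away from the diagonal the interaction is at most \<open>(a / |t - s|)^(3/2)\<close> with \<open>a = \<rho>\<^sup>4 R\<^sup>2\<close>.
  Integrating over \<open>|t - s| \<ge> \<rho>\<^sup>2 R\<^sup>2\<close> leaves \<open>a^(3/2) / (\<rho> R) = \<rho>\<^sup>5 R\<^sup>2\<close>, and the weights \<open>\<rho>\<^sup>4\<close> and \<open>\<rho>^(-4)\<close>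
  in the arithmetic-geometric mean inequality distribute it over the two scales \<open>\<rho>\<^sup>4 R\<close> and \<open>R\<close>.\<close>

lemma far_interaction:
  fixes \<phi> \<psi> :: "real \<Rightarrow> real"
  assumes rho: "\<rho> > 0" "\<rho> \<le> 1" and R: "R > 0" and C: "C \<ge> 0"
    and [measurable]: "\<phi> \<in> borel_measurable borel" "\<psi> \<in> borel_measurable borel"
    and Phi: "(\<integral>\<^sup>+t. ennreal ((\<phi> t)\<^sup>2) \<partial>lborel) \<le> ennreal \<Phi>" and Psi: "(\<integral>\<^sup>+t. ennreal ((\<psi> t)\<^sup>2) \<partial>lborel) \<le> ennreal \<Psi>"
    and nn: "\<Phi> \<ge> 0" "\<Psi> \<ge> 0"
  shows "(\<integral>\<^sup>+t. \<integral>\<^sup>+s. indicator {\<rho>\<^sup>2 * R\<^sup>2..} \<bar>t - s\<bar> * ennreal (C * decay (\<rho>^4 * R\<^sup>2) (t - s) * \<phi> t * \<psi> s) \<partial>lborel \<partial>lborel)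
    \<le> ennreal (2 * C * \<rho> * ((\<rho>^4 * R)\<^sup>2 * \<Phi> + R\<^sup>2 * \<Psi>))"
proof -
  define a M where "a = \<rho>^4 * R\<^sup>2" and "M = \<rho>\<^sup>2 * R\<^sup>2"
  have aM: "a > 0" "M > 0" "a \<le> M"
    using rho R power_decreasing[of 2 4 \<rho>] by (auto simp: a_def M_def)
  let ?k = "\<lambda>r. ennreal (\<bar>r\<bar> powr (- (3 / 2)) * indicator {M..} \<bar>r\<bar>)"
  let ?c = "C * a powr (3 / 2) / 2"
  have c0: "?c \<ge> 0" using C by simp
  have k: "(\<integral>\<^sup>+s. ?k (t - s) \<partial>lborel) \<le> ennreal (4 * M powr (- (1 / 2)))" "(\<integral>\<^sup>+t. ?k (t - s) \<partial>lborel) \<le> ennreal (4 * M powr (- (1 / 2)))" for t s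
    using nn_integral_far_powr_le[of "3 / 2" M t] nn_integral_far_powr_le[of "3 / 2" M s] aM
    by (simp_all add: abs_minus_commute)
  have "(\<integral>\<^sup>+t. \<integral>\<^sup>+s. indicator {M..} \<bar>t - s\<bar> * ennreal (C * decay a (t - s) * \<phi> t * \<psi> s) \<partial>lborel \<partial>lborel)
    \<le> (\<integral>\<^sup>+t. \<integral>\<^sup>+s. ennreal (?c * \<rho>^4) * ennreal ((\<phi> t)\<^sup>2) * ?k (t - s) + ennreal (?c / \<rho>^4) * ennreal ((\<psi> s)\<^sup>2) * ?k (t - s) \<partial>lborel \<partial>lborel)"
  proof (intro nn_integral_mono)
    fix t s
    show "indicator {M..} \<bar>t - s\<bar> * ennreal (C * decay a (t - s) * \<phi> t * \<psi> s) \<le> ennreal (?c * \<rho>^4) * ennreal ((\<phi> t)\<^sup>2) * ?k (t - s) + ennreal (?c / \<rho>^4) * ennreal ((\<psi> s)\<^sup>2) * ?k (t - s)"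
    proof (cases "M \<le> \<bar>t - s\<bar>")
      case True
      have d: "decay a (t - s) \<le> a powr (3 / 2) * \<bar>t - s\<bar> powr (- (3 / 2))"
      proof (cases "\<bar>t - s\<bar> \<le> a")
        case True': True
        then have "\<bar>t - s\<bar> = a" using True aM by linarith
        then show ?thesis using aM by (simp add: decay_def powr_minus)
      next
        case False
        then show ?thesis using aM by (simp add: decay_def powr_divide powr_minus_divide)
      qed
      have "0 \<le> (\<rho>\<^sup>2 * \<phi> t - \<psi> s / \<rho>\<^sup>2)\<^sup>2" by simp
      also have "\<dots> = \<rho>^4 * (\<phi> t)\<^sup>2 + (\<psi> s)\<^sup>2 / \<rho>^4 - 2 * (\<phi> t * \<psi> s)"
        using rho by (simp add: power2_diff power_mult_distrib power_divide flip: power_mult)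
      finally have p: "\<phi> t * \<psi> s \<le> (\<rho>^4 * (\<phi> t)\<^sup>2 + (\<psi> s)\<^sup>2 / \<rho>^4) / 2" by simp
      have "C * decay a (t - s) * (\<phi> t * \<psi> s) \<le> C * decay a (t - s) * ((\<rho>^4 * (\<phi> t)\<^sup>2 + (\<psi> s)\<^sup>2 / \<rho>^4) / 2)"
        using C decay_nonneg by (intro mult_left_mono p) auto
      also have "\<dots> \<le> C * (a powr (3 / 2) * \<bar>t - s\<bar> powr (- (3 / 2))) * ((\<rho>^4 * (\<phi> t)\<^sup>2 + (\<psi> s)\<^sup>2 / \<rho>^4) / 2)"
        using C d rho by (intro mult_right_mono mult_left_mono) auto
      also have "\<dots> = ?c * \<rho>^4 * (\<phi> t)\<^sup>2 * \<bar>t - s\<bar> powr (- (3 / 2)) + ?c / \<rho>^4 * (\<psi> s)\<^sup>2 * \<bar>t - s\<bar> powr (- (3 / 2))"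
        by (simp add: algebra_simps add_divide_distrib)
      finally have "ennreal (C * decay a (t - s) * \<phi> t * \<psi> s) \<le> ennreal (?c * \<rho>^4 * (\<phi> t)\<^sup>2 * \<bar>t - s\<bar> powr (- (3 / 2)) + ?c / \<rho>^4 * (\<psi> s)\<^sup>2 * \<bar>t - s\<bar> powr (- (3 / 2)))"
        by (intro ennreal_leI) (simp add: mult.assoc)
      also have "\<dots> = ennreal (?c * \<rho>^4 * (\<phi> t)\<^sup>2 * \<bar>t - s\<bar> powr (- (3 / 2))) + ennreal (?c / \<rho>^4 * (\<psi> s)\<^sup>2 * \<bar>t - s\<bar> powr (- (3 / 2)))"
        using C rho by (intro ennreal_plus mult_nonneg_nonneg divide_nonneg_nonneg) auto
      also have "\<dots> = ennreal (?c * \<rho>^4) * ennreal ((\<phi> t)\<^sup>2) * ennreal (\<bar>t - s\<bar> powr (- (3 / 2))) + ennreal (?c / \<rho>^4) * ennreal ((\<psi> s)\<^sup>2) * ennreal (\<bar>t - s\<bar> powr (- (3 / 2)))"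
        using C rho by (subst (1 2) ennreal_mult3) auto
      finally show ?thesis using True by simp
    qed simp
  qed
  also have "\<dots> = (\<integral>\<^sup>+t. \<integral>\<^sup>+s. ennreal (?c * \<rho>^4) * ennreal ((\<phi> t)\<^sup>2) * ?k (t - s) \<partial>lborel \<partial>lborel) + (\<integral>\<^sup>+t. \<integral>\<^sup>+s. ennreal (?c / \<rho>^4) * ennreal ((\<psi> s)\<^sup>2) * ?k (t - s) \<partial>lborel \<partial>lborel)"
    by (simp add: nn_integral_add)
  also have "(\<integral>\<^sup>+t. \<integral>\<^sup>+s. ennreal (?c / \<rho>^4) * ennreal ((\<psi> s)\<^sup>2) * ?k (t - s) \<partial>lborel \<partial>lborel) = (\<integral>\<^sup>+s. \<integral>\<^sup>+t. ennreal (?c / \<rho>^4) * ennreal ((\<psi> s)\<^sup>2) * ?k (t - s) \<partial>lborel \<partial>lborel)"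
    by (rule lborel_pair.Fubini'[symmetric]) measurable
  also have "(\<integral>\<^sup>+s. \<integral>\<^sup>+t. ennreal (?c / \<rho>^4) * ennreal ((\<psi> s)\<^sup>2) * ?k (t - s) \<partial>lborel \<partial>lborel) = (\<integral>\<^sup>+s. ennreal (?c / \<rho>^4) * ennreal ((\<psi> s)\<^sup>2) * (\<integral>\<^sup>+t. ?k (t - s) \<partial>lborel) \<partial>lborel)"
    by (intro nn_integral_cong nn_integral_cmult) measurable
  also have "(\<integral>\<^sup>+t. \<integral>\<^sup>+s. ennreal (?c * \<rho>^4) * ennreal ((\<phi> t)\<^sup>2) * ?k (t - s) \<partial>lborel \<partial>lborel) = (\<integral>\<^sup>+t. ennreal (?c * \<rho>^4) * ennreal ((\<phi> t)\<^sup>2) * (\<integral>\<^sup>+s. ?k (t - s) \<partial>lborel) \<partial>lborel)"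
    by (intro nn_integral_cong nn_integral_cmult) measurable
  finally have 1: "(\<integral>\<^sup>+t. \<integral>\<^sup>+s. indicator {M..} \<bar>t - s\<bar> * ennreal (C * decay a (t - s) * \<phi> t * \<psi> s) \<partial>lborel \<partial>lborel) \<le>
     (\<integral>\<^sup>+t. ennreal (?c * \<rho>^4) * ennreal ((\<phi> t)\<^sup>2) * (\<integral>\<^sup>+s. ?k (t - s) \<partial>lborel) \<partial>lborel) +
     (\<integral>\<^sup>+s. ennreal (?c / \<rho>^4) * ennreal ((\<psi> s)\<^sup>2) * (\<integral>\<^sup>+t. ?k (t - s) \<partial>lborel) \<partial>lborel)" .
  have e: "ennreal b * (\<integral>\<^sup>+t. ennreal ((f t)\<^sup>2) \<partial>lborel) * ennreal (4 * M powr (- (1 / 2))) \<le> ennreal (b * F * (4 * M powr (- (1 / 2))))"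
    if "b \<ge> 0" "F \<ge> 0" "(\<integral>\<^sup>+t. ennreal ((f t)\<^sup>2) \<partial>lborel) \<le> ennreal F" for b F and f :: "real \<Rightarrow> real"
  proof -
    have "ennreal b * (\<integral>\<^sup>+t. ennreal ((f t)\<^sup>2) \<partial>lborel) * ennreal (4 * M powr (- (1 / 2))) \<le> ennreal b * ennreal F * ennreal (4 * M powr (- (1 / 2)))"
      using that by (intro mult_right_mono mult_left_mono) auto
    also have "\<dots> = ennreal (b * F * (4 * M powr (- (1 / 2))))"
      using that by (intro ennreal_mult3[symmetric]) auto
    finally show ?thesis .
  qed
  have "(\<integral>\<^sup>+t. ennreal (?c * \<rho>^4) * ennreal ((\<phi> t)\<^sup>2) * (\<integral>\<^sup>+s. ?k (t - s) \<partial>lborel) \<partial>lborel) \<le> (\<integral>\<^sup>+t. ennreal (?c * \<rho>^4) * ennreal ((\<phi> t)\<^sup>2) * ennreal (4 * M powr (- (1 / 2))) \<partial>lborel)"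
    by (intro nn_integral_mono mult_left_mono k) auto
  also have "\<dots> = ennreal (?c * \<rho>^4) * (\<integral>\<^sup>+t. ennreal ((\<phi> t)\<^sup>2) \<partial>lborel) * ennreal (4 * M powr (- (1 / 2)))"
    by (simp add: nn_integral_multc nn_integral_cmult)
  also have "\<dots> \<le> ennreal (?c * \<rho>^4 * \<Phi> * (4 * M powr (- (1 / 2))))"
    using c0 rho Phi nn by (intro e mult_nonneg_nonneg) auto
  finally have 2: "(\<integral>\<^sup>+t. ennreal (?c * \<rho>^4) * ennreal ((\<phi> t)\<^sup>2) * (\<integral>\<^sup>+s. ?k (t - s) \<partial>lborel) \<partial>lborel) \<le> ennreal (?c * \<rho>^4 * \<Phi> * (4 * M powr (- (1 / 2))))" .
  have "(\<integral>\<^sup>+s. ennreal (?c / \<rho>^4) * ennreal ((\<psi> s)\<^sup>2) * (\<integral>\<^sup>+t. ?k (t - s) \<partial>lborel) \<partial>lborel) \<le> (\<integral>\<^sup>+s. ennreal (?c / \<rho>^4) * ennreal ((\<psi> s)\<^sup>2) * ennreal (4 * M powr (- (1 / 2))) \<partial>lborel)"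
    by (intro nn_integral_mono mult_left_mono k) auto
  also have "\<dots> = ennreal (?c / \<rho>^4) * (\<integral>\<^sup>+t. ennreal ((\<psi> t)\<^sup>2) \<partial>lborel) * ennreal (4 * M powr (- (1 / 2)))"
    by (simp add: nn_integral_multc nn_integral_cmult)
  also have "\<dots> \<le> ennreal (?c / \<rho>^4 * \<Psi> * (4 * M powr (- (1 / 2))))"
    using c0 rho Psi nn by (intro e divide_nonneg_nonneg) auto
  finally have 3: "(\<integral>\<^sup>+s. ennreal (?c / \<rho>^4) * ennreal ((\<psi> s)\<^sup>2) * (\<integral>\<^sup>+t. ?k (t - s) \<partial>lborel) \<partial>lborel) \<le> ennreal (?c / \<rho>^4 * \<Psi> * (4 * M powr (- (1 / 2))))" .
  have "a powr (3 / 2) * M powr (- (1 / 2)) = \<rho>^5 * R\<^sup>2"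
  proof -
    have sq: "(b\<^sup>2) powr c = b powr (2 * c)" if "b > 0" for b c :: real
      using that by (simp add: powr_powr flip: powr_numeral)
    have "a = (\<rho>\<^sup>2 * R)\<^sup>2" "M = (\<rho> * R)\<^sup>2" unfolding a_def M_def by algebra+
    then have "a powr (3 / 2) = (\<rho>\<^sup>2 * R) powr 3" "M powr (- (1 / 2)) = (\<rho> * R) powr (- 1)"
      using rho R by (simp_all add: sq)
    then have "a powr (3 / 2) = (\<rho>\<^sup>2 * R)^3" "M powr (- (1 / 2)) = 1 / (\<rho> * R)"
      using rho R by (simp_all add: powr_minus_divide)
    moreover have "(\<rho>\<^sup>2 * R)^3 = (\<rho>^5 * R\<^sup>2) * (\<rho> * R)" by algebra
    ultimately show ?thesis using rho R by simp
  qed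
  moreover have "C * x / 2 * (4 * y) = 2 * C * (x * y)" for x y by simp
  ultimately have am: "?c * (4 * M powr (- (1 / 2))) = 2 * C * (\<rho>^5 * R\<^sup>2)" by (simp only:)
  have dist: "c * r * x * m + c / r * y * m = (c * m) * (r * x + y / r)" for c r m x y :: real
    by (simp add: algebra_simps)
  have "?c * \<rho>^4 * \<Phi> * (4 * M powr (- (1 / 2))) + ?c / \<rho>^4 * \<Psi> * (4 * M powr (- (1 / 2))) = (?c * (4 * M powr (- (1 / 2)))) * (\<rho>^4 * \<Phi> + \<Psi> / \<rho>^4)"
    by (rule dist)
  also have "\<dots> = 2 * C * \<rho> * ((\<rho>^4 * R)\<^sup>2 * \<Phi> + R\<^sup>2 * \<Psi>)"
  proof -
    have "\<rho>^5 * R\<^sup>2 * (\<rho>^4 * \<Phi> + \<Psi> / \<rho>^4) = \<rho>^5 * R\<^sup>2 * \<rho>^4 * \<Phi> + R\<^sup>2 * \<Psi> * (\<rho>^5 / \<rho>^4)"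
      by (simp add: distrib_left)
    also have "\<rho>^5 * R\<^sup>2 * \<rho>^4 * \<Phi> = \<rho> * ((\<rho>^4 * R)\<^sup>2 * \<Phi>)" by algebra
    also have "\<rho>^5 / \<rho>^4 = \<rho>" using rho by (simp add: power_diff[symmetric])
    finally have "2 * C * (\<rho>^5 * R\<^sup>2 * (\<rho>^4 * \<Phi> + \<Psi> / \<rho>^4)) = 2 * C * (\<rho> * ((\<rho>^4 * R)\<^sup>2 * \<Phi>) + R\<^sup>2 * \<Psi> * \<rho>)"
      by (simp only:)
    moreover have "2 * C * (\<rho> * ((\<rho>^4 * R)\<^sup>2 * \<Phi>) + R\<^sup>2 * \<Psi> * \<rho>) = 2 * C * \<rho> * ((\<rho>^4 * R)\<^sup>2 * \<Phi> + R\<^sup>2 * \<Psi>)"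
      by algebra
    ultimately show ?thesis unfolding am by (simp only: mult.assoc)
  qed
  finally have fin: "?c * \<rho>^4 * \<Phi> * (4 * M powr (- (1 / 2))) + ?c / \<rho>^4 * \<Psi> * (4 * M powr (- (1 / 2))) = 2 * C * \<rho> * ((\<rho>^4 * R)\<^sup>2 * \<Phi> + R\<^sup>2 * \<Psi>)" .
  have "(\<integral>\<^sup>+t. \<integral>\<^sup>+s. indicator {M..} \<bar>t - s\<bar> * ennreal (C * decay a (t - s) * \<phi> t * \<psi> s) \<partial>lborel \<partial>lborel) \<le>
      ennreal (?c * \<rho>^4 * \<Phi> * (4 * M powr (- (1 / 2)))) + ennreal (?c / \<rho>^4 * \<Psi> * (4 * M powr (- (1 / 2))))"
    using 1 add_mono[OF 2 3] by (rule order_trans)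
  also have "\<dots> = ennreal (2 * C * \<rho> * ((\<rho>^4 * R)\<^sup>2 * \<Phi> + R\<^sup>2 * \<Psi>))"
    unfolding fin[symmetric] using C rho nn by (intro ennreal_plus[symmetric] mult_nonneg_nonneg divide_nonneg_nonneg) auto
  finally show ?thesis unfolding a_def M_def .
qed

lemma near_diagonal_measurable: "{p::real \<times> real. \<bar>fst p - snd p\<bar> < M} \<in> sets (lborel \<Otimes>\<^sub>M lborel)"
proof -
  have "open {p::real \<times> real. \<bar>fst p - snd p\<bar> < M}" by (intro open_Collect_less continuous_intros)
  then show ?thesis by (simp only: lborel_prod sets_lborel borel_open)
qed

text \<open>Near the diagonal the dispersive decay between the two scales is of no use, and the orthogonality in time of the
  finer piece replaces it: superposing \<open>w\<close> over the window \<open>|t - s| < \<rho>\<^sup>2 R\<^sup>2\<close> costs only the squared scale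
  \<open>(\<rho>\<^sup>4 R)\<^sup>2\<close> of \<open>w\<close> instead of the length of the window (\<open>schur_decay\<close>). Pairing with the slice
  \<open>v s\<close> uses the arithmetic-geometric mean inequality with parameter \<open>\<rho> R\<^sup>2\<close>.\<close>

lemma near_interaction:
  fixes w v :: "real \<Rightarrow> 'a::euclidean_space \<Rightarrow> complex" and \<phi> \<psi> :: "real \<Rightarrow> real"
  assumes rho: "\<rho> > 0" and R: "R > 0" and C: "C \<ge> 0"
    and w: "time_field w" and v: "time_field v"
    and [measurable]: "\<phi> \<in> borel_measurable borel" "\<psi> \<in> borel_measurable borel"
    and ww: "\<And>t s. cmod (inner_product w w t s) \<le> C * decay ((\<rho>^4 * R)\<^sup>2) (t - s) * \<phi> t * \<phi> s"
    and vv: "\<And>s. (\<integral>\<^sup>+y. ennreal ((cmod (v s y))\<^sup>2) \<partial>lborel) \<le> ennreal ((\<psi> s)\<^sup>2)"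
    and Phi: "(\<integral>\<^sup>+t. ennreal ((\<phi> t)\<^sup>2) \<partial>lborel) \<le> ennreal \<Phi>" and Psi: "(\<integral>\<^sup>+t. ennreal ((\<psi> t)\<^sup>2) \<partial>lborel) \<le> ennreal \<Psi>"
    and nn: "\<Phi> \<ge> 0" "\<Psi> \<ge> 0"
  shows "cmod (\<integral>p. of_real (indicator {p. \<bar>fst p - snd p\<bar> < \<rho>\<^sup>2 * R\<^sup>2} p) * inner_product w v (fst p) (snd p) \<partial>(lborel \<Otimes>\<^sub>M lborel))
    \<le> 6 * C * \<rho> * (\<rho>^4 * R)\<^sup>2 * \<Phi> + \<rho> * R\<^sup>2 * \<Psi> / 2"
proof -
  note [measurable (raw)] = time_field_measurable'[OF w] time_field_measurable'[OF v]
  define r M \<mu> where "r = \<rho>^4 * R" and "M = \<rho>\<^sup>2 * R\<^sup>2" and "\<mu> = \<rho> * R\<^sup>2"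
  have pos: "r > 0" "M > 0" "\<mu> > 0" using rho R by (auto simp: r_def M_def \<mu>_def)
  define N where "N = {p::real \<times> real. \<bar>fst p - snd p\<bar> < M}"
  have N[measurable]: "N \<in> sets (lborel \<Otimes>\<^sub>M lborel)" unfolding N_def by (rule near_diagonal_measurable)
  define T where "T s = {t::real. \<bar>t - s\<bar> < M}" for s
  have T[measurable]: "T s \<in> sets borel" for s unfolding T_def by (intro borel_open open_Collect_less continuous_intros)
  define J where "J s = (\<integral>t. of_real (indicator (T s) t) * inner_product w v t s \<partial>lborel)" for s
  have "(\<integral>p. of_real (indicator N p) * inner_product w v (fst p) (snd p) \<partial>(lborel \<Otimes>\<^sub>M lborel)) = (\<integral>s. J s \<partial>lborel)"
    using lborel_pair.integral_snd[of "\<lambda>t s. of_real (indicator N (t, s)) * inner_product w v t s"]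
      time_field_double_integral(3)[OF w v N]
    by (simp add: J_def case_prod_beta' N_def T_def indicator_def)
  moreover have "integrable lborel J"
    using lborel_pair.integrable_snd[of "\<lambda>t s. of_real (indicator N (t, s)) * inner_product w v t s"]
      time_field_double_integral(3)[OF w v N]
    by (simp add: J_def[abs_def] case_prod_beta' N_def T_def indicator_def)
  ultimately have 1: "ennreal (cmod (\<integral>p. of_real (indicator N p) * inner_product w v (fst p) (snd p) \<partial>(lborel \<Otimes>\<^sub>M lborel))) \<le> (\<integral>\<^sup>+s. ennreal (cmod (J s)) \<partial>lborel)"
    using integral_norm_bound_ennreal[of lborel J] by simp
  let ?c = "ennreal (1 / (2 * \<mu>) * (6 * C * r\<^sup>2))"
  have Jb: "ennreal (cmod (J s)) \<le> ?c * (\<integral>\<^sup>+t. ennreal ((\<phi> t)\<^sup>2) * indicator (T s) t \<partial>lborel) + ennreal (\<mu> / 2) * ennreal ((\<psi> s)\<^sup>2)" for s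
  proof -
    let ?V = "time_integral w (T s)"
    have [measurable]: "?V \<in> borel_measurable borel" by (rule borel_measurable_time_integral[OF w T])
    have vs: "integrable lborel (\<lambda>y. (cmod (v s y))\<^sup>2)"
      using vv[of s] by (intro integrableI_nonneg) (auto simp: le_less_trans)
    have Js: "J s = (\<integral>y. ?V y * cnj (v s y) \<partial>lborel)"
      unfolding J_def inner_product_def by (rule time_integral_slice[OF w _ vs T]) measurable
    have "ennreal (cmod (J s)) \<le> (\<integral>\<^sup>+y. ennreal (cmod (?V y * cnj (v s y))) \<partial>lborel)"
      unfolding Js by (cases "integrable lborel (\<lambda>y. ?V y * cnj (v s y))")
        (auto intro: integral_norm_bound_ennreal simp: not_integrable_integral_eq)
    also have "\<dots> \<le> (\<integral>\<^sup>+y. ennreal (1 / (2 * \<mu>)) * ennreal ((cmod (?V y))\<^sup>2) + ennreal (\<mu> / 2) * ennreal ((cmod (v s y))\<^sup>2) \<partial>lborel)"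
    proof (rule nn_integral_mono)
      fix y
      define a b where "a = cmod (?V y)" and "b = cmod (v s y)"
      have "0 \<le> (a - \<mu> * b)\<^sup>2 / (2 * \<mu>)" using pos by simp
      also have "\<dots> = 1 / (2 * \<mu>) * a\<^sup>2 + \<mu> / 2 * b\<^sup>2 - a * b"
        using pos by (simp add: power2_eq_square field_simps)
      finally have "a * b \<le> 1 / (2 * \<mu>) * a\<^sup>2 + \<mu> / 2 * b\<^sup>2" by simp
      then have "ennreal (a * b) \<le> ennreal (1 / (2 * \<mu>) * a\<^sup>2 + \<mu> / 2 * b\<^sup>2)" by (rule ennreal_leI)
      also have "\<dots> = ennreal (1 / (2 * \<mu>) * a\<^sup>2) + ennreal (\<mu> / 2 * b\<^sup>2)" using pos by (intro ennreal_plus) auto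
      also have "\<dots> = ennreal (1 / (2 * \<mu>)) * ennreal (a\<^sup>2) + ennreal (\<mu> / 2) * ennreal (b\<^sup>2)"
        using pos by (subst (1 2) ennreal_mult) auto
      finally show "ennreal (cmod (?V y * cnj (v s y))) \<le> ennreal (1 / (2 * \<mu>)) * ennreal ((cmod (?V y))\<^sup>2) + ennreal (\<mu> / 2) * ennreal ((cmod (v s y))\<^sup>2)"
        unfolding a_def b_def by (simp only: norm_mult complex_mod_cnj)
    qed
    also have "\<dots> = ennreal (1 / (2 * \<mu>)) * (\<integral>\<^sup>+y. ennreal ((cmod (?V y))\<^sup>2) \<partial>lborel) + ennreal (\<mu> / 2) * (\<integral>\<^sup>+y. ennreal ((cmod (v s y))\<^sup>2) \<partial>lborel)"
      by (simp add: nn_integral_add nn_integral_cmult)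
    also have "\<dots> \<le> ennreal (1 / (2 * \<mu>)) * (ennreal (6 * C * r\<^sup>2) * (\<integral>\<^sup>+t. ennreal ((\<phi> t)\<^sup>2) * indicator (T s) t \<partial>lborel)) + ennreal (\<mu> / 2) * ennreal ((\<psi> s)\<^sup>2)"
    proof (intro add_mono mult_left_mono vv)
      have "(\<integral>\<^sup>+y. ennreal ((cmod (?V y))\<^sup>2) \<partial>lborel) \<le> (\<integral>\<^sup>+t. \<integral>\<^sup>+t'. indicator (T s \<times> T s) (t, t') * ennreal (cmod (inner_product w w t t')) \<partial>lborel \<partial>lborel)"
        by (rule time_integral_norm(2)[OF w T])
      also have "\<dots> \<le> (\<integral>\<^sup>+t. \<integral>\<^sup>+t'. indicator (T s \<times> T s) (t, t') * ennreal (C * decay (r\<^sup>2) (t - t') * \<phi> t * \<phi> t') \<partial>lborel \<partial>lborel)"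
        using ww unfolding r_def by (intro nn_integral_mono mult_left_mono ennreal_leI) auto
      also have "\<dots> \<le> ennreal (6 * C * r\<^sup>2) * (\<integral>\<^sup>+t. ennreal ((\<phi> t)\<^sup>2) * indicator (T s) t \<partial>lborel)"
        using pos C by (intro schur_decay) auto
      finally show "(\<integral>\<^sup>+y. ennreal ((cmod (?V y))\<^sup>2) \<partial>lborel) \<le> ennreal (6 * C * r\<^sup>2) * (\<integral>\<^sup>+t. ennreal ((\<phi> t)\<^sup>2) * indicator (T s) t \<partial>lborel)" .
    qed auto
    also have "ennreal (1 / (2 * \<mu>)) * (ennreal (6 * C * r\<^sup>2) * (\<integral>\<^sup>+t. ennreal ((\<phi> t)\<^sup>2) * indicator (T s) t \<partial>lborel)) = ?c * (\<integral>\<^sup>+t. ennreal ((\<phi> t)\<^sup>2) * indicator (T s) t \<partial>lborel)"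
      using pos C by (subst ennreal_mult) (auto simp: mult.assoc)
    finally show ?thesis .
  qed
  have [measurable]: "(\<lambda>(s, t). indicator (T s) t :: ennreal) \<in> borel_measurable (lborel \<Otimes>\<^sub>M lborel)"
    unfolding T_def indicator_def by measurable
  have "(\<integral>\<^sup>+s. ennreal (cmod (J s)) \<partial>lborel) \<le> (\<integral>\<^sup>+s. ?c * (\<integral>\<^sup>+t. ennreal ((\<phi> t)\<^sup>2) * indicator (T s) t \<partial>lborel) + ennreal (\<mu> / 2) * ennreal ((\<psi> s)\<^sup>2) \<partial>lborel)"
    by (intro nn_integral_mono Jb)
  also have "\<dots> = ?c * (\<integral>\<^sup>+s. \<integral>\<^sup>+t. ennreal ((\<phi> t)\<^sup>2) * indicator (T s) t \<partial>lborel \<partial>lborel) + ennreal (\<mu> / 2) * (\<integral>\<^sup>+s. ennreal ((\<psi> s)\<^sup>2) \<partial>lborel)"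
    by (simp add: nn_integral_add nn_integral_cmult)
  also have "(\<integral>\<^sup>+s. \<integral>\<^sup>+t. ennreal ((\<phi> t)\<^sup>2) * indicator (T s) t \<partial>lborel \<partial>lborel) = (\<integral>\<^sup>+t. \<integral>\<^sup>+s. ennreal ((\<phi> t)\<^sup>2) * indicator (T s) t \<partial>lborel \<partial>lborel)"
    by (rule lborel_pair.Fubini'[symmetric]) measurable
  also have "\<dots> \<le> (\<integral>\<^sup>+t. ennreal ((\<phi> t)\<^sup>2) * ennreal (2 * M) \<partial>lborel)"
  proof (rule nn_integral_mono)
    fix t
    have "(\<integral>\<^sup>+s. ennreal ((\<phi> t)\<^sup>2) * indicator (T s) t \<partial>lborel) \<le> (\<integral>\<^sup>+s. ennreal ((\<phi> t)\<^sup>2) * indicator {..M} \<bar>s - t\<bar> \<partial>lborel)"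
      by (intro nn_integral_mono mult_left_mono) (auto simp: T_def indicator_def)
    also have "\<dots> = ennreal ((\<phi> t)\<^sup>2) * ennreal (2 * M)"
      using pos nn_integral_indicator_abs[of M t] by (subst nn_integral_cmult) auto
    finally show "(\<integral>\<^sup>+s. ennreal ((\<phi> t)\<^sup>2) * indicator (T s) t \<partial>lborel) \<le> ennreal ((\<phi> t)\<^sup>2) * ennreal (2 * M)" .
  qed
  also have "\<dots> = (\<integral>\<^sup>+t. ennreal ((\<phi> t)\<^sup>2) \<partial>lborel) * ennreal (2 * M)"
    by (simp add: nn_integral_multc)
  finally have "(\<integral>\<^sup>+s. ennreal (cmod (J s)) \<partial>lborel) \<le> ?c * ((\<integral>\<^sup>+t. ennreal ((\<phi> t)\<^sup>2) \<partial>lborel) * ennreal (2 * M)) + ennreal (\<mu> / 2) * (\<integral>\<^sup>+s. ennreal ((\<psi> s)\<^sup>2) \<partial>lborel)"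
    by (simp add: add_mono mult_left_mono)
  also have "\<dots> \<le> ?c * (ennreal \<Phi> * ennreal (2 * M)) + ennreal (\<mu> / 2) * ennreal \<Psi>"
    using Phi Psi by (intro add_mono mult_left_mono mult_right_mono) auto
  also have "\<dots> = ennreal (1 / (2 * \<mu>) * (6 * C * r\<^sup>2) * (\<Phi> * (2 * M)) + \<mu> / 2 * \<Psi>)"
  proof -
    have "ennreal a * (ennreal b * ennreal c) + ennreal d * ennreal e = ennreal (a * (b * c) + d * e)"
      if "a \<ge> 0" "b \<ge> 0" "c \<ge> 0" "d \<ge> 0" "e \<ge> 0" for a b c d e
      using that by (simp add: ennreal_mult)
    then show ?thesis using pos C nn by simp
  qed
  also have "1 / (2 * \<mu>) * (6 * C * r\<^sup>2) * (\<Phi> * (2 * M)) + \<mu> / 2 * \<Psi> = 6 * C * \<rho> * r\<^sup>2 * \<Phi> + \<rho> * R\<^sup>2 * \<Psi> / 2"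
  proof -
    have "1 / (2 * \<mu>) * (6 * C * r\<^sup>2) * (\<Phi> * (2 * M)) = 6 * C * r\<^sup>2 * \<Phi> * (M / \<mu>)"
      using pos by simp
    also have "M / \<mu> = \<rho>" unfolding \<mu>_def M_def using rho R by (simp add: power2_eq_square)
    finally show ?thesis by (simp add: \<mu>_def)
  qed
  finally have "(\<integral>\<^sup>+s. ennreal (cmod (J s)) \<partial>lborel) \<le> ennreal (6 * C * \<rho> * r\<^sup>2 * \<Phi> + \<rho> * R\<^sup>2 * \<Psi> / 2)" .
  with 1 have "ennreal (cmod (\<integral>p. of_real (indicator N p) * inner_product w v (fst p) (snd p) \<partial>(lborel \<Otimes>\<^sub>M lborel))) \<le> ennreal (6 * C * \<rho> * r\<^sup>2 * \<Phi> + \<rho> * R\<^sup>2 * \<Psi> / 2)"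
    by (rule order_trans)
  then show ?thesis using rho C nn unfolding N_def r_def M_def by (subst (asm) ennreal_le_iff) auto
qed

text \<open>The scales are \<open>\<rho>\<^sup>4 R\<close> for \<open>w\<close> and \<open>R\<close> for \<open>v\<close>. Splitting the time plane at \<open>|t - s| = \<rho>\<^sup>2 R\<^sup>2\<close>,
  between the product of the scales and the square of the larger one, gains the factor \<open>\<rho>\<close> in both parts.\<close>

theorem almost_orthogonal_pair:
  fixes w v :: "real \<Rightarrow> 'a::euclidean_space \<Rightarrow> complex" and \<phi> \<psi> :: "real \<Rightarrow> real"
  assumes rho: "\<rho> > 0" "\<rho> \<le> 1" and R: "R > 0" and C: "C \<ge> 1"
    and w: "time_field w" and v: "time_field v"
    and meas: "\<phi> \<in> borel_measurable borel" "\<psi> \<in> borel_measurable borel"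
    and ww: "\<And>t s. cmod (inner_product w w t s) \<le> C * decay ((\<rho>^4 * R)\<^sup>2) (t - s) * \<phi> t * \<phi> s"
    and wv: "\<And>t s. cmod (inner_product w v t s) \<le> C * decay (\<rho>^4 * R\<^sup>2) (t - s) * \<phi> t * \<psi> s"
    and vv: "\<And>s. (\<integral>\<^sup>+y. ennreal ((cmod (v s y))\<^sup>2) \<partial>lborel) \<le> ennreal ((\<psi> s)\<^sup>2)"
    and Phi: "(\<integral>\<^sup>+t. ennreal ((\<phi> t)\<^sup>2) \<partial>lborel) \<le> ennreal \<Phi>" and Psi: "(\<integral>\<^sup>+t. ennreal ((\<psi> t)\<^sup>2) \<partial>lborel) \<le> ennreal \<Psi>"
    and nn: "\<Phi> \<ge> 0" "\<Psi> \<ge> 0"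
  shows "cmod (\<integral>y. time_integral w UNIV y * cnj (time_integral v UNIV y) \<partial>lborel) \<le> 8 * C * \<rho> * ((\<rho>^4 * R)\<^sup>2 * \<Phi> + R\<^sup>2 * \<Psi>)"
proof -
  note [measurable] = meas
  let ?M = "\<rho>\<^sup>2 * R\<^sup>2"
  define N where "N = {p::real \<times> real. \<bar>fst p - snd p\<bar> < ?M}"
  have N[measurable]: "N \<in> sets (lborel \<Otimes>\<^sub>M lborel)" unfolding N_def by (rule near_diagonal_measurable)
  define F where "F = - N"
  have F[measurable]: "F \<in> sets (lborel \<Otimes>\<^sub>M lborel)"
    using sets.compl_sets[OF N] by (simp add: F_def space_pair_measure Compl_eq_Diff_UNIV)
  let ?ip = "\<lambda>p. inner_product w v (fst p) (snd p)"
  have "(\<integral>y. time_integral w UNIV y * cnj (time_integral v UNIV y) \<partial>lborel) =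
      (\<integral>p. of_real (indicator (UNIV \<times> UNIV) p) * ?ip p \<partial>(lborel \<Otimes>\<^sub>M lborel))"
    by (rule time_integral_inner(2)[OF w v]) auto
  also have "\<dots> = (\<integral>p. of_real (indicator N p) * ?ip p + of_real (indicator F p) * ?ip p \<partial>(lborel \<Otimes>\<^sub>M lborel))"
    by (intro Bochner_Integration.integral_cong) (auto simp: F_def indicator_def)
  also have "\<dots> = (\<integral>p. of_real (indicator N p) * ?ip p \<partial>(lborel \<Otimes>\<^sub>M lborel)) + (\<integral>p. of_real (indicator F p) * ?ip p \<partial>(lborel \<Otimes>\<^sub>M lborel))"
    by (intro Bochner_Integration.integral_add time_field_double_integral(3)[OF w v] N F)
  finally have "cmod (\<integral>y. time_integral w UNIV y * cnj (time_integral v UNIV y) \<partial>lborel) \<le>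
     cmod (\<integral>p. of_real (indicator N p) * ?ip p \<partial>(lborel \<Otimes>\<^sub>M lborel)) + cmod (\<integral>p. of_real (indicator F p) * ?ip p \<partial>(lborel \<Otimes>\<^sub>M lborel))"
    by (simp only: norm_triangle_ineq)
  moreover have "cmod (\<integral>p. of_real (indicator N p) * ?ip p \<partial>(lborel \<Otimes>\<^sub>M lborel)) \<le> 6 * C * \<rho> * (\<rho>^4 * R)\<^sup>2 * \<Phi> + \<rho> * R\<^sup>2 * \<Psi> / 2"
    unfolding N_def by (rule near_interaction[OF rho(1) R _ w v meas ww vv Phi Psi nn]) (use C in auto)
  moreover have "cmod (\<integral>p. of_real (indicator F p) * ?ip p \<partial>(lborel \<Otimes>\<^sub>M lborel)) \<le> 2 * C * \<rho> * ((\<rho>^4 * R)\<^sup>2 * \<Phi> + R\<^sup>2 * \<Psi>)"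
  proof -
    have "ennreal (cmod (\<integral>p. of_real (indicator F p) * ?ip p \<partial>(lborel \<Otimes>\<^sub>M lborel))) \<le> (\<integral>\<^sup>+t. \<integral>\<^sup>+s. indicator F (t, s) * ennreal (cmod (inner_product w v t s)) \<partial>lborel \<partial>lborel)"
      using time_field_double_integral(4,5)[OF w v F] by simp
    also have "\<dots> \<le> (\<integral>\<^sup>+t. \<integral>\<^sup>+s. indicator {?M..} \<bar>t - s\<bar> * ennreal (C * decay (\<rho>^4 * R\<^sup>2) (t - s) * \<phi> t * \<psi> s) \<partial>lborel \<partial>lborel)"
      using wv by (intro nn_integral_mono mult_mono ennreal_leI) (auto simp: F_def N_def indicator_def)
    also have "\<dots> \<le> ennreal (2 * C * \<rho> * ((\<rho>^4 * R)\<^sup>2 * \<Phi> + R\<^sup>2 * \<Psi>))"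
      using C by (intro far_interaction rho R meas Phi Psi nn) auto
    finally show ?thesis using C rho nn by (subst (asm) ennreal_le_iff) auto
  qed
  moreover have "6 * C * \<rho> * (\<rho>^4 * R)\<^sup>2 * \<Phi> + \<rho> * R\<^sup>2 * \<Psi> / 2 \<le> 6 * C * \<rho> * ((\<rho>^4 * R)\<^sup>2 * \<Phi> + R\<^sup>2 * \<Psi>)"
  proof -
    have "1 / 2 * (\<rho> * R\<^sup>2 * \<Psi>) \<le> 6 * C * (\<rho> * R\<^sup>2 * \<Psi>)"
      using C rho nn by (intro mult_right_mono) auto
    then show ?thesis by (simp add: distrib_left mult.assoc)
  qed
  ultimately show ?thesis by (simp add: algebra_simps)
qed

lemma sum_geometric_distance_le:
  fixes x :: real
  assumes x: "0 < x" "x < 1" and K: "finite K"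
  shows "(\<Sum>l\<in>K. x ^ nat \<bar>k - l\<bar>) \<le> 2 / (1 - x)"
proof -
  have half: "(\<Sum>l\<in>L. x ^ f l) \<le> 1 / (1 - x)" if "finite L" "inj_on f L" for L :: "int set" and f
  proof -
    have "(\<Sum>l\<in>L. x ^ f l) = (\<Sum>n\<in>f ` L. x ^ n)" using that by (simp add: sum.reindex)
    also have "\<dots> \<le> (\<Sum>n. x ^ n)" using that x by (intro sum_le_suminf summable_geometric) auto
    also have "\<dots> = 1 / (1 - x)" using x by (intro suminf_geometric) auto
    finally show ?thesis .
  qed
  have "(\<Sum>l\<in>K. x ^ nat \<bar>k - l\<bar>) = (\<Sum>l\<in>{l\<in>K. l \<le> k}. x ^ nat \<bar>k - l\<bar>) + (\<Sum>l\<in>{l\<in>K. \<not> l \<le> k}. x ^ nat \<bar>k - l\<bar>)"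
    using K by (subst sum.union_disjoint[symmetric]) (auto intro!: sum.cong)
  also have "\<dots> \<le> 1 / (1 - x) + 1 / (1 - x)"
    using K by (intro add_mono half) (auto simp: inj_on_def)
  finally show ?thesis by simp
qed

text \<open>With \<open>\<rho> = 2^(-|k - l|/4)\<close> the inner products of the superpositions at
  scales \<open>2^k\<close> and \<open>2^l\<close> are smaller than the natural size by a geometric factor in \<open>|k - l|\<close>, so the double sum over the scales
  is bounded by its diagonal, independently of how many scales occur.\<close>

theorem dyadic_almost_orthogonality:
  fixes w :: "int \<Rightarrow> real \<Rightarrow> 'a::euclidean_space \<Rightarrow> complex" and \<phi> :: "int \<Rightarrow> real \<Rightarrow> real" and \<Phi> :: "int \<Rightarrow> real"
  assumes K: "finite K" and C: "C \<ge> 1"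
    and w: "\<And>k. time_field (w k)" and meas: "\<And>k. \<phi> k \<in> borel_measurable borel"
    and ip: "\<And>k l t s. cmod (inner_product (w k) (w l) t s) \<le> C * decay (2 powr k * 2 powr l) (t - s) * \<phi> k t * \<phi> l s"
    and ww: "\<And>k s. (\<integral>\<^sup>+y. ennreal ((cmod (w k s y))\<^sup>2) \<partial>lborel) \<le> ennreal ((\<phi> k s)\<^sup>2)"
    and Phi: "\<And>k. (\<integral>\<^sup>+t. ennreal ((\<phi> k t)\<^sup>2) \<partial>lborel) \<le> ennreal (\<Phi> k)" and nn: "\<And>k. \<Phi> k \<ge> 0"
  shows "(\<integral>\<^sup>+y. ennreal ((cmod (\<Sum>k\<in>K. time_integral (w k) UNIV y))\<^sup>2) \<partial>lborel)
    \<le> ennreal (32 * C / (1 - 2 powr (- (1 / 4))) * (\<Sum>k\<in>K. (2 powr k)\<^sup>2 * \<Phi> k))"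
proof -
  \<comment> \<open>The ratio \<open>2^(-1/4)\<close>, so that \<open>x^(4 (l - k))\<close> is the quotient of the scales.\<close>
  define x :: real where "x = 2 powr (- (1 / 4))"
  have x01: "0 < x" "x < 1"
    using powr_less_mono[of "- (1 / 4)" 0 "2::real"] by (auto simp: x_def)
  have "x ^ 4 = x powr 4" using x01 by simp
  also have "\<dots> = 2 powr (- (1 / 4) * 4)" unfolding x_def powr_powr ..
  also have "\<dots> = 1 / 2" by (simp add: powr_minus_divide)
  finally have x: "0 < x" "x < 1" "x ^ 4 = 1 / 2" using x01 by auto
  define V where "V k = time_integral (w k) UNIV" for k
  define A where "A k = (2 powr k)\<^sup>2 * \<Phi> k" for k
  have pw: "2 powr k = (x ^ nat (l - k)) ^ 4 * 2 powr l" if "k \<le> l" for k l :: int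
  proof -
    have "(x ^ nat (l - k)) ^ 4 = (1 / 2) ^ nat (l - k)" unfolding x(3)[symmetric] by (simp only: power_mult[symmetric] mult.commute)
    also have "\<dots> = 2 powr (- real (nat (l - k)))" by (simp add: powr_minus_divide powr_realpow power_one_over)
    also have "\<dots> = 2 powr (k - l)" using that by simp
    finally show ?thesis by (simp flip: powr_add)
  qed
  have le: "cmod (\<integral>y. V k y * cnj (V l y) \<partial>lborel) \<le> 8 * C * x ^ nat \<bar>k - l\<bar> * (A k + A l)" if "k \<le> l" for k l
  proof -
    let ?r = "x ^ nat (l - k)"
    have pr: "2 powr k * 2 powr l = ?r ^ 4 * (2 powr l)\<^sup>2" "2 powr k * 2 powr k = (?r ^ 4 * 2 powr l)\<^sup>2"
      unfolding pw[OF that] by (simp_all add: power2_eq_square)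
    have "cmod (\<integral>y. V k y * cnj (V l y) \<partial>lborel) \<le> 8 * C * ?r * ((?r ^ 4 * 2 powr l)\<^sup>2 * \<Phi> k + (2 powr l)\<^sup>2 * \<Phi> l)"
      unfolding V_def
    proof (rule almost_orthogonal_pair[OF _ _ _ C w w meas meas _ _ ww Phi Phi nn nn])
      show "cmod (inner_product (w k) (w k) t s) \<le> C * decay ((?r ^ 4 * 2 powr l)\<^sup>2) (t - s) * \<phi> k t * \<phi> k s" for t s
        using ip[of k k t s] unfolding pr .
      show "cmod (inner_product (w k) (w l) t s) \<le> C * decay (?r ^ 4 * (2 powr l)\<^sup>2) (t - s) * \<phi> k t * \<phi> l s" for t s
        using ip[of k l t s] unfolding pr .
    qed (use x in \<open>auto intro: power_le_one\<close>)
    moreover have "nat \<bar>k - l\<bar> = nat (l - k)" using that by simp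
    ultimately show ?thesis unfolding A_def pw[OF that, symmetric] by (simp only:)
  qed
  have bound: "cmod (\<integral>y. V k y * cnj (V l y) \<partial>lborel) \<le> 8 * C * x ^ nat \<bar>k - l\<bar> * (A k + A l)" for k l
  proof (cases "k \<le> l")
    case False
    have "(\<integral>y. V k y * cnj (V l y) \<partial>lborel) = cnj (\<integral>y. V l y * cnj (V k y) \<partial>lborel)"
      by (simp add: mult.commute flip: Bochner_Integration.integral_cnj)
    then show ?thesis using le[of l k] False by (simp add: abs_minus_commute add.commute)
  qed (use le in auto)
  have int: "integrable lborel (\<lambda>y. V k y * cnj (V l y))" for k l
    unfolding V_def by (rule time_integral_inner(1)[OF w w]) auto
  let ?S = "\<lambda>y. \<Sum>k\<in>K. V k y"
  have exp: "?S y * cnj (?S y) = (\<Sum>k\<in>K. \<Sum>l\<in>K. V k y * cnj (V l y))" for y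
    by (simp add: sum_product)
  have intS: "integrable lborel (\<lambda>y. ?S y * cnj (?S y))" unfolding exp using int by auto
  have int2: "integrable lborel (\<lambda>y. (cmod (?S y))\<^sup>2)"
    using integrable_norm[OF intS] by (simp only: norm_mult complex_mod_cnj power2_eq_square)
  have "of_real (\<integral>y. (cmod (?S y))\<^sup>2 \<partial>lborel) = (\<integral>y. ?S y * cnj (?S y) \<partial>lborel)"
    by (simp only: complex_norm_square[symmetric] integral_complex_of_real)
  also have "\<dots> = (\<Sum>k\<in>K. \<Sum>l\<in>K. \<integral>y. V k y * cnj (V l y) \<partial>lborel)"
    unfolding exp using int by (subst Bochner_Integration.integral_sum; auto)+
  finally have "cmod (of_real (\<integral>y. (cmod (?S y))\<^sup>2 \<partial>lborel)) = cmod (\<Sum>k\<in>K. \<Sum>l\<in>K. \<integral>y. V k y * cnj (V l y) \<partial>lborel)"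
    by (simp only:)
  then have "(\<integral>y. (cmod (?S y))\<^sup>2 \<partial>lborel) = cmod (\<Sum>k\<in>K. \<Sum>l\<in>K. \<integral>y. V k y * cnj (V l y) \<partial>lborel)"
    by (simp add: integral_nonneg_AE)
  also have "\<dots> \<le> (\<Sum>k\<in>K. \<Sum>l\<in>K. 8 * C * x ^ nat \<bar>k - l\<bar> * (A k + A l))"
    by (intro sum_norm_le bound)
  also have "\<dots> = (\<Sum>k\<in>K. \<Sum>l\<in>K. 8 * C * A k * x ^ nat \<bar>k - l\<bar>) + (\<Sum>k\<in>K. \<Sum>l\<in>K. 8 * C * A l * x ^ nat \<bar>k - l\<bar>)"
    by (simp add: sum.distrib[symmetric] algebra_simps)
  also have "(\<Sum>k\<in>K. \<Sum>l\<in>K. 8 * C * A l * x ^ nat \<bar>k - l\<bar>) = (\<Sum>k\<in>K. \<Sum>l\<in>K. 8 * C * A k * x ^ nat \<bar>k - l\<bar>)"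
    by (subst sum.swap) (simp add: abs_minus_commute)
  also have "(\<Sum>k\<in>K. \<Sum>l\<in>K. 8 * C * A k * x ^ nat \<bar>k - l\<bar>) + (\<Sum>k\<in>K. \<Sum>l\<in>K. 8 * C * A k * x ^ nat \<bar>k - l\<bar>)
      = 2 * (\<Sum>k\<in>K. 8 * C * A k * (\<Sum>l\<in>K. x ^ nat \<bar>k - l\<bar>))"
    by (simp add: sum_distrib_left)
  also have "\<dots> \<le> 2 * (\<Sum>k\<in>K. 8 * C * A k * (2 / (1 - x)))"
    using C nn x K by (intro mult_left_mono sum_mono sum_geometric_distance_le) (auto simp: A_def)
  also have "(\<Sum>k\<in>K. 8 * C * A k * (2 / (1 - x))) = 16 * C / (1 - x) * (\<Sum>k\<in>K. A k)"
    unfolding sum_distrib_left by (rule sum.cong) simp_all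
  also have "2 * (16 * C / (1 - x) * (\<Sum>k\<in>K. A k)) = 32 * C / (1 - x) * (\<Sum>k\<in>K. A k)" by simp
  finally show ?thesis
    using int2 unfolding V_def A_def x_def by (subst nn_integral_eq_integral) (auto intro: ennreal_leI)
qed

text \<open>The diagonal \<open>t = s\<close>, where the assumed bound is void because \<open>0 powr a = 0\<close>, is a null set.\<close>

theorem hls_time_integral:
  fixes w :: "real \<Rightarrow> 'a::euclidean_space \<Rightarrow> complex"
  assumes q: "q > 2" and p: "p = q / (q - 1)" and C: "C \<ge> 0" and w: "time_field w"
    and [measurable]: "\<phi> \<in> borel_measurable borel" and nn: "\<And>t. \<phi> t \<ge> 0"
    and ip: "\<And>t s. t \<noteq> s \<Longrightarrow> cmod (inner_product w w t s) \<le> C * (\<phi> t * \<phi> s * \<bar>s - t\<bar> powr (- (2 / q)))"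
    and X: "X > 0" "(\<integral>\<^sup>+t. ennreal (\<phi> t powr p) \<partial>lborel) \<le> ennreal X"
  shows "(\<integral>\<^sup>+y. ennreal ((cmod (time_integral w UNIV y))\<^sup>2) \<partial>lborel) \<le> ennreal (C * (2 * (2 / (1 - 2 / q) + 3) * X powr (2 / p)))"
proof -
  have "(\<integral>\<^sup>+y. ennreal ((cmod (time_integral w UNIV y))\<^sup>2) \<partial>lborel) \<le> (\<integral>\<^sup>+t. \<integral>\<^sup>+s. indicator (UNIV \<times> UNIV) (t, s) * ennreal (cmod (inner_product w w t s)) \<partial>lborel \<partial>lborel)"
    by (rule time_integral_norm(2)[OF w]) auto
  also have "\<dots> \<le> (\<integral>\<^sup>+t. \<integral>\<^sup>+s. ennreal C * ennreal (\<phi> t * \<phi> s * \<bar>s - t\<bar> powr (- (2 / q))) \<partial>lborel \<partial>lborel)"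
  proof (rule nn_integral_mono)
    fix t :: real
    have "AE s in lborel. s \<noteq> t" by (rule AE_lborel_singleton)
    then have "AE s in lborel. indicator (UNIV \<times> UNIV) (t, s) * ennreal (cmod (inner_product w w t s)) \<le> ennreal C * ennreal (\<phi> t * \<phi> s * \<bar>s - t\<bar> powr (- (2 / q)))"
    proof eventually_elim
      case (elim s)
      then show ?case using ip[of t s] C nn by (simp add: ennreal_mult[symmetric])
    qed
    then show "(\<integral>\<^sup>+s. indicator (UNIV \<times> UNIV) (t, s) * ennreal (cmod (inner_product w w t s)) \<partial>lborel) \<le> (\<integral>\<^sup>+s. ennreal C * ennreal (\<phi> t * \<phi> s * \<bar>s - t\<bar> powr (- (2 / q))) \<partial>lborel)"
      by (rule nn_integral_mono_AE)
  qed
  also have "\<dots> = ennreal C * (\<integral>\<^sup>+t. \<integral>\<^sup>+s. ennreal (\<phi> t * \<phi> s * \<bar>s - t\<bar> powr (- (2 / q))) \<partial>lborel \<partial>lborel)"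
    by (simp add: nn_integral_cmult)
  also have "\<dots> \<le> ennreal C * ennreal (2 * (2 / (1 - 2 / q) + 3) * X powr (2 / p))"
    by (intro mult_left_mono hardy_littlewood_sobolev_diagonal[OF q p _ nn X]) auto
  also have "\<dots> = ennreal (C * (2 * (2 / (1 - 2 / q) + 3) * X powr (2 / p)))"
    using C q by (intro ennreal_mult[symmetric]) auto
  finally show ?thesis .
qed

section \<open>Duality for the regularised evolution\<close>

abbreviation ctime :: "real \<Rightarrow> real \<Rightarrow> complex"
  where "ctime e t \<equiv> of_real e + \<i> * of_real t"

lemma integral_norm_heat_kernel_power2_le:
  assumes z: "Re z > 0"
  shows "(\<integral>x. (cmod (heat_kernel z (x::'a::euclidean_space)))\<^sup>2 \<partial>lborel) \<le> 1 / sqrt (4 * pi * Re z) ^ DIM('a)"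
proof -
  let ?d = "DIM('a)"
  have z0: "cmod z > 0" using z by auto
  have "(\<integral>(x::'a). (cmod (heat_kernel z x))\<^sup>2 \<partial>lborel) \<le> (\<integral>(x::'a). 1 / sqrt (4 * pi * cmod z) ^ ?d * cmod (heat_kernel z x) \<partial>lborel)"
  proof (rule integral_mono)
    fix x :: 'a
    show "(cmod (heat_kernel z x))\<^sup>2 \<le> 1 / sqrt (4 * pi * cmod z) ^ ?d * cmod (heat_kernel z x)"
      unfolding power2_eq_square by (intro mult_right_mono heat_kernel_bounded z) auto
  qed (auto intro!: integrable_power2_heat_kernel integrable_norm_heat_kernel z)
  also have "\<dots> = 1 / sqrt (4 * pi * cmod z) ^ ?d * (\<integral>(x::'a). cmod (heat_kernel z x) \<partial>lborel)"
    by simp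
  also have "(\<integral>(x::'a). cmod (heat_kernel z x) \<partial>lborel) = sqrt (pi / (Re z / (4 * (cmod z)\<^sup>2))) ^ ?d / sqrt (4 * pi * cmod z) ^ ?d"
  proof -
    have "Re z / (4 * (cmod z)\<^sup>2) > 0" using z z0 by simp
    from integral_gaussian[OF this, where 'a='a] show ?thesis unfolding norm_heat_kernel by simp
  qed
  also have "1 / sqrt (4 * pi * cmod z) ^ ?d * (sqrt (pi / (Re z / (4 * (cmod z)\<^sup>2))) ^ ?d / sqrt (4 * pi * cmod z) ^ ?d) =
     (sqrt (pi / (Re z / (4 * (cmod z)\<^sup>2))) / (sqrt (4 * pi * cmod z) * sqrt (4 * pi * cmod z))) ^ ?d"
    by (simp only: power_divide power_mult_distrib) simp
  also have "sqrt (pi / (Re z / (4 * (cmod z)\<^sup>2))) / (sqrt (4 * pi * cmod z) * sqrt (4 * pi * cmod z)) = 1 / sqrt (4 * pi * Re z)"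
  proof -
    have "sqrt (pi / (Re z / (4 * (cmod z)\<^sup>2))) = 2 * cmod z * sqrt pi / sqrt (Re z)"
      using z0 by (simp add: real_sqrt_mult real_sqrt_divide)
    moreover have "sqrt (4 * pi * cmod z) * sqrt (4 * pi * cmod z) = 4 * cmod z * (sqrt pi * sqrt pi)"
      using z0 by simp
    ultimately show ?thesis using z z0 by (simp add: real_sqrt_mult field_simps)
  qed
  finally show ?thesis by (simp add: power_divide)
qed

text \<open>Cauchy--Schwarz against the square integrable kernel. The bound degenerates as
  \<open>Re z\<close> tends to zero and serves only to justify integrability and truncations.\<close>

lemma propagate_L2_bounded:
  fixes f :: "'a::euclidean_space \<Rightarrow> complex"
  assumes z: "Re z > 0" and [measurable]: "f \<in> borel_measurable borel" and f2: "integrable lborel (\<lambda>x. (cmod (f x))\<^sup>2)"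
  shows "integrable lborel (\<lambda>y. f y * heat_kernel z (x - y))"
    and "(\<integral>y. cmod (f y) * cmod (heat_kernel z (x - y)) \<partial>lborel) \<le> sqrt (\<integral>x. (cmod (f x))\<^sup>2 \<partial>lborel) * sqrt (1 / sqrt (4 * pi * Re z) ^ DIM('a))"
    and "cmod (propagate z f x) \<le> sqrt (\<integral>x. (cmod (f x))\<^sup>2 \<partial>lborel) * sqrt (1 / sqrt (4 * pi * Re z) ^ DIM('a))"
proof -
  have h2: "integrable lborel (\<lambda>y. (cmod (heat_kernel z (x - y)))\<^sup>2)"
    by (rule integrable_heat_kernel_shift[OF z])
  have "(\<integral>y. (cmod (heat_kernel z (x - y)))\<^sup>2 \<partial>lborel) = (\<integral>y. (cmod (heat_kernel z (- x + y)))\<^sup>2 \<partial>lborel)"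
    by (simp add: heat_kernel_minus[of z x])
  also have "\<dots> = (\<integral>(y::'a). (cmod (heat_kernel z y))\<^sup>2 \<partial>lborel)"
    by (rule integral_translate) simp
  also have "\<dots> \<le> 1 / sqrt (4 * pi * Re z) ^ DIM('a)" by (rule integral_norm_heat_kernel_power2_le[OF z])
  finally have le: "sqrt (\<integral>x. (cmod (f x))\<^sup>2 \<partial>lborel) * sqrt (\<integral>y. (cmod (heat_kernel z (x - y)))\<^sup>2 \<partial>lborel) \<le>
      sqrt (\<integral>x. (cmod (f x))\<^sup>2 \<partial>lborel) * sqrt (1 / sqrt (4 * pi * Re z) ^ DIM('a))"
    by (intro mult_left_mono real_sqrt_le_mono) (auto intro!: integral_nonneg_AE)
  note cs = cauchy_schwarz_integral[OF _ _ f2 h2]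
  show "integrable lborel (\<lambda>y. f y * heat_kernel z (x - y))" by (rule cs(1)) auto
  show "(\<integral>y. cmod (f y) * cmod (heat_kernel z (x - y)) \<partial>lborel) \<le> sqrt (\<integral>x. (cmod (f x))\<^sup>2 \<partial>lborel) * sqrt (1 / sqrt (4 * pi * Re z) ^ DIM('a))"
    by (rule order_trans[OF cs(2) le]) auto
  show "cmod (propagate z f x) \<le> sqrt (\<integral>x. (cmod (f x))\<^sup>2 \<partial>lborel) * sqrt (1 / sqrt (4 * pi * Re z) ^ DIM('a))"
    unfolding propagate_def by (rule order_trans[OF cs(3) le]) auto
qed

text \<open>The class of dual functions \<open>\<Phi>\<close>: truncations of the evolution are bounded with bounded support, which makes all
  norms of \<open>\<Phi>\<close> finite.\<close>

definition bounded_support :: "(real \<Rightarrow> 'a::euclidean_space \<Rightarrow> complex) \<Rightarrow> bool"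
  where "bounded_support \<Phi> \<longleftrightarrow> (\<lambda>(t, x). \<Phi> t x) \<in> borel_measurable (lborel \<Otimes>\<^sub>M lborel) \<and>
    (\<exists>M m. \<forall>t x. cmod (\<Phi> t x) \<le> M \<and> (m < \<bar>t\<bar> \<or> m < norm x \<longrightarrow> \<Phi> t x = 0))"

lemma bounded_supportE:
  assumes "bounded_support \<Phi>"
  obtains M m where "M > 0" "m > 0" "\<And>t x. cmod (\<Phi> t x) \<le> M" "\<And>t x. m < \<bar>t\<bar> \<Longrightarrow> \<Phi> t x = 0" "\<And>t x. m < norm x \<Longrightarrow> \<Phi> t x = 0"
proof -
  obtain M m where *: "\<And>t x. cmod (\<Phi> t x) \<le> M" "\<And>t x. m < \<bar>t\<bar> \<or> m < norm x \<Longrightarrow> \<Phi> t x = 0"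
    using assms unfolding bounded_support_def by blast
  show ?thesis
  proof (rule that[of "max M 1" "max m 1"])
    show "cmod (\<Phi> t x) \<le> max M 1" for t x using *(1)[of t x] by simp
  qed (use *(2) in auto)
qed

lemma bounded_support_measurable':
  assumes "bounded_support w" "f \<in> borel_measurable M" "g \<in> borel_measurable M"
  shows "(\<lambda>x. w (f x) (g x)) \<in> borel_measurable M"
proof -
  have [measurable]: "f \<in> M \<rightarrow>\<^sub>M lborel" "g \<in> M \<rightarrow>\<^sub>M lborel" using assms by auto
  have "(\<lambda>(t, y). w t y) \<in> borel_measurable (lborel \<Otimes>\<^sub>M lborel)" using assms by (simp add: bounded_support_def)
  then have "(\<lambda>x. (\<lambda>(t, y). w t y) (f x, g x)) \<in> borel_measurable M"
    by (rule measurable_compose[rotated]) measurable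
  then show ?thesis by simp
qed

lemma integrable_bounded_cball:
  fixes g :: "'a::euclidean_space \<Rightarrow> 'b::{banach, second_countable_topology}"
  assumes [measurable]: "g \<in> borel_measurable borel" and M: "\<And>x. norm (g x) \<le> M" and m: "\<And>x. m < norm x \<Longrightarrow> g x = 0"
  shows "integrable lborel g"
proof (rule Bochner_Integration.integrable_bound)
  have "emeasure lborel (cball (0::'a) m) < \<infinity>" by (intro emeasure_bounded_finite) auto
  then show "integrable lborel (\<lambda>x. M * indicator (cball (0::'a) m) x)"
    by (intro integrable_mult_right integrable_real_indicator) auto
  show "AE x in lborel. norm (g x) \<le> norm (M * indicator (cball (0::'a) m) x)"
  proof (rule AE_I2)
    fix x show "norm (g x) \<le> norm (M * indicator (cball (0::'a) m) x)"
      using M[of x] m[of x] by (cases "norm x \<le> m") auto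
  qed
qed simp

lemma bounded_support_integrable:
  assumes "bounded_support \<Phi>"
  shows "integrable lborel (\<Phi> t)" and "integrable lborel (\<lambda>x. (cmod (\<Phi> t x))\<^sup>2)"
proof -
  note [measurable (raw)] = bounded_support_measurable'[OF assms]
  obtain M m where M: "M > 0" "m > 0" "\<And>t x. cmod (\<Phi> t x) \<le> M" "\<And>t x. m < \<bar>t\<bar> \<Longrightarrow> \<Phi> t x = 0" "\<And>t x. m < norm x \<Longrightarrow> \<Phi> t x = 0"
    using bounded_supportE[OF assms] by metis
  show "integrable lborel (\<Phi> t)"
    by (rule integrable_bounded_cball[where M=M and m=m]) (use M in \<open>simp_all, measurable\<close>)
  show "integrable lborel (\<lambda>x. (cmod (\<Phi> t x))\<^sup>2)"
    by (rule integrable_bounded_cball[where M="M\<^sup>2" and m=m]) (use M in \<open>simp_all add: power_mono, measurable\<close>)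
qed

definition slice_norm :: "(real \<Rightarrow> 'a::euclidean_space \<Rightarrow> complex) \<Rightarrow> real \<Rightarrow> real"
  where "slice_norm \<Phi> t = sqrt (\<integral>x. (cmod (\<Phi> t x))\<^sup>2 \<partial>lborel)"

lemma slice_norm_nonneg: "slice_norm \<Phi> t \<ge> 0"
  by (auto simp: slice_norm_def intro!: integral_nonneg_AE)

lemma slice_norm_power2: "(slice_norm \<Phi> t)\<^sup>2 = (\<integral>x. (cmod (\<Phi> t x))\<^sup>2 \<partial>lborel)"
  by (simp add: slice_norm_def integral_nonneg_AE)

lemma slice_norm_measurable:
  assumes "bounded_support \<Phi>"
  shows "slice_norm \<Phi> \<in> borel_measurable borel"
proof -
  note [measurable (raw)] = bounded_support_measurable'[OF assms]
  show ?thesis unfolding slice_norm_def by measurable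
qed

lemma nn_integral_slice_norm:
  assumes "bounded_support \<Phi>"
  shows "(\<integral>\<^sup>+x. ennreal ((cmod (\<Phi> t x))\<^sup>2) \<partial>lborel) = ennreal ((slice_norm \<Phi> t)\<^sup>2)"
  unfolding slice_norm_power2 using bounded_support_integrable(2)[OF assms] by (intro nn_integral_eq_integral) auto

lemma nn_integral_bounded_support_finite:
  assumes "bounded_support (\<Phi> :: real \<Rightarrow> 'a::euclidean_space \<Rightarrow> complex)" and that: "a > 0"
  shows "(\<integral>\<^sup>+t. \<integral>\<^sup>+x. ennreal ((cmod (\<Phi> t x)) powr a) \<partial>lborel \<partial>lborel) < \<infinity>"
proof -
  obtain M m where M: "M > 0" "m > 0" "\<And>t x. cmod (\<Phi> t x) \<le> M" "\<And>t x. m < \<bar>t\<bar> \<Longrightarrow> \<Phi> t x = 0" "\<And>t x. m < norm x \<Longrightarrow> \<Phi> t x = 0"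
    using bounded_supportE[OF assms(1)] by metis
  have "(\<integral>\<^sup>+t. \<integral>\<^sup>+x. ennreal ((cmod (\<Phi> t x)) powr a) \<partial>lborel \<partial>lborel) \<le> (\<integral>\<^sup>+t. \<integral>\<^sup>+x. ennreal (M powr a) * indicator {-m..m} t * indicator (cball (0::'a) m) x \<partial>lborel \<partial>lborel)"
  proof (intro nn_integral_mono)
    fix t x
    show "ennreal ((cmod (\<Phi> t x)) powr a) \<le> ennreal (M powr a) * indicator {-m..m} t * indicator (cball (0::'a) m) x"
    proof (cases "\<bar>t\<bar> \<le> m \<and> norm x \<le> m")
      case True
      then show ?thesis using M(1,3) that by (auto simp: abs_le_iff intro!: ennreal_leI powr_mono2)
    next
      case False
      then have "\<Phi> t x = 0" using M(4)[of t x] M(5)[of x t] by linarith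
      then show ?thesis by simp
    qed
  qed
  also have "\<dots> = ennreal (M powr a) * ennreal (2 * m) * emeasure lborel (cball (0::'a) m)"
  proof -
    have "(\<integral>\<^sup>+t. \<integral>\<^sup>+x. ennreal (M powr a) * indicator {-m..m} t * indicator (cball (0::'a) m) x \<partial>lborel \<partial>lborel) =
        (\<integral>\<^sup>+t. (ennreal (M powr a) * emeasure lborel (cball (0::'a) m)) * indicator {-m..m} t \<partial>lborel)"
      by (intro nn_integral_cong, subst nn_integral_cmult_indicator) (auto simp: mult_ac)
    also have "\<dots> = (ennreal (M powr a) * emeasure lborel (cball (0::'a) m)) * ennreal (2 * m)"
      using M(2) by (subst nn_integral_cmult_indicator) auto
    finally show ?thesis by (simp only: mult_ac)
  qed
  also have "\<dots> < \<infinity>"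
    using emeasure_bounded_finite[of "cball (0::'a) m"] by (auto simp: ennreal_mult_less_top)
  finally show ?thesis .
qed

text \<open>The adjoint evolution: \<open>\<Phi> t\<close> is carried from time \<open>t\<close> back to time zero.\<close>

definition back_propagate :: "real \<Rightarrow> (real \<Rightarrow> 'a::euclidean_space \<Rightarrow> complex) \<Rightarrow> real \<Rightarrow> 'a \<Rightarrow> complex"
  where "back_propagate e \<Phi> t y = (\<integral>x. \<Phi> t x * cnj (heat_kernel (ctime e t) (x - y)) \<partial>lborel)"

lemma back_propagate_cnj: "back_propagate e \<Phi> t y = cnj (propagate (ctime e t) (\<lambda>x. cnj (\<Phi> t x)) y)"
  unfolding back_propagate_def propagate_def
  by (simp add: heat_kernel_minus[of _ y] flip: Bochner_Integration.integral_cnj)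

lemma back_propagate_L2:
  assumes e: "e > 0" and Phi: "bounded_support \<Phi>"
  shows "(\<integral>\<^sup>+y. ennreal ((cmod (back_propagate e \<Phi> t y))\<^sup>2) \<partial>lborel) \<le> ennreal ((slice_norm \<Phi> t)\<^sup>2)"
    and "integrable lborel (\<lambda>y. (cmod (back_propagate e \<Phi> t y))\<^sup>2)"
proof -
  have "Re (ctime e t) > 0" using e by simp
  note L = propagate_L2[OF this, of "\<lambda>x. cnj (\<Phi> t x)"]
  note I = bounded_support_integrable[OF Phi, of t]
  show int: "integrable lborel (\<lambda>y. (cmod (back_propagate e \<Phi> t y))\<^sup>2)"
    unfolding back_propagate_cnj using L(1) I by simp
  show "(\<integral>\<^sup>+y. ennreal ((cmod (back_propagate e \<Phi> t y))\<^sup>2) \<partial>lborel) \<le> ennreal ((slice_norm \<Phi> t)\<^sup>2)"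
    using int L(2) I unfolding slice_norm_power2 back_propagate_cnj by (subst nn_integral_eq_integral) (auto intro: ennreal_leI)
qed

lemma back_propagate_time_field:
  assumes e: "e > 0" and Phi: "bounded_support \<Phi>"
  shows "time_field (back_propagate e \<Phi>)"
  unfolding time_field_def
proof (intro conjI)
  note [measurable (raw)] = bounded_support_measurable'[OF Phi]
  note [measurable] = slice_norm_measurable[OF Phi]
  show "(\<lambda>(t, y). back_propagate e \<Phi> t y) \<in> borel_measurable (lborel \<Otimes>\<^sub>M lborel)"
    unfolding back_propagate_def by measurable
  obtain M m where M: "M > 0" "m > 0" "\<And>t x. cmod (\<Phi> t x) \<le> M" "\<And>t x. m < \<bar>t\<bar> \<Longrightarrow> \<Phi> t x = 0" "\<And>t x. m < norm x \<Longrightarrow> \<Phi> t x = 0"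
    using bounded_supportE[OF Phi] by metis
  show "\<exists>m. \<forall>t y. m < \<bar>t\<bar> \<longrightarrow> back_propagate e \<Phi> t y = 0"
    by (intro exI[of _ m] allI impI) (simp add: back_propagate_def M(4))
  have "(\<integral>\<^sup>+t. \<integral>\<^sup>+y. ennreal ((cmod (back_propagate e \<Phi> t y))\<^sup>2) \<partial>lborel \<partial>lborel) \<le> (\<integral>\<^sup>+t. ennreal ((slice_norm \<Phi> t)\<^sup>2) \<partial>lborel)"
    by (intro nn_integral_mono back_propagate_L2 e Phi)
  also have "\<dots> = (\<integral>\<^sup>+t. \<integral>\<^sup>+x. ennreal ((cmod (\<Phi> t x)) powr 2) \<partial>lborel \<partial>lborel)"
    by (simp add: nn_integral_slice_norm[OF Phi, symmetric])
  also have "\<dots> < \<infinity>" by (rule nn_integral_bounded_support_finite[OF Phi]) simp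
  finally show "(\<integral>\<^sup>+t. \<integral>\<^sup>+y. ennreal ((cmod (back_propagate e \<Phi> t y))\<^sup>2) \<partial>lborel \<partial>lborel) < \<infinity>" .
qed

text \<open>By \<open>propagate_pairing\<close> the two back-propagations combine into one propagation over \<open>2 \<epsilon> + i (s - t)\<close>;
  the second bound is the contraction of \<open>L\<^sup>2\<close>.\<close>

lemma back_propagate_inner:
  fixes \<Phi> \<Psi> :: "real \<Rightarrow> 'a::euclidean_space \<Rightarrow> complex"
  assumes e: "e > 0" and Phi: "bounded_support \<Phi>" and Psi: "bounded_support \<Psi>"
  shows "cmod (inner_product (back_propagate e \<Phi>) (back_propagate e \<Psi>) t s) =
      cmod (\<integral>x. \<Phi> t x * propagate (ctime (2 * e) (s - t)) (\<lambda>x. cnj (\<Psi> s x)) x \<partial>lborel)"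
    and "cmod (inner_product (back_propagate e \<Phi>) (back_propagate e \<Psi>) t s) \<le> slice_norm \<Phi> t * slice_norm \<Psi> s"
proof -
  have z: "Re (ctime e t) > 0" "Re (ctime e s) > 0" using e by auto
  have zz: "cnj (ctime e t) + ctime e s = ctime (2 * e) (s - t)" by (simp add: algebra_simps)
  show "cmod (inner_product (back_propagate e \<Phi>) (back_propagate e \<Psi>) t s) =
      cmod (\<integral>x. \<Phi> t x * propagate (ctime (2 * e) (s - t)) (\<lambda>x. cnj (\<Psi> s x)) x \<partial>lborel)"
  proof -
    obtain \<omega> where om: "cmod \<omega> = 1" and pair: "\<And>g h :: 'a \<Rightarrow> complex. integrable lborel g \<Longrightarrow> integrable lborel h \<Longrightarrow>
      (\<integral>y. (\<integral>x. g x * cnj (heat_kernel (ctime e t) (x - y)) \<partial>lborel) * cnj (\<integral>x. h x * cnj (heat_kernel (ctime e s) (x - y)) \<partial>lborel) \<partial>lborel)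
      = \<omega> * (\<integral>x. g x * propagate (cnj (ctime e t) + ctime e s) (\<lambda>x. cnj (h x)) x \<partial>lborel)"
      using propagate_pairing[OF z] by blast
    show ?thesis
      unfolding inner_product_def back_propagate_def
        pair[OF bounded_support_integrable(1)[OF Phi] bounded_support_integrable(1)[OF Psi]] norm_mult om zz by simp
  qed
  note [measurable (raw)] = time_field_measurable'[OF back_propagate_time_field[OF e Phi]] time_field_measurable'[OF back_propagate_time_field[OF e Psi]]
  let ?a = "\<lambda>y. back_propagate e \<Phi> t y" and ?b = "\<lambda>y. cnj (back_propagate e \<Psi> s y)"
  have sq: "sqrt (\<integral>y. (cmod (back_propagate e \<Phi> t y))\<^sup>2 \<partial>lborel) \<le> slice_norm \<Phi> t" if "bounded_support \<Phi>" for \<Phi> t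
  proof -
    have "ennreal (\<integral>y. (cmod (back_propagate e \<Phi> t y))\<^sup>2 \<partial>lborel) \<le> ennreal ((slice_norm \<Phi> t)\<^sup>2)"
      using back_propagate_L2[OF e that, of t] by (subst (asm) nn_integral_eq_integral) auto
    then have "(\<integral>y. (cmod (back_propagate e \<Phi> t y))\<^sup>2 \<partial>lborel) \<le> (slice_norm \<Phi> t)\<^sup>2" by simp
    then show ?thesis using slice_norm_nonneg[of \<Phi> t] by (simp add: real_le_lsqrt integral_nonneg_AE)
  qed
  have "cmod (\<integral>y. ?a y * ?b y \<partial>lborel) \<le> sqrt (\<integral>y. (cmod (?a y))\<^sup>2 \<partial>lborel) * sqrt (\<integral>y. (cmod (?b y))\<^sup>2 \<partial>lborel)"
    using back_propagate_L2(2)[OF e Phi, of t] back_propagate_L2(2)[OF e Psi, of s]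
    by (intro cauchy_schwarz_integral(3)) (simp_all, measurable)
  also have "\<dots> \<le> slice_norm \<Phi> t * slice_norm \<Psi> s"
    using sq[OF Phi, of t] sq[OF Psi, of s] by (intro mult_mono) (auto simp: slice_norm_nonneg integral_nonneg_AE)
  finally show "cmod (inner_product (back_propagate e \<Phi>) (back_propagate e \<Psi>) t s) \<le> slice_norm \<Phi> t * slice_norm \<Psi> s"
    unfolding inner_product_def .
qed

lemma back_propagate_dispersive:
  fixes \<Phi> \<Psi> :: "real \<Rightarrow> 'a::euclidean_space \<Rightarrow> complex"
  assumes e: "e > 0" and Phi: "bounded_support \<Phi>" and Psi: "bounded_support \<Psi>" and ts: "t \<noteq> s"
  shows "cmod (inner_product (back_propagate e \<Phi>) (back_propagate e \<Psi>) t s) \<le>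
    1 / sqrt (4 * pi * \<bar>t - s\<bar>) ^ DIM('a) * ((\<integral>x. cmod (\<Phi> t x) \<partial>lborel) * (\<integral>x. cmod (\<Psi> s x) \<partial>lborel))"
proof -
  let ?z = "ctime (2 * e) (s - t)" and ?c = "1 / sqrt (4 * pi * \<bar>t - s\<bar>) ^ DIM('a)"
  have z: "Re ?z > 0" using e by simp
  have I: "integrable lborel (\<Phi> t)" "integrable lborel (\<lambda>x. cnj (\<Psi> s x))"
    using bounded_support_integrable(1)[OF Phi] bounded_support_integrable(1)[OF Psi] by auto
  have hb: "cmod (heat_kernel ?z (x::'a)) \<le> ?c" for x
    using heat_kernel_dispersive[of ?z x] e ts by (simp add: abs_minus_commute)
  have b: "cmod (propagate ?z (\<lambda>x. cnj (\<Psi> s x)) x) \<le> ?c * (\<integral>x. cmod (\<Psi> s x) \<partial>lborel)" for x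
    using propagate_bounded(1)[OF I(2) z hb, of x] by simp
  have m: "propagate ?z (\<lambda>x. cnj (\<Psi> s x)) \<in> borel_measurable lborel" using I(2) by measurable
  have int: "integrable lborel (\<lambda>x. \<Phi> t x * propagate ?z (\<lambda>x. cnj (\<Psi> s x)) x)"
    by (rule integrable_product_bounded[OF I(1) m b])
  have "cmod (\<integral>x. \<Phi> t x * propagate ?z (\<lambda>x. cnj (\<Psi> s x)) x \<partial>lborel) \<le> (\<integral>x. cmod (\<Phi> t x * propagate ?z (\<lambda>x. cnj (\<Psi> s x)) x) \<partial>lborel)"
    by (rule integral_norm_bound)
  also have "\<dots> \<le> (\<integral>x. cmod (\<Phi> t x) * (?c * (\<integral>x. cmod (\<Psi> s x) \<partial>lborel)) \<partial>lborel)"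
  proof (intro integral_mono integrable_mult_left integrable_norm int I(1))
    fix x
    show "cmod (\<Phi> t x * propagate ?z (\<lambda>x. cnj (\<Psi> s x)) x) \<le> cmod (\<Phi> t x) * (?c * (\<integral>x. cmod (\<Psi> s x) \<partial>lborel))"
      unfolding norm_mult by (intro mult_left_mono b) auto
  qed
  also have "\<dots> = ?c * ((\<integral>x. cmod (\<Phi> t x) \<partial>lborel) * (\<integral>x. cmod (\<Psi> s x) \<partial>lborel))"
    by simp
  finally show ?thesis unfolding back_propagate_inner(1)[OF e Phi Psi] .
qed

text \<open>Fubini moves the evolution from \<open>f\<close> to \<open>\<Phi>\<close>.\<close>

lemma duality_pairing:
  fixes f :: "'a::euclidean_space \<Rightarrow> complex"
  assumes e: "e > 0" and [measurable]: "f \<in> borel_measurable borel" and f2: "integrable lborel (\<lambda>x. (cmod (f x))\<^sup>2)"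
    and Phi: "bounded_support \<Phi>"
  shows "(\<integral>t. \<integral>x. propagate (ctime e t) f x * cnj (\<Phi> t x) \<partial>lborel \<partial>lborel) =
    cnj (\<integral>y. time_integral (back_propagate e \<Phi>) UNIV y * cnj (f y) \<partial>lborel)"
proof -
  note [measurable (raw)] = bounded_support_measurable'[OF Phi]
  have "(\<integral>x. propagate (ctime e t) f x * cnj (\<Phi> t x) \<partial>lborel) = cnj (\<integral>y. back_propagate e \<Phi> t y * cnj (f y) \<partial>lborel)" for t
  proof -
    let ?z = "ctime e t"
    have z: "Re ?z > 0" using e by simp
    let ?B = "sqrt (\<integral>x. (cmod (f x))\<^sup>2 \<partial>lborel) * sqrt (1 / sqrt (4 * pi * Re ?z) ^ DIM('a))"
    have int: "integrable (lborel \<Otimes>\<^sub>M lborel) (\<lambda>(x, y). cnj (\<Phi> t x) * (f y * heat_kernel ?z (x - y)))"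
    proof (rule lborel_pair.Fubini_integrable)
      show "(\<lambda>(x, y). cnj (\<Phi> t x) * (f y * heat_kernel ?z (x - y))) \<in> borel_measurable (lborel \<Otimes>\<^sub>M lborel)" by measurable
      show "AE x in lborel. integrable lborel (\<lambda>y. case (x, y) of (x, y) \<Rightarrow> cnj (\<Phi> t x) * (f y * heat_kernel ?z (x - y)))"
        using propagate_L2_bounded(1)[OF z _ f2] by (auto simp del: mult_cancel_left)
      show "integrable lborel (\<lambda>x. \<integral>y. norm (case (x, y) of (x, y) \<Rightarrow> cnj (\<Phi> t x) * (f y * heat_kernel ?z (x - y))) \<partial>lborel)"
      proof (rule Bochner_Integration.integrable_bound)
        show "integrable lborel (\<lambda>x. cmod (\<Phi> t x) * ?B)"
          using bounded_support_integrable(1)[OF Phi] by (intro integrable_mult_left integrable_norm)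
        show "AE x in lborel. norm (\<integral>y. norm (case (x, y) of (x, y) \<Rightarrow> cnj (\<Phi> t x) * (f y * heat_kernel ?z (x - y))) \<partial>lborel) \<le> norm (cmod (\<Phi> t x) * ?B)"
        proof (rule AE_I2)
          fix x
          have "(\<integral>y. norm (case (x, y) of (x, y) \<Rightarrow> cnj (\<Phi> t x) * (f y * heat_kernel ?z (x - y))) \<partial>lborel) = cmod (\<Phi> t x) * (\<integral>y. cmod (f y) * cmod (heat_kernel ?z (x - y)) \<partial>lborel)"
            by (simp add: norm_mult)
          also have "\<dots> \<le> cmod (\<Phi> t x) * ?B"
            by (intro mult_left_mono propagate_L2_bounded(2)[OF z _ f2]) auto
          moreover have n0: "0 \<le> (\<integral>y. norm (case (x, y) of (x, y) \<Rightarrow> cnj (\<Phi> t x) * (f y * heat_kernel ?z (x - y))) \<partial>lborel)"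
            by (rule integral_nonneg_AE) simp
          ultimately show "norm (\<integral>y. norm (case (x, y) of (x, y) \<Rightarrow> cnj (\<Phi> t x) * (f y * heat_kernel ?z (x - y))) \<partial>lborel) \<le> norm (cmod (\<Phi> t x) * ?B)"
            using n0 unfolding real_norm_def by linarith
        qed
      qed measurable
    qed
    have "(\<integral>x. propagate ?z f x * cnj (\<Phi> t x) \<partial>lborel) = (\<integral>x. \<integral>y. cnj (\<Phi> t x) * (f y * heat_kernel ?z (x - y)) \<partial>lborel \<partial>lborel)"
      unfolding propagate_def by (simp add: mult.commute)
    also have "\<dots> = (\<integral>y. \<integral>x. cnj (\<Phi> t x) * (f y * heat_kernel ?z (x - y)) \<partial>lborel \<partial>lborel)"
      using lborel_pair.Fubini_integral[OF int] by simp
    also have "\<dots> = (\<integral>y. f y * cnj (back_propagate e \<Phi> t y) \<partial>lborel)"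
      unfolding back_propagate_def by (simp add: mult.left_commute flip: Bochner_Integration.integral_cnj)
    also have "\<dots> = cnj (\<integral>y. back_propagate e \<Phi> t y * cnj (f y) \<partial>lborel)"
      by (simp add: mult.commute flip: Bochner_Integration.integral_cnj)
    finally show ?thesis .
  qed
  then have "(\<integral>t. \<integral>x. propagate (ctime e t) f x * cnj (\<Phi> t x) \<partial>lborel \<partial>lborel) = cnj (\<integral>t. \<integral>y. back_propagate e \<Phi> t y * cnj (f y) \<partial>lborel \<partial>lborel)"
    by simp
  also have "(\<integral>t. \<integral>y. back_propagate e \<Phi> t y * cnj (f y) \<partial>lborel \<partial>lborel) = (\<integral>y. time_integral (back_propagate e \<Phi>) UNIV y * cnj (f y) \<partial>lborel)"
    using time_integral_slice[OF back_propagate_time_field[OF e Phi] _ f2, of UNIV] by simp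
  finally show ?thesis .
qed

section \<open>The Kato smoothing estimate\<close>

text \<open>Passes from truncated integrands, for which the duality argument is available, to the full
  space-time integral.\<close>

lemma fatou_double:
  fixes G :: "nat \<Rightarrow> real \<Rightarrow> 'a::euclidean_space \<Rightarrow> ennreal"
  assumes G: "\<And>m. (\<lambda>(t, x). G m t x) \<in> borel_measurable (lborel \<Otimes>\<^sub>M lborel)"
    and ev: "\<And>t x. eventually (\<lambda>m. g t x \<le> G m t x) sequentially"
    and c: "\<And>m. (\<integral>\<^sup>+t. \<integral>\<^sup>+x. G m t x \<partial>lborel \<partial>lborel) \<le> c"
  shows "(\<integral>\<^sup>+t. \<integral>\<^sup>+x. g t x \<partial>lborel \<partial>lborel) \<le> c"
proof -
  note [measurable] = G
  have [measurable]: "G m t \<in> borel_measurable borel" for m t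
    using measurable_compose_Pair1[OF _ G[of m], of t] by simp
  have [measurable]: "(\<lambda>t. \<integral>\<^sup>+x. G m t x \<partial>lborel) \<in> borel_measurable borel" for m
    using lborel.borel_measurable_nn_integral_fst[OF G[of m]] by simp
  have "(\<integral>\<^sup>+t. \<integral>\<^sup>+x. g t x \<partial>lborel \<partial>lborel) \<le> (\<integral>\<^sup>+t. \<integral>\<^sup>+x. liminf (\<lambda>m. G m t x) \<partial>lborel \<partial>lborel)"
    by (intro nn_integral_mono Liminf_bounded ev)
  also have "\<dots> \<le> (\<integral>\<^sup>+t. liminf (\<lambda>m. \<integral>\<^sup>+x. G m t x \<partial>lborel) \<partial>lborel)"
    by (intro nn_integral_mono nn_integral_liminf) simp
  also have "\<dots> \<le> liminf (\<lambda>m. \<integral>\<^sup>+t. \<integral>\<^sup>+x. G m t x \<partial>lborel \<partial>lborel)"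
    by (intro nn_integral_liminf) simp
  also have "\<dots> \<le> c"
    by (rule order_trans[OF Liminf_le_Limsup], simp) (intro Limsup_bounded always_eventually allI c)
  finally show ?thesis .
qed

lemma integral_bounded_support:
  fixes \<Psi> :: "real \<Rightarrow> 'a::euclidean_space \<Rightarrow> complex"
  assumes "bounded_support \<Psi>"
  shows "(\<integral>\<^sup>+t. \<integral>\<^sup>+x. ennreal (cmod (\<Psi> t x)) \<partial>lborel \<partial>lborel) = ennreal (\<integral>t. \<integral>x. cmod (\<Psi> t x) \<partial>lborel \<partial>lborel)"
proof -
  note [measurable (raw)] = bounded_support_measurable'[OF assms]
  have 1: "(\<integral>\<^sup>+x. ennreal (cmod (\<Psi> t x)) \<partial>lborel) = ennreal (\<integral>x. cmod (\<Psi> t x) \<partial>lborel)" for t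
    using bounded_support_integrable(1)[OF assms] by (intro nn_integral_eq_integral) auto
  have "(\<integral>\<^sup>+t. \<integral>\<^sup>+x. ennreal (cmod (\<Psi> t x)) \<partial>lborel \<partial>lborel) < \<infinity>"
    using nn_integral_bounded_support_finite[OF assms, of 1] by simp
  then have "integrable lborel (\<lambda>t. \<integral>x. cmod (\<Psi> t x) \<partial>lborel)"
    unfolding 1 by (intro integrableI_nonneg) (auto intro!: integral_nonneg_AE)
  then show ?thesis unfolding 1 by (intro nn_integral_eq_integral) (auto intro!: integral_nonneg_AE)
qed

lemma bounded_supportI:
  assumes "(\<lambda>(t, x). \<Phi> t x) \<in> borel_measurable (lborel \<Otimes>\<^sub>M lborel)"
    and "\<And>t x. cmod (\<Phi> t x) \<le> M" and "\<And>t x. m < \<bar>t\<bar> \<Longrightarrow> \<Phi> t x = 0" and "\<And>t x. m < norm x \<Longrightarrow> \<Phi> t x = 0"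
  shows "bounded_support \<Phi>"
  using assms unfolding bounded_support_def by blast

lemma measurable_propagate_ctime:
  assumes [measurable]: "f \<in> borel_measurable borel"
  shows "(\<lambda>(t, x). propagate (ctime e t) f x) \<in> borel_measurable (lborel \<Otimes>\<^sub>M lborel)"
  unfolding propagate_def by measurable

lemma measure_cball_le:
  assumes R: "R \<ge> 0"
  shows "measure lborel (cball (0::'a::euclidean_space) R) \<le> (2 * R) ^ DIM('a)"
proof -
  have sub: "cball (0::'a) R \<subseteq> cbox (- (R *\<^sub>R One)) (R *\<^sub>R One)"
  proof
    fix x :: 'a assume "x \<in> cball 0 R"
    then have "norm x \<le> R" by simp
    then have "\<bar>x \<bullet> b\<bar> \<le> R" if "b \<in> Basis" for b using Basis_le_norm[OF that, of x] by linarith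
    then show "x \<in> cbox (- (R *\<^sub>R One)) (R *\<^sub>R One)" by (fastforce simp: mem_box abs_le_iff)
  qed
  have "measure lborel (cball (0::'a) R) \<le> measure lborel (cbox (- (R *\<^sub>R One)) (R *\<^sub>R One :: 'a))"
    using sub by (intro measure_mono_fmeasurable) (auto simp: fmeasurable_cbox)
  also have "\<dots> = (2 * R) ^ DIM('a)"
  proof -
    have "(\<Prod>b\<in>Basis. ((R *\<^sub>R One :: 'a) - - (R *\<^sub>R One)) \<bullet> b) = (\<Prod>b\<in>(Basis::'a set). 2 * R)"
      by (rule prod.cong) (simp_all add: inner_simps)
    then show ?thesis using R by simp
  qed
  finally show ?thesis .
qed

text \<open>Cauchy--Schwarz; the dispersive estimate needs \<open>L\<^sup>1\<close> norms, and on an annulus of radius \<open>R\<close>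
  these cost a factor of order \<open>R^(d/2)\<close>, which is the source of \<open>decay\<close>.\<close>

lemma L1_le_L2_on_ball:
  fixes g :: "'a::euclidean_space \<Rightarrow> complex"
  assumes [measurable]: "g \<in> borel_measurable borel" and g2: "integrable lborel (\<lambda>x. (cmod (g x))\<^sup>2)"
    and R: "R \<ge> 0" and supp: "\<And>x. R < norm x \<Longrightarrow> g x = 0"
  shows "(\<integral>x. cmod (g x) \<partial>lborel) \<le> sqrt (2 * R) ^ DIM('a) * sqrt (\<integral>x. (cmod (g x))\<^sup>2 \<partial>lborel)"
proof -
  let ?i = "\<lambda>x. of_real (indicator (cball (0::'a) R) x) :: complex"
  have [measurable]: "cball (0::'a) R \<in> sets borel" by simp
  have [measurable]: "?i \<in> borel_measurable borel" by measurable
  have sq: "(cmod (?i x))\<^sup>2 = indicator (cball 0 R) x" for x by (auto simp: indicator_def)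
  have fin: "emeasure lborel (cball (0::'a) R) < \<infinity>" by (intro emeasure_bounded_finite) auto
  have int: "integrable lborel (\<lambda>x. (cmod (?i x))\<^sup>2)"
    unfolding sq using fin by (intro integrable_real_indicator) auto
  have "(\<integral>x. cmod (g x) \<partial>lborel) = (\<integral>x. cmod (g x) * cmod (?i x) \<partial>lborel)"
    using supp by (intro Bochner_Integration.integral_cong) (auto simp: indicator_def)
  also have "\<dots> \<le> sqrt (\<integral>x. (cmod (g x))\<^sup>2 \<partial>lborel) * sqrt (\<integral>x. (cmod (?i x))\<^sup>2 \<partial>lborel)"
    by (intro cauchy_schwarz_integral(2) g2 int) auto
  also have "(\<integral>x. (cmod (?i x))\<^sup>2 \<partial>lborel) = measure lborel (cball (0::'a) R)"
    unfolding sq by simp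
  also have "sqrt (\<integral>x. (cmod (g x))\<^sup>2 \<partial>lborel) * sqrt (measure lborel (cball (0::'a) R)) \<le> sqrt (\<integral>x. (cmod (g x))\<^sup>2 \<partial>lborel) * sqrt ((2 * R) ^ DIM('a))"
    by (intro mult_left_mono real_sqrt_le_mono measure_cball_le R) (simp add: integral_nonneg_AE)
  finally show ?thesis by (simp only: real_sqrt_power mult.commute)
qed

text \<open>The dual functions are \<open>\<Phi> k = U / |x|\<^sup>2\<close> on the annulus \<open>2^k \<le> |x| < 2^(k + 1)\<close> and \<open>|t| \<le> m\<close>. With \<open>N k\<close> the
  contribution of this annulus to the left-hand side, the squared norm of \<open>\<Phi> k\<close> is at most \<open>N k / 4^k\<close>, exactly
  the weight that \<open>dyadic_almost_orthogonality\<close> restores. Duality then gives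
  \<open>S \<le> (D S)^(1/2) \<parallel>f\<parallel>\<close> for the sum \<open>S\<close> of the \<open>N k\<close>, and \<open>S\<close> is finite by truncation, so it can be cancelled.\<close>

theorem kato_smoothing:
  fixes f :: "'a::euclidean_space \<Rightarrow> complex"
  assumes d: "DIM('a) \<ge> 3" and e: "e > 0" and [measurable]: "f \<in> borel_measurable borel"
    and f2: "integrable lborel (\<lambda>x. (cmod (f x))\<^sup>2)"
  shows "(\<integral>\<^sup>+t. \<integral>\<^sup>+x. ennreal ((cmod (propagate (ctime e t) f x))\<^sup>2 / (norm x)\<^sup>2) \<partial>lborel \<partial>lborel)
    \<le> ennreal (32 * sqrt (4 / pi) ^ DIM('a) / (1 - 2 powr (- (1 / 4))) * (\<integral>x. (cmod (f x))\<^sup>2 \<partial>lborel))"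
proof -
  let ?d = "DIM('a)"
  define U where "U t x = propagate (ctime e t) f x" for t x
  define F where "F = sqrt (\<integral>x. (cmod (f x))\<^sup>2 \<partial>lborel)"
  have F0: "F \<ge> 0" and F2: "F\<^sup>2 = (\<integral>x. (cmod (f x))\<^sup>2 \<partial>lborel)"
    by (auto simp: F_def intro!: integral_nonneg_AE)
  define B where "B = F * sqrt (1 / sqrt (4 * pi * e) ^ ?d)"
  have UB: "cmod (U t x) \<le> B" for t x
    using propagate_L2_bounded(3)[of "ctime e t" f x] e f2 by (simp add: U_def B_def F_def)
  have B0: "B \<ge> 0" using UB[of 0 0] norm_ge_zero[of "U 0 0"] by linarith
  have Um: "(\<lambda>(t, x). U t x) \<in> borel_measurable (lborel \<Otimes>\<^sub>M lborel)"
    unfolding U_def by (rule measurable_propagate_ctime) measurable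
  have Um'[measurable (raw)]: "(\<lambda>p. U (a p) (b p)) \<in> borel_measurable M"
    if [measurable]: "a \<in> borel_measurable M" "b \<in> borel_measurable M" for a b and M :: "'c measure"
  proof -
    have [measurable]: "a \<in> M \<rightarrow>\<^sub>M lborel" "b \<in> M \<rightarrow>\<^sub>M lborel" using that by auto
    show ?thesis using measurable_compose[OF _ Um, of "\<lambda>p. (a p, b p)" M] by simp
  qed
  define C where "C = sqrt (4 / pi) ^ ?d"
  have C: "C \<ge> 1" using pi_less_4 by (simp add: C_def one_le_power)
  define D where "D = 32 * C / (1 - 2 powr (- (1 / 4)))"
  have D0: "D > 0" using C powr_less_mono[of "- (1 / 4)" 0 "2::real"] by (simp add: D_def)
  have bound: "(\<integral>\<^sup>+t. \<integral>\<^sup>+x. (\<Sum>k\<in>{- int m..int m}. ennreal (if \<bar>t\<bar> \<le> m \<and> 2 powr k \<le> norm x \<and> norm x < 2 * 2 powr k then (cmod (U t x))\<^sup>2 / (norm x)\<^sup>2 else 0)) \<partial>lborel \<partial>lborel)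
      \<le> ennreal (D * F\<^sup>2)" for m :: nat
  proof -
    let ?K = "{- int m..int m}"
    define on where "on k t x \<longleftrightarrow> \<bar>t\<bar> \<le> real m \<and> 2 powr k \<le> norm x \<and> norm x < 2 * 2 powr k" for k :: int and t and x :: 'a
    define \<Phi> where "\<Phi> k t x = (if on k t x then U t x / of_real ((norm x)\<^sup>2) else 0)" for k t x
    define \<Psi> where "\<Psi> k t x = U t x * cnj (\<Phi> k t x)" for k t x
    have on0: "2 powr k > 0" "norm x > 0" "2 powr k \<le> norm x" if "on k t x" for k t x
    proof -
      show "2 powr k > 0" by simp
      show "2 powr k \<le> norm x" using that by (simp add: on_def)
      then show "norm x > 0" using powr_gt_zero[of 2 k] by linarith
    qed
    have Phi_b: "cmod (\<Phi> k t x) \<le> B / (2 powr k)\<^sup>2" for k t x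
    proof (cases "on k t x")
      case True
      have "cmod (U t x) / (norm x)\<^sup>2 \<le> B / (2 powr k)\<^sup>2"
        using on0[OF True] UB B0 by (intro frac_le power_mono) auto
      then show ?thesis using True by (simp add: \<Phi>_def norm_divide norm_power)
    next
      case False
      then have "\<Phi> k t x = 0" by (simp add: \<Phi>_def)
      then show ?thesis using B0 by simp
    qed
    have supp: "\<And>k t x. 2 * 2 powr real_of_int k < norm x \<Longrightarrow> \<Phi> k t x = 0" by (auto simp: \<Phi>_def on_def)
    have supp': "\<And>k t x. real m < \<bar>t\<bar> \<Longrightarrow> \<Phi> k t x = 0" by (auto simp: \<Phi>_def on_def)
    have Phi_m: "(\<lambda>(t, x). \<Phi> k t x) \<in> borel_measurable (lborel \<Otimes>\<^sub>M lborel)" for k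
      unfolding \<Phi>_def on_def by measurable
    have bs: "bounded_support (\<Phi> k)" for k
    proof (rule bounded_supportI[OF Phi_m Phi_b, where m="max (real m) (2 * 2 powr k)"])
      show "\<Phi> k t x = 0" if "max (real m) (2 * 2 powr k) < \<bar>t\<bar>" for t x using that by (auto intro: supp')
      show "\<Phi> k t x = 0" if "max (real m) (2 * 2 powr k) < norm x" for t x using that by (auto intro: supp)
    qed
    note [measurable (raw)] = bounded_support_measurable'[OF bs]
    have bsPsi: "bounded_support (\<Psi> k)" for k
    proof (rule bounded_supportI[where M="B * (B / (2 powr k)\<^sup>2)" and m="max (real m) (2 * 2 powr k)"])
      show "(\<lambda>(t, x). \<Psi> k t x) \<in> borel_measurable (lborel \<Otimes>\<^sub>M lborel)" unfolding \<Psi>_def by measurable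
      show "cmod (\<Psi> k t x) \<le> B * (B / (2 powr k)\<^sup>2)" for t x
        unfolding \<Psi>_def norm_mult complex_mod_cnj using B0 by (intro mult_mono UB Phi_b) auto
      show "\<Psi> k t x = 0" if "max (real m) (2 * 2 powr k) < \<bar>t\<bar>" for t x
        using that by (simp add: \<Psi>_def supp')
      show "\<Psi> k t x = 0" if "max (real m) (2 * 2 powr k) < norm x" for t x
        using that by (simp add: \<Psi>_def supp)
    qed
    have Psi_eq: "\<Psi> k t x = of_real (cmod (\<Psi> k t x))" "cmod (\<Psi> k t x) = (if on k t x then (cmod (U t x))\<^sup>2 / (norm x)\<^sup>2 else 0)" for k t x
    proof -
      have P: "\<Psi> k t x = of_real (if on k t x then (cmod (U t x))\<^sup>2 / (norm x)\<^sup>2 else 0)"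
        by (simp add: \<Psi>_def \<Phi>_def complex_norm_square[symmetric])
      have "0 \<le> (if on k t x then (cmod (U t x))\<^sup>2 / (norm x)\<^sup>2 else 0)" by simp
      with P show "cmod (\<Psi> k t x) = (if on k t x then (cmod (U t x))\<^sup>2 / (norm x)\<^sup>2 else 0)"
        by (simp only: norm_of_real abs_of_nonneg)
      then show "\<Psi> k t x = of_real (cmod (\<Psi> k t x))" using P by simp
    qed
    define N where "N k = (\<integral>t. \<integral>x. cmod (\<Psi> k t x) \<partial>lborel \<partial>lborel)" for k
    have N0: "N k \<ge> 0" for k unfolding N_def by (auto intro!: integral_nonneg_AE)
    have Nnn: "(\<integral>\<^sup>+t. \<integral>\<^sup>+x. ennreal (cmod (\<Psi> k t x)) \<partial>lborel \<partial>lborel) = ennreal (N k)" for k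
      unfolding N_def by (rule integral_bounded_support[OF bsPsi])
    have Nc: "of_real (N k) = (\<integral>t. \<integral>x. U t x * cnj (\<Phi> k t x) \<partial>lborel \<partial>lborel)" for k
      unfolding N_def \<Psi>_def[symmetric] using Psi_eq(1) by (simp only: integral_complex_of_real[symmetric])
    define w where "w k = back_propagate e (\<Phi> k)" for k
    have w: "time_field (w k)" for k unfolding w_def by (rule back_propagate_time_field[OF e bs])
    let ?V = "\<lambda>y. \<Sum>k\<in>?K. time_integral (w k) UNIV y"
    have V: "(\<integral>\<^sup>+y. ennreal ((cmod (?V y))\<^sup>2) \<partial>lborel) \<le> ennreal (32 * C / (1 - 2 powr (- (1 / 4))) * (\<Sum>k\<in>?K. (2 powr k)\<^sup>2 * (N k / (2 powr k)\<^sup>2)))"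
    proof (rule dyadic_almost_orthogonality[where \<phi>="\<lambda>k. slice_norm (\<Phi> k)"])
      show "cmod (inner_product (w k) (w l) t s) \<le> C * decay (2 powr k * 2 powr l) (t - s) * slice_norm (\<Phi> k) t * slice_norm (\<Phi> l) s" for k l t s
      proof (cases "\<bar>t - s\<bar> \<le> 2 powr k * 2 powr l")
        case True
        have "cmod (inner_product (w k) (w l) t s) \<le> 1 * (slice_norm (\<Phi> k) t * slice_norm (\<Phi> l) s)"
          unfolding w_def using back_propagate_inner(2)[OF e bs bs] by simp
        also have "\<dots> \<le> C * (slice_norm (\<Phi> k) t * slice_norm (\<Phi> l) s)"
          using C by (intro mult_right_mono mult_nonneg_nonneg slice_norm_nonneg) auto
        finally show ?thesis using True by (simp add: decay_def mult.assoc)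
      next
        case False
        let ?a = "2 powr k * 2 powr l :: real" and ?r = "\<bar>t - s\<bar>"
        have a: "?a > 0" by simp
        with False have r: "?r > 0" "t \<noteq> s" by auto
        have l1: "(\<integral>x. cmod (\<Phi> k t x) \<partial>lborel) \<le> sqrt (2 * (2 * 2 powr k)) ^ ?d * slice_norm (\<Phi> k) t" for k t
          unfolding slice_norm_def using bounded_support_integrable[OF bs] supp by (intro L1_le_L2_on_ball) auto
        have "cmod (inner_product (w k) (w l) t s) \<le> 1 / sqrt (4 * pi * ?r) ^ ?d * ((\<integral>x. cmod (\<Phi> k t x) \<partial>lborel) * (\<integral>x. cmod (\<Phi> l s x) \<partial>lborel))"
          unfolding w_def by (rule back_propagate_dispersive[OF e bs bs r(2)])
        also have "\<dots> \<le> 1 / sqrt (4 * pi * ?r) ^ ?d * ((sqrt (2 * (2 * 2 powr k)) ^ ?d * slice_norm (\<Phi> k) t) * (sqrt (2 * (2 * 2 powr l)) ^ ?d * slice_norm (\<Phi> l) s))"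
          using r by (intro mult_left_mono mult_mono l1) (auto intro!: integral_nonneg_AE mult_nonneg_nonneg slice_norm_nonneg)
        also have "\<dots> = (sqrt (2 * (2 * 2 powr k)) * sqrt (2 * (2 * 2 powr l)) / sqrt (4 * pi * ?r)) ^ ?d * (slice_norm (\<Phi> k) t * slice_norm (\<Phi> l) s)"
          by (simp add: power_mult_distrib power_divide)
        also have "sqrt (2 * (2 * 2 powr k)) * sqrt (2 * (2 * 2 powr l)) / sqrt (4 * pi * ?r) = sqrt (4 / pi) * sqrt (?a / ?r)"
        proof -
          have "sqrt (2 * (2 * 2 powr k)) * sqrt (2 * (2 * 2 powr l)) / sqrt (4 * pi * ?r) = sqrt ((2 * (2 * 2 powr k)) * (2 * (2 * 2 powr l)) / (4 * pi * ?r))"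
            by (simp only: real_sqrt_mult real_sqrt_divide)
          also have "(2 * (2 * 2 powr k)) * (2 * (2 * 2 powr l)) / (4 * pi * ?r) = (4 / pi) * (?a / ?r)" by simp
          finally show ?thesis by (simp only: real_sqrt_mult)
        qed
        also have "(sqrt (4 / pi) * sqrt (?a / ?r)) ^ ?d = C * sqrt (?a / ?r) ^ ?d"
          by (simp add: power_mult_distrib C_def)
        also have "C * sqrt (?a / ?r) ^ ?d * (slice_norm (\<Phi> k) t * slice_norm (\<Phi> l) s) \<le> C * (?a / ?r) powr (3 / 2) * (slice_norm (\<Phi> k) t * slice_norm (\<Phi> l) s)"
        proof (intro mult_right_mono mult_left_mono)
          have "?a / ?r \<le> 1" using False a r by simp
          then have "sqrt (?a / ?r) ^ ?d \<le> sqrt (?a / ?r) ^ 3"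
            using a r d by (intro power_decreasing) auto
          also have "\<dots> = ((?a / ?r) powr (1 / 2)) powr 3"
            using a r by (simp add: powr_half_sqrt)
          also have "\<dots> = (?a / ?r) powr (3 / 2)" by (simp only: powr_powr) simp
          finally show "sqrt (?a / ?r) ^ ?d \<le> (?a / ?r) powr (3 / 2)" .
        qed (use C in \<open>auto intro!: mult_nonneg_nonneg slice_norm_nonneg\<close>)
        finally show ?thesis using False by (simp add: decay_def mult.assoc)
      qed
      show "(\<integral>\<^sup>+y. ennreal ((cmod (w k s y))\<^sup>2) \<partial>lborel) \<le> ennreal ((slice_norm (\<Phi> k) s)\<^sup>2)" for k s
        unfolding w_def by (rule back_propagate_L2[OF e bs])
      show "(\<integral>\<^sup>+t. ennreal ((slice_norm (\<Phi> k) t)\<^sup>2) \<partial>lborel) \<le> ennreal (N k / (2 powr k)\<^sup>2)" for k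
      proof -
        have "(\<integral>\<^sup>+t. ennreal ((slice_norm (\<Phi> k) t)\<^sup>2) \<partial>lborel) = (\<integral>\<^sup>+t. \<integral>\<^sup>+x. ennreal ((cmod (\<Phi> k t x))\<^sup>2) \<partial>lborel \<partial>lborel)"
          by (simp add: nn_integral_slice_norm[OF bs])
        also have "\<dots> \<le> (\<integral>\<^sup>+t. \<integral>\<^sup>+x. ennreal (1 / (2 powr k)\<^sup>2) * ennreal (cmod (\<Psi> k t x)) \<partial>lborel \<partial>lborel)"
        proof (intro nn_integral_mono)
          fix t x
          have "(cmod (\<Phi> k t x))\<^sup>2 \<le> 1 / (2 powr k)\<^sup>2 * cmod (\<Psi> k t x)"
          proof (cases "on k t x")
            case True
            have "(cmod (\<Phi> k t x))\<^sup>2 = 1 / (norm x)\<^sup>2 * ((cmod (U t x))\<^sup>2 / (norm x)\<^sup>2)"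
              using True by (simp add: \<Phi>_def norm_divide norm_mult power_divide power2_eq_square)
            also have "\<dots> \<le> 1 / (2 powr k)\<^sup>2 * ((cmod (U t x))\<^sup>2 / (norm x)\<^sup>2)"
              using on0[OF True] by (intro mult_right_mono frac_le power_mono) auto
            finally show ?thesis using True by (simp add: Psi_eq(2))
          qed (simp add: \<Phi>_def)
          then show "ennreal ((cmod (\<Phi> k t x))\<^sup>2) \<le> ennreal (1 / (2 powr k)\<^sup>2) * ennreal (cmod (\<Psi> k t x))"
            by (simp add: ennreal_mult[symmetric] ennreal_leI)
        qed
        also have "\<dots> = ennreal (1 / (2 powr k)\<^sup>2) * (\<integral>\<^sup>+t. \<integral>\<^sup>+x. ennreal (cmod (\<Psi> k t x)) \<partial>lborel \<partial>lborel)"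
        proof -
          note [measurable (raw)] = bounded_support_measurable'[OF bsPsi]
          show ?thesis by (simp add: nn_integral_cmult)
        qed
        also have "\<dots> = ennreal (1 / (2 powr k)\<^sup>2 * N k)"
          unfolding Nnn by (rule ennreal_mult[symmetric]) (auto intro: N0)
        finally show ?thesis by simp
      qed
    qed (auto intro: C w slice_norm_measurable[OF bs] intro!: divide_nonneg_nonneg N0)
    define S where "S = (\<Sum>k\<in>?K. N k)"
    have S0: "S \<ge> 0" unfolding S_def by (intro sum_nonneg N0)
    have V': "(\<integral>\<^sup>+y. ennreal ((cmod (?V y))\<^sup>2) \<partial>lborel) \<le> ennreal (D * S)"
      using V unfolding D_def S_def by simp
    have Vm[measurable]: "?V \<in> borel_measurable borel"
      using borel_measurable_time_integral[OF w, of UNIV] by measurable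
    have V2: "integrable lborel (\<lambda>y. (cmod (?V y))\<^sup>2)"
      using V' by (intro integrableI_nonneg) (auto simp: le_less_trans)
    have Vle: "(\<integral>y. (cmod (?V y))\<^sup>2 \<partial>lborel) \<le> D * S"
      using V' V2 D0 S0 by (subst (asm) nn_integral_eq_integral) auto
    have Vi: "integrable lborel (\<lambda>y. time_integral (w k) UNIV y * cnj (f y))" for k
    proof (rule cauchy_schwarz_integral(1))
      show "time_integral (w k) UNIV \<in> borel_measurable lborel" using borel_measurable_time_integral[OF w, of UNIV k] by simp
      show "integrable lborel (\<lambda>x. (cmod (time_integral (w k) UNIV x))\<^sup>2)" by (rule time_integral_norm(1)[OF w]) simp
    qed (use f2 in auto)
    have "of_real S = (\<Sum>k\<in>?K. cnj (\<integral>y. time_integral (w k) UNIV y * cnj (f y) \<partial>lborel))"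
      unfolding S_def of_real_sum Nc w_def U_def using duality_pairing[OF e _ f2 bs] by simp
    also have "\<dots> = cnj (\<integral>y. ?V y * cnj (f y) \<partial>lborel)"
      unfolding sum_distrib_right using Vi by (subst Bochner_Integration.integral_sum) auto
    finally have "cmod (of_real S) = cmod (\<integral>y. ?V y * cnj (f y) \<partial>lborel)" by (simp only: complex_mod_cnj)
    then have "S = cmod (\<integral>y. ?V y * cnj (f y) \<partial>lborel)" using S0 by simp
    also have "\<dots> \<le> sqrt (\<integral>y. (cmod (?V y))\<^sup>2 \<partial>lborel) * sqrt (\<integral>y. (cmod (cnj (f y)))\<^sup>2 \<partial>lborel)"
      using V2 f2 by (intro cauchy_schwarz_integral(3)) auto
    also have "\<dots> \<le> sqrt (D * S) * F"
      unfolding F_def using Vle D0 S0 by (intro mult_mono) (auto intro!: integral_nonneg_AE)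
    finally have "S \<le> sqrt (D * S) * F" .
    then have "S\<^sup>2 \<le> (sqrt (D * S) * F)\<^sup>2" using S0 by (intro power_mono) auto
    \<comment> \<open>Cancelling \<open>S\<close> is legitimate because the truncated sum is finite.\<close>
    then have "S * S \<le> (D * F\<^sup>2) * S" using D0 S0 by (simp add: power_mult_distrib power2_eq_square[of S] mult_ac)
    then have "S \<le> D * F\<^sup>2" using S0 D0 by (cases "S = 0") auto
    have "(\<integral>\<^sup>+t. \<integral>\<^sup>+x. (\<Sum>k\<in>?K. ennreal (cmod (\<Psi> k t x))) \<partial>lborel \<partial>lborel) = (\<Sum>k\<in>?K. ennreal (N k))"
    proof -
      note [measurable (raw)] = bounded_support_measurable'[OF bsPsi]
      show ?thesis unfolding Nnn[symmetric] by (simp add: nn_integral_sum del: sum_ennreal)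
    qed
    also have "\<dots> = ennreal S" unfolding S_def by (intro sum_ennreal N0)
    also have "\<dots> \<le> ennreal (D * F\<^sup>2)" by (rule ennreal_leI) fact
    finally show ?thesis unfolding Psi_eq(2) on_def .
  qed
  define G where "G m t x = (\<Sum>k\<in>{- int m..int m}. ennreal (if \<bar>t\<bar> \<le> m \<and> 2 powr k \<le> norm x \<and> norm x < 2 * 2 powr k then (cmod (U t x))\<^sup>2 / (norm x)\<^sup>2 else 0))" for m :: nat and t :: real and x :: 'a
  have "(\<integral>\<^sup>+t. \<integral>\<^sup>+x. ennreal ((cmod (U t x))\<^sup>2 / (norm x)\<^sup>2) \<partial>lborel \<partial>lborel) \<le> ennreal (D * F\<^sup>2)"
  proof (rule fatou_double[where G=G])
    show "(\<integral>\<^sup>+t. \<integral>\<^sup>+x. G m t x \<partial>lborel \<partial>lborel) \<le> ennreal (D * F\<^sup>2)" for m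
      unfolding G_def by (rule bound)
    show "(\<lambda>(t, x). G m t x) \<in> borel_measurable (lborel \<Otimes>\<^sub>M lborel)" for m
      unfolding G_def by measurable
    fix t :: real and x :: 'a
    show "eventually (\<lambda>m. ennreal ((cmod (U t x))\<^sup>2 / (norm x)\<^sup>2) \<le> G m t x) sequentially"
    proof (cases "x = 0")
      case False
      \<comment> \<open>The index of the dyadic annulus that contains \<open>x\<close>.\<close>
      define k0 where "k0 = \<lfloor>log 2 (norm x)\<rfloor>"
      have k0: "2 powr k0 \<le> norm x" "norm x < 2 * 2 powr k0"
      proof -
        have n: "norm x = 2 powr log 2 (norm x)" using False by simp
        have "real_of_int k0 \<le> log 2 (norm x)" "log 2 (norm x) < real_of_int k0 + 1" by (auto simp: k0_def)
        then have "2 powr real_of_int k0 \<le> 2 powr log 2 (norm x)" "2 powr log 2 (norm x) < 2 powr (real_of_int k0 + 1)" by auto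
        then show "2 powr k0 \<le> norm x" "norm x < 2 * 2 powr k0" unfolding n[symmetric] by (simp_all add: powr_add)
      qed
      obtain m0 where m0: "\<bar>t\<bar> \<le> real m0" using real_arch_simple by blast
      show ?thesis
      proof (rule eventually_sequentiallyI[of "max m0 (nat \<bar>k0\<bar>)"])
        fix m assume m: "max m0 (nat \<bar>k0\<bar>) \<le> m"
        then have "k0 \<in> {- int m..int m}" "\<bar>t\<bar> \<le> real m" using m0 by auto
        then have "ennreal ((cmod (U t x))\<^sup>2 / (norm x)\<^sup>2) = ennreal (if \<bar>t\<bar> \<le> m \<and> 2 powr k0 \<le> norm x \<and> norm x < 2 * 2 powr k0 then (cmod (U t x))\<^sup>2 / (norm x)\<^sup>2 else 0)"
          using k0 by simp
        also have "\<dots> \<le> G m t x"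
          unfolding G_def by (rule member_le_sum[of k0]) (use \<open>k0 \<in> _\<close> in auto)
        finally show "ennreal ((cmod (U t x))\<^sup>2 / (norm x)\<^sup>2) \<le> G m t x" .
      qed
    qed simp
  qed
  then show ?thesis unfolding U_def D_def C_def F2 .
qed

section \<open>The Strichartz estimate\<close>

text \<open>Hoelder's inequality and \<open>marcinkiewicz_propagate\<close> with \<open>\<Lambda> = (4 \<pi> |s - t|)^(-d/2)\<close>. For
  \<open>q = 2 + 4/d\<close> the resulting power is \<open>(d/2) (1 - 2/q) = 2/q\<close>, the exponent at which the Hardy--Littlewood--Sobolev inequality closes.\<close>

lemma inner_product_Lp_bound:
  fixes \<Phi> :: "real \<Rightarrow> 'a::euclidean_space \<Rightarrow> complex"
  assumes e: "e > 0" and bs: "bounded_support \<Phi>"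
    and q: "q = 2 + 4 / DIM('a)" and p: "p = q / (q - 1)" and ts: "t \<noteq> s"
  defines "X \<equiv> \<lambda>t. \<integral>x. cmod (\<Phi> t x) powr p \<partial>lborel"
  defines "c \<equiv> 4 * q / (q - 2) * 2 powr (q - 2)"
  shows "cmod (inner_product (back_propagate e \<Phi>) (back_propagate e \<Phi>) t s) \<le>
    c powr (1 / q) * (4 * pi) powr (- (2 / q)) * (X t powr (1 / p) * X s powr (1 / p) * \<bar>s - t\<bar> powr (- (2 / q)))"
proof -
  note [measurable (raw)] = bounded_support_measurable'[OF bs]
  have d: "real DIM('a) > 0" by simp
  have q2: "q > 2" using d unfolding q by simp
  have p1: "p > 1" "1 / p + 1 / q = 1" using q2 unfolding p by (auto simp: field_simps)
  have c0: "c > 0" using q2 unfolding c_def by simp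
  let ?z = "ctime (2 * e) (s - t)"
  let ?L = "1 / sqrt (4 * pi * \<bar>s - t\<bar>) ^ DIM('a)"
  have z: "Re ?z > 0" using e by simp
  have hb: "cmod (heat_kernel ?z (x::'a)) \<le> ?L" for x
    using heat_kernel_dispersive[of ?z x] e ts by simp
  have L0: "?L > 0" using ts by simp
  obtain M m where M: "M > 0" "m > 0" "\<And>t x. cmod (\<Phi> t x) \<le> M" "\<And>t x. m < \<bar>t\<bar> \<Longrightarrow> \<Phi> t x = 0" "\<And>t x. m < norm x \<Longrightarrow> \<Phi> t x = 0"
    using bounded_supportE[OF bs] by metis
  have ip: "integrable lborel (\<lambda>x. cmod (\<Phi> t x) powr p)" for t
  proof (rule integrable_bounded_cball[where M="M powr p" and m=m])
    show "norm (cmod (\<Phi> t x) powr p) \<le> M powr p" for x using M(1,3) p1 by (simp add: powr_mono2)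
    show "cmod (\<Phi> t x) powr p = 0" if "m < norm x" for x using M(5)[OF that] by simp
  qed measurable
  have Xnn: "(\<integral>\<^sup>+x. ennreal (cmod (\<Phi> t x) powr p) \<partial>lborel) = ennreal (X t)" for t
    unfolding X_def using ip by (intro nn_integral_eq_integral) auto
  have X0: "X t \<ge> 0" for t unfolding X_def by (auto intro!: integral_nonneg_AE)
  have zero: "AE x in lborel. \<Phi> t x = 0" if "X t = 0" for t
  proof -
    have "AE x in lborel. cmod (\<Phi> t x) powr p = 0"
      using that ip[of t] unfolding X_def by (subst (asm) integral_nonneg_eq_0_iff_AE) auto
    then show ?thesis by (auto elim: eventually_mono)
  qed
  have I: "integrable lborel (\<Phi> t)" for t by (rule bounded_support_integrable(1)[OF bs])
  let ?P = "propagate ?z (\<lambda>x. cnj (\<Phi> s x))"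
  have [measurable]: "?P \<in> borel_measurable borel" by measurable
  have "cmod (\<integral>x. \<Phi> t x * ?P x \<partial>lborel) \<le>
    c powr (1 / q) * (4 * pi) powr (- (2 / q)) * (X t powr (1 / p) * X s powr (1 / p) * \<bar>s - t\<bar> powr (- (2 / q)))"
  proof (cases "X t = 0 \<or> X s = 0")
    case True
    then have "AE x in lborel. \<Phi> t x * ?P x = 0"
    proof
      assume "X t = 0"
      from zero[OF this] show ?thesis by (auto elim: eventually_mono)
    next
      assume "X s = 0"
      then have "AE x in lborel. \<Phi> s x = 0" by (rule zero)
      then have "?P x = 0" for x
        unfolding propagate_def by (intro integral_eq_zero_AE) (auto elim: eventually_mono)
      then show ?thesis by simp
    qed
    then have "(\<integral>x. \<Phi> t x * ?P x \<partial>lborel) = 0" by (rule integral_eq_zero_AE)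
    then show ?thesis by (simp add: X0)
  next
    case False
    then have Xp: "X t > 0" "X s > 0" using X0[of t] X0[of s] by auto
    have Pq: "(\<integral>\<^sup>+x. ennreal (cmod (?P x) powr q) \<partial>lborel) \<le> ennreal (c * (?L powr (q - 2) * X s powr (q - 1)))"
      unfolding c_def
    proof (rule marcinkiewicz_propagate[OF q2 p z L0 hb, where M=M])
      show "integrable lborel (\<lambda>x. cnj (\<Phi> s x))" using I[of s] by simp
      show "cmod (cnj (\<Phi> s x)) \<le> M" for x using M(3) by simp
      show "(\<integral>\<^sup>+x. ennreal (cmod (cnj (\<Phi> s x)) powr p) \<partial>lborel) \<le> ennreal (X s)" using Xnn[of s] by simp
    qed (rule Xp)
    have "ennreal (cmod (\<integral>x. \<Phi> t x * ?P x \<partial>lborel)) \<le> (\<integral>\<^sup>+x. ennreal (cmod (\<Phi> t x * ?P x)) \<partial>lborel)"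
      by (cases "integrable lborel (\<lambda>x. \<Phi> t x * ?P x)") (auto intro: integral_norm_bound_ennreal simp: not_integrable_integral_eq)
    also have "\<dots> = (\<integral>\<^sup>+x. ennreal (cmod (\<Phi> t x) * cmod (?P x)) \<partial>lborel)" by (simp add: norm_mult)
    also have "\<dots> \<le> ennreal (X t powr (1 / p) * (c * (?L powr (q - 2) * X s powr (q - 1))) powr (1 / q))"
    proof (rule holder_nn_integral[OF p1(1) _ p1(2)])
      show "0 < c * (?L powr (q - 2) * X s powr (q - 1))" using c0 ts Xp by (intro mult_pos_pos) auto
    qed (use q2 Xp Pq Xnn[of t] in simp_all)
    also have "X t powr (1 / p) * (c * (?L powr (q - 2) * X s powr (q - 1))) powr (1 / q) =
       c powr (1 / q) * (4 * pi) powr (- (2 / q)) * (X t powr (1 / p) * X s powr (1 / p) * \<bar>s - t\<bar> powr (- (2 / q)))"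
    proof -
      have "(c * (?L powr (q - 2) * X s powr (q - 1))) powr (1 / q) = c powr (1 / q) * ((?L powr (q - 2)) powr (1 / q) * (X s powr (q - 1)) powr (1 / q))"
        using c0 L0 Xp by (simp only: powr_mult less_imp_le powr_ge_zero mult_nonneg_nonneg)
      also have "(X s powr (q - 1)) powr (1 / q) = X s powr (1 / p)"
        unfolding powr_powr p by simp
      also have "(?L powr (q - 2)) powr (1 / q) = (4 * pi) powr (- (2 / q)) * \<bar>s - t\<bar> powr (- (2 / q))"
      proof -
        let ?y = "4 * pi * \<bar>s - t\<bar>"
        have y: "?y > 0" using ts by simp
        have "sqrt ?y ^ DIM('a) = (?y powr (1 / 2)) powr (real DIM('a))"
          using y by (simp add: powr_half_sqrt powr_realpow)
        then have "?L = ?y powr (- (1 / 2 * real DIM('a)))"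
          using powr_minus_divide[of ?y "1 / 2 * real DIM('a)"] by (simp only: powr_powr)
        then have "(?L powr (q - 2)) powr (1 / q) = ?y powr (- (1 / 2 * real DIM('a)) * (q - 2) * (1 / q))"
          by (simp only: powr_powr)
        also have "- (1 / 2 * real DIM('a)) * (q - 2) * (1 / q) = - (2 / q)"
        proof -
          have "real DIM('a) * (q - 2) = 4" using d unfolding q by simp
          then show ?thesis using q2 by (simp add: field_simps)
        qed
        finally show ?thesis by (simp add: powr_mult)
      qed
      finally show ?thesis by (simp add: mult_ac)
    qed
    finally show ?thesis using c0 X0 by (subst (asm) ennreal_le_iff) (auto intro!: mult_nonneg_nonneg)
  qed
  then show ?thesis unfolding back_propagate_inner(1)[OF e bs bs] .
qed

text \<open>The dual function is \<open>\<Phi> = |U|^(q - 2) U\<close>, truncated. With \<open>N\<close> the truncated integral of \<open>|U|^q\<close>, duality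
  gives \<open>N\<^sup>2 \<le> D \<parallel>f\<parallel>\<^sup>2 N^(2/p)\<close>, and since \<open>2/p + 2/q = 2\<close> this is a bound for \<open>N\<close>, because the
  truncation makes \<open>N\<close> finite.\<close>

theorem strichartz:
  fixes q :: real
  assumes q: "q = 2 + 4 / DIM('a)"
  obtains C where "C > 0"
    "\<And>(f::'a::euclidean_space \<Rightarrow> complex) e. e > 0 \<Longrightarrow> f \<in> borel_measurable borel \<Longrightarrow> integrable lborel (\<lambda>x. (cmod (f x))\<^sup>2) \<Longrightarrow>
      (\<integral>\<^sup>+t. \<integral>\<^sup>+x. ennreal (cmod (propagate (ctime e t) f x) powr q) \<partial>lborel \<partial>lborel)
        \<le> ennreal (C * (\<integral>x. (cmod (f x))\<^sup>2 \<partial>lborel) powr (q / 2))"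
proof -
  have d: "real DIM('a) > 0" by simp
  have q2: "q > 2" using d unfolding q by simp
  define p where "p = q / (q - 1)"
  have p1: "p > 1" "1 / p + 1 / q = 1" "(q - 1) * p = q" using q2 unfolding p_def by (auto simp: field_simps)
  define c0 where "c0 = (4 * q / (q - 2) * 2 powr (q - 2)) powr (1 / q) * (4 * pi) powr (- (2 / q))"
  define D where "D = c0 * (2 * (2 / (1 - 2 / q) + 3))"
  have c0: "c0 > 0" using q2 by (simp add: c0_def)
  have D0: "D > 0" using c0 q2 unfolding D_def by (intro mult_pos_pos add_pos_pos divide_pos_pos) auto
  show ?thesis
  proof (rule that[of "D powr (q / 2)"])
    show "D powr (q / 2) > 0" using D0 by simp
    fix f :: "'a \<Rightarrow> complex" and e :: real
    assume e: "e > 0" and [measurable]: "f \<in> borel_measurable borel" and f2: "integrable lborel (\<lambda>x. (cmod (f x))\<^sup>2)"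
    define U where "U t x = propagate (ctime e t) f x" for t x
    define F where "F = sqrt (\<integral>x. (cmod (f x))\<^sup>2 \<partial>lborel)"
    have F0: "F \<ge> 0" and F2: "F\<^sup>2 = (\<integral>x. (cmod (f x))\<^sup>2 \<partial>lborel)"
      by (auto simp: F_def intro!: integral_nonneg_AE)
    define B where "B = F * sqrt (1 / sqrt (4 * pi * e) ^ DIM('a))"
    have UB: "cmod (U t x) \<le> B" for t x
      using propagate_L2_bounded(3)[of "ctime e t" f x] e f2 by (simp add: U_def B_def F_def)
    have B0: "B \<ge> 0" using UB[of 0 0] norm_ge_zero[of "U 0 0"] by linarith
    have Um: "(\<lambda>(t, x). U t x) \<in> borel_measurable (lborel \<Otimes>\<^sub>M lborel)"
      unfolding U_def by (rule measurable_propagate_ctime) measurable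
    have Um'[measurable (raw)]: "(\<lambda>p. U (a p) (b p)) \<in> borel_measurable M"
      if [measurable]: "a \<in> borel_measurable M" "b \<in> borel_measurable M" for a b and M :: "'c measure"
    proof -
      have [measurable]: "a \<in> M \<rightarrow>\<^sub>M lborel" "b \<in> M \<rightarrow>\<^sub>M lborel" using that by auto
      show ?thesis using measurable_compose[OF _ Um, of "\<lambda>p. (a p, b p)" M] by simp
    qed
    have bound: "(\<integral>\<^sup>+t. \<integral>\<^sup>+x. ennreal (if \<bar>t\<bar> \<le> real m \<and> norm x \<le> real m then cmod (U t x) powr q else 0) \<partial>lborel \<partial>lborel) \<le> ennreal ((D * F\<^sup>2) powr (q / 2))" for m :: nat
    proof -
      define \<Phi> where "\<Phi> t x = (if \<bar>t\<bar> \<le> real m \<and> norm x \<le> real m then of_real (cmod (U t x) powr (q - 2)) * U t x else 0)" for t :: real and x :: 'a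
      define \<Psi> where "\<Psi> t x = U t x * cnj (\<Phi> t x)" for t x
      have Phi_m: "(\<lambda>(t, x). \<Phi> t x) \<in> borel_measurable (lborel \<Otimes>\<^sub>M lborel)" unfolding \<Phi>_def by measurable
      have nPhi: "cmod (\<Phi> t x) = (if \<bar>t\<bar> \<le> real m \<and> norm x \<le> real m then cmod (U t x) powr (q - 1) else 0)" for t x
      proof -
        have "cmod (U t x) powr (q - 2) * cmod (U t x) = cmod (U t x) powr (q - 1)"
        proof (cases "U t x = 0")
          case False
          then show ?thesis using powr_add[of "cmod (U t x)" "q - 2" 1] by simp
        qed simp
        then show ?thesis by (simp add: \<Phi>_def norm_mult)
      qed
      have Phi_b: "cmod (\<Phi> t x) \<le> B powr (q - 1)" for t x
        unfolding nPhi using UB[of t x] q2 by (auto intro!: powr_mono2)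
      have bs: "bounded_support \<Phi>"
        by (rule bounded_supportI[OF Phi_m Phi_b, where m=m]) (auto simp: \<Phi>_def)
      note [measurable (raw)] = bounded_support_measurable'[OF bs]
      have bsPsi: "bounded_support \<Psi>"
      proof (rule bounded_supportI[where M="B * B powr (q - 1)" and m=m])
        show "(\<lambda>(t, x). \<Psi> t x) \<in> borel_measurable (lborel \<Otimes>\<^sub>M lborel)" unfolding \<Psi>_def by measurable
        show "cmod (\<Psi> t x) \<le> B * B powr (q - 1)" for t x
          unfolding \<Psi>_def norm_mult complex_mod_cnj using B0 by (intro mult_mono UB Phi_b) auto
      qed (auto simp: \<Psi>_def \<Phi>_def)
      have Psi_eq: "\<Psi> t x = of_real (cmod (\<Psi> t x))" "cmod (\<Psi> t x) = (if \<bar>t\<bar> \<le> real m \<and> norm x \<le> real m then cmod (U t x) powr q else 0)" for t x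
      proof -
        have n: "cmod (U t x) powr (q - 2) * (cmod (U t x))\<^sup>2 = cmod (U t x) powr q"
        proof (cases "U t x = 0")
          case False
          then show ?thesis using powr_add[of "cmod (U t x)" "q - 2" 2] by simp
        qed (use q2 in simp)
        have P: "\<Psi> t x = of_real (if \<bar>t\<bar> \<le> real m \<and> norm x \<le> real m then cmod (U t x) powr q else 0)"
        proof -
          have sq: "U t x * cnj (U t x) = of_real ((cmod (U t x))\<^sup>2)" by (rule complex_norm_square[symmetric])
          have "U t x * cnj (of_real (cmod (U t x) powr (q - 2)) * U t x) = of_real (cmod (U t x) powr (q - 2)) * (U t x * cnj (U t x))"
            by (simp add: mult.left_commute)
          also have "\<dots> = of_real (cmod (U t x) powr q)" unfolding sq n[symmetric] by simp
          finally show ?thesis by (simp add: \<Psi>_def \<Phi>_def)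
        qed
        have "0 \<le> (if \<bar>t\<bar> \<le> real m \<and> norm x \<le> real m then cmod (U t x) powr q else 0)" by simp
        with P show "cmod (\<Psi> t x) = (if \<bar>t\<bar> \<le> real m \<and> norm x \<le> real m then cmod (U t x) powr q else 0)"
          by (simp only: norm_of_real abs_of_nonneg)
        then show "\<Psi> t x = of_real (cmod (\<Psi> t x))" using P by simp
      qed
      define N where "N = (\<integral>t. \<integral>x. cmod (\<Psi> t x) \<partial>lborel \<partial>lborel)"
      have N0: "N \<ge> 0" unfolding N_def by (auto intro!: integral_nonneg_AE)
      have Nnn: "(\<integral>\<^sup>+t. \<integral>\<^sup>+x. ennreal (cmod (\<Psi> t x)) \<partial>lborel \<partial>lborel) = ennreal N"
        unfolding N_def by (rule integral_bounded_support[OF bsPsi])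
      have Nc: "of_real N = (\<integral>t. \<integral>x. U t x * cnj (\<Phi> t x) \<partial>lborel \<partial>lborel)"
        unfolding N_def \<Psi>_def[symmetric] using Psi_eq(1) by (simp only: integral_complex_of_real[symmetric])
      have "N \<le> (D * F\<^sup>2) powr (q / 2)"
      proof (cases "N = 0")
        case False
        then have Np: "N > 0" using N0 by simp
        define w where "w = back_propagate e \<Phi>"
        have w: "time_field w" unfolding w_def by (rule back_propagate_time_field[OF e bs])
        let ?V = "time_integral w UNIV"
        define X where "X t = (\<integral>x. cmod (\<Phi> t x) powr p \<partial>lborel)" for t
        have X0: "X t \<ge> 0" for t unfolding X_def by (auto intro!: integral_nonneg_AE)
        have pw: "cmod (\<Phi> t x) powr p = cmod (\<Psi> t x)" for t x
          unfolding nPhi Psi_eq(2) using p1 by (auto simp: powr_powr)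
        have Xnn: "ennreal (X t) = (\<integral>\<^sup>+x. ennreal (cmod (\<Psi> t x)) \<partial>lborel)" for t
          unfolding X_def pw using bounded_support_integrable(1)[OF bsPsi] by (intro nn_integral_eq_integral[symmetric]) auto
        have V: "(\<integral>\<^sup>+y. ennreal ((cmod (?V y))\<^sup>2) \<partial>lborel) \<le> ennreal (c0 * (2 * (2 / (1 - 2 / q) + 3) * N powr (2 / p)))"
        proof (rule hls_time_integral[OF q2 p_def _ w, where \<phi>="\<lambda>t. X t powr (1 / p)"])
          show "(\<lambda>t. X t powr (1 / p)) \<in> borel_measurable borel" unfolding X_def by measurable
          show "cmod (inner_product w w t s) \<le> c0 * (X t powr (1 / p) * X s powr (1 / p) * \<bar>s - t\<bar> powr (- (2 / q)))" if "t \<noteq> s" for t s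
            unfolding w_def X_def c0_def by (rule inner_product_Lp_bound[OF e bs q p_def that])
          have "(X t powr (1 / p)) powr p = X t" for t using X0[of t] p1 by (simp add: powr_powr)
          then show "(\<integral>\<^sup>+t. ennreal ((X t powr (1 / p)) powr p) \<partial>lborel) \<le> ennreal N"
            by (simp add: Xnn Nnn)
        qed (use c0 Np in auto)
        have V': "(\<integral>\<^sup>+y. ennreal ((cmod (?V y))\<^sup>2) \<partial>lborel) \<le> ennreal (D * N powr (2 / p))"
          using V unfolding D_def by (simp only: mult.assoc)
        have Vm[measurable]: "?V \<in> borel_measurable borel" by (rule borel_measurable_time_integral[OF w]) simp
        have V2: "integrable lborel (\<lambda>y. (cmod (?V y))\<^sup>2)" by (rule time_integral_norm(1)[OF w]) simp
        have Vle: "(\<integral>y. (cmod (?V y))\<^sup>2 \<partial>lborel) \<le> D * N powr (2 / p)"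
          using V' V2 D0 by (subst (asm) nn_integral_eq_integral) auto
        have "of_real N = cnj (\<integral>y. ?V y * cnj (f y) \<partial>lborel)"
          unfolding Nc w_def U_def by (rule duality_pairing[OF e _ f2 bs]) measurable
        then have "cmod (of_real N) = cmod (\<integral>y. ?V y * cnj (f y) \<partial>lborel)" by (simp only: complex_mod_cnj)
        then have "N = cmod (\<integral>y. ?V y * cnj (f y) \<partial>lborel)" using N0 by simp
        also have "\<dots> \<le> sqrt (\<integral>y. (cmod (?V y))\<^sup>2 \<partial>lborel) * sqrt (\<integral>y. (cmod (cnj (f y)))\<^sup>2 \<partial>lborel)"
          using V2 f2 by (intro cauchy_schwarz_integral(3)) auto
        also have "\<dots> \<le> sqrt (D * N powr (2 / p)) * F"
          unfolding F_def using Vle D0 by (intro mult_mono) (auto intro!: integral_nonneg_AE)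
        finally have "N\<^sup>2 \<le> (sqrt (D * N powr (2 / p)) * F)\<^sup>2" using N0 by (intro power_mono) auto
        then have "N\<^sup>2 \<le> D * F\<^sup>2 * N powr (2 / p)" using D0 by (simp add: power_mult_distrib mult_ac)
        also have "N\<^sup>2 = N powr (2 / q) * N powr (2 / p)"
        proof -
          have "2 / q + 2 / p = 2" using p1(2) by (simp add: field_simps)
          then show ?thesis using Np by (simp add: powr_add[symmetric])
        qed
        finally have "N powr (2 / q) \<le> D * F\<^sup>2" using Np by simp
        then have "(N powr (2 / q)) powr (q / 2) \<le> (D * F\<^sup>2) powr (q / 2)" using q2 by (intro powr_mono2) auto
        then show ?thesis using q2 Np by (simp add: powr_powr)
      qed simp
      then show ?thesis using Nnn unfolding Psi_eq(2) by (simp add: ennreal_leI)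
    qed
    have "(\<integral>\<^sup>+t. \<integral>\<^sup>+x. ennreal (cmod (U t x) powr q) \<partial>lborel \<partial>lborel) \<le> ennreal ((D * F\<^sup>2) powr (q / 2))"
    proof (rule fatou_double[OF _ _ bound])
      show "(\<lambda>(t, x). ennreal (if \<bar>t\<bar> \<le> real m \<and> norm x \<le> real m then cmod (U t x) powr q else 0)) \<in> borel_measurable (lborel \<Otimes>\<^sub>M lborel)" for m :: nat
        by measurable
      fix t and x :: 'a
      obtain m0 where m0: "max \<bar>t\<bar> (norm x) \<le> real m0" using real_arch_simple by blast
      show "eventually (\<lambda>m. ennreal (cmod (U t x) powr q) \<le> ennreal (if \<bar>t\<bar> \<le> real m \<and> norm x \<le> real m then cmod (U t x) powr q else 0)) sequentially"
        by (rule eventually_sequentiallyI[of m0]) (use m0 in auto)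
    qed
    also have "(D * F\<^sup>2) powr (q / 2) = D powr (q / 2) * (\<integral>x. (cmod (f x))\<^sup>2 \<partial>lborel) powr (q / 2)"
      using D0 F0 by (simp add: powr_mult F2[symmetric])
    finally show "(\<integral>\<^sup>+t. \<integral>\<^sup>+x. ennreal (cmod (propagate (ctime e t) f x) powr q) \<partial>lborel \<partial>lborel) \<le> ennreal (D powr (q / 2) * (\<integral>x. (cmod (f x))\<^sup>2 \<partial>lborel) powr (q / 2))"
      unfolding U_def .
  qed
qed

section \<open>Truncated Gaussians as test functions\<close>

text \<open>The family \<open>s^(-k) exp (-1/s)\<close>, extended by zero, is closed under differentiation up to linear
  combinations, so smoothness of the whole family follows from one computation.\<close>

definition bump :: "nat \<Rightarrow> real \<Rightarrow> real"
  where "bump k s = (if s > 0 then exp (- (1 / s)) / s ^ k else 0)"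

lemma bump_tendsto_zero: "((\<lambda>r. bump k r) \<longlongrightarrow> 0) (at 0)"
proof -
  have "((\<lambda>r. bump k r) \<longlongrightarrow> 0) (at_right 0)"
  proof -
    have "((\<lambda>r::real. (inverse r) ^ k / exp (inverse r)) \<longlongrightarrow> 0) (at_right 0)"
      by (rule filterlim_compose[OF tendsto_power_div_exp_0 filterlim_inverse_at_top_right])
    then show ?thesis
      by (rule Lim_transform_eventually)
        (auto simp: eventually_at_filter bump_def exp_minus field_simps power_inverse intro!: always_eventually)
  qed
  moreover have "((\<lambda>r. bump k r) \<longlongrightarrow> 0) (at_left 0)"
    by (rule Lim_transform_eventually[OF tendsto_const]) (auto simp: eventually_at_filter bump_def)
  ultimately show ?thesis by (simp add: filterlim_at_split)
qed

lemma bump_has_derivative: "(bump k has_real_derivative bump (k + 2) s - real k * bump (k + 1) s) (at s)"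
proof (cases s "0::real" rule: linorder_cases)
  case less
  have "((\<lambda>_. 0) has_real_derivative 0) (at s)" by simp
  then have "(bump k has_real_derivative 0) (at s)"
    by (rule has_field_derivative_transform_within_open[where S="{..<0}"]) (use less in \<open>auto simp: bump_def\<close>)
  then show ?thesis using less by (simp add: bump_def)
next
  case greater
  have "((\<lambda>s. exp (- (1 / s)) / s ^ k) has_real_derivative bump (k + 2) s - real k * bump (k + 1) s) (at s)"
  proof -
    have "((\<lambda>s. exp (- (1 / s)) * inverse s ^ k) has_real_derivative
        exp (- (1 / s)) * (1 / s\<^sup>2) * inverse s ^ k + exp (- (1 / s)) * (real k * inverse s ^ (k - 1) * (- (1 / s\<^sup>2)))) (at s)"
      using greater by (auto intro!: derivative_eq_intros simp: power2_eq_square divide_inverse mult_ac)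
    moreover have "exp (- (1 / s)) * (1 / s\<^sup>2) * inverse s ^ k + exp (- (1 / s)) * (real k * inverse s ^ (k - 1) * (- (1 / s\<^sup>2))) = bump (k + 2) s - real k * bump (k + 1) s"
    proof (cases k)
      case (Suc j)
      then show ?thesis using greater by (simp add: bump_def power_inverse power2_eq_square field_simps)
    qed (use greater in \<open>simp add: bump_def power2_eq_square\<close>)
    ultimately show ?thesis by (simp add: power_inverse divide_inverse)
  qed
  then show ?thesis
    by (rule has_field_derivative_transform_within_open[where S="{0<..}"]) (use greater in \<open>auto simp: bump_def\<close>)
next
  case equal
  have "((\<lambda>r. (bump k r - bump k 0) / (r - 0)) \<longlongrightarrow> 0) (at 0)"
    by (rule Lim_transform_eventually[OF bump_tendsto_zero[of "k + 1"]])
      (auto simp: eventually_at_filter bump_def intro!: always_eventually)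
  then show ?thesis using equal by (simp add: has_field_derivative_iff bump_def)
qed

lemma bump_nonneg: "bump k s \<ge> 0"
  by (simp add: bump_def)

lemma bump_zero_le_1: "bump 0 s \<le> 1"
  by (simp add: bump_def)

lemma continuous_bump: "continuous_on S (bump k)"
  by (rule continuous_at_imp_continuous_on) (auto intro: DERIV_isCont bump_has_derivative)

lemma bump_bounded:
  obtains M where "M \<ge> 0" "\<And>s. s \<le> 1 \<Longrightarrow> bump k s \<le> M"
proof -
  have "compact (bump k ` {0..1})" by (intro compact_continuous_image continuous_bump compact_Icc)
  then have "bounded (bump k ` {0..1})" by (rule compact_imp_bounded)
  then obtain M where M: "\<forall>x\<in>bump k ` {0..1}. norm x \<le> M" unfolding bounded_iff by blast
  have "bump k s \<le> max M 0" if "s \<le> 1" for s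
  proof (cases "s \<ge> 0")
    case True
    then have "norm (bump k s) \<le> M" using M that by auto
    then show ?thesis by simp
  qed (simp add: bump_def)
  then show ?thesis by (intro that[of "max M 0"]) auto
qed

text \<open>Test functions require all iterated partial derivatives. This class is closed under taking partial
  derivatives, which yields all orders by induction on the list of directions.\<close>

inductive elementary_smooth :: "('a::euclidean_space \<Rightarrow> complex) \<Rightarrow> bool" where
  const: "elementary_smooth (\<lambda>x. c)"
| coordinate: "elementary_smooth (\<lambda>x. of_real (x \<bullet> b))"
| add: "elementary_smooth f \<Longrightarrow> elementary_smooth g \<Longrightarrow> elementary_smooth (\<lambda>x. f x + g x)"
| mult: "elementary_smooth f \<Longrightarrow> elementary_smooth g \<Longrightarrow> elementary_smooth (\<lambda>x. f x * g x)"
| exp: "elementary_smooth f \<Longrightarrow> elementary_smooth (\<lambda>x. exp (f x))"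
| bump: "elementary_smooth (\<lambda>x. of_real (bump k (1 - (norm x)\<^sup>2 / R\<^sup>2)))"

lemma bump_radial_has_derivative:
  "((\<lambda>x::'a::euclidean_space. complex_of_real (bump k (1 - (norm x)\<^sup>2 / R\<^sup>2))) has_derivative
    (\<lambda>v. of_real ((bump (k + 2) (1 - (norm x)\<^sup>2 / R\<^sup>2) - real k * bump (k + 1) (1 - (norm x)\<^sup>2 / R\<^sup>2)) * (- 2 / R\<^sup>2) * (x \<bullet> v)))) (at x)"
proof -
  have "((\<lambda>x::'a. 1 - c * (x \<bullet> x)) has_derivative (\<lambda>v. - (c * (x \<bullet> v + v \<bullet> x)))) (at x)" for c
    by (auto intro!: derivative_eq_intros)
  from this[of "1 / R\<^sup>2"] have r: "((\<lambda>x::'a. 1 - (norm x)\<^sup>2 / R\<^sup>2) has_derivative (\<lambda>v. (- 2 / R\<^sup>2) * (x \<bullet> v))) (at x)"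
    by (simp add: power2_norm_eq_inner inner_commute)
  have "(bump k has_derivative (\<lambda>v. v * (bump (k + 2) (1 - (norm x)\<^sup>2 / R\<^sup>2) - real k * bump (k + 1) (1 - (norm x)\<^sup>2 / R\<^sup>2)))) (at (1 - (norm x)\<^sup>2 / R\<^sup>2))"
    using bump_has_derivative[of k "1 - (norm x)\<^sup>2 / R\<^sup>2"] by (simp add: has_field_derivative_def mult.commute[of _ "_ - _"])
  from has_derivative_of_real[OF diff_chain_at[OF r this], where 'a=complex]
  have "((\<lambda>x::'a. complex_of_real (bump k (1 - (norm x)\<^sup>2 / R\<^sup>2))) has_derivative
    (\<lambda>v. of_real ((- 2 / R\<^sup>2) * (x \<bullet> v) * (bump (k + 2) (1 - (norm x)\<^sup>2 / R\<^sup>2) - real k * bump (k + 1) (1 - (norm x)\<^sup>2 / R\<^sup>2))))) (at x)"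
    by (simp only: comp_def)
  then show ?thesis by (simp only: mult_ac)
qed

lemma elementary_smooth_derivative:
  assumes "elementary_smooth (f :: 'a::euclidean_space \<Rightarrow> complex)"
  shows "\<exists>D. (\<forall>x. (f has_derivative D x) (at x)) \<and> (\<forall>b. elementary_smooth (\<lambda>x. D x b))"
  using assms
proof induction
  case (const c)
  show ?case by (intro exI[of _ "\<lambda>x v. 0"]) (auto intro: elementary_smooth.intros)
next
  case (coordinate b)
  have "((\<lambda>x::'a. complex_of_real (x \<bullet> b)) has_derivative (\<lambda>v. of_real (v \<bullet> b))) (at x)" for x
    by (auto intro!: derivative_eq_intros)
  then show ?case by (intro exI[of _ "\<lambda>x v. of_real (v \<bullet> b)"]) (auto intro: elementary_smooth.intros)
next
  case (add f g)
  then obtain D E where D: "\<forall>x. (f has_derivative D x) (at x)" "\<forall>b. elementary_smooth (\<lambda>x. D x b)"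
    and E: "\<forall>x. (g has_derivative E x) (at x)" "\<forall>b. elementary_smooth (\<lambda>x. E x b)" by blast
  show ?case
    using D E by (intro exI[of _ "\<lambda>x v. D x v + E x v"]) (auto intro: elementary_smooth.intros has_derivative_add)
next
  case (mult f g)
  then obtain D E where D: "\<forall>x. (f has_derivative D x) (at x)" "\<forall>b. elementary_smooth (\<lambda>x. D x b)"
    and E: "\<forall>x. (g has_derivative E x) (at x)" "\<forall>b. elementary_smooth (\<lambda>x. E x b)" by blast
  show ?case
    using D E mult by (intro exI[of _ "\<lambda>x v. f x * E x v + D x v * g x"]) (auto intro!: elementary_smooth.intros has_derivative_mult)
next
  case (exp f)
  then obtain D where D: "\<forall>x. (f has_derivative D x) (at x)" "\<forall>b. elementary_smooth (\<lambda>x. D x b)" by blast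
  have "((\<lambda>x. exp (f x)) has_derivative (\<lambda>v. exp (f x) * D x v)) (at x)" for x
  proof -
    have "(exp has_derivative (\<lambda>v. exp (f x) * v)) (at (f x))"
      using DERIV_exp[of "f x"] by (simp add: has_field_derivative_def)
    from diff_chain_at[OF D(1)[rule_format, of x] this] show ?thesis by (simp add: comp_def)
  qed
  then show ?case
    using D exp by (intro exI[of _ "\<lambda>x v. exp (f x) * D x v"]) (auto intro!: elementary_smooth.intros)
next
  case (bump k R)
  let ?r = "\<lambda>x::'a. 1 - (norm x)\<^sup>2 / R\<^sup>2"
  let ?D = "\<lambda>x v. complex_of_real ((bump (k + 2) (?r x) - real k * bump (k + 1) (?r x)) * (- 2 / R\<^sup>2) * (x \<bullet> v))"
  have eq: "?D x b = (of_real (bump (k + 2) (?r x)) + (- of_real (real k)) * of_real (bump (k + 1) (?r x))) * of_real (- 2 / R\<^sup>2) * of_real (x \<bullet> b)" for x b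
    by simp
  show ?case
  proof (intro exI[of _ ?D] conjI allI)
    show "((\<lambda>x. complex_of_real (bump k (?r x))) has_derivative ?D x) (at x)" for x
      by (rule bump_radial_has_derivative)
    show "elementary_smooth (\<lambda>x. ?D x b)" for b
      unfolding eq by (intro elementary_smooth.intros)
  qed
qed

lemma partial_derivative_eq:
  assumes "(f has_derivative D) (at x)"
  shows "partial_derivative b f x = D b"
  using frechet_derivative_at[OF assms] by (simp add: partial_derivative_def)

lemma elementary_smooth_partial:
  assumes "elementary_smooth f"
  shows "f differentiable_on UNIV" and "elementary_smooth (partial_derivative b f)"
proof -
  obtain D where D: "\<forall>x. (f has_derivative D x) (at x)" "\<forall>b. elementary_smooth (\<lambda>x. D x b)"
    using elementary_smooth_derivative[OF assms] by blast
  show "f differentiable_on UNIV" using D(1) by (auto simp: differentiable_on_def differentiable_def)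
  have "partial_derivative b f = (\<lambda>x. D x b)" using D(1) partial_derivative_eq by blast
  then show "elementary_smooth (partial_derivative b f)" using D(2) by simp
qed

lemma elementary_smooth_iterated: "elementary_smooth f \<Longrightarrow> elementary_smooth (foldr partial_derivative bs f)"
  by (induction bs) (auto intro: elementary_smooth_partial)

lemma elementary_smooth_sum: "finite A \<Longrightarrow> (\<And>a. a \<in> A \<Longrightarrow> elementary_smooth (f a)) \<Longrightarrow> elementary_smooth (\<lambda>x. \<Sum>a\<in>A. f a x)"
  by (induction A rule: finite_induct) (auto intro: elementary_smooth.intros)

text \<open>A smooth function supported in the ball of radius \<open>R\<close>. As \<open>R\<close> grows, the cutoff tends to \<open>bump 0 1 = exp (-1)\<close>.\<close>

definition cutoff_gaussian :: "real \<Rightarrow> complex \<Rightarrow> 'a::euclidean_space \<Rightarrow> 'a \<Rightarrow> complex"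
  where "cutoff_gaussian R \<zeta> y x = of_real (bump 0 (1 - (norm x)\<^sup>2 / R\<^sup>2)) * exp (- \<zeta> * of_real ((norm (x - y))\<^sup>2))"

lemma test_function_cutoff_gaussian:
  assumes R: "R > 0"
  shows "test_function (cutoff_gaussian R \<zeta> (y::'a::euclidean_space))"
proof -
  have n: "complex_of_real ((norm (x - y))\<^sup>2) = (\<Sum>b\<in>Basis. (of_real (x \<bullet> b) + of_real (- (y \<bullet> b))) * (of_real (x \<bullet> b) + of_real (- (y \<bullet> b))))" for x
  proof -
    have "(norm (x - y))\<^sup>2 = (\<Sum>b\<in>Basis. ((x - y) \<bullet> b) * ((x - y) \<bullet> b))"
      by (simp only: power2_norm_eq_inner euclidean_inner[of "x - y" "x - y"])
    then show ?thesis by (simp add: inner_diff_left)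
  qed
  have sm: "elementary_smooth (cutoff_gaussian R \<zeta> y)"
    unfolding cutoff_gaussian_def[abs_def] n by (intro elementary_smooth.intros elementary_smooth_sum) auto
  have "{x. cutoff_gaussian R \<zeta> y x \<noteq> 0} \<subseteq> cball 0 R"
  proof
    fix x assume "x \<in> {x. cutoff_gaussian R \<zeta> y x \<noteq> 0}"
    then have "1 - (norm x)\<^sup>2 / R\<^sup>2 > 0" by (auto simp: cutoff_gaussian_def bump_def split: if_splits)
    then have "(norm x)\<^sup>2 < R\<^sup>2" using R by (simp add: field_simps)
    then show "x \<in> cball 0 R" using R by (simp add: power2_less_imp_less less_imp_le)
  qed
  then have "bounded {x. cutoff_gaussian R \<zeta> y x \<noteq> 0}" using bounded_cball bounded_subset by blast
  then show ?thesis
    unfolding test_function_def using elementary_smooth_iterated[OF sm] elementary_smooth_partial(1) by (auto simp: compact_closure)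
qed

text \<open>The first summand is the cutoff times the Laplacian of the Gaussian; the remaining summands involve
  derivatives of the cutoff.\<close>

lemma laplacian_cutoff_gaussian:
  fixes x y :: "'a::euclidean_space"
  shows "laplacian (cutoff_gaussian R \<zeta> y) x =
    (of_real (bump 0 (1 - (norm x)\<^sup>2 / R\<^sup>2)) * (4 * \<zeta>\<^sup>2 * of_real ((norm (x - y))\<^sup>2) - 2 * of_nat DIM('a) * \<zeta>)
     + (of_real (- 2 * real DIM('a) / R\<^sup>2 * bump 2 (1 - (norm x)\<^sup>2 / R\<^sup>2)
         + 4 * (norm x)\<^sup>2 / R^4 * (bump 4 (1 - (norm x)\<^sup>2 / R\<^sup>2) - 2 * bump 3 (1 - (norm x)\<^sup>2 / R\<^sup>2)))
        + 8 * \<zeta> * of_real (x \<bullet> (x - y) / R\<^sup>2 * bump 2 (1 - (norm x)\<^sup>2 / R\<^sup>2))))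
    * exp (- \<zeta> * of_real ((norm (x - y))\<^sup>2))"
proof -
  let ?r = "\<lambda>x::'a. 1 - (norm x)\<^sup>2 / R\<^sup>2"
  define G where "G x = exp (- \<zeta> * of_real ((norm (x - y))\<^sup>2))" for x :: 'a
  have dG: "(G has_derivative (\<lambda>v. - 2 * \<zeta> * of_real ((x - y) \<bullet> v) * G x)) (at x)" for x
  proof -
    have "((\<lambda>x::'a. (x - y) \<bullet> (x - y)) has_derivative (\<lambda>v. (x - y) \<bullet> v + v \<bullet> (x - y))) (at x)"
      by (auto intro!: derivative_eq_intros)
    then have "((\<lambda>x::'a. (norm (x - y))\<^sup>2) has_derivative (\<lambda>v. 2 * ((x - y) \<bullet> v))) (at x)"
      by (simp add: power2_norm_eq_inner inner_commute)
    from has_derivative_mult_right[OF has_derivative_of_real[OF this], of "- \<zeta>"]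
    have 1: "((\<lambda>x. - \<zeta> * of_real ((norm (x - y))\<^sup>2)) has_derivative (\<lambda>v. - \<zeta> * of_real (2 * ((x - y) \<bullet> v)))) (at x)" .
    have "(exp has_derivative (\<lambda>v. exp (- \<zeta> * of_real ((norm (x - y))\<^sup>2)) * v)) (at (- \<zeta> * of_real ((norm (x - y))\<^sup>2)))"
      using DERIV_exp[of "- \<zeta> * of_real ((norm (x - y))\<^sup>2)"] by (simp add: has_field_derivative_def)
    from diff_chain_at[OF 1 this] show ?thesis by (simp add: comp_def G_def[abs_def] mult_ac)
  qed
  define h where "h k x = complex_of_real (bump k (?r x))" for k x
  define c where "c = complex_of_real (- 2 / R\<^sup>2)"
  have dh0: "(h 0 has_derivative (\<lambda>v. c * of_real (x \<bullet> v) * h 2 x)) (at x)" for x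
    using bump_radial_has_derivative[of 0 R x] by (simp add: h_def[abs_def] c_def mult_ac numeral_2_eq_2)
  have dh2: "(h 2 has_derivative (\<lambda>v. c * of_real (x \<bullet> v) * (h 4 x - 2 * h 3 x))) (at x)" for x
    using bump_radial_has_derivative[of 2 R x] by (simp add: h_def[abs_def] c_def mult_ac right_diff_distrib)
  have cg: "cutoff_gaussian R \<zeta> y = (\<lambda>x. h 0 x * G x)" by (auto simp: cutoff_gaussian_def h_def G_def)
  have p1: "partial_derivative b (cutoff_gaussian R \<zeta> y) x = c * (of_real (x \<bullet> b) * (h 2 x * G x)) + (- 2 * \<zeta>) * (of_real ((x - y) \<bullet> b) * (h 0 x * G x))" for b x
    unfolding cg partial_derivative_eq[OF has_derivative_mult[OF dh0 dG]] by (simp add: algebra_simps)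
  have p2: "partial_derivative b (partial_derivative b (cutoff_gaussian R \<zeta> y)) x =
      (c * h 2 x + c\<^sup>2 * of_real ((x \<bullet> b) * (x \<bullet> b)) * (h 4 x - 2 * h 3 x) + 2 * (c * (- 2 * \<zeta>)) * of_real ((x \<bullet> b) * ((x - y) \<bullet> b)) * h 2 x
        + (- 2 * \<zeta>) * h 0 x + (4 * \<zeta>\<^sup>2) * of_real (((x - y) \<bullet> b) * ((x - y) \<bullet> b)) * h 0 x) * G x" if b: "b \<in> Basis" for b x
  proof -
    have co: "((\<lambda>x::'a. complex_of_real (x \<bullet> b)) has_derivative (\<lambda>v. of_real (v \<bullet> b))) (at x)"
      "((\<lambda>x::'a. complex_of_real ((x - y) \<bullet> b)) has_derivative (\<lambda>v. of_real (v \<bullet> b))) (at x)"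
      by (auto intro!: derivative_eq_intros)
    have pd: "partial_derivative b (cutoff_gaussian R \<zeta> y) = (\<lambda>x. c * (of_real (x \<bullet> b) * (h 2 x * G x)) + (- 2 * \<zeta>) * (of_real ((x - y) \<bullet> b) * (h 0 x * G x)))"
      using p1 by blast
    have bb: "b \<bullet> b = 1" using b by (simp add: inner_Basis)
    show ?thesis
      unfolding pd partial_derivative_eq[OF has_derivative_add[OF has_derivative_mult_right[OF has_derivative_mult[OF co(1) has_derivative_mult[OF dh2 dG]]]
            has_derivative_mult_right[OF has_derivative_mult[OF co(2) has_derivative_mult[OF dh0 dG]]]]]
      by (simp add: bb algebra_simps power2_eq_square)
  qed
  have s1: "(\<Sum>b\<in>Basis. (x \<bullet> b) * (x \<bullet> b)) = (norm x)\<^sup>2" "(\<Sum>b\<in>Basis. (x \<bullet> b) * ((x - y) \<bullet> b)) = x \<bullet> (x - y)"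
    "(\<Sum>b\<in>Basis. ((x - y) \<bullet> b) * ((x - y) \<bullet> b)) = (norm (x - y))\<^sup>2"
    by (simp_all only: power2_norm_eq_inner euclidean_inner[symmetric])
  have "laplacian (cutoff_gaussian R \<zeta> y) x = (\<Sum>b\<in>Basis. (c * h 2 x + c\<^sup>2 * of_real ((x \<bullet> b) * (x \<bullet> b)) * (h 4 x - 2 * h 3 x) + 2 * (c * (- 2 * \<zeta>)) * of_real ((x \<bullet> b) * ((x - y) \<bullet> b)) * h 2 x
        + (- 2 * \<zeta>) * h 0 x + (4 * \<zeta>\<^sup>2) * of_real (((x - y) \<bullet> b) * ((x - y) \<bullet> b)) * h 0 x) * G x)"
    unfolding laplacian_def using p2 by simp
  also have "\<dots> = (of_nat DIM('a) * (c * h 2 x) + c\<^sup>2 * of_real ((norm x)\<^sup>2) * (h 4 x - 2 * h 3 x) + 2 * (c * (- 2 * \<zeta>)) * of_real (x \<bullet> (x - y)) * h 2 x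
        + of_nat DIM('a) * ((- 2 * \<zeta>) * h 0 x) + (4 * \<zeta>\<^sup>2) * of_real ((norm (x - y))\<^sup>2) * h 0 x) * G x"
    unfolding s1[symmetric] of_real_sum sum_distrib_right[symmetric] sum_distrib_left[symmetric] sum.distrib sum_constant
    by (simp only: sum_distrib_left sum_distrib_right mult_ac)
  also have "\<dots> = (h 0 x * (4 * \<zeta>\<^sup>2 * of_real ((norm (x - y))\<^sup>2) - 2 * of_nat DIM('a) * \<zeta>)
     + ((of_nat DIM('a) * c * h 2 x + c\<^sup>2 * of_real ((norm x)\<^sup>2) * (h 4 x - 2 * h 3 x))
        + 8 * \<zeta> * (- c / 2 * of_real (x \<bullet> (x - y)) * h 2 x))) * G x"
    by (simp add: algebra_simps)
  also have "of_nat DIM('a) * c * h 2 x + c\<^sup>2 * of_real ((norm x)\<^sup>2) * (h 4 x - 2 * h 3 x) =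
      of_real (- 2 * real DIM('a) / R\<^sup>2 * bump 2 (?r x) + 4 * (norm x)\<^sup>2 / R^4 * (bump 4 (?r x) - 2 * bump 3 (?r x)))"
    unfolding c_def h_def by (simp add: power_divide flip: power_mult)
  also have "- c / 2 * of_real (x \<bullet> (x - y)) * h 2 x = of_real (x \<bullet> (x - y) / R\<^sup>2 * bump 2 (?r x))"
    unfolding c_def h_def by simp
  finally show ?thesis unfolding h_def G_def .
qed

section \<open>Gaussian bounds and solution curves\<close>

text \<open>The coefficient is the one that the Laplacian of the kernel produces: the kernel solves the
  heat equation in complex time.\<close>

lemma heat_kernel_has_field_derivative:
  fixes x :: "'a::euclidean_space"
  assumes z: "Re z > 0"
  shows "((\<lambda>z. heat_kernel z x) has_field_derivative
    (of_real ((norm x)\<^sup>2) / (4 * z\<^sup>2) - of_nat DIM('a) / (2 * z)) * heat_kernel z x) (at z)"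
proof -
  have z0: "z \<noteq> 0" using z by auto
  define c where "c z = csqrt (of_real (4 * pi) * z)" for z
  have c2: "c z * c z = of_real (4 * pi) * z" by (simp add: c_def flip: power2_eq_square)
  have c0: "c z \<noteq> 0" using z0 by (simp add: c_def)
  have "of_real (4 * pi) * z \<notin> \<real>\<^sub>\<le>\<^sub>0" using z pi_gt_zero by (auto simp: complex_nonpos_Reals_iff mult_le_0_iff simp del: pi_gt_zero)
  then have "(c has_field_derivative inverse (2 * c z) * of_real (4 * pi)) (at z)"
    unfolding c_def by (intro DERIV_chain2[OF has_field_derivative_csqrt DERIV_cmult_Id])
  moreover have "inverse (2 * c z) * of_real (4 * pi) = c z / (2 * z)"
    using c2 c0 z0 by (simp add: field_simps)
  ultimately have dc: "(c has_field_derivative c z / (2 * z)) (at z)" by simp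
  obtain m where m: "DIM('a) = Suc m" using DIM_positive[where 'a='a] gr0_implies_Suc by blast
  let ?n = "complex_of_real ((norm x)\<^sup>2)"
  have 1: "((\<lambda>z. exp (- ?n / (4 * z))) has_field_derivative ?n / (4 * z\<^sup>2) * exp (- ?n / (4 * z))) (at z)"
    using z0 by (auto intro!: derivative_eq_intros simp: power2_eq_square)
  have 2: "((\<lambda>z. c z ^ DIM('a)) has_field_derivative of_nat DIM('a) / (2 * z) * c z ^ DIM('a)) (at z)"
  proof -
    have "((\<lambda>z. c z ^ DIM('a)) has_field_derivative of_nat DIM('a) * (c z / (2 * z) * c z ^ (DIM('a) - Suc 0))) (at z)"
      by (rule DERIV_power[OF dc])
    moreover have "of_nat DIM('a) * (c z / (2 * z) * c z ^ (DIM('a) - Suc 0)) = of_nat DIM('a) / (2 * z) * c z ^ DIM('a)"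
      unfolding m by (simp add: mult_ac)
    ultimately show ?thesis by (simp only:)
  qed
  have "((\<lambda>z. exp (- ?n / (4 * z)) / c z ^ DIM('a)) has_field_derivative
     (?n / (4 * z\<^sup>2) * exp (- ?n / (4 * z)) * c z ^ DIM('a) - exp (- ?n / (4 * z)) * (of_nat DIM('a) / (2 * z) * c z ^ DIM('a))) / (c z ^ DIM('a) * c z ^ DIM('a))) (at z)"
    by (rule DERIV_divide[OF 1 2]) (use c0 in simp)
  moreover have alg: "(a * g * p - g * (b * p)) / (p * p) = (a - b) * (g / p)" if "p \<noteq> 0" for a b g p :: complex
    using that by (simp add: field_simps)
  ultimately show ?thesis
    unfolding heat_kernel_def c_def[symmetric] using c0 by (simp only: alg power_not_zero not_False_eq_True)
qed

text \<open>A common majorant, uniform for times in a compact set, of the kernel and of its time derivative.\<close>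

definition gaussian_weight :: "real \<Rightarrow> 'a::euclidean_space \<Rightarrow> 'a \<Rightarrow> real"
  where "gaussian_weight \<beta> y x = (1 + norm (x - y))\<^sup>2 * exp (- \<beta> * (norm (x - y))\<^sup>2)"

lemma gaussian_weight_measurable [measurable]: "gaussian_weight \<beta> y \<in> borel_measurable borel"
  unfolding gaussian_weight_def by measurable

lemma gaussian_weight_nonneg: "gaussian_weight \<beta> y x \<ge> 0"
  by (simp add: gaussian_weight_def)

lemma lebesgue_measurable_of_borel:
  "g \<in> borel_measurable borel \<Longrightarrow> g \<in> borel_measurable lebesgue"
  by (intro measurable_completion) simp

lemma integrable_lebesgue_iff_lborel:
  fixes g :: "'a::euclidean_space \<Rightarrow> 'b::{banach, second_countable_topology}"
  assumes "g \<in> borel_measurable borel"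
  shows "integrable lebesgue g \<longleftrightarrow> integrable lborel g"
  using assms by (intro integrable_completion) simp

lemma gaussian_weight_L2:
  assumes b: "\<beta> > 0"
  shows "integrable lborel (\<lambda>x::'a::euclidean_space. (gaussian_weight \<beta> y x)\<^sup>2)"
proof (rule Bochner_Integration.integrable_bound)
  let ?C = "2 + 8 / \<beta>"
  have "integrable lborel (\<lambda>x::'a. exp (- \<beta> * (norm (- y + x))\<^sup>2))"
    by (rule integrable_translate[OF integrable_gaussian[OF b]])
  then show "integrable lborel (\<lambda>x::'a. ?C\<^sup>2 * exp (- \<beta> * (norm (x - y))\<^sup>2))"
    by (intro integrable_mult_right) simp
  show "AE x in lborel. norm ((gaussian_weight \<beta> y x)\<^sup>2) \<le> norm (?C\<^sup>2 * exp (- \<beta> * (norm (x - y))\<^sup>2))"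
  proof (rule AE_I2)
    fix x :: 'a
    have "gaussian_weight \<beta> y x \<le> ?C * exp (- (\<beta> / 2) * (norm (x - y))\<^sup>2)"
      using quadratic_gaussian_le[OF b, of "norm (x - y)" 0] by (simp add: gaussian_weight_def)
    then have "(gaussian_weight \<beta> y x)\<^sup>2 \<le> (?C * exp (- (\<beta> / 2) * (norm (x - y))\<^sup>2))\<^sup>2"
      by (intro power_mono gaussian_weight_nonneg)
    also have "\<dots> = ?C\<^sup>2 * exp (- \<beta> * (norm (x - y))\<^sup>2)"
      by (simp add: power_mult_distrib exp_double[symmetric])
    finally show "norm ((gaussian_weight \<beta> y x)\<^sup>2) \<le> norm (?C\<^sup>2 * exp (- \<beta> * (norm (x - y))\<^sup>2))" by simp
  qed
qed simp

text \<open>On the set \<open>\<delta> \<le> Re z\<close>, \<open>|z| \<le> A\<close> the rate \<open>Re z / (4 |z|\<^sup>2)\<close> of Gaussian decay is at least \<open>\<beta>\<close>.\<close>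

lemma heat_kernel_box_bounds:
  fixes x y :: "'a::euclidean_space"
  assumes dl: "\<delta> > 0" and z: "\<delta> \<le> Re z" "cmod z \<le> A"
  defines "c0 \<equiv> 1 / sqrt (4 * pi * \<delta>) ^ DIM('a)" and "\<beta> \<equiv> \<delta> / (4 * A\<^sup>2)"
  shows "cmod (heat_kernel z (x - y)) \<le> c0 * exp (- \<beta> * (norm (x - y))\<^sup>2)"
    and "cmod (heat_kernel z (x - y)) \<le> c0 * gaussian_weight \<beta> y x"
    and "cmod ((of_real ((norm (x - y))\<^sup>2) / (4 * z\<^sup>2) - of_nat DIM('a) / (2 * z)) * heat_kernel z (x - y)) \<le>
      (1 / (4 * \<delta>\<^sup>2) + real DIM('a) / (2 * \<delta>)) * c0 * gaussian_weight \<beta> y x"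
proof -
  have zd: "\<delta> \<le> cmod z" using z(1) complex_Re_le_cmod[of z] by linarith
  have A0: "A > 0" using zd dl z by linarith
  have b: "\<beta> \<le> Re z / (4 * (cmod z)\<^sup>2)"
    unfolding \<beta>_def using dl z zd by (intro frac_le mult_left_mono power_mono) auto
  have c00: "c0 \<ge> 0" using dl by (simp add: c0_def)
  show 1: "cmod (heat_kernel z (x - y)) \<le> c0 * exp (- \<beta> * (norm (x - y))\<^sup>2)"
  proof -
    have "exp (- (Re z / (4 * (cmod z)\<^sup>2)) * (norm (x - y))\<^sup>2) \<le> exp (- \<beta> * (norm (x - y))\<^sup>2)"
      using mult_right_mono[OF b zero_le_power2[of "norm (x - y)"]] by simp
    moreover have "1 / sqrt (4 * pi * cmod z) ^ DIM('a) \<le> c0"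
      unfolding c0_def using dl zd by (intro frac_le power_mono real_sqrt_le_mono) auto
    ultimately have "exp (- (Re z / (4 * (cmod z)\<^sup>2)) * (norm (x - y))\<^sup>2) * (1 / sqrt (4 * pi * cmod z) ^ DIM('a)) \<le> exp (- \<beta> * (norm (x - y))\<^sup>2) * c0"
      using c00 by (intro mult_mono) auto
    then show ?thesis unfolding norm_heat_kernel by (simp add: mult.commute)
  qed
  have w1: "exp (- \<beta> * (norm (x - y))\<^sup>2) \<le> gaussian_weight \<beta> y x"
    using mult_right_mono[of 1 "(1 + norm (x - y))\<^sup>2" "exp (- \<beta> * (norm (x - y))\<^sup>2)"]
    by (simp add: gaussian_weight_def one_le_power)
  show "cmod (heat_kernel z (x - y)) \<le> c0 * gaussian_weight \<beta> y x"
    using 1 mult_left_mono[OF w1 c00] by linarith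
  have 2: "cmod (of_real ((norm (x - y))\<^sup>2) / (4 * z\<^sup>2) - of_nat DIM('a) / (2 * z)) \<le> (1 / (4 * \<delta>\<^sup>2) + real DIM('a) / (2 * \<delta>)) * (1 + norm (x - y))\<^sup>2"
  proof -
    have "cmod (of_real ((norm (x - y))\<^sup>2) / (4 * z\<^sup>2) - of_nat DIM('a) / (2 * z)) \<le> cmod (of_real ((norm (x - y))\<^sup>2) / (4 * z\<^sup>2)) + cmod (of_nat DIM('a) / (2 * z))"
      by (rule norm_triangle_ineq4)
    also have "\<dots> = (norm (x - y))\<^sup>2 * (1 / (4 * (cmod z)\<^sup>2)) + 1 * (real DIM('a) / (2 * cmod z))"
      by (simp add: norm_divide norm_mult norm_power)
    also have "\<dots> \<le> (1 + norm (x - y))\<^sup>2 * (1 / (4 * \<delta>\<^sup>2)) + (1 + norm (x - y))\<^sup>2 * (real DIM('a) / (2 * \<delta>))"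
      using dl zd by (intro add_mono mult_mono frac_le power_mono mult_left_mono) (auto simp: one_le_power)
    finally show ?thesis by (simp add: algebra_simps)
  qed
  show "cmod ((of_real ((norm (x - y))\<^sup>2) / (4 * z\<^sup>2) - of_nat DIM('a) / (2 * z)) * heat_kernel z (x - y)) \<le>
      (1 / (4 * \<delta>\<^sup>2) + real DIM('a) / (2 * \<delta>)) * c0 * gaussian_weight \<beta> y x"
  proof -
    have "cmod ((of_real ((norm (x - y))\<^sup>2) / (4 * z\<^sup>2) - of_nat DIM('a) / (2 * z)) * heat_kernel z (x - y)) \<le>
       ((1 / (4 * \<delta>\<^sup>2) + real DIM('a) / (2 * \<delta>)) * (1 + norm (x - y))\<^sup>2) * (c0 * exp (- \<beta> * (norm (x - y))\<^sup>2))"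
      unfolding norm_mult using dl by (intro mult_mono 2 1) auto
    then show ?thesis by (simp only: gaussian_weight_def mult_ac)
  qed
qed

lemma square_integrableD:
  assumes "square_integrable f"
  shows "f \<in> borel_measurable lebesgue" "integrable lebesgue (\<lambda>x. (cmod (f x))\<^sup>2)"
  using assms by (auto simp: square_integrable_def)

lemma has_vector_derivative_zeroI:
  fixes f :: "real \<Rightarrow> complex"
  assumes "f t = 0" and ev: "eventually (\<lambda>s. cmod (f s) \<le> \<eta> s * \<bar>s - t\<bar>) (at t)" and lim: "(\<eta> \<longlongrightarrow> 0) (at t)"
  shows "(f has_vector_derivative 0) (at t)"
  unfolding has_vector_derivative_def has_derivative_at2
proof (intro conjI)
  show "bounded_linear (\<lambda>x. x *\<^sub>R (0::complex))" by (simp add: bounded_linear_zero)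
  have "((\<lambda>y. 1 / norm (y - t) * norm (f y - (f t + (y - t) *\<^sub>R 0))) \<longlongrightarrow> 0) (at t)"
  proof (rule Lim_null_comparison[OF _ lim])
    show "eventually (\<lambda>y. norm (1 / norm (y - t) * norm (f y - (f t + (y - t) *\<^sub>R 0))) \<le> \<eta> y) (at t)"
      using ev eventually_neq_at_within[of t t UNIV]
    proof eventually_elim
      case (elim y)
      then show ?case using assms(1) by (simp add: divide_le_eq)
    qed
  qed
  then show "((\<lambda>y. (1 / norm (y - t)) *\<^sub>R (f y - (f t + (y - t) *\<^sub>R 0))) \<longlongrightarrow> 0) (at t)"
    by (subst tendsto_norm_zero_iff[symmetric]) simp
qed

lemma square_integrable_diff:
  assumes "square_integrable f" "square_integrable g"
  shows "square_integrable (\<lambda>x. f x - g x)"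
  unfolding square_integrable_def
proof
  note f = square_integrableD[OF assms(1)] and g = square_integrableD[OF assms(2)]
  note [measurable] = f(1) g(1)
  show "(\<lambda>x. f x - g x) \<in> borel_measurable lebesgue" by measurable
  show "integrable lebesgue (\<lambda>x. (cmod (f x - g x))\<^sup>2)"
  proof (rule Bochner_Integration.integrable_bound)
    show "integrable lebesgue (\<lambda>x. 2 * (cmod (f x))\<^sup>2 + 2 * (cmod (g x))\<^sup>2)" using f g by simp
    show "AE x in lebesgue. norm ((cmod (f x - g x))\<^sup>2) \<le> norm (2 * (cmod (f x))\<^sup>2 + 2 * (cmod (g x))\<^sup>2)"
    proof (rule AE_I2)
      fix x
      have "(cmod (f x - g x))\<^sup>2 \<le> (cmod (f x) + cmod (g x))\<^sup>2" by (intro power_mono norm_triangle_ineq4) auto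
      also have "\<dots> \<le> 2 * (cmod (f x))\<^sup>2 + 2 * (cmod (g x))\<^sup>2"
        using sum_squares_bound[of "cmod (f x)" "cmod (g x)"] by (simp add: power2_sum)
      finally show "norm ((cmod (f x - g x))\<^sup>2) \<le> norm (2 * (cmod (f x))\<^sup>2 + 2 * (cmod (g x))\<^sup>2)" by simp
    qed
  qed measurable
qed

text \<open>Continuity in \<open>L\<^sup>2\<close> gives local boundedness of the norm, and Bolzano's principle makes it uniform on a compact interval.\<close>

lemma solution_locally_bounded:
  fixes u :: "real \<Rightarrow> 'a::euclidean_space \<Rightarrow> complex"
  assumes sq: "\<And>t. square_integrable (u t)"
    and cont: "\<And>t. ((\<lambda>s. \<integral>x. (cmod (u s x - u t x))\<^sup>2 \<partial>lebesgue) \<longlongrightarrow> 0) (at t)" and ab: "a \<le> b"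
  obtains M where "\<And>t. a \<le> t \<Longrightarrow> t \<le> b \<Longrightarrow> (\<integral>x. (cmod (u t x))\<^sup>2 \<partial>lebesgue) \<le> M"
proof -
  let ?N = "\<lambda>t. \<integral>x. (cmod (u t x))\<^sup>2 \<partial>lebesgue"
  have "\<exists>M. \<forall>s. a \<le> s \<and> s \<le> b \<longrightarrow> ?N s \<le> M" using ab
  proof (induction rule: Bolzano)
    case (trans a b c)
    then obtain M M' where "\<forall>s. a \<le> s \<and> s \<le> b \<longrightarrow> ?N s \<le> M" "\<forall>s. b \<le> s \<and> s \<le> c \<longrightarrow> ?N s \<le> M'" by blast
    then have "\<forall>s. a \<le> s \<and> s \<le> c \<longrightarrow> ?N s \<le> max M M'" by (metis linear max.coboundedI1 max.coboundedI2)
    then show ?case by blast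
  next
    case (local t)
    have "eventually (\<lambda>s. (\<integral>x. (cmod (u s x - u t x))\<^sup>2 \<partial>lebesgue) < 1) (at t)"
      using order_tendstoD(2)[OF cont, of 1] by simp
    then obtain d where d: "d > 0" "\<And>s. s \<noteq> t \<Longrightarrow> dist s t < d \<Longrightarrow> (\<integral>x. (cmod (u s x - u t x))\<^sup>2 \<partial>lebesgue) < 1"
      by (auto simp: eventually_at)
    have N: "?N s \<le> 2 * ?N t + 2" if "dist s t < d" for s
    proof (cases "s = t")
      case False
      note 1 = square_integrableD[OF sq[of t]] and 2 = square_integrableD[OF square_integrable_diff[OF sq sq, of s t]]
      have "?N s \<le> (\<integral>x. 2 * (cmod (u t x))\<^sup>2 + 2 * (cmod (u s x - u t x))\<^sup>2 \<partial>lebesgue)"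
      proof (rule integral_mono)
        show "integrable lebesgue (\<lambda>x. (cmod (u s x))\<^sup>2)" by (rule square_integrableD[OF sq])
        show "integrable lebesgue (\<lambda>x. 2 * (cmod (u t x))\<^sup>2 + 2 * (cmod (u s x - u t x))\<^sup>2)" using 1 2 by simp
        fix x
        have "(cmod (u s x))\<^sup>2 \<le> (cmod (u t x) + cmod (u s x - u t x))\<^sup>2"
          using norm_triangle_ineq[of "u t x" "u s x - u t x"] by (intro power_mono) auto
        also have "\<dots> \<le> 2 * (cmod (u t x))\<^sup>2 + 2 * (cmod (u s x - u t x))\<^sup>2"
          using sum_squares_bound[of "cmod (u t x)" "cmod (u s x - u t x)"] by (simp add: power2_sum)
        finally show "(cmod (u s x))\<^sup>2 \<le> 2 * (cmod (u t x))\<^sup>2 + 2 * (cmod (u s x - u t x))\<^sup>2" .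
      qed
      also have "\<dots> = 2 * ?N t + 2 * (\<integral>x. (cmod (u s x - u t x))\<^sup>2 \<partial>lebesgue)" using 1 2 by simp
      also have "\<dots> \<le> 2 * ?N t + 2" using d(2)[OF False that] by simp
      finally show ?thesis .
    qed (simp add: integral_nonneg_AE)
    have "\<exists>M. \<forall>s. a \<le> s \<and> s \<le> b \<longrightarrow> ?N s \<le> M" if "a \<le> t \<and> t \<le> b \<and> b - a < d" for a b
    proof (intro exI allI impI)
      fix s assume "a \<le> s \<and> s \<le> b"
      then show "?N s \<le> 2 * ?N t + 2" using that by (intro N) (auto simp: dist_real_def)
    qed
    then show ?case using d(1) by blast
  qed
  then show ?thesis using that by blast
qed

section \<open>Representation of weak solutions\<close>

text \<open>Up to a factor depending on \<open>z\<close> only, a truncated heat kernel centred at \<open>y\<close> is a test function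
  (\<open>cutoff_kernel_eq_gaussian\<close>).\<close>

definition cutoff_kernel :: "real \<Rightarrow> complex \<Rightarrow> 'a::euclidean_space \<Rightarrow> 'a \<Rightarrow> complex"
  where "cutoff_kernel R z y x = of_real (bump 0 (1 - (norm x)\<^sup>2 / R\<^sup>2)) * heat_kernel z (x - y)"

definition cutoff_kernel_deriv :: "real \<Rightarrow> complex \<Rightarrow> 'a::euclidean_space \<Rightarrow> 'a \<Rightarrow> complex"
  where "cutoff_kernel_deriv R z y x = of_real (bump 0 (1 - (norm x)\<^sup>2 / R\<^sup>2)) *
    ((of_real ((norm (x - y))\<^sup>2) / (4 * z\<^sup>2) - of_nat DIM('a) / (2 * z)) * heat_kernel z (x - y))"

text \<open>The commutator of the Laplacian with the cutoff, applied to the kernel.\<close>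

definition cutoff_error :: "real \<Rightarrow> complex \<Rightarrow> 'a::euclidean_space \<Rightarrow> 'a \<Rightarrow> complex"
  where "cutoff_error R z y x =
    (of_real (- 2 * real DIM('a) / R\<^sup>2 * bump 2 (1 - (norm x)\<^sup>2 / R\<^sup>2)
         + 4 * (norm x)\<^sup>2 / R^4 * (bump 4 (1 - (norm x)\<^sup>2 / R\<^sup>2) - 2 * bump 3 (1 - (norm x)\<^sup>2 / R\<^sup>2)))
        + 2 / z * of_real (x \<bullet> (x - y) / R\<^sup>2 * bump 2 (1 - (norm x)\<^sup>2 / R\<^sup>2))) * heat_kernel z (x - y)"

lemma bump_measurable [measurable]: "bump k \<in> borel_measurable borel"
  by (rule borel_measurable_continuous_onI[OF continuous_bump])

lemma cutoff_measurable [measurable]: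
  "cutoff_kernel R z y \<in> borel_measurable borel"
  "cutoff_kernel_deriv R z y \<in> borel_measurable borel"
  "cutoff_error R z y \<in> borel_measurable borel"
  unfolding cutoff_kernel_def cutoff_kernel_deriv_def cutoff_error_def by measurable

lemma cutoff_kernel_eq_gaussian:
  "cutoff_kernel R z (y::'a::euclidean_space) x =
    1 / csqrt (of_real (4 * pi) * z) ^ DIM('a) * cutoff_gaussian R (1 / (4 * z)) y x"
  unfolding cutoff_kernel_def cutoff_gaussian_def heat_kernel_def by simp

text \<open>The truncated kernel solves the heat equation up to \<open>cutoff_error\<close>.\<close>

lemma laplacian_cutoff_kernel:
  fixes x y :: "'a::euclidean_space"
  assumes "z \<noteq> 0"
  shows "1 / csqrt (of_real (4 * pi) * z) ^ DIM('a) * laplacian (cutoff_gaussian R (1 / (4 * z)) y) x =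
    cutoff_kernel_deriv R z y x + cutoff_error R z y x"
proof -
  have alg: "1 / c * ((f * (4 * w\<^sup>2 * n - 2 * d * w) + (e1 + 8 * w * e2)) * g) =
      f * ((n * (4 * w\<^sup>2) - d * (2 * w)) * (g / c)) + (e1 + 8 * w * e2) * (g / c)" for c f w n d e1 e2 g :: complex
    by (simp add: divide_inverse algebra_simps)
  have w: "4 * (1 / (4 * z))\<^sup>2 = 1 / (4 * z\<^sup>2)" "2 * (1 / (4 * z)) = 1 / (2 * z)" "8 * (1 / (4 * z)) = 2 / z"
    using assms by (auto simp: power2_eq_square field_simps)
  have g: "exp (- (1 / (4 * z)) * of_real ((norm (x - y))\<^sup>2)) / csqrt (of_real (4 * pi) * z) ^ DIM('a) = heat_kernel z (x - y)"
    by (simp add: heat_kernel_def)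
  show ?thesis
    unfolding laplacian_cutoff_gaussian alg g cutoff_kernel_deriv_def cutoff_error_def
    unfolding w by simp
qed

lemma cutoff_kernel_has_derivative:
  assumes "Re z > 0"
  shows "((\<lambda>z. cutoff_kernel R z y x) has_field_derivative cutoff_kernel_deriv R z y x) (at z)"
  unfolding cutoff_kernel_def cutoff_kernel_deriv_def
  by (rule DERIV_cmult[OF heat_kernel_has_field_derivative[OF assms]])

lemma cutoff_kernel_bounds:
  fixes x y :: "'a::euclidean_space"
  assumes dl: "\<delta> > 0" and z: "\<delta> \<le> Re z" "cmod z \<le> A"
  defines "c0 \<equiv> 1 / sqrt (4 * pi * \<delta>) ^ DIM('a)" and "\<beta> \<equiv> \<delta> / (4 * A\<^sup>2)"
  shows "cmod (cutoff_kernel R z y x) \<le> c0 * gaussian_weight \<beta> y x"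
    and "cmod (cutoff_kernel_deriv R z y x) \<le> (1 / (4 * \<delta>\<^sup>2) + real DIM('a) / (2 * \<delta>)) * c0 * gaussian_weight \<beta> y x"
proof -
  have *: "cmod (of_real (bump 0 s) * w) \<le> B" if "cmod w \<le> B" for s w B
  proof -
    have "cmod (of_real (bump 0 s) * w) \<le> 1 * cmod w"
      unfolding norm_mult by (intro mult_right_mono) (auto simp: bump_nonneg bump_zero_le_1)
    then show ?thesis using that by simp
  qed
  show "cmod (cutoff_kernel R z y x) \<le> c0 * gaussian_weight \<beta> y x"
    unfolding cutoff_kernel_def c0_def \<beta>_def by (rule *[OF heat_kernel_box_bounds(2)[OF dl z]])
  show "cmod (cutoff_kernel_deriv R z y x) \<le> (1 / (4 * \<delta>\<^sup>2) + real DIM('a) / (2 * \<delta>)) * c0 * gaussian_weight \<beta> y x"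
    unfolding cutoff_kernel_deriv_def c0_def \<beta>_def by (rule *[OF heat_kernel_box_bounds(3)[OF dl z]])
qed

text \<open>On the support of the cutoff \<open>|x| \<le> R\<close>, so each derivative that falls on the cutoff gains \<open>1/R\<close>. The remaining
  growth in \<open>|x - y|\<close> is absorbed by \<open>gaussian_weight\<close>.\<close>

lemma cutoff_error_bound:
  fixes y :: "'a::euclidean_space"
  assumes dl: "\<delta> > 0"
  obtains C where "C \<ge> 0" "\<And>R z x. R \<ge> 1 \<Longrightarrow> \<delta> \<le> Re z \<Longrightarrow> cmod z \<le> A \<Longrightarrow>
    cmod (cutoff_error R z y x) \<le> C / R * gaussian_weight (\<delta> / (4 * A\<^sup>2)) y x"
proof -
  obtain M2 where M2: "M2 \<ge> 0" "\<And>s. s \<le> 1 \<Longrightarrow> bump 2 s \<le> M2" using bump_bounded[of 2] by blast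
  obtain M3 where M3: "M3 \<ge> 0" "\<And>s. s \<le> 1 \<Longrightarrow> bump 3 s \<le> M3" using bump_bounded[of 3] by blast
  obtain M4 where M4: "M4 \<ge> 0" "\<And>s. s \<le> 1 \<Longrightarrow> bump 4 s \<le> M4" using bump_bounded[of 4] by blast
  define c0 where "c0 = 1 / sqrt (4 * pi * \<delta>) ^ DIM('a)"
  define K1 where "K1 = 2 * real DIM('a) * M2 + 4 * (M4 + 2 * M3)"
  define K2 where "K2 = 2 / \<delta> * M2"
  have pos: "c0 \<ge> 0" "K1 \<ge> 0" "K2 \<ge> 0" using dl M2 M3 M4 by (auto simp: c0_def K1_def K2_def)
  show ?thesis
  proof (rule that)
    show "(K1 + K2) * c0 \<ge> 0" using pos by simp
    fix R :: real and z and x :: 'a assume R: "R \<ge> 1" and z: "\<delta> \<le> Re z" "cmod z \<le> A"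
    let ?\<rho> = "1 - (norm x)\<^sup>2 / R\<^sup>2" and ?r = "norm (x - y)"
    define E where "E = of_real (- 2 * real DIM('a) / R\<^sup>2 * bump 2 ?\<rho> + 4 * (norm x)\<^sup>2 / R^4 * (bump 4 ?\<rho> - 2 * bump 3 ?\<rho>))
        + 2 / z * of_real (x \<bullet> (x - y) / R\<^sup>2 * bump 2 ?\<rho>)"
    have zd: "\<delta> \<le> cmod z" using z(1) complex_Re_le_cmod[of z] by linarith
    have E: "cmod E \<le> (K1 + K2) / R * (1 + ?r)\<^sup>2"
    proof (cases "norm x \<ge> R")
      case True
      then have "(norm x)\<^sup>2 \<ge> R\<^sup>2" using R by (intro power_mono) auto
      then have "?\<rho> \<le> 0" using R by (simp add: le_divide_eq)
      then have "E = 0" by (simp add: E_def bump_def)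
      then show ?thesis using pos R by simp
    next
      case False
      then have xR: "norm x \<le> R" by simp
      have \<rho>1: "?\<rho> \<le> 1" by simp
      note f2 = M2(2)[OF \<rho>1] and f3 = M3(2)[OF \<rho>1] and f4 = M4(2)[OF \<rho>1]
      have RR: "1 / R\<^sup>2 \<le> 1 / R" using R by (intro frac_le) (auto simp: power2_eq_square)
      have a: "\<bar>- 2 * real DIM('a) / R\<^sup>2 * bump 2 ?\<rho>\<bar> \<le> 2 * real DIM('a) * M2 * (1 / R)"
      proof -
        have "\<bar>- 2 * real DIM('a) / R\<^sup>2 * bump 2 ?\<rho>\<bar> = (2 * real DIM('a)) * bump 2 ?\<rho> * (1 / R\<^sup>2)"
          by (simp add: abs_mult bump_nonneg)
        also have "\<dots> \<le> 2 * real DIM('a) * M2 * (1 / R)"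
          using f2 RR M2(1) bump_nonneg[of 2 ?\<rho>] by (intro mult_mono mult_left_mono mult_nonneg_nonneg) auto
        finally show ?thesis .
      qed
      have b: "\<bar>4 * (norm x)\<^sup>2 / R^4 * (bump 4 ?\<rho> - 2 * bump 3 ?\<rho>)\<bar> \<le> 4 * (1 / R) * (M4 + 2 * M3)"
      proof -
        have "(norm x)\<^sup>2 / R^4 \<le> R\<^sup>2 / R^4" using xR R by (intro divide_right_mono power_mono) auto
        also have "\<dots> = 1 / R\<^sup>2" using R by (simp add: field_simps power_numeral_reduce)
        finally have n: "(norm x)\<^sup>2 / R^4 \<le> 1 / R" using RR by linarith
        have "\<bar>4 * (norm x)\<^sup>2 / R^4 * (bump 4 ?\<rho> - 2 * bump 3 ?\<rho>)\<bar> = 4 * ((norm x)\<^sup>2 / R^4) * \<bar>bump 4 ?\<rho> - 2 * bump 3 ?\<rho>\<bar>"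
          by (simp add: abs_mult)
        also have "\<dots> \<le> 4 * (1 / R) * (M4 + 2 * M3)"
          using n f3 f4 bump_nonneg[of 3 ?\<rho>] bump_nonneg[of 4 ?\<rho>] R by (intro mult_mono) auto
        finally show ?thesis .
      qed
      have c: "cmod (2 / z * of_real (x \<bullet> (x - y) / R\<^sup>2 * bump 2 ?\<rho>)) \<le> 2 / \<delta> * (1 / R * ?r * M2)"
      proof -
        have "\<bar>x \<bullet> (x - y)\<bar> \<le> R * ?r"
          using Cauchy_Schwarz_ineq2[of x "x - y"] mult_right_mono[OF xR norm_ge_zero[of "x - y"]] by linarith
        then have "\<bar>x \<bullet> (x - y)\<bar> / R\<^sup>2 \<le> R * ?r / R\<^sup>2" by (intro divide_right_mono) auto
        also have "\<dots> = 1 / R * ?r" using R by (simp add: power2_eq_square)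
        finally have n: "\<bar>x \<bullet> (x - y)\<bar> / R\<^sup>2 \<le> 1 / R * ?r" .
        have "cmod (2 / z * of_real (x \<bullet> (x - y) / R\<^sup>2 * bump 2 ?\<rho>)) = 2 / cmod z * (\<bar>x \<bullet> (x - y)\<bar> / R\<^sup>2 * bump 2 ?\<rho>)"
          by (simp add: norm_mult norm_divide norm_power abs_mult bump_nonneg)
        also have "\<dots> \<le> 2 / \<delta> * (1 / R * ?r * M2)"
          using zd dl n f2 R bump_nonneg[of 2 ?\<rho>] by (intro mult_mono frac_le mult_nonneg_nonneg) auto
        finally show ?thesis .
      qed
      have "cmod E \<le> cmod (of_real (- 2 * real DIM('a) / R\<^sup>2 * bump 2 ?\<rho> + 4 * (norm x)\<^sup>2 / R^4 * (bump 4 ?\<rho> - 2 * bump 3 ?\<rho>)))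
          + cmod (2 / z * of_real (x \<bullet> (x - y) / R\<^sup>2 * bump 2 ?\<rho>))"
        unfolding E_def by (rule norm_triangle_ineq)
      also have "\<dots> \<le> (2 * real DIM('a) * M2 * (1 / R) + 4 * (1 / R) * (M4 + 2 * M3)) + 2 / \<delta> * (1 / R * ?r * M2)"
        using a b c unfolding norm_of_real by linarith
      also have "\<dots> = (K1 * 1 + K2 * ?r) / R"
        unfolding K1_def K2_def using R dl by (simp add: field_simps)
      also have "\<dots> \<le> (K1 * (1 + ?r)\<^sup>2 + K2 * (1 + ?r)\<^sup>2) / R"
        using pos R by (intro divide_right_mono add_mono mult_left_mono) (auto simp: one_le_power power2_eq_square algebra_simps)
      also have "\<dots> = (K1 + K2) / R * (1 + ?r)\<^sup>2" by (simp add: algebra_simps)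
      finally show ?thesis .
    qed
    have "cmod (cutoff_error R z y x) = cmod E * cmod (heat_kernel z (x - y))"
      by (simp add: cutoff_error_def E_def norm_mult)
    also have "\<dots> \<le> ((K1 + K2) / R * (1 + ?r)\<^sup>2) * (c0 * exp (- (\<delta> / (4 * A\<^sup>2)) * ?r\<^sup>2))"
      using E heat_kernel_box_bounds(1)[OF dl z, of x y] pos R unfolding c0_def by (intro mult_mono) auto
    also have "\<dots> = (K1 + K2) * c0 / R * gaussian_weight (\<delta> / (4 * A\<^sup>2)) y x"
      by (simp add: gaussian_weight_def mult_ac)
    finally show "cmod (cutoff_error R z y x) \<le> (K1 + K2) * c0 / R * gaussian_weight (\<delta> / (4 * A\<^sup>2)) y x" .
  qed
qed

lemma pairing_gaussian_weight:
  fixes v g :: "'a::euclidean_space \<Rightarrow> complex"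
  assumes v: "square_integrable v" and b: "\<beta> > 0" and g [measurable]: "g \<in> borel_measurable borel"
    and le: "\<And>x. cmod (g x) \<le> K * gaussian_weight \<beta> y x"
  shows "integrable lebesgue (\<lambda>x. v x * g x)"
    and "cmod (\<integral>x. v x * g x \<partial>lebesgue) \<le>
      K * (sqrt (\<integral>x. (cmod (v x))\<^sup>2 \<partial>lebesgue) * sqrt (\<integral>x. (gaussian_weight \<beta> y x)\<^sup>2 \<partial>lebesgue))"
proof -
  note [measurable] = square_integrableD(1)[OF v] lebesgue_measurable_of_borel[OF g]
  have "K * gaussian_weight \<beta> y y \<ge> 0" using le[of y] norm_ge_zero order_trans by blast
  then have K: "K \<ge> 0" by (simp add: gaussian_weight_def)
  have W: "integrable lebesgue (\<lambda>x::'a. (gaussian_weight \<beta> y x)\<^sup>2)"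
    by (subst integrable_lebesgue_iff_lborel) (auto intro!: gaussian_weight_L2[OF b])
  have sq: "(cmod (g x))\<^sup>2 \<le> K\<^sup>2 * (gaussian_weight \<beta> y x)\<^sup>2" for x
    using power_mono[OF le, of x 2] by (simp add: power_mult_distrib)
  have g2: "integrable lebesgue (\<lambda>x. (cmod (g x))\<^sup>2)"
    by (rule Bochner_Integration.integrable_bound[where f="\<lambda>x. K\<^sup>2 * (gaussian_weight \<beta> y x)\<^sup>2"])
       (use W sq in auto)
  note cs = cauchy_schwarz_integral[OF square_integrableD(1)[OF v] lebesgue_measurable_of_borel[OF g] square_integrableD(2)[OF v] g2]
  show "integrable lebesgue (\<lambda>x. v x * g x)" by (rule cs(1))
  have "sqrt (\<integral>x. (cmod (g x))\<^sup>2 \<partial>lebesgue) \<le> sqrt (\<integral>x. K\<^sup>2 * (gaussian_weight \<beta> y x)\<^sup>2 \<partial>lebesgue)"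
    using g2 W sq by (intro real_sqrt_le_mono integral_mono) auto
  also have "\<dots> = K * sqrt (\<integral>x. (gaussian_weight \<beta> y x)\<^sup>2 \<partial>lebesgue)" using K by (simp add: real_sqrt_mult)
  finally have "sqrt (\<integral>x. (cmod (v x))\<^sup>2 \<partial>lebesgue) * sqrt (\<integral>x. (cmod (g x))\<^sup>2 \<partial>lebesgue) \<le>
     sqrt (\<integral>x. (cmod (v x))\<^sup>2 \<partial>lebesgue) * (K * sqrt (\<integral>x. (gaussian_weight \<beta> y x)\<^sup>2 \<partial>lebesgue))"
    by (rule mult_left_mono) (simp add: integral_nonneg_AE)
  also have "\<dots> = K * (sqrt (\<integral>x. (cmod (v x))\<^sup>2 \<partial>lebesgue) * sqrt (\<integral>x. (gaussian_weight \<beta> y x)\<^sup>2 \<partial>lebesgue))"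
    by (rule mult.left_commute)
  finally show "cmod (\<integral>x. v x * g x \<partial>lebesgue) \<le>
      K * (sqrt (\<integral>x. (cmod (v x))\<^sup>2 \<partial>lebesgue) * sqrt (\<integral>x. (gaussian_weight \<beta> y x)\<^sup>2 \<partial>lebesgue))"
    using cs(3) by linarith
qed

text \<open>Both factors of the pairing depend on \<open>s\<close>. The weak equation differentiates the solution against the
  kernel frozen at \<open>t\<close>, and the moving kernel is differentiated against \<open>u t\<close>. The kernel runs backwards in time, hence the two main
  terms cancel and only the cutoff error remains. The mixed remainder is \<open>o(|s - t|)\<close>, because \<open>u s\<close> tends to \<open>u t\<close> in \<open>L\<^sup>2\<close>
  while the kernel is Lipschitz in time.\<close>

lemma cutoff_pairing_derivative:
  fixes u :: "real \<Rightarrow> 'a::euclidean_space \<Rightarrow> complex"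
  assumes sol: "schrodinger_solution f u" and R: "R \<ge> 1" and e: "e > 0"
  shows "((\<lambda>s. \<integral>x. u s x * cutoff_kernel R (ctime e (T - s)) y x \<partial>lebesgue) has_vector_derivative
    \<i> * (\<integral>x. u t x * cutoff_error R (ctime e (T - t)) y x \<partial>lebesgue)) (at t)"
proof -
  have sq: "square_integrable (u s)" for s using sol by (simp add: schrodinger_solution_def)
  define z where "z s = ctime e (T - s)" for s
  define \<delta> A where "\<delta> = e / 2" and "A = cmod (z t) + e"
  define \<beta> where "\<beta> = \<delta> / (4 * A\<^sup>2)"
  define c0 where "c0 = 1 / sqrt (4 * pi * \<delta>) ^ DIM('a)"
  define K where "K = (1 / (4 * \<delta>\<^sup>2) + real DIM('a) / (2 * \<delta>)) * c0"
  have Rz: "Re (z s) = e" for s by (simp add: z_def)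
  have dl: "\<delta> > 0" using e by (simp add: \<delta>_def)
  have A: "A > 0" using e by (simp add: A_def add_nonneg_pos)
  have b: "\<beta> > 0" using dl A by (simp add: \<beta>_def)
  have K: "K \<ge> 0" using dl by (simp add: K_def c0_def)
  have box: "\<delta> \<le> Re w" "cmod w \<le> A" if "w \<in> ball (z t) \<delta>" for w
  proof -
    have d: "cmod (z t - w) < \<delta>" using that by (simp add: dist_norm)
    show "\<delta> \<le> Re w" using abs_Re_le_cmod[of "z t - w"] d Rz[of t] by (simp add: \<delta>_def)
    show "cmod w \<le> A" using norm_triangle_ineq2[of w "z t"] d e unfolding A_def \<delta>_def by (simp add: norm_minus_commute)
  qed
  have kb: "cmod (cutoff_kernel R w y x) \<le> c0 * gaussian_weight \<beta> y x"
    and kd: "cmod (cutoff_kernel_deriv R w y x) \<le> K * gaussian_weight \<beta> y x" if "w \<in> ball (z t) \<delta>" for w x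
    using cutoff_kernel_bounds[OF dl box[OF that]] by (simp_all add: c0_def \<beta>_def K_def)
  have zt: "z t \<in> ball (z t) \<delta>" using dl by simp
  have Re_pos: "Re w > 0" if "w \<in> ball (z t) \<delta>" for w using box(1)[OF that] dl by linarith
  have lip: "cmod (cutoff_kernel R w y x - cutoff_kernel R (z t) y x) \<le> K * gaussian_weight \<beta> y x * cmod (w - z t)"
    if "w \<in> ball (z t) \<delta>" for w x
  proof (rule field_differentiable_bound[where S="ball (z t) \<delta>" and f'="\<lambda>w. cutoff_kernel_deriv R w y x"])
    fix w assume w: "w \<in> ball (z t) \<delta>"
    show "((\<lambda>w. cutoff_kernel R w y x) has_field_derivative cutoff_kernel_deriv R w y x) (at w within ball (z t) \<delta>)"
      by (rule has_field_derivative_at_within[OF cutoff_kernel_has_derivative[OF Re_pos[OF w]]])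
    show "cmod (cutoff_kernel_deriv R w y x) \<le> K * gaussian_weight \<beta> y x" by (rule kd[OF w])
  qed (use that zt in auto)
  define W where "W s w = (\<integral>x. u s x * cutoff_kernel R w y x \<partial>lebesgue)" for s w
  have intW: "integrable lebesgue (\<lambda>x. u s x * cutoff_kernel R w y x)" if "w \<in> ball (z t) \<delta>" for s w
    by (rule pairing_gaussian_weight(1)[OF sq b cutoff_measurable(1) kb[OF that]])
  have intD: "integrable lebesgue (\<lambda>x. u t x * cutoff_kernel_deriv R (z t) y x)"
    by (rule pairing_gaussian_weight(1)[OF sq b cutoff_measurable(2) kd[OF zt]])
  have d1: "((\<lambda>s. W s (z t)) has_vector_derivative
     \<i> * (\<integral>x. u t x * (cutoff_kernel_deriv R (z t) y x + cutoff_error R (z t) y x) \<partial>lebesgue)) (at t)"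
  proof -
    have pull: "k * (\<integral>x. v x * g x \<partial>lebesgue) = (\<integral>x. v x * (k * g x) \<partial>lebesgue)"
      for k and v g :: "'a \<Rightarrow> complex"
      unfolding integral_mult_right_zero[symmetric] by (rule arg_cong[where f="integral\<^sup>L lebesgue"], rule ext, rule mult.left_commute)
    have weak: "test_function \<phi> \<Longrightarrow> ((\<lambda>s. \<integral>x. u s x * \<phi> x \<partial>lebesgue) has_vector_derivative
             \<i> * (\<integral>x. u t x * laplacian \<phi> x \<partial>lebesgue)) (at t)" for \<phi>
      using sol by (simp add: schrodinger_solution_def)
    let ?k = "1 / csqrt (of_real (4 * pi) * z t) ^ DIM('a)" and ?\<phi> = "cutoff_gaussian R (1 / (4 * z t)) y"
    have "((\<lambda>s. \<integral>x. u s x * ?\<phi> x \<partial>lebesgue) has_vector_derivative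
             \<i> * (\<integral>x. u t x * laplacian ?\<phi> x \<partial>lebesgue)) (at t)"
      by (rule weak[OF test_function_cutoff_gaussian]) (use R in simp)
    then have "((\<lambda>s. ?k * (\<integral>x. u s x * ?\<phi> x \<partial>lebesgue)) has_vector_derivative
             ?k * (\<i> * (\<integral>x. u t x * laplacian ?\<phi> x \<partial>lebesgue))) (at t)"
      by (rule has_vector_derivative_mult_right)
    moreover have "?k * (\<integral>x. u s x * ?\<phi> x \<partial>lebesgue) = W s (z t)" for s
      unfolding W_def cutoff_kernel_eq_gaussian by (rule pull)
    moreover have "?k * (\<i> * (\<integral>x. u t x * laplacian ?\<phi> x \<partial>lebesgue)) =
       \<i> * (\<integral>x. u t x * (cutoff_kernel_deriv R (z t) y x + cutoff_error R (z t) y x) \<partial>lebesgue)"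
    proof -
      have "z t \<noteq> 0" using Rz[of t] e by auto
      then have l: "cutoff_kernel_deriv R (z t) y x + cutoff_error R (z t) y x = ?k * laplacian ?\<phi> x" for x
        by (rule laplacian_cutoff_kernel[symmetric])
      show ?thesis
        unfolding l pull[symmetric] by (rule mult.left_commute)
    qed
    ultimately show ?thesis by (simp only:)
  qed
  have d2: "((\<lambda>s. W t (z s)) has_vector_derivative
     (- \<i>) * (\<integral>x. u t x * cutoff_kernel_deriv R (z t) y x \<partial>lebesgue)) (at t)"
  proof -
    have dW: "(W t has_field_derivative (\<integral>x. u t x * cutoff_kernel_deriv R (z t) y x \<partial>lebesgue)) (at (z t))"
      unfolding W_def[abs_def]
    proof (rule has_field_derivative_integral_dominated[where e=\<delta> and M=lebesgue and F="\<lambda>w x. u t x * cutoff_kernel R w y x"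
          and F'="\<lambda>w x. u t x * cutoff_kernel_deriv R w y x" and ?z0.0="z t" and g="\<lambda>x. cmod (u t x * of_real (K * gaussian_weight \<beta> y x))"])
      show "integrable lebesgue (\<lambda>x. cmod (u t x * of_real (K * gaussian_weight \<beta> y x)))"
      proof (rule integrable_norm, rule pairing_gaussian_weight(1)[OF sq b])
        show "cmod (of_real (K * gaussian_weight \<beta> y x)) \<le> K * gaussian_weight \<beta> y x" for x
          unfolding norm_of_real using K gaussian_weight_nonneg[of \<beta> y x] by simp
      qed measurable
      fix w x assume w: "w \<in> ball (z t) \<delta>"
      show "((\<lambda>z. u t x * cutoff_kernel R z y x) has_field_derivative u t x * cutoff_kernel_deriv R w y x) (at w)"
        by (rule DERIV_cmult[OF cutoff_kernel_has_derivative[OF Re_pos[OF w]]])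
      show "cmod (u t x * cutoff_kernel_deriv R w y x) \<le> cmod (u t x * of_real (K * gaussian_weight \<beta> y x))"
        unfolding norm_mult[of "u t x"] using kd[OF w, of x] K gaussian_weight_nonneg[of \<beta> y x]
        by (intro mult_left_mono) (auto simp: norm_mult)
      show "integrable lebesgue (\<lambda>x. u t x * cutoff_kernel R w y x)" by (rule intW[OF w])
    qed (rule dl)
    have dz: "(z has_vector_derivative - \<i>) (at t)"
    proof -
      have "((\<lambda>s. of_real e + \<i> * of_real (T - s)) has_vector_derivative 0 + \<i> * of_real (0 - 1)) (at t)"
        by (intro has_vector_derivative_add has_vector_derivative_const has_vector_derivative_mult_right
            has_vector_derivative_of_real DERIV_diff DERIV_const DERIV_ident)
      then show ?thesis unfolding z_def by simp
    qed
    show ?thesis using field_vector_diff_chain_at[OF dz dW] unfolding o_def .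
  qed
  define rem where "rem s = (\<integral>x. (u s x - u t x) * (cutoff_kernel R (z s) y x - cutoff_kernel R (z t) y x) \<partial>lebesgue)" for s
  have zdiff: "cmod (z s - z t) = \<bar>s - t\<bar>" for s
  proof -
    have "z s - z t = \<i> * of_real (t - s)" by (simp add: z_def algebra_simps)
    then show ?thesis by (simp add: norm_mult abs_minus_commute del: of_real_diff)
  qed
  have zs: "z s \<in> ball (z t) \<delta>" if "\<bar>s - t\<bar> < \<delta>" for s
    using that zdiff[of s] by (simp add: dist_norm norm_minus_commute)
  have d3: "(rem has_vector_derivative 0) (at t)"
  proof (rule has_vector_derivative_zeroI)
    show "rem t = 0" by (simp add: rem_def)
    let ?N = "\<lambda>s. \<integral>x. (cmod (u s x - u t x))\<^sup>2 \<partial>lebesgue" and ?G = "sqrt (\<integral>x. (gaussian_weight \<beta> y x)\<^sup>2 \<partial>lebesgue)"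
    have "(?N \<longlongrightarrow> 0) (at t)" using sol by (simp add: schrodinger_solution_def)
    then have "((\<lambda>s. K * (sqrt (?N s) * ?G)) \<longlongrightarrow> K * (sqrt 0 * ?G)) (at t)" by (intro tendsto_intros)
    then show "((\<lambda>s. K * (sqrt (?N s) * ?G)) \<longlongrightarrow> 0) (at t)" by simp
    have "cmod (rem s) \<le> K * (sqrt (?N s) * ?G) * \<bar>s - t\<bar>" if "dist s t < \<delta>" for s
    proof -
      have st: "\<bar>s - t\<bar> < \<delta>" using that by (simp add: dist_real_def)
      have "cmod (rem s) \<le> (K * \<bar>s - t\<bar>) * (sqrt (?N s) * ?G)"
        unfolding rem_def
      proof (rule pairing_gaussian_weight(2)[OF square_integrable_diff[OF sq sq] b])
        show "(\<lambda>x. cutoff_kernel R (z s) y x - cutoff_kernel R (z t) y x) \<in> borel_measurable borel" by measurable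
        fix x show "cmod (cutoff_kernel R (z s) y x - cutoff_kernel R (z t) y x) \<le> K * \<bar>s - t\<bar> * gaussian_weight \<beta> y x"
          using lip[OF zs[OF st], of x] unfolding zdiff by (simp only: mult_ac)
      qed
      then show ?thesis by (simp only: mult_ac)
    qed
    then show "eventually (\<lambda>s. cmod (rem s) \<le> K * (sqrt (?N s) * ?G) * \<bar>s - t\<bar>) (at t)"
      unfolding eventually_at using dl by blast
  qed
  \<comment> \<open>The pairing at \<open>s\<close> as sum of the frozen-kernel term, the moving-kernel term and the mixed remainder.\<close>
  have split: "W s (z s) = W s (z t) + W t (z s) + rem s - W t (z t)" if "s \<in> ball t \<delta>" for s
  proof -
    have st: "z s \<in> ball (z t) \<delta>" using that by (intro zs) (simp add: dist_real_def abs_minus_commute)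
    have "rem s = (\<integral>x. u s x * cutoff_kernel R (z s) y x - u s x * cutoff_kernel R (z t) y x
        - (u t x * cutoff_kernel R (z s) y x - u t x * cutoff_kernel R (z t) y x) \<partial>lebesgue)"
      unfolding rem_def by (rule Bochner_Integration.integral_cong) (simp_all add: algebra_simps)
    also have "\<dots> = W s (z s) - W s (z t) - (W t (z s) - W t (z t))"
      unfolding W_def using intW[OF st] intW[OF zt]
      by (simp only: Bochner_Integration.integral_diff Bochner_Integration.integrable_diff)
    finally show ?thesis by simp
  qed
  have alg: "\<i> * (a + b) + (- \<i>) * a + 0 - 0 = \<i> * b" for a b :: complex
    by (simp add: distrib_left)
  have "((\<lambda>s. W s (z t) + W t (z s) + rem s - W t (z t)) has_vector_derivative
     \<i> * (\<integral>x. u t x * (cutoff_kernel_deriv R (z t) y x + cutoff_error R (z t) y x) \<partial>lebesgue)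
     + (- \<i>) * (\<integral>x. u t x * cutoff_kernel_deriv R (z t) y x \<partial>lebesgue) + 0 - 0) (at t)"
    by (intro has_vector_derivative_diff has_vector_derivative_add d1 d2 d3 has_vector_derivative_const)
  moreover have "(\<integral>x. u t x * (cutoff_kernel_deriv R (z t) y x + cutoff_error R (z t) y x) \<partial>lebesgue) =
     (\<integral>x. u t x * cutoff_kernel_deriv R (z t) y x \<partial>lebesgue) + (\<integral>x. u t x * cutoff_error R (z t) y x \<partial>lebesgue)"
  proof -
    obtain C where C: "C \<ge> 0" "\<And>R z x. R \<ge> 1 \<Longrightarrow> \<delta> \<le> Re z \<Longrightarrow> cmod z \<le> A \<Longrightarrow>
      cmod (cutoff_error R z y x) \<le> C / R * gaussian_weight (\<delta> / (4 * A\<^sup>2)) y x" using cutoff_error_bound[OF dl] by blast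
    have intE: "integrable lebesgue (\<lambda>x. u t x * cutoff_error R (z t) y x)"
      by (rule pairing_gaussian_weight(1)[OF sq b cutoff_measurable(3) C(2)[OF R box[OF zt], folded \<beta>_def]])
    show ?thesis unfolding distrib_left by (rule Bochner_Integration.integral_add[OF intD intE])
  qed
  ultimately have "((\<lambda>s. W s (z t) + W t (z s) + rem s - W t (z t)) has_vector_derivative
     \<i> * (\<integral>x. u t x * cutoff_error R (z t) y x \<partial>lebesgue)) (at t)"
    by (simp only: alg)
  then have "((\<lambda>s. W s (z s)) has_vector_derivative
     \<i> * (\<integral>x. u t x * cutoff_error R (z t) y x \<partial>lebesgue)) (at t)"
  proof (rule has_vector_derivative_transform_within_open)
    show "t \<in> ball t \<delta>" using dl by simp
    show "W s (z t) + W t (z s) + rem s - W t (z t) = W s (z s)" if "s \<in> ball t \<delta>" for s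
      by (rule split[OF that, symmetric])
  qed simp
  then show ?thesis unfolding W_def z_def .
qed

text \<open>Mean value inequality between the times \<open>0\<close> and \<open>T\<close>.\<close>

lemma cutoff_pairing_drift:
  fixes u :: "real \<Rightarrow> 'a::euclidean_space \<Rightarrow> complex"
  assumes sol: "schrodinger_solution f u" and e: "e > 0"
  obtains C where "\<And>R. R \<ge> 1 \<Longrightarrow>
    cmod ((\<integral>x. u T x * cutoff_kernel R (ctime e (T - T)) y x \<partial>lebesgue) -
      (\<integral>x. u 0 x * cutoff_kernel R (ctime e (T - 0)) y x \<partial>lebesgue)) \<le> C / R"
proof -
  have sq: "square_integrable (u s)" for s using sol by (simp add: schrodinger_solution_def)
  have cont: "((\<lambda>s. \<integral>x. (cmod (u s x - u t x))\<^sup>2 \<partial>lebesgue) \<longlongrightarrow> 0) (at t)" for t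
    using sol by (simp add: schrodinger_solution_def)
  define A where "A = e + \<bar>T\<bar>"
  define \<beta> where "\<beta> = e / (4 * A\<^sup>2)"
  have A: "A > 0" using e by (simp add: A_def)
  have b: "\<beta> > 0" using e A by (simp add: \<beta>_def)
  obtain C where C: "C \<ge> 0" "\<And>R z x. R \<ge> 1 \<Longrightarrow> e \<le> Re z \<Longrightarrow> cmod z \<le> A \<Longrightarrow>
      cmod (cutoff_error R z y x) \<le> C / R * gaussian_weight (e / (4 * A\<^sup>2)) y x"
    using cutoff_error_bound[OF e] by blast
  have "- \<bar>T\<bar> \<le> \<bar>T\<bar>" by simp
  then obtain M where M: "\<And>t. - \<bar>T\<bar> \<le> t \<Longrightarrow> t \<le> \<bar>T\<bar> \<Longrightarrow> (\<integral>x. (cmod (u t x))\<^sup>2 \<partial>lebesgue) \<le> M"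
    using solution_locally_bounded[OF sq cont] by metis
  define G where "G = sqrt (\<integral>x. (gaussian_weight \<beta> y x)\<^sup>2 \<partial>lebesgue)"
  have G: "G \<ge> 0" by (simp add: G_def integral_nonneg_AE)
  show ?thesis
  proof (rule that)
    fix R :: real assume R: "R \<ge> 1"
    let ?P = "\<lambda>s. \<integral>x. u s x * cutoff_kernel R (ctime e (T - s)) y x \<partial>lebesgue"
    let ?P' = "\<lambda>t. \<i> * (\<integral>x. u t x * cutoff_error R (ctime e (T - t)) y x \<partial>lebesgue)"
    have bnd: "cmod (?P' t) \<le> C / R * (sqrt M * G)" if t: "t \<in> closed_segment 0 T" for t
    proof -
      have tT: "- \<bar>T\<bar> \<le> t" "t \<le> \<bar>T\<bar>" "\<bar>T - t\<bar> \<le> \<bar>T\<bar>"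
        using t by (auto simp: closed_segment_eq_real_ivl split: if_splits)
      have z: "e \<le> Re (ctime e (T - t))" by simp
      have z2: "cmod (ctime e (T - t)) \<le> A"
        using norm_triangle_ineq[of "of_real e" "\<i> * of_real (T - t)"] tT(3) e unfolding norm_mult norm_of_real A_def by simp
      have "cmod (\<integral>x. u t x * cutoff_error R (ctime e (T - t)) y x \<partial>lebesgue) \<le>
          C / R * (sqrt (\<integral>x. (cmod (u t x))\<^sup>2 \<partial>lebesgue) * G)"
        unfolding G_def by (rule pairing_gaussian_weight(2)[OF sq b cutoff_measurable(3)]) (rule C(2)[OF R z z2, folded \<beta>_def])
      also have "\<dots> \<le> C / R * (sqrt M * G)"
        using C(1) R G M[OF tT(1,2)] by (intro mult_left_mono mult_right_mono real_sqrt_le_mono) auto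
      finally show ?thesis by (simp add: norm_mult)
    qed
    have "norm (?P T - ?P 0) \<le> (C / R * (sqrt M * G)) * norm (T - 0)"
    proof (rule differentiable_bound[where S="closed_segment 0 T" and f'="\<lambda>t h. h *\<^sub>R ?P' t"])
      fix t assume t: "t \<in> closed_segment 0 T"
      show "(?P has_derivative (\<lambda>h. h *\<^sub>R ?P' t)) (at t within closed_segment 0 T)"
        using cutoff_pairing_derivative[OF sol R e, of T y t] unfolding has_vector_derivative_def
        by (rule has_derivative_at_withinI)
      show "onorm (\<lambda>h. h *\<^sub>R ?P' t) \<le> C / R * (sqrt M * G)"
      proof (rule onorm_le)
        fix h :: real
        have "norm (h *\<^sub>R ?P' t) = cmod (?P' t) * \<bar>h\<bar>" unfolding norm_scaleR by (rule mult.commute)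
        also have "\<dots> \<le> C / R * (sqrt M * G) * \<bar>h\<bar>" by (rule mult_right_mono[OF bnd[OF t]]) simp
        finally show "norm (h *\<^sub>R ?P' t) \<le> C / R * (sqrt M * G) * norm h" by simp
      qed
    qed auto
    then show "cmod (?P T - ?P 0) \<le> (C * (sqrt M * G) * \<bar>T\<bar>) / R" by simp
  qed
qed

lemma cutoff_pairing_limit:
  fixes v :: "'a::euclidean_space \<Rightarrow> complex"
  assumes v: "square_integrable v" and z: "Re z > 0"
  shows "(\<lambda>n. \<integral>x. v x * cutoff_kernel (real (Suc n)) z y x \<partial>lebesgue) \<longlonglongrightarrow>
    exp (-1) * (\<integral>x. v x * heat_kernel z (x - y) \<partial>lebesgue)"
proof -
  let ?\<beta> = "Re z / (4 * (cmod z)\<^sup>2)"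
  have "z \<noteq> 0" using z by auto
  then have b: "?\<beta> > 0" using z by simp
  have h: "(\<lambda>x::'a. heat_kernel z (x - y)) \<in> borel_measurable borel" by measurable
  have int: "integrable lebesgue (\<lambda>x. v x * heat_kernel z (x - y))"
    by (rule pairing_gaussian_weight(1)[OF v b h]) (rule heat_kernel_box_bounds(2)[OF z order_refl order_refl])
  note [measurable] = square_integrableD(1)[OF v] lebesgue_measurable_of_borel[OF h] lebesgue_measurable_of_borel[OF cutoff_measurable(1)]
  have "(\<lambda>n. \<integral>x. v x * cutoff_kernel (real (Suc n)) z y x \<partial>lebesgue) \<longlonglongrightarrow>
    (\<integral>x. exp (-1) * (v x * heat_kernel z (x - y)) \<partial>lebesgue)"
  proof (rule integral_dominated_convergence[where w="\<lambda>x. cmod (v x * heat_kernel z (x - y))"])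
    show "integrable lebesgue (\<lambda>x. cmod (v x * heat_kernel z (x - y)))" by (rule integrable_norm[OF int])
    show "AE x in lebesgue. (\<lambda>n. v x * cutoff_kernel (real (Suc n)) z y x) \<longlonglongrightarrow> exp (-1) * (v x * heat_kernel z (x - y))"
    proof (rule AE_I2)
      fix x :: 'a
      have "(\<lambda>n. 1 - (norm x)\<^sup>2 * (inverse (real (Suc n)))\<^sup>2) \<longlonglongrightarrow> 1 - (norm x)\<^sup>2 * 0\<^sup>2"
        by (intro tendsto_intros LIMSEQ_inverse_real_of_nat)
      then have "(\<lambda>n. 1 - (norm x)\<^sup>2 / (real (Suc n))\<^sup>2) \<longlonglongrightarrow> 1"
        by (simp add: divide_inverse power_inverse)
      then have "(\<lambda>n. bump 0 (1 - (norm x)\<^sup>2 / (real (Suc n))\<^sup>2)) \<longlonglongrightarrow> bump 0 1"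
        by (rule isCont_tendsto_compose[OF DERIV_isCont[OF bump_has_derivative]])
      then have "(\<lambda>n. v x * (of_real (bump 0 (1 - (norm x)\<^sup>2 / (real (Suc n))\<^sup>2)) * heat_kernel z (x - y))) \<longlonglongrightarrow>
          v x * (of_real (bump 0 1) * heat_kernel z (x - y))"
        by (intro tendsto_intros)
      moreover have "complex_of_real (bump 0 1) = exp (-1)" by (simp add: bump_def flip: exp_of_real)
      ultimately show "(\<lambda>n. v x * cutoff_kernel (real (Suc n)) z y x) \<longlonglongrightarrow> exp (-1) * (v x * heat_kernel z (x - y))"
        unfolding cutoff_kernel_def mult.left_commute[of "v x"] by simp
    qed
    show "AE x in lebesgue. norm (v x * cutoff_kernel (real (Suc n)) z y x) \<le> cmod (v x * heat_kernel z (x - y))" for n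
    proof (rule AE_I2)
      fix x :: 'a
      let ?fl = "bump 0 (1 - (norm x)\<^sup>2 / (real (Suc n))\<^sup>2)"
      have "norm (v x * cutoff_kernel (real (Suc n)) z y x) = ?fl * cmod (v x * heat_kernel z (x - y))"
        unfolding cutoff_kernel_def norm_mult norm_of_real abs_of_nonneg[OF bump_nonneg] by (rule mult.left_commute)
      also have "\<dots> \<le> 1 * cmod (v x * heat_kernel z (x - y))"
        by (intro mult_right_mono bump_zero_le_1) simp
      finally show "norm (v x * cutoff_kernel (real (Suc n)) z y x) \<le> cmod (v x * heat_kernel z (x - y))" by simp
    qed
  next
    show "(\<lambda>x. exp (-1) * (v x * heat_kernel z (x - y))) \<in> borel_measurable lebesgue" by measurable
    show "(\<lambda>x. v x * cutoff_kernel (real (Suc n)) z y x) \<in> borel_measurable lebesgue" for n by measurable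
  qed
  then show ?thesis unfolding integral_mult_right_zero .
qed

text \<open>Removing the cutoff makes the pairing independent of \<open>s\<close>; comparing \<open>s = T\<close>, where the kernel is
  the heat kernel at time \<open>\<epsilon>\<close>, with \<open>s = 0\<close> gives the claim. In particular the solution is determined by its datum.\<close>

lemma solution_smoothed_representation:
  fixes u :: "real \<Rightarrow> 'a::euclidean_space \<Rightarrow> complex"
  assumes sol: "schrodinger_solution f u" and f: "square_integrable f" and e: "e > 0"
  shows "(\<integral>x. u T x * heat_kernel (of_real e) (x - y) \<partial>lebesgue) =
    (\<integral>x. f x * heat_kernel (ctime e T) (x - y) \<partial>lebesgue)"
proof -
  have sq: "square_integrable (u s)" for s using sol by (simp add: schrodinger_solution_def)
  obtain C where C: "\<And>R. R \<ge> 1 \<Longrightarrow>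
    cmod ((\<integral>x. u T x * cutoff_kernel R (ctime e (T - T)) y x \<partial>lebesgue) -
      (\<integral>x. u 0 x * cutoff_kernel R (ctime e (T - 0)) y x \<partial>lebesgue)) \<le> C / R"
    using cutoff_pairing_drift[OF sol e] by blast
  let ?I = "\<lambda>s. \<integral>x. u s x * heat_kernel (ctime e (T - s)) (x - y) \<partial>lebesgue"
  have lim: "(\<lambda>n. (\<integral>x. u T x * cutoff_kernel (real (Suc n)) (ctime e (T - T)) y x \<partial>lebesgue) -
      (\<integral>x. u 0 x * cutoff_kernel (real (Suc n)) (ctime e (T - 0)) y x \<partial>lebesgue)) \<longlonglongrightarrow> exp (-1) * ?I T - exp (-1) * ?I 0"
    using e by (intro tendsto_diff cutoff_pairing_limit sq) auto
  have "(\<lambda>n. C * inverse (real (Suc n))) \<longlonglongrightarrow> C * 0"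
    by (intro tendsto_intros LIMSEQ_inverse_real_of_nat)
  then have z: "(\<lambda>n. C / real (Suc n)) \<longlonglongrightarrow> 0" by (simp add: divide_inverse)
  have "(\<lambda>n. (\<integral>x. u T x * cutoff_kernel (real (Suc n)) (ctime e (T - T)) y x \<partial>lebesgue) -
      (\<integral>x. u 0 x * cutoff_kernel (real (Suc n)) (ctime e (T - 0)) y x \<partial>lebesgue)) \<longlonglongrightarrow> 0"
    by (rule Lim_null_comparison[OF _ z]) (intro always_eventually allI C, simp)
  from LIMSEQ_unique[OF lim this] have "exp (-1) * (?I T - ?I 0) = 0" by (simp only: right_diff_distrib)
  then have "?I T = ?I 0" by simp
  moreover have "?I 0 = (\<integral>x. f x * heat_kernel (ctime e T) (x - y) \<partial>lebesgue)"
  proof -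
    have ae: "AE x in lebesgue. u 0 x = f x" using sol by (simp add: schrodinger_solution_def)
    have [measurable]: "(\<lambda>x. heat_kernel (ctime e T) (x - y)) \<in> borel_measurable lebesgue"
      by (rule lebesgue_measurable_of_borel) measurable
    note [measurable] = square_integrableD(1)[OF f] square_integrableD(1)[OF sq]
    show ?thesis by (rule integral_cong_AE) (use ae in auto)
  qed
  ultimately show ?thesis by simp
qed

section \<open>The heat flow as an approximate identity\<close>

lemma norm_heat_kernel_real:
  assumes "e > 0"
  shows "cmod (heat_kernel (of_real e) (x::'a::euclidean_space)) = exp (- (norm x)\<^sup>2 / (4 * e)) / sqrt (4 * pi * e) ^ DIM('a)"
  using assms by (subst heat_kernel_real(2)[OF assms]) (simp only: norm_of_real, simp)

text \<open>Half of the exponent is spent on the factor that vanishes as \<open>e\<close> tends to zero; the other half is the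
  kernel at time \<open>2 e\<close>, whose mass is one.\<close>

lemma heat_kernel_real_tail:
  fixes x :: "'a::euclidean_space"
  assumes e: "e > 0" and dl: "0 \<le> \<delta>" "\<delta> \<le> norm x"
  shows "cmod (heat_kernel (of_real e) x) \<le> sqrt 2 ^ DIM('a) * exp (- \<delta>\<^sup>2 / (8 * e)) * cmod (heat_kernel (of_real (2 * e)) x)"
proof -
  have e2: "2 * e > 0" using e by simp
  have s: "sqrt (4 * pi * (2 * e)) = sqrt 2 * sqrt (4 * pi * e)"
    by (subst real_sqrt_mult[symmetric]) (simp add: mult_ac)
  have "exp (- (norm x)\<^sup>2 / (4 * e)) = exp (- (norm x)\<^sup>2 / (8 * e)) * exp (- (norm x)\<^sup>2 / (4 * (2 * e)))"
    using e by (simp add: exp_add[symmetric] field_simps)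
  also have "\<dots> \<le> exp (- \<delta>\<^sup>2 / (8 * e)) * exp (- (norm x)\<^sup>2 / (4 * (2 * e)))"
    using dl e by (intro mult_right_mono) (auto intro!: divide_right_mono power_mono)
  finally have "exp (- (norm x)\<^sup>2 / (4 * e)) / sqrt (4 * pi * e) ^ DIM('a) \<le>
      exp (- \<delta>\<^sup>2 / (8 * e)) * exp (- (norm x)\<^sup>2 / (4 * (2 * e))) / sqrt (4 * pi * e) ^ DIM('a)"
    using e by (intro divide_right_mono) auto
  also have "\<dots> = sqrt 2 ^ DIM('a) * exp (- \<delta>\<^sup>2 / (8 * e)) * (exp (- (norm x)\<^sup>2 / (4 * (2 * e))) / sqrt (4 * pi * (2 * e)) ^ DIM('a))"
    unfolding s power_mult_distrib by simp
  finally show ?thesis unfolding norm_heat_kernel_real[OF e] norm_heat_kernel_real[OF e2] .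
qed

lemma heat_kernel_real_mass:
  fixes x :: "'a::euclidean_space"
  assumes e: "e > 0"
  shows "integrable lborel (\<lambda>y. cmod (heat_kernel (of_real e) (x - y)))"
    and "(\<integral>y. cmod (heat_kernel (of_real e) (x - y)) \<partial>lborel) = 1"
proof -
  show i: "integrable lborel (\<lambda>y. cmod (heat_kernel (of_real e) (x - y)))"
    by (rule integrableI_nonneg) (auto simp: nn_integral_heat_kernel_real[OF e])
  show "(\<integral>y. cmod (heat_kernel (of_real e) (x - y)) \<partial>lborel) = 1"
    by (subst integral_eq_nn_integral) (auto simp: nn_integral_heat_kernel_real[OF e])
qed

lemma propagate_real_sup_bound:
  fixes g :: "'a::euclidean_space \<Rightarrow> complex"
  assumes e: "e > 0" and [measurable]: "g \<in> borel_measurable borel" and m: "\<And>x. cmod (g x) \<le> m"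
  shows "integrable lborel (\<lambda>y. g y * heat_kernel (of_real e) (x - y))"
    and "cmod (propagate (of_real e) g x) \<le> m"
proof -
  have i: "integrable lborel (\<lambda>y. m * cmod (heat_kernel (of_real e) (x - y)))"
    by (rule integrable_mult_right[OF heat_kernel_real_mass(1)[OF e]])
  have le: "cmod (g y * heat_kernel (of_real e) (x - y)) \<le> m * cmod (heat_kernel (of_real e) (x - y))" for y
    unfolding norm_mult by (rule mult_right_mono[OF m]) simp
  have m0: "m \<ge> 0" using order_trans[OF norm_ge_zero m] by blast
  show *: "integrable lborel (\<lambda>y. g y * heat_kernel (of_real e) (x - y))"
    by (rule Bochner_Integration.integrable_bound[OF i]) (use le m0 in \<open>auto simp: abs_mult\<close>)
  have "cmod (propagate (of_real e) g x) \<le> (\<integral>y. m * cmod (heat_kernel (of_real e) (x - y)) \<partial>lborel)"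
    unfolding propagate_def by (rule Bochner_Integration.integral_norm_bound_integral[OF * i le])
  also have "\<dots> = m" using heat_kernel_real_mass[OF e, of x] by simp
  finally show "cmod (propagate (of_real e) g x) \<le> m" .
qed

lemma propagate_real_tendsto_at_continuity_point:
  fixes g :: "'a::euclidean_space \<Rightarrow> complex"
  assumes [measurable]: "g \<in> borel_measurable borel" and m: "\<And>x. cmod (g x) \<le> m" and cont: "isCont g x"
  shows "((\<lambda>e. propagate (of_real e) g x) \<longlongrightarrow> g x) (at_right 0)"
proof (rule tendstoI)
  fix r :: real assume r: "r > 0"
  obtain \<delta> where dl: "\<delta> > 0" "\<And>y. dist y x < \<delta> \<Longrightarrow> dist (g y) (g x) < r / 2"
    using cont r half_gt_zero unfolding continuous_at_eps_delta by meson
  let ?c = "2 * m * sqrt 2 ^ DIM('a)"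
  have m0: "m \<ge> 0" using order_trans[OF norm_ge_zero m] by blast
  have bound: "dist (propagate (of_real e) g x) (g x) \<le> r / 2 + ?c * exp (- \<delta>\<^sup>2 / (8 * e))" if e: "e > 0" for e :: real
  proof -
    have e2: "2 * e > 0" using e by simp
    let ?H = "\<lambda>y. heat_kernel (of_real e) (x - y)" and ?H2 = "\<lambda>y. heat_kernel (of_real (2 * e)) (x - y)"
    have H: "?H y = of_real (cmod (?H y))" for y by (rule heat_kernel_real(1)[OF e])
    have intH: "integrable lborel ?H"
      by (rule Bochner_Integration.integrable_bound[OF heat_kernel_real_mass(1)[OF e, of x]]) auto
    have "(\<integral>y. ?H y \<partial>lborel) = (\<integral>y. complex_of_real (cmod (?H y)) \<partial>lborel)"
      by (rule Bochner_Integration.integral_cong[OF refl H])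
    also have "\<dots> = 1" using heat_kernel_real_mass[OF e, of x] by simp
    finally have massH: "(\<integral>y. ?H y \<partial>lborel) = 1" .
    have gH: "integrable lborel (\<lambda>y. g y * ?H y)" by (rule propagate_real_sup_bound(1)[OF e assms(1) m])
    have "propagate (of_real e) g x - g x = (\<integral>y. g y * ?H y \<partial>lborel) - (\<integral>y. g x * ?H y \<partial>lborel)"
      using massH by (simp add: propagate_def)
    also have "\<dots> = (\<integral>y. g y * ?H y - g x * ?H y \<partial>lborel)"
      using gH intH by (intro Bochner_Integration.integral_diff[symmetric]) auto
    finally have "cmod (propagate (of_real e) g x - g x) = cmod (\<integral>y. g y * ?H y - g x * ?H y \<partial>lborel)" by simp
    also have "\<dots> \<le> (\<integral>y. r / 2 * cmod (?H y) + ?c * exp (- \<delta>\<^sup>2 / (8 * e)) * cmod (?H2 y) \<partial>lborel)"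
    proof (rule Bochner_Integration.integral_norm_bound_integral)
      show "integrable lborel (\<lambda>y. g y * ?H y - g x * ?H y)"
        using gH intH by auto
      show "integrable lborel (\<lambda>y. r / 2 * cmod (?H y) + ?c * exp (- \<delta>\<^sup>2 / (8 * e)) * cmod (?H2 y))"
        by (intro Bochner_Integration.integrable_add integrable_mult_right heat_kernel_real_mass(1) e e2)
      fix y
      have "g y * ?H y - g x * ?H y = (g y - g x) * ?H y" by (simp add: left_diff_distrib)
      then have n: "norm (g y * ?H y - g x * ?H y) = cmod (g y - g x) * cmod (?H y)" by (simp only: norm_mult)
      show "norm (g y * ?H y - g x * ?H y) \<le> r / 2 * cmod (?H y) + ?c * exp (- \<delta>\<^sup>2 / (8 * e)) * cmod (?H2 y)"
      proof (cases "dist y x < \<delta>")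
        case True
        have "cmod (g y - g x) * cmod (?H y) \<le> r / 2 * cmod (?H y)"
          using dl(2)[OF True] by (intro mult_right_mono) (auto simp: dist_norm)
        moreover have "0 \<le> ?c * exp (- \<delta>\<^sup>2 / (8 * e)) * cmod (?H2 y)" using m0 by simp
        ultimately show ?thesis unfolding n by linarith
      next
        case False
        then have "cmod (?H y) \<le> sqrt 2 ^ DIM('a) * exp (- \<delta>\<^sup>2 / (8 * e)) * cmod (?H2 y)"
          using dl(1) by (intro heat_kernel_real_tail[OF e]) (auto simp: dist_norm norm_minus_commute)
        moreover have "cmod (g y - g x) \<le> 2 * m"
          using norm_triangle_ineq4[of "g y" "g x"] m[of y] m[of x] by linarith
        ultimately have "cmod (g y - g x) * cmod (?H y) \<le> (2 * m) * (sqrt 2 ^ DIM('a) * exp (- \<delta>\<^sup>2 / (8 * e)) * cmod (?H2 y))"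
          using m0 by (intro mult_mono) auto
        moreover have "0 \<le> r / 2 * cmod (?H y)" using r by simp
        ultimately show ?thesis unfolding n by (simp only: mult.assoc)
      qed
    qed
    also have "\<dots> = r / 2 + ?c * exp (- \<delta>\<^sup>2 / (8 * e))"
      using heat_kernel_real_mass[OF e, of x] heat_kernel_real_mass[OF e2, of x] by simp
    finally show ?thesis by (simp only: dist_norm)
  qed
  have "((\<lambda>e. ?c * exp (- (\<delta>\<^sup>2 / 8 * inverse e))) \<longlongrightarrow> ?c * 0) (at_right 0)"
  proof (intro tendsto_intros filterlim_compose[OF exp_at_bot])
    have "filterlim (\<lambda>e. \<delta>\<^sup>2 / 8 * inverse e) at_top (at_right (0::real))"
      using dl(1) by (intro filterlim_tendsto_pos_mult_at_top[OF tendsto_const] filterlim_inverse_at_top_right) auto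
    then show "filterlim (\<lambda>e. - (\<delta>\<^sup>2 / 8 * inverse e)) at_bot (at_right (0::real))"
      by (simp add: filterlim_uminus_at_bot)
  qed
  then have "eventually (\<lambda>e. ?c * exp (- (\<delta>\<^sup>2 / 8 * inverse e)) < r / 2) (at_right 0)"
    by (rule order_tendstoD(2)) (use r in simp)
  moreover have "eventually (\<lambda>e::real. e > 0) (at_right 0)" by (simp add: eventually_at_right_less)
  ultimately show "eventually (\<lambda>e. dist (propagate (of_real e) g x) (g x) < r) (at_right 0)"
  proof eventually_elim
    case (elim e)
    have eq: "- \<delta>\<^sup>2 / (8 * e) = - (\<delta>\<^sup>2 / 8 * inverse e)" using elim(2) by (simp add: field_simps)
    show ?case using bound[OF elim(2)] elim(1) unfolding eq by linarith
  qed
qed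

text \<open>A concrete sequence of regularisation parameters, so that Fatou's lemma for sequences applies.\<close>

definition small :: "nat \<Rightarrow> real"
  where "small n = inverse (real (Suc n))"

lemma small_pos: "small n > 0"
  by (simp add: small_def)

lemma small_tendsto: "filterlim small (at_right 0) sequentially"
  unfolding filterlim_at
proof
  show "small \<longlonglongrightarrow> 0" unfolding small_def[abs_def] by (rule LIMSEQ_inverse_real_of_nat)
  show "eventually (\<lambda>n. small n \<in> {0<..} \<and> small n \<noteq> 0) sequentially"
    using small_pos by (intro always_eventually allI) (metis greaterThan_iff less_irrefl)
qed

text \<open>The square of the distance expands into \<open>\<parallel>H g\<parallel>\<^sup>2 - 2 Re (H g, g) + \<parallel>g\<parallel>\<^sup>2\<close>. The first term is
  at most the last by contraction, and the pairing converges to \<open>\<parallel>g\<parallel>\<^sup>2\<close> by dominated convergence on the support of \<open>g\<close>. This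
  avoids estimating \<open>H g\<close> far from the support.\<close>

lemma propagate_real_tendsto_L2_compact_support:
  fixes g :: "'a::euclidean_space \<Rightarrow> complex"
  assumes cont: "continuous_on UNIV g" and m: "\<And>x. cmod (g x) \<le> m" and N: "\<And>x. N < norm x \<Longrightarrow> g x = 0"
  shows "(\<lambda>n. \<integral>x. (cmod (propagate (of_real (small n)) g x - g x))\<^sup>2 \<partial>lborel) \<longlonglongrightarrow> 0"
proof -
  have [measurable]: "g \<in> borel_measurable borel" by (rule borel_measurable_continuous_onI[OF cont])
  have m0: "m \<ge> 0" using order_trans[OF norm_ge_zero m] by blast
  have g1: "integrable lborel g" by (rule integrable_bounded_cball[OF _ m N]) simp_all
  have sq: "(cmod (g x))\<^sup>2 \<le> m\<^sup>2" for x using m by (intro power_mono) auto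
  have g2: "integrable lborel (\<lambda>x. (cmod (g x))\<^sup>2)"
    by (rule integrable_bounded_cball[where M="m\<^sup>2" and m=N]) (use sq N in auto)
  let ?H = "\<lambda>n. propagate (of_real (small n)) g" and ?G = "\<integral>x. (cmod (g x))\<^sup>2 \<partial>lborel"
  have Hm [measurable]: "?H n \<in> borel_measurable borel" for n by (rule borel_measurable_propagate) simp
  have Hb: "cmod (?H n x) \<le> m" for n x by (rule propagate_real_sup_bound(2)[OF small_pos _ m]) simp
  have H2: "integrable lborel (\<lambda>x. (cmod (?H n x))\<^sup>2)" "(\<integral>x. (cmod (?H n x))\<^sup>2 \<partial>lborel) \<le> ?G" for n
    using propagate_L2[OF _ g1 g2, of "of_real (small n)"] small_pos by auto
  let ?I = "\<lambda>n x. Re (?H n x * cnj (g x))"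
  have Ib: "\<bar>?I n x\<bar> \<le> m * cmod (g x)" for n x
  proof -
    have "\<bar>?I n x\<bar> \<le> cmod (?H n x) * cmod (g x)" using abs_Re_le_cmod[of "?H n x * cnj (g x)"] by (simp add: norm_mult)
    also have "\<dots> \<le> m * cmod (g x)" by (rule mult_right_mono[OF Hb]) simp
    finally show ?thesis .
  qed
  have polar: "(cmod (a - b))\<^sup>2 = (cmod a)\<^sup>2 + (cmod b)\<^sup>2 - 2 * Re (a * cnj b)" for a b
    unfolding cmod_power2 by (simp add: power2_eq_square algebra_simps)
  have w: "integrable lborel (\<lambda>x. m * cmod (g x))" using g1 by simp
  have I: "integrable lborel (?I n)" for n
    by (rule Bochner_Integration.integrable_bound[OF w]) (use Ib m0 in \<open>auto simp: abs_mult\<close>)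
  have "(\<lambda>n. \<integral>x. ?I n x \<partial>lborel) \<longlonglongrightarrow> (\<integral>x. (cmod (g x))\<^sup>2 \<partial>lborel)"
  proof (rule integral_dominated_convergence[OF _ _ w])
    show "AE x in lborel. (\<lambda>n. ?I n x) \<longlonglongrightarrow> (cmod (g x))\<^sup>2"
    proof (rule AE_I2)
      fix x
      have "isCont g x" using cont by (simp add: continuous_on_eq_continuous_at)
      then have "(\<lambda>n. ?H n x) \<longlonglongrightarrow> g x"
        by (intro filterlim_compose[OF propagate_real_tendsto_at_continuity_point[OF _ m] small_tendsto]) auto
      then have "(\<lambda>n. ?I n x) \<longlonglongrightarrow> Re (g x * cnj (g x))" by (intro tendsto_intros)
      moreover have "Re (g x * cnj (g x)) = (cmod (g x))\<^sup>2" using cmod_power2[of "g x"] by (simp add: power2_eq_square)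
      ultimately show "(\<lambda>n. ?I n x) \<longlonglongrightarrow> (cmod (g x))\<^sup>2" by simp
    qed
    show "AE x in lborel. norm (?I n x) \<le> m * cmod (g x)" for n using Ib by auto
  qed measurable
  then have "(\<lambda>n. 2 * ?G - 2 * (\<integral>x. ?I n x \<partial>lborel)) \<longlonglongrightarrow> 2 * ?G - 2 * ?G"
    by (intro tendsto_intros)
  then have up: "(\<lambda>n. 2 * ?G - 2 * (\<integral>x. ?I n x \<partial>lborel)) \<longlonglongrightarrow> 0" by simp
  show ?thesis
  proof (rule tendsto_sandwich[OF _ _ tendsto_const up])
    show "eventually (\<lambda>n. 0 \<le> (\<integral>x. (cmod (?H n x - g x))\<^sup>2 \<partial>lborel)) sequentially"
      by (simp add: integral_nonneg_AE)
    have "(\<integral>x. (cmod (?H n x - g x))\<^sup>2 \<partial>lborel) \<le> 2 * ?G - 2 * (\<integral>x. ?I n x \<partial>lborel)" for n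
    proof -
      have "(\<integral>x. (cmod (?H n x - g x))\<^sup>2 \<partial>lborel) = (\<integral>x. (cmod (?H n x))\<^sup>2 + (cmod (g x))\<^sup>2 - 2 * ?I n x \<partial>lborel)"
        unfolding polar ..
      also have "\<dots> = (\<integral>x. (cmod (?H n x))\<^sup>2 \<partial>lborel) + ?G - 2 * (\<integral>x. ?I n x \<partial>lborel)"
        using H2(1)[of n] g2 I[of n] by (simp del: times_complex.sel)
      finally show ?thesis using H2(2)[of n] by linarith
    qed
    then show "eventually (\<lambda>n. (\<integral>x. (cmod (?H n x - g x))\<^sup>2 \<partial>lborel) \<le> 2 * ?G - 2 * (\<integral>x. ?I n x \<partial>lborel)) sequentially"
      by simp
  qed
qed

text \<open>Extends \<open>propagate_L2\<close> from integrable functions by truncation to balls and Fatou's lemma.\<close>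

lemma propagate_L2_contraction:
  fixes v :: "'a::euclidean_space \<Rightarrow> complex"
  assumes z: "Re z > 0" and [measurable]: "v \<in> borel_measurable borel" and v2: "integrable lborel (\<lambda>x. (cmod (v x))\<^sup>2)"
  shows "integrable lborel (\<lambda>x. (cmod (propagate z v x))\<^sup>2)"
    and "(\<integral>x. (cmod (propagate z v x))\<^sup>2 \<partial>lborel) \<le> (\<integral>x. (cmod (v x))\<^sup>2 \<partial>lborel)"
proof -
  define w where "w n x = (if norm x \<le> real n then v x else 0)" for n :: nat and x :: 'a
  have [measurable]: "w n \<in> borel_measurable borel" for n unfolding w_def by measurable
  have [measurable]: "propagate z g \<in> borel_measurable borel" if "g \<in> borel_measurable borel" for g :: "'a \<Rightarrow> complex"
    using that by (rule borel_measurable_propagate)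
  have wv: "cmod (w n x) \<le> cmod (v x)" for n x by (simp add: w_def)
  have w2: "integrable lborel (\<lambda>x. (cmod (w n x))\<^sup>2)" for n
    by (rule Bochner_Integration.integrable_bound[OF v2]) (auto intro!: power_mono wv)
  have w1: "integrable lborel (w n)" for n
  proof -
    have c: "integrable lborel (\<lambda>x. indicator (cball (0::'a) n) x :: real)"
      using emeasure_bounded_finite[OF bounded_cball, of "0::'a" n] by (intro integrable_real_indicator) (auto simp: less_top)
    show ?thesis
    proof (rule Bochner_Integration.integrable_bound[OF Bochner_Integration.integrable_add[OF v2 c]])
      show "AE x in lborel. norm (w n x) \<le> norm ((cmod (v x))\<^sup>2 + indicator (cball 0 (real n)) x)"
      proof (rule AE_I2)
        fix x
        \<comment> \<open>On a ball an \<open>L\<^sup>2\<close> function is integrable.\<close>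
        have "cmod (v x) \<le> (cmod (v x))\<^sup>2 + 1"
          using zero_le_power2[of "cmod (v x) - 1/2"] by (simp add: power2_eq_square algebra_simps)
        then show "norm (w n x) \<le> norm ((cmod (v x))\<^sup>2 + indicator (cball 0 (real n)) x)"
          by (simp add: w_def indicator_def)
      qed
    qed measurable
  qed
  have lim: "(\<lambda>n. propagate z (w n) x) \<longlonglongrightarrow> propagate z v x" for x
    unfolding propagate_def
  proof (rule integral_dominated_convergence[where w="\<lambda>y. cmod (v y * heat_kernel z (x - y))"])
    show "integrable lborel (\<lambda>y. cmod (v y * heat_kernel z (x - y)))"
      by (intro integrable_norm propagate_L2_bounded(1)[OF z _ v2]) simp
    show "AE y in lborel. (\<lambda>n. w n y * heat_kernel z (x - y)) \<longlonglongrightarrow> v y * heat_kernel z (x - y)"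
    proof (rule AE_I2)
      fix y :: 'a
      obtain k where k: "norm y \<le> real k" using real_arch_simple by blast
      have "eventually (\<lambda>n. w n y = v y) sequentially"
        using eventually_ge_at_top[of k] by eventually_elim (use k in \<open>auto simp: w_def\<close>)
      then show "(\<lambda>n. w n y * heat_kernel z (x - y)) \<longlonglongrightarrow> v y * heat_kernel z (x - y)"
        by (intro tendsto_eventually) (auto elim: eventually_mono)
    qed
    show "AE y in lborel. norm (w n y * heat_kernel z (x - y)) \<le> cmod (v y * heat_kernel z (x - y))" for n
      by (rule AE_I2) (auto simp: norm_mult intro!: mult_right_mono wv)
  qed measurable
  have "(\<integral>\<^sup>+x. ennreal ((cmod (propagate z v x))\<^sup>2) \<partial>lborel) = (\<integral>\<^sup>+x. liminf (\<lambda>n. ennreal ((cmod (propagate z (w n) x))\<^sup>2)) \<partial>lborel)"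
  proof (rule nn_integral_cong)
    fix x
    have "(\<lambda>n. ennreal ((cmod (propagate z (w n) x))\<^sup>2)) \<longlonglongrightarrow> ennreal ((cmod (propagate z v x))\<^sup>2)"
      by (intro tendsto_intros lim)
    then show "ennreal ((cmod (propagate z v x))\<^sup>2) = liminf (\<lambda>n. ennreal ((cmod (propagate z (w n) x))\<^sup>2))"
      by (rule lim_imp_Liminf[OF sequentially_bot, symmetric])
  qed
  also have "\<dots> \<le> liminf (\<lambda>n. \<integral>\<^sup>+x. ennreal ((cmod (propagate z (w n) x))\<^sup>2) \<partial>lborel)"
    by (rule nn_integral_liminf) measurable
  also have "\<dots> \<le> ennreal (\<integral>x. (cmod (v x))\<^sup>2 \<partial>lborel)"
  proof (rule Liminf_le[OF sequentially_bot], rule always_eventually, rule allI)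
    fix n
    have "(\<integral>\<^sup>+x. ennreal ((cmod (propagate z (w n) x))\<^sup>2) \<partial>lborel) = ennreal (\<integral>x. (cmod (propagate z (w n) x))\<^sup>2 \<partial>lborel)"
      by (rule nn_integral_eq_integral[OF propagate_L2(1)[OF z w1 w2]]) simp
    also have "\<dots> \<le> ennreal (\<integral>x. (cmod (w n x))\<^sup>2 \<partial>lborel)" by (rule ennreal_leI[OF propagate_L2(2)[OF z w1 w2]])
    also have "\<dots> \<le> ennreal (\<integral>x. (cmod (v x))\<^sup>2 \<partial>lborel)"
      by (intro ennreal_leI integral_mono w2 v2 power_mono wv) simp
    finally show "(\<integral>\<^sup>+x. ennreal ((cmod (propagate z (w n) x))\<^sup>2) \<partial>lborel) \<le> ennreal (\<integral>x. (cmod (v x))\<^sup>2 \<partial>lborel)" .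
  qed
  finally have le: "(\<integral>\<^sup>+x. ennreal ((cmod (propagate z v x))\<^sup>2) \<partial>lborel) \<le> ennreal (\<integral>x. (cmod (v x))\<^sup>2 \<partial>lborel)" .
  show i: "integrable lborel (\<lambda>x. (cmod (propagate z v x))\<^sup>2)"
    by (rule integrableI_nonneg) (use le in \<open>auto intro: le_less_trans\<close>)
  show "(\<integral>x. (cmod (propagate z v x))\<^sup>2 \<partial>lborel) \<le> (\<integral>x. (cmod (v x))\<^sup>2 \<partial>lborel)"
    using le by (subst (asm) nn_integral_eq_integral[OF i]) (auto simp: ennreal_le_iff integral_nonneg_AE)
qed

text \<open>Truncate \<open>v\<close> in size and in space, approximate the truncation almost everywhere by
  continuous functions, and clamp these to the same size and a slightly larger ball, so that dominated convergence applies.\<close>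

lemma continuous_compact_support_dense_L2:
  fixes v :: "'a::euclidean_space \<Rightarrow> complex"
  assumes [measurable]: "v \<in> borel_measurable borel" and v2: "integrable lborel (\<lambda>x. (cmod (v x))\<^sup>2)" and r: "r > 0"
  obtains g m N where "continuous_on UNIV g" "\<And>x. cmod (g x) \<le> m" "\<And>x. N < norm x \<Longrightarrow> g x = 0"
    "(\<integral>x. (cmod (v x - g x))\<^sup>2 \<partial>lborel) < r"
proof -
  define w where "w n x = (if cmod (v x) \<le> real n \<and> norm x \<le> real n then v x else 0)" for n :: nat and x :: 'a
  have [measurable]: "w n \<in> borel_measurable borel" for n unfolding w_def by measurable
  have dom: "(cmod (v x - w n x))\<^sup>2 \<le> (cmod (v x))\<^sup>2" for n x by (simp add: w_def)
  have vw: "integrable lborel (\<lambda>x. (cmod (v x - w n x))\<^sup>2)" for n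
    by (rule Bochner_Integration.integrable_bound[OF v2]) (use dom in auto)
  have "(\<lambda>n. \<integral>x. (cmod (v x - w n x))\<^sup>2 \<partial>lborel) \<longlonglongrightarrow> (\<integral>(x::'a). 0 \<partial>lborel)"
  proof (rule integral_dominated_convergence[OF _ _ v2])
    show "AE x in lborel. (\<lambda>n. (cmod (v x - w n x))\<^sup>2) \<longlonglongrightarrow> 0"
    proof (rule AE_I2)
      fix x :: 'a
      obtain k where k: "max (cmod (v x)) (norm x) \<le> real k" using real_arch_simple by blast
      have "eventually (\<lambda>n. w n x = v x) sequentially"
        using eventually_ge_at_top[of k] by eventually_elim (use k in \<open>auto simp: w_def\<close>)
      then show "(\<lambda>n. (cmod (v x - w n x))\<^sup>2) \<longlonglongrightarrow> 0"
        by (intro tendsto_eventually) (auto elim: eventually_mono)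
    qed
    show "AE x in lborel. norm ((cmod (v x - w n x))\<^sup>2) \<le> (cmod (v x))\<^sup>2" for n using dom by auto
  qed measurable
  then have "eventually (\<lambda>n. (\<integral>x. (cmod (v x - w n x))\<^sup>2 \<partial>lborel) < r / 4) sequentially"
    using order_tendstoD(2)[of _ 0 _ "r / 4"] r by simp
  then obtain k where k: "(\<integral>x. (cmod (v x - w k x))\<^sup>2 \<partial>lborel) < r / 4"
    using eventually_happens by fastforce
  have wb: "cmod (w k x) \<le> real k" for x by (simp add: w_def)
  have "w k \<in> borel_measurable (lebesgue_on UNIV)" using lebesgue_measurable_of_borel[of "w k"] by simp
  then have "w k measurable_on UNIV" by (subst measurable_on_iff_borel_measurable) auto
  then obtain S h where S: "negligible S" and h: "\<And>n. continuous_on UNIV (h n)" "\<And>x. x \<notin> S \<Longrightarrow> (\<lambda>n. h n x) \<longlonglongrightarrow> w k x"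
    unfolding measurable_on_def by auto
  define M where "M = real k + 1"
  have M: "M > 0" by (simp add: M_def)
  \<comment> \<open>Equal to one on the support of the truncation and to zero outside the ball of radius \<open>M\<close>.\<close>
  define cut where "cut x = max 0 (min 1 (M - norm x))" for x :: 'a
  define clamp where "clamp c = c * of_real (M / max M (cmod c))" for c
  define g where "g n x = of_real (cut x) * clamp (h n x)" for n x
  have clamp_le: "cmod (clamp c) \<le> M" for c
  proof -
    have "cmod (clamp c) = cmod c * M / max M (cmod c)" using M by (simp add: clamp_def norm_mult norm_divide)
    also have "\<dots> \<le> M" using M by (simp add: divide_le_eq mult.commute mult_left_mono)
    finally show ?thesis .
  qed
  have chi: "0 \<le> cut x" "cut x \<le> 1" "M < norm x \<Longrightarrow> cut x = 0" "norm x \<le> real k \<Longrightarrow> cut x = 1" for x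
    by (auto simp: cut_def M_def)
  have contc: "continuous_on UNIV clamp"
    unfolding clamp_def[abs_def] using M by (intro continuous_intros) auto
  have cont: "continuous_on UNIV (g n)" for n
    unfolding g_def[abs_def] cut_def[abs_def]
    by (intro continuous_intros continuous_on_compose2[OF contc h(1)]) auto
  have [measurable]: "g n \<in> borel_measurable borel" for n by (rule borel_measurable_continuous_onI[OF cont])
  have gb: "cmod (g n x) \<le> M" for n x
  proof -
    have "cmod (g n x) \<le> 1 * M" unfolding g_def norm_mult norm_of_real using chi clamp_le by (intro mult_mono) auto
    then show ?thesis by simp
  qed
  have g0: "g n x = 0" if "M < norm x" for n x using chi(3)[OF that] by (simp add: g_def)
  have glim: "(\<lambda>n. g n x) \<longlonglongrightarrow> w k x" if "x \<notin> S" for x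
  proof -
    have "isCont clamp (w k x)" using contc by (simp add: continuous_on_eq_continuous_at)
    then have "(\<lambda>n. g n x) \<longlonglongrightarrow> of_real (cut x) * clamp (w k x)"
      unfolding g_def by (intro tendsto_intros isCont_tendsto_compose[OF _ h(2)[OF that]])
    moreover have "clamp (w k x) = w k x" using wb[of x] M unfolding clamp_def M_def by (simp add: max_def)
    moreover have "of_real (cut x) * w k x = w k x" using chi(4)[of x] by (auto simp: w_def)
    ultimately show ?thesis by simp
  qed
  have ae: "AE x in lborel. x \<notin> S"
  proof -
    have "S \<in> null_sets lebesgue" using S by (simp add: negligible_iff_null_sets)
    then have "AE x in lebesgue. x \<notin> S" by (rule AE_not_in)
    then show ?thesis by (simp add: AE_completion_iff)
  qed
  have sqb: "(cmod (w k x - g n x))\<^sup>2 \<le> (2 * M)\<^sup>2 * indicator (cball 0 M) x" for n x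
  proof (cases "norm x \<le> M")
    case True
    have "cmod (w k x - g n x) \<le> 2 * M"
      using norm_triangle_ineq4[of "w k x" "g n x"] wb[of x] gb[of n x] by (simp add: M_def)
    then show ?thesis using True power_mono[of "cmod (w k x - g n x)" "2 * M" 2] by simp
  next
    case False
    then have "w k x = 0" "g n x = 0" using g0[of x n] by (auto simp: w_def M_def)
    then show ?thesis by simp
  qed
  have ib: "integrable lborel (\<lambda>x::'a. (2 * M)\<^sup>2 * indicator (cball 0 M) x)"
    using emeasure_bounded_finite[OF bounded_cball, of "0::'a" M] by (intro integrable_mult_right integrable_real_indicator) (auto simp: less_top)
  have wg: "integrable lborel (\<lambda>x. (cmod (w k x - g n x))\<^sup>2)" for n
    by (rule Bochner_Integration.integrable_bound[OF ib]) (use sqb in auto)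
  have "(\<lambda>n. \<integral>x. (cmod (w k x - g n x))\<^sup>2 \<partial>lborel) \<longlonglongrightarrow> (\<integral>(x::'a). 0 \<partial>lborel)"
  proof (rule integral_dominated_convergence[OF _ _ ib])
    show "AE x in lborel. (\<lambda>n. (cmod (w k x - g n x))\<^sup>2) \<longlonglongrightarrow> 0"
      using ae
    proof eventually_elim
      case (elim x)
      have "(\<lambda>n. (cmod (w k x - g n x))\<^sup>2) \<longlonglongrightarrow> (cmod (w k x - w k x))\<^sup>2"
        by (intro tendsto_intros glim elim)
      then show ?case by simp
    qed
    show "AE x in lborel. norm ((cmod (w k x - g n x))\<^sup>2) \<le> (2 * M)\<^sup>2 * indicator (cball 0 M) x" for n using sqb by auto
  qed measurable
  then have "eventually (\<lambda>n. (\<integral>x. (cmod (w k x - g n x))\<^sup>2 \<partial>lborel) < r / 4) sequentially"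
    using order_tendstoD(2)[of _ 0 _ "r / 4"] r by simp
  then obtain n where n: "(\<integral>x. (cmod (w k x - g n x))\<^sup>2 \<partial>lborel) < r / 4"
    using eventually_happens by fastforce
  have tri: "(cmod (v x - g n x))\<^sup>2 \<le> 2 * (cmod (v x - w k x))\<^sup>2 + 2 * (cmod (w k x - g n x))\<^sup>2" for x
  proof -
    have "(cmod (v x - g n x))\<^sup>2 \<le> (cmod (v x - w k x) + cmod (w k x - g n x))\<^sup>2"
      using norm_triangle_ineq[of "v x - w k x" "w k x - g n x"] by (intro power_mono) auto
    also have "\<dots> \<le> 2 * (cmod (v x - w k x))\<^sup>2 + 2 * (cmod (w k x - g n x))\<^sup>2"
      using sum_squares_bound[of "cmod (v x - w k x)" "cmod (w k x - g n x)"] by (simp add: power2_sum)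
    finally show ?thesis .
  qed
  have i2: "integrable lborel (\<lambda>x. 2 * (cmod (v x - w k x))\<^sup>2 + 2 * (cmod (w k x - g n x))\<^sup>2)"
    using vw[of k] wg[of n] by simp
  have "integrable lborel (\<lambda>x. (cmod (v x - g n x))\<^sup>2)"
    by (rule Bochner_Integration.integrable_bound[OF i2]) (use tri in auto)
  then have "(\<integral>x. (cmod (v x - g n x))\<^sup>2 \<partial>lborel) \<le> (\<integral>x. 2 * (cmod (v x - w k x))\<^sup>2 + 2 * (cmod (w k x - g n x))\<^sup>2 \<partial>lborel)"
    by (rule integral_mono[OF _ i2 tri])
  also have "\<dots> < r" using vw[of k] wg[of n] k n by simp
  finally show ?thesis using that[OF cont gb g0] by blast
qed

text \<open>Contraction and density: it is enough to know the convergence for continuous functions of compact support.\<close>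

lemma propagate_real_tendsto_L2:
  fixes v :: "'a::euclidean_space \<Rightarrow> complex"
  assumes [measurable]: "v \<in> borel_measurable borel" and v2: "integrable lborel (\<lambda>x. (cmod (v x))\<^sup>2)"
  shows "\<And>n. integrable lborel (\<lambda>x. (cmod (propagate (of_real (small n)) v x - v x))\<^sup>2)"
    and "(\<lambda>n. \<integral>x. (cmod (propagate (of_real (small n)) v x - v x))\<^sup>2 \<partial>lborel) \<longlonglongrightarrow> 0"
proof -
  have z: "Re (of_real (small n)) > 0" for n using small_pos by simp
  have [measurable]: "propagate z g \<in> borel_measurable borel" if "g \<in> borel_measurable borel" for z and g :: "'a \<Rightarrow> complex"
    using that by (rule borel_measurable_propagate)
  have diff2: "integrable lborel (\<lambda>x. (cmod (a x - b x))\<^sup>2)"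
    if [measurable]: "a \<in> borel_measurable borel" "b \<in> borel_measurable borel"
      and "integrable lborel (\<lambda>x. (cmod (a x))\<^sup>2)" "integrable lborel (\<lambda>x. (cmod (b x))\<^sup>2)" for a b :: "'a \<Rightarrow> complex"
  proof (rule Bochner_Integration.integrable_bound)
    show "integrable lborel (\<lambda>x. 2 * (cmod (a x))\<^sup>2 + 2 * (cmod (b x))\<^sup>2)" using that by simp
    have "(cmod (a x - b x))\<^sup>2 \<le> 2 * (cmod (a x))\<^sup>2 + 2 * (cmod (b x))\<^sup>2" for x
    proof -
      have "(cmod (a x - b x))\<^sup>2 \<le> (cmod (a x) + cmod (b x))\<^sup>2" by (intro power_mono norm_triangle_ineq4) auto
      also have "\<dots> \<le> 2 * (cmod (a x))\<^sup>2 + 2 * (cmod (b x))\<^sup>2"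
        using sum_squares_bound[of "cmod (a x)" "cmod (b x)"] by (simp add: power2_sum)
      finally show ?thesis .
    qed
    then show "AE x in lborel. norm ((cmod (a x - b x))\<^sup>2) \<le> norm (2 * (cmod (a x))\<^sup>2 + 2 * (cmod (b x))\<^sup>2)" by auto
  qed measurable
  show int: "integrable lborel (\<lambda>x. (cmod (propagate (of_real (small n)) v x - v x))\<^sup>2)" for n
    by (rule diff2) (auto intro!: propagate_L2_contraction(1) z v2)
  show "(\<lambda>n. \<integral>x. (cmod (propagate (of_real (small n)) v x - v x))\<^sup>2 \<partial>lborel) \<longlonglongrightarrow> 0"
  proof (rule order_tendstoI)
    fix r :: real assume "r < 0"
    have "r < (\<integral>x. (cmod (propagate (of_real (small n)) v x - v x))\<^sup>2 \<partial>lborel)" for n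
      by (rule less_le_trans[OF \<open>r < 0\<close>]) (simp add: integral_nonneg_AE)
    then show "eventually (\<lambda>n. r < (\<integral>x. (cmod (propagate (of_real (small n)) v x - v x))\<^sup>2 \<partial>lborel)) sequentially" by simp
  next
    fix r :: real assume r: "0 < r"
    then have "r / 9 > 0" by simp
    from continuous_compact_support_dense_L2[OF assms(1) v2 this] obtain g m N where g: "continuous_on UNIV g"
      "\<And>x. cmod (g x) \<le> m" "\<And>x. N < norm x \<Longrightarrow> g x = 0" "(\<integral>x. (cmod (v x - g x))\<^sup>2 \<partial>lborel) < r / 9" by blast
    have [measurable]: "g \<in> borel_measurable borel" by (rule borel_measurable_continuous_onI[OF g(1)])
    have sq: "(cmod (g x))\<^sup>2 \<le> m\<^sup>2" for x using g(2) by (intro power_mono) auto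
    have g2: "integrable lborel (\<lambda>x. (cmod (g x))\<^sup>2)"
      by (rule integrable_bounded_cball[where M="m\<^sup>2" and m=N]) (use sq g(3) in auto)
    have vg: "integrable lborel (\<lambda>x. (cmod (v x - g x))\<^sup>2)" by (rule diff2) (auto intro: v2 g2)
    have gn: "integrable lborel (\<lambda>x. (cmod (propagate (of_real (small n)) g x - g x))\<^sup>2)" for n
      by (rule diff2) (auto intro!: propagate_L2_contraction(1) z g2)
    have "(\<lambda>n. \<integral>x. (cmod (propagate (of_real (small n)) g x - g x))\<^sup>2 \<partial>lborel) \<longlonglongrightarrow> 0"
      by (rule propagate_real_tendsto_L2_compact_support[where N=N, OF g(1,2) g(3)])
    then have "eventually (\<lambda>n. (\<integral>x. (cmod (propagate (of_real (small n)) g x - g x))\<^sup>2 \<partial>lborel) < r / 9) sequentially"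
      by (rule order_tendstoD(2)) (use r in simp)
    then show "eventually (\<lambda>n. (\<integral>x. (cmod (propagate (of_real (small n)) v x - v x))\<^sup>2 \<partial>lborel) < r) sequentially"
    proof eventually_elim
      case (elim n)
      let ?z = "complex_of_real (small n)"
      let ?d = "\<lambda>x. v x - g x"
      have dm: "?d \<in> borel_measurable borel" by measurable
      have lin: "propagate ?z v x - propagate ?z g x = propagate ?z ?d x" for x
      proof -
        have "(\<integral>y. ?d y * heat_kernel ?z (x - y) \<partial>lborel) = (\<integral>y. v y * heat_kernel ?z (x - y) - g y * heat_kernel ?z (x - y) \<partial>lborel)"
          by (simp add: left_diff_distrib)
        also have "\<dots> = (\<integral>y. v y * heat_kernel ?z (x - y) \<partial>lborel) - (\<integral>y. g y * heat_kernel ?z (x - y) \<partial>lborel)"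
          by (rule Bochner_Integration.integral_diff[OF propagate_L2_bounded(1)[OF z assms(1) v2] propagate_L2_bounded(1)[OF z _ g2]]) simp
        finally show ?thesis by (simp only: propagate_def)
      qed
      have three: "(cmod (a + b + c))\<^sup>2 \<le> 3 * (cmod a)\<^sup>2 + 3 * (cmod b)\<^sup>2 + 3 * (cmod c)\<^sup>2" for a b c
      proof -
        have "cmod (a + b + c) \<le> cmod a + cmod b + cmod c"
          using norm_triangle_ineq[of "a + b" c] norm_triangle_ineq[of a b] by linarith
        then have "(cmod (a + b + c))\<^sup>2 \<le> (cmod a + cmod b + cmod c)\<^sup>2" by (intro power_mono) auto
        also have "\<dots> \<le> 3 * (cmod a)\<^sup>2 + 3 * (cmod b)\<^sup>2 + 3 * (cmod c)\<^sup>2"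
          using sum_squares_bound[of "cmod a" "cmod b"] sum_squares_bound[of "cmod b" "cmod c"] sum_squares_bound[of "cmod a" "cmod c"]
          by (simp add: power2_eq_square algebra_simps)
        finally show ?thesis .
      qed
      have c: "integrable lborel (\<lambda>x. (cmod (propagate ?z ?d x))\<^sup>2)"
         "(\<integral>x. (cmod (propagate ?z ?d x))\<^sup>2 \<partial>lborel) \<le> (\<integral>x. (cmod (v x - g x))\<^sup>2 \<partial>lborel)"
        by (rule propagate_L2_contraction[OF z dm vg])+
      have "(\<integral>x. (cmod (propagate ?z v x - v x))\<^sup>2 \<partial>lborel) \<le>
        (\<integral>x. 3 * (cmod (propagate ?z ?d x))\<^sup>2 + 3 * (cmod (propagate ?z g x - g x))\<^sup>2 + 3 * (cmod (v x - g x))\<^sup>2 \<partial>lborel)"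
      proof (rule integral_mono[OF int])
        show "integrable lborel (\<lambda>x. 3 * (cmod (propagate ?z ?d x))\<^sup>2 + 3 * (cmod (propagate ?z g x - g x))\<^sup>2 + 3 * (cmod (v x - g x))\<^sup>2)"
          by (intro Bochner_Integration.integrable_add integrable_mult_right c gn vg)
        fix x :: 'a
        have eq: "propagate ?z v x - v x = propagate ?z ?d x + (propagate ?z g x - g x) + (g x - v x)"
          unfolding lin[symmetric] by simp
        show "(cmod (propagate ?z v x - v x))\<^sup>2 \<le> 3 * (cmod (propagate ?z ?d x))\<^sup>2 + 3 * (cmod (propagate ?z g x - g x))\<^sup>2 + 3 * (cmod (v x - g x))\<^sup>2"
          using three[of "propagate ?z ?d x" "propagate ?z g x - g x" "g x - v x"] unfolding eq norm_minus_commute[of "g x" "v x"] .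
      qed
      also have "\<dots> = 3 * (\<integral>x. (cmod (propagate ?z ?d x))\<^sup>2 \<partial>lborel) + 3 * (\<integral>x. (cmod (propagate ?z g x - g x))\<^sup>2 \<partial>lborel) + 3 * (\<integral>x. (cmod (v x - g x))\<^sup>2 \<partial>lborel)"
        using c(1) gn[of n] vg by simp
      also have "\<dots> < r" using c(2) g(4) elim by linarith
      finally show ?case .
    qed
  qed
qed

section \<open>The weighted estimate\<close>

text \<open>With \<open>X = a\<^sup>2 / (r F)\<^sup>2\<close> and \<open>Y = (a / F)^q\<close> the left-hand side is \<open>F^p X^(1 - \<theta>) Y^\<theta>\<close>, and a
  geometric mean is at most \<open>max X Y\<close>.\<close>

lemma interpolated_power_le:
  fixes a r F \<theta> p q :: real
  assumes a: "a \<ge> 0" and r: "r \<ge> 0" and F: "F > 0" and th: "0 \<le> \<theta>" "\<theta> \<le> 1" and p: "p = 2 * (1 - \<theta>) + q * \<theta>"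
  shows "a powr p / r powr (2 * (1 - \<theta>)) \<le> F powr p / F\<^sup>2 * (a\<^sup>2 / r\<^sup>2) + F powr p / F powr q * a powr q"
proof (cases "a = 0 \<or> r = 0")
  case True
  then show ?thesis using a r F by auto
next
  case False
  then have pos: "a > 0" "r > 0" using a r by auto
  define X Y where "X = a\<^sup>2 / (r\<^sup>2 * F\<^sup>2)" and "Y = a powr q / F powr q"
  have XY: "X > 0" "Y > 0" using pos F by (auto simp: X_def Y_def)
  have "X powr (1 - \<theta>) * Y powr \<theta> \<le> max X Y powr (1 - \<theta>) * max X Y powr \<theta>"
    using XY th by (intro mult_mono powr_mono2) auto
  also have "\<dots> = max X Y" using XY by (simp add: powr_add[symmetric])
  also have "\<dots> \<le> X + Y" using XY by simp
  finally have le: "X powr (1 - \<theta>) * Y powr \<theta> \<le> X + Y" .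
  have X2: "X = (a / (r * F)) powr 2"
    using pos F by (simp add: X_def powr_numeral power_divide power_mult_distrib)
  have Y2: "Y = (a / F) powr q" using pos F by (simp add: Y_def powr_divide)
  have "X powr (1 - \<theta>) = a powr (2 * (1 - \<theta>)) / (r powr (2 * (1 - \<theta>)) * F powr (2 * (1 - \<theta>)))"
    unfolding X2 powr_powr using pos F by (simp add: powr_divide powr_mult)
  moreover have "Y powr \<theta> = a powr (q * \<theta>) / F powr (q * \<theta>)"
    unfolding Y2 powr_powr using pos F by (simp add: powr_divide)
  moreover have "b powr p = b powr (2 * (1 - \<theta>)) * b powr (q * \<theta>)" for b :: real
    unfolding p by (rule powr_add)
  ultimately have "X powr (1 - \<theta>) * Y powr \<theta> * F powr p = a powr p / r powr (2 * (1 - \<theta>))"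
    using pos F by simp
  then have "a powr p / r powr (2 * (1 - \<theta>)) \<le> (X + Y) * F powr p"
    using mult_right_mono[OF le, of "F powr p"] by simp
  also have "\<dots> = F powr p / F\<^sup>2 * (a\<^sup>2 / r\<^sup>2) + F powr p / F powr q * a powr q"
    unfolding X_def Y_def by (simp add: distrib_left distrib_right mult.commute)
  finally show ?thesis .
qed

text \<open>Taking \<open>F = \<parallel>f\<parallel>\<close> in \<open>interpolated_power_le\<close> makes both endpoint terms multiples of \<open>\<parallel>f\<parallel>^p\<close>.\<close>

lemma weighted_smoothed_bound:
  fixes p :: real
  assumes d: "DIM('a::euclidean_space) \<ge> 3" and p: "2 \<le> p" "p \<le> 2 + 4 / DIM('a)"
  obtains C where "C > 0"
    "\<And>(f::'a \<Rightarrow> complex) e. e > 0 \<Longrightarrow> f \<in> borel_measurable borel \<Longrightarrow> integrable lborel (\<lambda>x. (cmod (f x))\<^sup>2) \<Longrightarrow>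
      (\<integral>\<^sup>+t. \<integral>\<^sup>+x. ennreal (cmod (propagate (ctime e t) f x) powr p / norm x powr (real DIM('a) + 2 - p * real DIM('a) / 2)) \<partial>lborel \<partial>lborel)
        \<le> ennreal (C * (\<integral>x. (cmod (f x))\<^sup>2 \<partial>lborel) powr (p / 2))"
proof -
  define q where "q = 2 + 4 / real DIM('a)"
  obtain CS where CS: "CS > 0"
    "\<And>(f::'a \<Rightarrow> complex) e. e > 0 \<Longrightarrow> f \<in> borel_measurable borel \<Longrightarrow> integrable lborel (\<lambda>x. (cmod (f x))\<^sup>2) \<Longrightarrow>
      (\<integral>\<^sup>+t. \<integral>\<^sup>+x. ennreal (cmod (propagate (ctime e t) f x) powr q) \<partial>lborel \<partial>lborel)
        \<le> ennreal (CS * (\<integral>x. (cmod (f x))\<^sup>2 \<partial>lborel) powr (q / 2))"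
    using strichartz[OF q_def] by blast
  define CK where "CK = 32 * sqrt (4 / pi) ^ DIM('a) / (1 - 2 powr (- (1 / 4)))"
  have "(2::real) powr (- (1 / 4)) < 2 powr 0" by (intro powr_less_mono) auto
  then have CK0: "CK > 0" by (auto simp: CK_def)
  define \<theta> where "\<theta> = (p - 2) * DIM('a) / 4"
  have d0: "real DIM('a) > 0" by simp
  have "(p - 2) * real DIM('a) \<le> 4" using p(2) d0 by (simp add: field_simps)
  then have th: "0 \<le> \<theta>" "\<theta> \<le> 1" using p(1) by (auto simp: \<theta>_def)
  have pq: "p = 2 * (1 - \<theta>) + q * \<theta>"
  proof -
    have "4 / real DIM('a) * \<theta> = p - 2" using d0 by (simp add: \<theta>_def)
    moreover have "q * \<theta> = 2 * \<theta> + 4 / real DIM('a) * \<theta>" by (simp add: q_def distrib_right)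
    ultimately show ?thesis by simp
  qed
  have w: "real DIM('a) + 2 - p * DIM('a) / 2 = 2 * (1 - \<theta>)"
    by (simp add: \<theta>_def algebra_simps add_divide_distrib diff_divide_distrib)
  show ?thesis
  proof (rule that)
    show "CK + CS > 0" using CK0 CS by simp
    fix f :: "'a \<Rightarrow> complex" and e :: real
    assume e: "e > 0" and fm [measurable]: "f \<in> borel_measurable borel" and f2: "integrable lborel (\<lambda>x. (cmod (f x))\<^sup>2)"
    let ?U = "\<lambda>t x. propagate (ctime e t) f x" and ?F2 = "\<integral>x. (cmod (f x))\<^sup>2 \<partial>lborel"
    note [measurable] = measurable_propagate_ctime[OF fm]
    have F2: "?F2 \<ge> 0" by (simp add: integral_nonneg_AE)
    have split: "ennreal (a * b + c * d) = ennreal a * ennreal b + ennreal c * ennreal d"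
      if "a \<ge> 0" "b \<ge> 0" "c \<ge> 0" "d \<ge> 0" for a b c d
      using that by (simp add: ennreal_mult)
    show "(\<integral>\<^sup>+t. \<integral>\<^sup>+x. ennreal (cmod (?U t x) powr p / norm x powr (real DIM('a) + 2 - p * real DIM('a) / 2)) \<partial>lborel \<partial>lborel)
        \<le> ennreal ((CK + CS) * ?F2 powr (p / 2))"
    proof (cases "?F2 = 0")
      case True
      \<comment> \<open>For a null datum the evolution vanishes and the normalisation is not available.\<close>
      have "?U t x = 0" for t x
        using propagate_L2_bounded(3)[OF _ fm f2, of "ctime e t" x] e True by simp
      then show ?thesis by simp
    next
      case False
      define F where "F = sqrt ?F2"
      have F: "F > 0" using False F2 by (simp add: F_def less_le)
      have Fp: "?F2 powr (b / 2) = F powr b" for b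
        using F2 False by (simp add: F_def powr_half_sqrt[symmetric] powr_powr mult.commute)
      have FF: "F\<^sup>2 = ?F2" using F2 by (simp add: F_def)
      have "(\<integral>\<^sup>+t. \<integral>\<^sup>+x. ennreal (cmod (?U t x) powr p / norm x powr (real DIM('a) + 2 - p * real DIM('a) / 2)) \<partial>lborel \<partial>lborel)
        \<le> (\<integral>\<^sup>+t. \<integral>\<^sup>+x. ennreal (F powr p / F\<^sup>2) * ennreal ((cmod (?U t x))\<^sup>2 / (norm x)\<^sup>2) +
             ennreal (F powr p / F powr q) * ennreal (cmod (?U t x) powr q) \<partial>lborel \<partial>lborel)"
      proof (intro nn_integral_mono)
        fix t :: real and x :: 'a
        have "ennreal (cmod (?U t x) powr p / norm x powr (2 * (1 - \<theta>))) \<le>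
           ennreal (F powr p / F\<^sup>2 * ((cmod (?U t x))\<^sup>2 / (norm x)\<^sup>2) + F powr p / F powr q * cmod (?U t x) powr q)"
          by (intro ennreal_leI interpolated_power_le[OF _ _ F th pq]) auto
        also have "\<dots> = ennreal (F powr p / F\<^sup>2) * ennreal ((cmod (?U t x))\<^sup>2 / (norm x)\<^sup>2) +
             ennreal (F powr p / F powr q) * ennreal (cmod (?U t x) powr q)"
          by (rule split) auto
        finally show "ennreal (cmod (?U t x) powr p / norm x powr (real DIM('a) + 2 - p * real DIM('a) / 2)) \<le>
          ennreal (F powr p / F\<^sup>2) * ennreal ((cmod (?U t x))\<^sup>2 / (norm x)\<^sup>2) +
             ennreal (F powr p / F powr q) * ennreal (cmod (?U t x) powr q)" unfolding w .
      qed
      also have "\<dots> = ennreal (F powr p / F\<^sup>2) * (\<integral>\<^sup>+t. \<integral>\<^sup>+x. ennreal ((cmod (?U t x))\<^sup>2 / (norm x)\<^sup>2) \<partial>lborel \<partial>lborel) +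
          ennreal (F powr p / F powr q) * (\<integral>\<^sup>+t. \<integral>\<^sup>+x. ennreal (cmod (?U t x) powr q) \<partial>lborel \<partial>lborel)"
        by (simp add: nn_integral_add nn_integral_cmult)
      also have "\<dots> \<le> ennreal (F powr p / F\<^sup>2) * ennreal (CK * ?F2) + ennreal (F powr p / F powr q) * ennreal (CS * ?F2 powr (q / 2))"
        using kato_smoothing[OF d e fm f2] CS(2)[OF e fm f2] unfolding CK_def
        by (intro add_mono mult_left_mono) auto
      also have "\<dots> = ennreal (F powr p / F\<^sup>2 * (CK * F\<^sup>2) + F powr p / F powr q * (CS * F powr q))"
        unfolding Fp unfolding FF[symmetric] by (rule split[symmetric]) (use CK0 CS F in auto)
      also have "F powr p / F\<^sup>2 * (CK * F\<^sup>2) + F powr p / F powr q * (CS * F powr q) = (CK + CS) * ?F2 powr (p / 2)"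
        unfolding Fp using F by (simp add: distrib_right)
      finally show ?thesis .
    qed
  qed
qed

text \<open>Lebesgue measurable functions are replaced by Borel versions, on which convolutions and product measures can be used.\<close>

lemma square_integrable_borel_version:
  fixes f :: "'a::euclidean_space \<Rightarrow> complex"
  assumes f: "square_integrable f"
  obtains g where "g \<in> borel_measurable borel" "AE x in lebesgue. f x = g x" "integrable lborel (\<lambda>x. (cmod (g x))\<^sup>2)"
    "(\<integral>x. (cmod (g x))\<^sup>2 \<partial>lborel) = (\<integral>x. (cmod (f x))\<^sup>2 \<partial>lebesgue)"
proof -
  note [measurable] = square_integrableD(1)[OF f]
  have re: "(\<lambda>x. Re (f x)) \<in> borel_measurable lebesgue" and im: "(\<lambda>x. Im (f x)) \<in> borel_measurable lebesgue"
    by measurable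
  from completion_ex_borel_measurable_real[OF re] obtain a
    where "a \<in> borel_measurable lborel" and aeq: "AE x in lborel. Re (f x) = a x" by blast
  then have [measurable]: "a \<in> borel_measurable borel" by simp
  from completion_ex_borel_measurable_real[OF im] obtain b
    where "b \<in> borel_measurable lborel" and beq: "AE x in lborel. Im (f x) = b x" by blast
  then have [measurable]: "b \<in> borel_measurable borel" by simp
  define g where "g x = Complex (a x) (b x)" for x
  have gm [measurable]: "g \<in> borel_measurable borel"
    unfolding g_def[abs_def] Complex_eq by measurable
  note [measurable] = lebesgue_measurable_of_borel[OF gm]
  have "AE x in lborel. f x = g x" using aeq beq by eventually_elim (simp add: g_def complex_eq_iff)
  then have ae: "AE x in lebesgue. f x = g x" by (rule AE_completion)
  have "integrable lebesgue (\<lambda>x. (cmod (f x))\<^sup>2) = integrable lebesgue (\<lambda>x. (cmod (g x))\<^sup>2)"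
    by (rule integrable_cong_AE) (use ae in auto)
  then have "integrable lborel (\<lambda>x. (cmod (g x))\<^sup>2)"
    using square_integrableD(2)[OF f] by (subst integrable_lebesgue_iff_lborel[symmetric]) auto
  moreover have "(\<integral>x. (cmod (f x))\<^sup>2 \<partial>lebesgue) = (\<integral>x. (cmod (g x))\<^sup>2 \<partial>lebesgue)"
    by (rule integral_cong_AE) (use ae in auto)
  moreover have "(\<integral>x. (cmod (g x))\<^sup>2 \<partial>lebesgue) = (\<integral>x. (cmod (g x))\<^sup>2 \<partial>lborel)"
    by (rule integral_completion) simp
  ultimately show ?thesis using that[OF gm ae] by simp
qed

lemma smoothed_solution:
  fixes u :: "real \<Rightarrow> 'a::euclidean_space \<Rightarrow> complex"
  assumes sol: "schrodinger_solution f u" and f: "square_integrable f" and e: "e > 0"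
    and v: "v \<in> borel_measurable borel" "AE x in lebesgue. u t x = v x"
    and g: "g \<in> borel_measurable borel" "AE x in lebesgue. f x = g x"
  shows "propagate (of_real e) v y = propagate (ctime e t) g y"
proof -
  have ut: "square_integrable (u t)" using sol by (simp add: schrodinger_solution_def)
  have *: "(\<integral>x. a x * heat_kernel z (x - y) \<partial>lebesgue) = propagate z b y"
    if a: "square_integrable a" and [measurable]: "b \<in> borel_measurable borel" and ae: "AE x in lebesgue. a x = b x" for z a b
  proof -
    have h: "(\<lambda>x. b x * heat_kernel z (x - y)) \<in> borel_measurable borel" by measurable
    have h': "(\<lambda>x::'a. heat_kernel z (x - y)) \<in> borel_measurable borel" by measurable
    note [measurable] = square_integrableD(1)[OF a] lebesgue_measurable_of_borel[OF h] lebesgue_measurable_of_borel[OF h']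
    have "(\<integral>x. a x * heat_kernel z (x - y) \<partial>lebesgue) = (\<integral>x. b x * heat_kernel z (x - y) \<partial>lebesgue)"
      by (rule integral_cong_AE) (use ae in auto)
    also have "\<dots> = (\<integral>x. b x * heat_kernel z (x - y) \<partial>lborel)" by (rule integral_completion) (use h in simp)
    also have "\<dots> = propagate z b y" unfolding propagate_def by (simp only: heat_kernel_minus[of z y])
    finally show ?thesis .
  qed
  show ?thesis
    using solution_smoothed_representation[OF sol f e, of t y] unfolding *[OF ut v] *[OF f g] .
qed

text \<open>Choose a subsequence along which the integrals tend to the lower limit, then a further one along which \<open>L\<^sup>2\<close>
  convergence becomes convergence almost everywhere, and apply Fatou's lemma to it.\<close>

lemma weighted_integral_le_liminf:
  fixes v :: "'a::euclidean_space \<Rightarrow> complex"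
  assumes v [measurable]: "v \<in> borel_measurable borel" and v2: "integrable lborel (\<lambda>x. (cmod (v x))\<^sup>2)" and p: "p > 0"
  shows "(\<integral>\<^sup>+x. ennreal (cmod (v x) powr p / norm x powr s) \<partial>lborel) \<le>
    liminf (\<lambda>n. \<integral>\<^sup>+x. ennreal (cmod (propagate (of_real (small n)) v x) powr p / norm x powr s) \<partial>lborel)"
proof -
  let ?H = "\<lambda>n. propagate (of_real (small n)) v"
  let ?w = "\<lambda>c x. ennreal (cmod c powr p / norm (x::'a) powr s)"
  let ?b = "\<lambda>n. \<integral>\<^sup>+x. ?w (?H n x) x \<partial>lborel"
  have [measurable]: "?H n \<in> borel_measurable borel" for n by (rule borel_measurable_propagate) simp
  obtain r where r: "strict_mono r" "(?b \<circ> r) \<longlonglongrightarrow> liminf ?b" using liminf_subseq_lim by blast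
  note L2 = propagate_real_tendsto_L2[OF v v2]
  have "(\<lambda>n. \<integral>x. norm ((cmod (?H (r n) x - v x))\<^sup>2) \<partial>lborel) \<longlonglongrightarrow> 0"
    using LIMSEQ_subseq_LIMSEQ[OF L2(2) r(1)] by (simp add: o_def)
  from tendsto_L1_AE_subseq[OF L2(1) this] obtain k where k: "strict_mono k"
    and ae: "AE x in lborel. (\<lambda>n. (cmod (?H (r (k n)) x - v x))\<^sup>2) \<longlonglongrightarrow> 0" by blast
  have "(\<integral>\<^sup>+x. ?w (v x) x \<partial>lborel) = (\<integral>\<^sup>+x. liminf (\<lambda>n. ?w (?H (r (k n)) x) x) \<partial>lborel)"
  proof (rule nn_integral_cong_AE)
    show "AE x in lborel. ?w (v x) x = liminf (\<lambda>n. ?w (?H (r (k n)) x) x)"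
      using ae
    proof eventually_elim
      case (elim x)
      have "(\<lambda>n. sqrt ((cmod (?H (r (k n)) x - v x))\<^sup>2)) \<longlonglongrightarrow> sqrt 0"
        by (rule tendsto_real_sqrt[OF elim])
      then have "(\<lambda>n. ?H (r (k n)) x - v x) \<longlonglongrightarrow> 0"
        by (subst tendsto_norm_zero_iff[symmetric]) simp
      then have "(\<lambda>n. ?H (r (k n)) x) \<longlonglongrightarrow> v x" by (rule LIM_zero_cancel)
      then have "(\<lambda>n. cmod (?H (r (k n)) x) powr p) \<longlonglongrightarrow> cmod (v x) powr p"
        by (intro tendsto_powr' tendsto_norm tendsto_const) (use p in auto)
      then have "(\<lambda>n. ?w (?H (r (k n)) x) x) \<longlonglongrightarrow> ?w (v x) x"
        unfolding divide_inverse by (intro tendsto_ennrealI tendsto_mult_right)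
      then show ?case by (rule lim_imp_Liminf[OF sequentially_bot, symmetric])
    qed
  qed
  also have "\<dots> \<le> liminf (\<lambda>n. ?b (r (k n)))" by (rule nn_integral_liminf) measurable
  also have "\<dots> = liminf ?b"
    using LIMSEQ_subseq_LIMSEQ[OF r(2) k] by (intro lim_imp_Liminf) (simp_all add: o_def)
  finally show ?thesis .
qed

text \<open>Fatou's lemma is used twice: in space for each time, and in time. Only the smoothed
  integrals need to be measurable in time, so the choice of representatives of \<open>u t\<close> for different \<open>t\<close> is immaterial.\<close>

theorem weighted_space_time_estimate:
  fixes p :: real
  assumes d: "DIM('a::euclidean_space) \<ge> 3" and p: "2 \<le> p" "p \<le> 2 + 4 / DIM('a)"
  obtains C where "C > 0"
    "\<And>(f::'a \<Rightarrow> complex) u. square_integrable f \<Longrightarrow> schrodinger_solution f u \<Longrightarrow>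
      (\<integral>\<^sup>+t. \<integral>\<^sup>+x. ennreal (cmod (u t x) powr p / norm x powr (real DIM('a) + 2 - p * real DIM('a) / 2)) \<partial>lebesgue \<partial>lebesgue)
        \<le> ennreal (C * (\<integral>x. (cmod (f x))\<^sup>2 \<partial>lebesgue) powr (p / 2))"
proof -
  obtain C where C: "C > 0"
    "\<And>(f::'a \<Rightarrow> complex) e. e > 0 \<Longrightarrow> f \<in> borel_measurable borel \<Longrightarrow> integrable lborel (\<lambda>x. (cmod (f x))\<^sup>2) \<Longrightarrow>
      (\<integral>\<^sup>+t. \<integral>\<^sup>+x. ennreal (cmod (propagate (ctime e t) f x) powr p / norm x powr (real DIM('a) + 2 - p * real DIM('a) / 2)) \<partial>lborel \<partial>lborel)
        \<le> ennreal (C * (\<integral>x. (cmod (f x))\<^sup>2 \<partial>lborel) powr (p / 2))"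
    using weighted_smoothed_bound[OF d p] by blast
  show ?thesis
  proof (rule that[OF C(1)])
    fix f :: "'a \<Rightarrow> complex" and u
    assume f: "square_integrable f" and sol: "schrodinger_solution f u"
    obtain g where g: "g \<in> borel_measurable borel" "AE x in lebesgue. f x = g x" "integrable lborel (\<lambda>x. (cmod (g x))\<^sup>2)"
      "(\<integral>x. (cmod (g x))\<^sup>2 \<partial>lborel) = (\<integral>x. (cmod (f x))\<^sup>2 \<partial>lebesgue)"
      using square_integrable_borel_version[OF f] by blast
    define s where "s = real DIM('a) + 2 - p * DIM('a) / 2"
    let ?w = "\<lambda>c x. ennreal (cmod c powr p / norm (x::'a) powr s)"
    let ?b = "\<lambda>n t. \<integral>\<^sup>+x. ?w (propagate (ctime (small n) t) g x) x \<partial>lborel"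
    note [measurable] = measurable_propagate_ctime[OF g(1)]
    have bm: "?b n \<in> borel_measurable lborel" for n by measurable
    have "(\<integral>\<^sup>+t. \<integral>\<^sup>+x. ?w (u t x) x \<partial>lebesgue \<partial>lebesgue) \<le> (\<integral>\<^sup>+t. liminf (\<lambda>n. ?b n t) \<partial>lborel)"
      unfolding nn_integral_completion[of lborel "\<lambda>t. \<integral>\<^sup>+x. ?w (u t x) x \<partial>lebesgue"]
    proof (rule nn_integral_mono)
      fix t
      have ut: "square_integrable (u t)" using sol by (simp add: schrodinger_solution_def)
      obtain v where v: "v \<in> borel_measurable borel" "AE x in lebesgue. u t x = v x" "integrable lborel (\<lambda>x. (cmod (v x))\<^sup>2)"
        using square_integrable_borel_version[OF ut] by blast
      have "(\<integral>\<^sup>+x. ?w (u t x) x \<partial>lebesgue) = (\<integral>\<^sup>+x. ?w (v x) x \<partial>lebesgue)"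
        by (rule nn_integral_cong_AE) (use v(2) in \<open>auto elim: eventually_mono\<close>)
      also have "\<dots> = (\<integral>\<^sup>+x. ?w (v x) x \<partial>lborel)" by (rule nn_integral_completion)
      also have "\<dots> \<le> liminf (\<lambda>n. \<integral>\<^sup>+x. ?w (propagate (of_real (small n)) v x) x \<partial>lborel)"
        by (rule weighted_integral_le_liminf[OF v(1,3)]) (use p in simp)
      also have "\<dots> = liminf (\<lambda>n. ?b n t)"
        by (simp only: smoothed_solution[OF sol f small_pos v(1,2) g(1,2)])
      finally show "(\<integral>\<^sup>+x. ?w (u t x) x \<partial>lebesgue) \<le> liminf (\<lambda>n. ?b n t)" .
    qed
    also have "\<dots> \<le> liminf (\<lambda>n. \<integral>\<^sup>+t. ?b n t \<partial>lborel)" by (rule nn_integral_liminf[OF bm])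
    also have "\<dots> \<le> ennreal (C * (\<integral>x. (cmod (f x))\<^sup>2 \<partial>lebesgue) powr (p / 2))"
      unfolding g(4)[symmetric]
    proof (rule Liminf_le[OF sequentially_bot], rule always_eventually, rule allI)
      show "(\<integral>\<^sup>+t. ?b n t \<partial>lborel) \<le> ennreal (C * (\<integral>x. (cmod (g x))\<^sup>2 \<partial>lborel) powr (p / 2))" for n
        unfolding s_def by (rule C(2)[OF small_pos g(1,3)])
    qed
    finally show "(\<integral>\<^sup>+t. \<integral>\<^sup>+x. ennreal (cmod (u t x) powr p / norm x powr (real DIM('a) + 2 - p * real DIM('a) / 2)) \<partial>lebesgue \<partial>lebesgue)
        \<le> ennreal (C * (\<integral>x. (cmod (f x))\<^sup>2 \<partial>lebesgue) powr (p / 2))" unfolding s_def .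
  qed
qed

theorem corollary10:
  fixes p :: real
  assumes "CARD('n::finite) \<ge> 3"
    and "2 \<le> p" and "p \<le> 2 + 4 / real CARD('n)"
  shows "\<exists>C>0. \<forall>f :: real ^ 'n \<Rightarrow> complex. square_integrable f \<longrightarrow>
    (\<forall>u. schrodinger_solution f u \<longrightarrow>
      ennreal_powr
        (\<integral>\<^sup>+t. (\<integral>\<^sup>+x. ennreal (cmod (u t x) powr p /
            norm x powr (real CARD('n) + 2 - p * real CARD('n) / 2)) \<partial>lebesgue) \<partial>lebesgue)
        (1 / p)
      \<le> ennreal (C * (\<integral>x. (cmod (f x))\<^sup>2 \<partial>lebesgue) powr (1 / 2)))"
proof -
  have dim: "DIM(real ^ 'n) = CARD('n)" by simp
  obtain C where C: "C > 0" "\<And>(f :: real ^ 'n \<Rightarrow> complex) u. square_integrable f \<Longrightarrow> schrodinger_solution f u \<Longrightarrow>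
      (\<integral>\<^sup>+t. \<integral>\<^sup>+x. ennreal (cmod (u t x) powr p / norm x powr (real CARD('n) + 2 - p * real CARD('n) / 2)) \<partial>lebesgue \<partial>lebesgue)
        \<le> ennreal (C * (\<integral>x. (cmod (f x))\<^sup>2 \<partial>lebesgue) powr (p / 2))"
    using weighted_space_time_estimate[where 'a="real ^ 'n" and p=p, unfolded dim, OF assms] by blast
  show ?thesis
  proof (intro exI[of _ "C powr (1 / p)"] conjI allI impI)
    show "C powr (1 / p) > 0" using C(1) by simp
    fix f :: "real ^ 'n \<Rightarrow> complex" and u
    assume f: "square_integrable f" and sol: "schrodinger_solution f u"
    let ?I = "\<integral>\<^sup>+t. (\<integral>\<^sup>+x. ennreal (cmod (u t x) powr p /
            norm x powr (real CARD('n) + 2 - p * real CARD('n) / 2)) \<partial>lebesgue) \<partial>lebesgue"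
    let ?F2 = "\<integral>x. (cmod (f x))\<^sup>2 \<partial>lebesgue"
    have F2: "?F2 \<ge> 0" by (simp add: integral_nonneg_AE)
    have le: "?I \<le> ennreal (C * ?F2 powr (p / 2))" by (rule C(2)[OF f sol])
    have B: "0 \<le> C * ?F2 powr (p / 2)" using C(1) by simp
    from le have fin: "?I \<noteq> \<infinity>" by (auto simp: top_unique)
    have "enn2real ?I \<le> C * ?F2 powr (p / 2)"
      using enn2real_mono[OF le] B by simp
    then have "enn2real ?I powr (1 / p) \<le> (C * ?F2 powr (p / 2)) powr (1 / p)"
      using assms(2) by (intro powr_mono2) auto
    also have "\<dots> = C powr (1 / p) * ?F2 powr (1 / 2)"
      using C(1) F2 assms(2) by (simp add: powr_mult powr_powr)
    finally show "ennreal_powr ?I (1 / p) \<le> ennreal (C powr (1 / p) * ?F2 powr (1 / 2))"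
      using fin by (simp add: ennreal_powr_def ennreal_leI)
  qed
qed

end
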